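(* Let $M$ be a complete metric space containing a thick family of geodesics, let $G$ be a Carnot group, and let $B$ be a Banach space with the Radon-Nikod\'ym property. Then $M$ does not biLipschitz embed into the product metric space $G\times B$.
   Context: A $p$-$q$ geodesic in a metric space $(M,d)$ is an isometric embedding of a compact interval into $M$ sending the left endpoint to $p$ and the right endpoint to $q$. A nonempty family $\Gamma$ of $p$-$q$ geodesics with common domain $[a,b]$ is concatenation closed if whenever $\gamma_1,\gamma_2\in\Gamma$, $c\in[a,b]$ and $\gamma_1(c)=\gamma_2(c)$, the curve equal to $\gamma_1$ on $[a,c]$ and to $\gamma_2$ on $[c,b]$ belongs to $\Gamma$. A thick family of geodesics is a nonempty concatenation closed family $\Gamma$ of $p$-$q$ geodesics (for some points $p,q\in M$) with common domain $[a,b]$ for which there is $\alpha>0$ such that for every $\gamma\in\Gamma$ and $a=t_0<t_1<\dots<t_k=b$ there exist $a=q_0<s_1<q_1<s_2<\dots<s_j<q_j=b$ and $\tilde\gamma\in\Gamma$ with $\{t_i\}\subseteq\{q_i\}$, $\gamma(q_i)=\tilde\gamma(q_i)$ for all $i$, and $\sum_{i=1}^j d(\gamma(s_i),\tilde\gamma(s_i))\ge\alpha$. A Banach space $B$ has the Radon-Nikod\'ym property (RNP) if every Lipschitz map $\mathbb R\to B$ is differentiable Lebesgue-almost everywhere. A Carnot group is equipped with its Carnot-Carath\'eodory metric. The product $G\times B$ carries a product metric, e.g. the maximum of the two coordinate distances (the usual choices are biLipschitz equivalent). *)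

theory Defs
  imports "HOL-Analysis.Analysis"
begin

section \<open>Thick families of geodesics\<close>

text \<open>A curve with domain \<open>[a,b]\<close> is represented by an element of \<open>extensional {a..b}\<close>, so that
  equality of functions is equality of curves.\<close>

definition geodesics :: "real \<Rightarrow> real \<Rightarrow> 'm::metric_space \<Rightarrow> 'm \<Rightarrow> (real \<Rightarrow> 'm) set" where
  "geodesics a b p q =
     {\<gamma> \<in> extensional {a..b}. a \<le> b \<and> \<gamma> a = p \<and> \<gamma> b = q \<and>
        (\<forall>s\<in>{a..b}. \<forall>t\<in>{a..b}. dist (\<gamma> s) (\<gamma> t) = \<bar>s - t\<bar>)}"

definition concatenation_closed :: "real \<Rightarrow> real \<Rightarrow> (real \<Rightarrow> 'm) set \<Rightarrow> bool" where
  "concatenation_closed a b \<Gamma> \<longleftrightarrow>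
     (\<forall>\<gamma>1\<in>\<Gamma>. \<forall>\<gamma>2\<in>\<Gamma>. \<forall>c\<in>{a..b}. \<gamma>1 c = \<gamma>2 c \<longrightarrow>
        restrict (\<lambda>t. if t \<le> c then \<gamma>1 t else \<gamma>2 t) {a..b} \<in> \<Gamma>)"

definition thick_family ::
    "real \<Rightarrow> real \<Rightarrow> 'm::metric_space \<Rightarrow> 'm \<Rightarrow> (real \<Rightarrow> 'm) set \<Rightarrow> bool" where
  "thick_family a b p q \<Gamma> \<longleftrightarrow>
     \<Gamma> \<noteq> {} \<and> \<Gamma> \<subseteq> geodesics a b p q \<and> concatenation_closed a b \<Gamma> \<and>
     (\<exists>\<alpha>>0. \<forall>\<gamma>\<in>\<Gamma>. \<forall>(k::nat) (t::nat \<Rightarrow> real).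
        t 0 = a \<and> t k = b \<and> (\<forall>i<k. t i < t (Suc i)) \<longrightarrow>
        (\<exists>(j::nat) (r::nat \<Rightarrow> real) (s::nat \<Rightarrow> real). \<exists>\<gamma>'\<in>\<Gamma>.
           r 0 = a \<and> r j = b \<and> (\<forall>i<j. r i < s (Suc i) \<and> s (Suc i) < r (Suc i)) \<and>
           t ` {..k} \<subseteq> r ` {..j} \<and>
           (\<forall>i\<le>j. \<gamma> (r i) = \<gamma>' (r i)) \<and>
           (\<Sum>i=1..j. dist (\<gamma> (s i)) (\<gamma>' (s i))) \<ge> \<alpha>))"


section \<open>The Radon-Nikodym property\<close>

definition RNP :: "'b::banach itself \<Rightarrow> bool" where
  "RNP _ \<longleftrightarrow> (\<forall>f::real \<Rightarrow> 'b. (\<exists>L. L-lipschitz_on UNIV f) \<longrightarrow>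
                 (AE t in lebesgue. f differentiable (at t)))"


section \<open>Lie groups\<close>

text \<open>Intended for open \<open>S\<close> only.\<close>

primrec Ck_on :: "nat \<Rightarrow> ('a::euclidean_space \<Rightarrow> 'b::euclidean_space) \<Rightarrow> 'a set \<Rightarrow> bool" where
  "Ck_on 0 f S \<longleftrightarrow> continuous_on S f"
| "Ck_on (Suc k) f S \<longleftrightarrow>
     (\<forall>x\<in>S. f differentiable (at x)) \<and>
     (\<forall>v. Ck_on k (\<lambda>x. frechet_derivative f (at x) v) S)"

definition smooth_on :: "('a::euclidean_space \<Rightarrow> 'b::euclidean_space) \<Rightarrow> 'a set \<Rightarrow> bool" where
  "smooth_on f S \<longleftrightarrow> (\<forall>k. Ck_on k f S)"

type_synonym ('g, 'e) chart = "'g set \<times> ('g \<Rightarrow> 'e)"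

definition smooth_atlas :: "('g::topological_space, 'e::euclidean_space) chart set \<Rightarrow> bool" where
  "smooth_atlas A \<longleftrightarrow>
     (\<forall>(U, \<phi>)\<in>A. open U \<and> open (\<phi> ` U) \<and> homeomorphism U (\<phi> ` U) \<phi> (inv_into U \<phi>)) \<and>
     (\<Union>(U, \<phi>)\<in>A. U) = UNIV \<and>
     (\<forall>(U, \<phi>)\<in>A. \<forall>(W, \<psi>)\<in>A. smooth_on (\<psi> \<circ> inv_into U \<phi>) (\<phi> ` (U \<inter> W)))"

definition prod_atlas ::
    "('g, 'e) chart set \<Rightarrow> ('h, 'f) chart set \<Rightarrow> ('g \<times> 'h, 'e \<times> 'f) chart set" where
  "prod_atlas A B = (\<lambda>((U, \<phi>), (W, \<psi>)). (U \<times> W, map_prod \<phi> \<psi>)) ` (A \<times> B)"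

definition smooth_map ::
    "('g::topological_space, 'e::euclidean_space) chart set \<Rightarrow>
     ('h::topological_space, 'f::euclidean_space) chart set \<Rightarrow> ('g \<Rightarrow> 'h) \<Rightarrow> bool" where
  "smooth_map A B f \<longleftrightarrow> continuous_on UNIV f \<and>
     (\<forall>(U, \<phi>)\<in>A. \<forall>(W, \<psi>)\<in>B. smooth_on (\<psi> \<circ> f \<circ> inv_into U \<phi>) (\<phi> ` (U \<inter> f -` W)))"

definition lie_group ::
    "('g \<Rightarrow> 'g \<Rightarrow> 'g) \<Rightarrow> 'g \<Rightarrow> ('g \<Rightarrow> 'g) \<Rightarrow>
     ('g::{t2_space, second_countable_topology}, 'e::euclidean_space) chart set \<Rightarrow> bool" where
  "lie_group mul e iv A \<longleftrightarrow>
     group mul e iv \<and> smooth_atlas A \<and>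
     smooth_map (prod_atlas A A) A (\<lambda>(x, y). mul x y) \<and> smooth_map A A iv"

text \<open>The Lie algebra is the tangent space at \<open>e\<close>, identified with the model space \<open>'e\<close> through
  a chart \<open>(U, \<phi>)\<close> around \<open>e\<close>.  In this chart, \<open>left_field mul e c X\<close> is the left-invariant
  vector field with value \<open>X\<close> at \<open>e\<close>, and the bracket is the value at \<open>e\<close> of the
  commutator \<open>DY(X) - DX(Y)\<close> of left-invariant vector fields.\<close>

definition left_field ::
    "('g \<Rightarrow> 'g \<Rightarrow> 'g) \<Rightarrow> 'g \<Rightarrow> ('g, 'e::euclidean_space) chart \<Rightarrow> 'e \<Rightarrow> 'e \<Rightarrow> 'e" where
  "left_field mul e c X = (case c of (U, \<phi>) \<Rightarrow>
     (\<lambda>x. frechet_derivative (\<lambda>y. \<phi> (mul (inv_into U \<phi> x) (inv_into U \<phi> y))) (at (\<phi> e)) X))"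

definition lie_bracket ::
    "('g \<Rightarrow> 'g \<Rightarrow> 'g) \<Rightarrow> 'g \<Rightarrow> ('g, 'e::euclidean_space) chart \<Rightarrow> 'e \<Rightarrow> 'e \<Rightarrow> 'e" where
  "lie_bracket mul e c X Y =
     frechet_derivative (left_field mul e c Y) (at (snd c e)) X
     - frechet_derivative (left_field mul e c X) (at (snd c e)) Y"


section \<open>Carnot groups\<close>

definition stratification ::
    "('e \<Rightarrow> 'e \<Rightarrow> 'e) \<Rightarrow> nat \<Rightarrow> (nat \<Rightarrow> 'e::euclidean_space set) \<Rightarrow> bool" where
  "stratification br s V \<longleftrightarrow>
     s \<ge> 1 \<and> (\<forall>i\<in>{1..s}. subspace (V i)) \<and>
     (\<forall>x. \<exists>!v. v \<in> PiE {1..s} V \<and> x = (\<Sum>i=1..s. v i)) \<and>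
     (\<forall>i. 1 \<le> i \<and> i < s \<longrightarrow> span {br X Y | X Y. X \<in> V 1 \<and> Y \<in> V i} = V (Suc i)) \<and>
     (\<forall>X\<in>V 1. \<forall>Y\<in>V s. br X Y = 0) \<and>
     V s \<noteq> {0}"

definition inner_product_on :: "'e::real_vector set \<Rightarrow> ('e \<Rightarrow> 'e \<Rightarrow> real) \<Rightarrow> bool" where
  "inner_product_on V ip \<longleftrightarrow>
     (\<forall>x\<in>V. \<forall>y\<in>V. ip x y = ip y x) \<and>
     (\<forall>x\<in>V. \<forall>y\<in>V. \<forall>z\<in>V. \<forall>r. ip (r *\<^sub>R x + y) z = r * ip x z + ip y z) \<and>
     (\<forall>x\<in>V. x \<noteq> 0 \<longrightarrow> ip x x > 0)"

text \<open>\<open>c\<close> is the chart around the identity through which the Lie algebra is identified with \<open>'e\<close>;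
  \<open>V\<close> is a stratification of the Lie algebra with \<open>s\<close> layers, and \<open>ip\<close> an inner product on the
  first layer.\<close>

definition carnot_group ::
    "('g \<Rightarrow> 'g \<Rightarrow> 'g) \<Rightarrow> 'g \<Rightarrow> ('g \<Rightarrow> 'g) \<Rightarrow>
     ('g::{t2_space, second_countable_topology}, 'e::euclidean_space) chart set \<Rightarrow>
     ('g, 'e) chart \<Rightarrow> nat \<Rightarrow> (nat \<Rightarrow> 'e set) \<Rightarrow> ('e \<Rightarrow> 'e \<Rightarrow> real) \<Rightarrow> bool" where
  "carnot_group mul e iv A c s V ip \<longleftrightarrow>
     lie_group mul e iv A \<and>
     connected (UNIV :: 'g set) \<and> simply_connected (UNIV :: 'g set) \<and>
     c \<in> A \<and> e \<in> fst c \<and>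
     stratification (lie_bracket mul e c) s V \<and>
     inner_product_on (V 1) ip"

text \<open>\<open>u t\<close> is the velocity of \<open>\<gamma>\<close> at time \<open>t\<close> translated back to the identity; that it lies in
  the first layer \<open>V1\<close> means that \<open>\<gamma>\<close> is tangent at time \<open>t\<close> to the left-invariant distribution
  generated by \<open>V1\<close>.\<close>

definition horizontal_curve ::
    "('g \<Rightarrow> 'g \<Rightarrow> 'g) \<Rightarrow> ('g \<Rightarrow> 'g) \<Rightarrow> ('g::topological_space, 'e::euclidean_space) chart \<Rightarrow>
     'e set \<Rightarrow> (real \<Rightarrow> 'g) \<Rightarrow> (real \<Rightarrow> 'e) \<Rightarrow> bool" where
  "horizontal_curve mul iv c V1 \<gamma> u \<longleftrightarrow>
     continuous_on {0..1} \<gamma> \<and>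
     (\<exists>T. finite T \<and> continuous_on ({0..1} - T) u \<and>
        (\<forall>t\<in>{0..1} - T. u t \<in> V1 \<and>
           ((\<lambda>r. snd c (mul (iv (\<gamma> t)) (\<gamma> r))) has_vector_derivative u t) (at t within {0..1})))"

text \<open>The Carnot-Caratheodory distance: the infimum of the lengths of the piecewise \<open>C\<^sup>1\<close>
  horizontal curves of finite length between two points.  In a Carnot group such curves exist for
  all pairs of points (Chow-Rashevskii), so the infimum is never taken over the empty set.\<close>

definition cc_dist ::
    "('g \<Rightarrow> 'g \<Rightarrow> 'g) \<Rightarrow> ('g \<Rightarrow> 'g) \<Rightarrow> ('g::topological_space, 'e::euclidean_space) chart \<Rightarrow>
     'e set \<Rightarrow> ('e \<Rightarrow> 'e \<Rightarrow> real) \<Rightarrow> 'g \<Rightarrow> 'g \<Rightarrow> real" where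
  "cc_dist mul iv c V1 ip x y =
     Inf {l. \<exists>\<gamma> u. horizontal_curve mul iv c V1 \<gamma> u \<and> \<gamma> 0 = x \<and> \<gamma> 1 = y \<and>
               ((\<lambda>t. sqrt (ip (u t) (u t))) has_integral l) {0..1}}"


section \<open>BiLipschitz embeddings and product metrics\<close>

definition max_dist ::
    "('x \<Rightarrow> 'x \<Rightarrow> real) \<Rightarrow> ('y \<Rightarrow> 'y \<Rightarrow> real) \<Rightarrow> 'x \<times> 'y \<Rightarrow> 'x \<times> 'y \<Rightarrow> real" where
  "max_dist d1 d2 z w = max (d1 (fst z) (fst w)) (d2 (snd z) (snd w))"

definition bilipschitz_embedding ::
    "('x \<Rightarrow> 'x \<Rightarrow> real) \<Rightarrow> ('y \<Rightarrow> 'y \<Rightarrow> real) \<Rightarrow> ('x \<Rightarrow> 'y) \<Rightarrow> bool" where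
  "bilipschitz_embedding dX dY f \<longleftrightarrow>
     (\<exists>c>0. \<exists>C>0. \<forall>x y. c * dX x y \<le> dY (f x) (f y) \<and> dY (f x) (f y) \<le> C * dX x y)"

end

theory Submission
  imports Defs
begin

text \<open>A thick family yields, by choosing geodesics \<open>\<gamma>\<^sub>0, \<gamma>\<^sub>1, \<dots>\<close> in \<open>\<Gamma>\<close> so that each agrees with its
  predecessor on an increasing finite set of times, a limit curve \<open>\<gamma>\<close> whose image under a given
  embedding \<open>f\<close> is not infinitesimally affine: on partitions of arbitrarily small mesh, the deviations of \<open>f \<circ> \<gamma>\<close>
  from affine interpolation, measured at one point per interval, add up to at least some \<open>\<beta> > 0\<close>.
  The reason is that two curves with the same endpoints and different midpoints cannot both be
  close to the same interpolating point.  On the other hand, a Lipschitz curve in \<open>G \<times> B\<close> has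
  deviation \<open>o(r - p)\<close> on the intervals \<open>[p, r]\<close> shrinking to almost every time, so dominated
  convergence makes these sums tend to zero.

  In \<open>B\<close> this is the Radon-Nikodym property.  In \<open>G\<close> it is Pansu's theorem for curves.  Affine
  interpolation is defined by local dilations in coordinates of the second kind, for which the
  left-invariant frame is homogeneous.  The horizontal projection of a Lipschitz curve is
  differentiable almost everywhere by Rademacher's theorem in one variable.  At such a time the
  curve is approximated by horizontal curves of controlled length whose projections are uniformly
  close to a straight line; after rescaling to unit size, horizontal curves with uniformly close
  projections are themselves uniformly close.\<close>

section \<open>Calculus preliminaries\<close>

text \<open>A thick family provides deviation at one scale per geodesic, while differentiability
  speaks of one curve at all small scales. Hence the limit curve: the intermediate points of each
  stage, and not only its partition points, are frozen at all later stages, so that the limit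
  inherits every scale. Only one property of the deviation enters there: for the same end data, the
  deviations of two points add up to at least a multiple of their distance. This permits adding the
  deviations in G and B and treating them as one. In G the obstacle is that all tools are local. The
  group is given by charts, so exponentials, coordinates and dilations exist near \<open>e\<close>
  only, and short pieces of a curve are moved there by left translation. The scale \<open>l0\<close>
  at which horizontal curves are compared does not depend on the desired accuracy. A piece of length
  \<open>ll\<close> is enlarged by \<open>l0 / ll\<close>, compared at this fixed scale and scaled
  back, which turns a fixed closeness into an error proportional to \<open>ll\<close>.\<close>

lemma second_derivative_symmetric:
  fixes f :: "'a::real_normed_vector \<Rightarrow> 'b::euclidean_space"
  assumes S: "open S" "z \<in> S"
    and f: "\<And>x. x \<in> S \<Longrightarrow> (f has_derivative f' x) (at x)"
    and v: "\<And>x. x \<in> S \<Longrightarrow> ((\<lambda>x. f' x v) has_derivative g x) (at x)"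
    and w: "\<And>x. x \<in> S \<Longrightarrow> ((\<lambda>x. f' x w) has_derivative h x) (at x)"
    and cg: "continuous (at z) (\<lambda>x. g x w)"
    and ch: "continuous (at z) (\<lambda>x. h x v)"
  shows "g z w = h z v"
proof (rule euclidean_eqI)
  fix b :: 'b assume b: "b \<in> Basis"
  have "\<bar>(g z w - h z v) \<bullet> b\<bar> \<le> 2 * \<epsilon>" if \<epsilon>: "\<epsilon> > 0" for \<epsilon>
  proof -
    obtain d1 where d1: "d1 > 0" "\<And>x. dist x z < d1 \<Longrightarrow> dist (g x w) (g z w) < \<epsilon>"
      using cg \<epsilon> unfolding continuous_at_eps_delta by blast
    obtain d2 where d2: "d2 > 0" "\<And>x. dist x z < d2 \<Longrightarrow> dist (h x v) (h z v) < \<epsilon>"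
      using ch \<epsilon> unfolding continuous_at_eps_delta by blast
    obtain d3 where d3: "d3 > 0" "ball z d3 \<subseteq> S"
      using S open_contains_ball by blast
    define d where "d = min d1 (min d2 d3)"
    \<comment> \<open>The parallelogram spanned by \<open>s *\<^sub>R v\<close> and
      \<open>s *\<^sub>R w\<close> at \<open>z\<close> lies within distance \<open>d\<close>; the
      summand 1 avoids a zero denominator.\<close>
    define s where "s = d / (norm v + norm w + 1)"
    have d0: "d > 0" using d1 d2 d3 by (auto simp: d_def)
    have s0: "s > 0" using d0 by (auto simp: s_def intro!: divide_pos_pos add_nonneg_pos)
    have near: "dist (z + x *\<^sub>R v + y *\<^sub>R w) z < d" if "0 \<le> x" "x \<le> s" "0 \<le> y" "y \<le> s" for x y
    proof -
      have "norm (x *\<^sub>R v + y *\<^sub>R w) \<le> x * norm v + y * norm w"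
        using norm_triangle_ineq[of "x *\<^sub>R v" "y *\<^sub>R w"] that by simp
      also have "\<dots> \<le> s * norm v + s * norm w"
        using that by (intro add_mono mult_right_mono) auto
      also have "\<dots> < s * (norm v + norm w + 1)" using s0 by (simp add: algebra_simps)
      also have "\<dots> = d" unfolding s_def
        using norm_ge_zero[of v] norm_ge_zero[of w] by (simp add: add_nonneg_eq_0_iff)
      finally show ?thesis by (simp add: dist_norm algebra_simps)
    qed
    have inS: "z + x *\<^sub>R v + y *\<^sub>R w \<in> S" if "0 \<le> x" "x \<le> s" "0 \<le> y" "y \<le> s" for x y
      using near[OF that] d3 by (auto simp: d_def dist_commute)
    \<comment> \<open>The second difference over this parallelogram. Two mean value steps, along
      \<open>v\<close> then \<open>w\<close> or along \<open>w\<close> then \<open>v\<close>,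
      express it through \<open>g\<close> or through \<open>h\<close>. The component along
      \<open>b\<close> is taken because the mean value theorem is for real functions.\<close>
    define \<Delta> where "\<Delta> = (f (z + s *\<^sub>R v + s *\<^sub>R w) - f (z + s *\<^sub>R v) - f (z + s *\<^sub>R w) + f z) \<bullet> b"
    have line: "((\<lambda>x. F (c + x *\<^sub>R a) \<bullet> b) has_real_derivative (F' a \<bullet> b)) (at x)"
      if "(F has_derivative F') (at (c + x *\<^sub>R a))" for F :: "'a \<Rightarrow> 'b" and F' c a x
    proof -
      interpret bounded_linear F' using that has_derivative_bounded_linear by blast
      have *: "((\<lambda>x. c + x *\<^sub>R a) has_derivative (\<lambda>x. x *\<^sub>R a)) (at x)"
        by (auto intro!: derivative_eq_intros)
      have "((\<lambda>x. F (c + x *\<^sub>R a) \<bullet> b) has_derivative (\<lambda>h. F' (h *\<^sub>R a) \<bullet> b)) (at x)"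
        using has_derivative_compose[OF * that] by (rule has_derivative_inner_left)
      thus ?thesis by (simp add: has_field_derivative_def scale mult.commute[of "F' a \<bullet> b"] mult_commute_abs)
    qed
    have mvt: "\<exists>x>0. x < s \<and> F s - F 0 = (s - 0) * F' x"
      if "\<And>x. 0 \<le> x \<Longrightarrow> x \<le> s \<Longrightarrow> (F has_real_derivative F' x) (at x)" for F F' :: "real \<Rightarrow> real"
      using MVT2[OF s0 that] by blast
    have "((\<lambda>x. f (z + s *\<^sub>R w + x *\<^sub>R v) \<bullet> b - f (z + x *\<^sub>R v) \<bullet> b) has_real_derivative
        f' (z + s *\<^sub>R w + x *\<^sub>R v) v \<bullet> b - f' (z + x *\<^sub>R v) v \<bullet> b) (at x)"
      if "0 \<le> x" "x \<le> s" for x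
      using inS[of x s] inS[of x 0] that s0 by (intro DERIV_diff line f) (auto simp: add_ac)
    from mvt[OF this] obtain x1 where x1: "0 < x1" "x1 < s" and
      "(f (z + s *\<^sub>R w + s *\<^sub>R v) \<bullet> b - f (z + s *\<^sub>R v) \<bullet> b) - (f (z + s *\<^sub>R w + 0 *\<^sub>R v) \<bullet> b - f (z + 0 *\<^sub>R v) \<bullet> b)
        = (s - 0) * (f' (z + s *\<^sub>R w + x1 *\<^sub>R v) v \<bullet> b - f' (z + x1 *\<^sub>R v) v \<bullet> b)"
      by blast
    moreover
    have "((\<lambda>y. f' (z + x1 *\<^sub>R v + y *\<^sub>R w) v \<bullet> b) has_real_derivative
        g (z + x1 *\<^sub>R v + y *\<^sub>R w) w \<bullet> b) (at y)" if "0 \<le> y" "y \<le> s" for y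
      using inS[of x1 y] that x1 by (intro line[of "\<lambda>x. f' x v"] v) auto
    from mvt[OF this] obtain y1 where y1: "0 < y1" "y1 < s" and
      "f' (z + x1 *\<^sub>R v + s *\<^sub>R w) v \<bullet> b - f' (z + x1 *\<^sub>R v + 0 *\<^sub>R w) v \<bullet> b
        = (s - 0) * (g (z + x1 *\<^sub>R v + y1 *\<^sub>R w) w \<bullet> b)"
      by blast
    ultimately have e1: "\<Delta> = s * s * (g (z + x1 *\<^sub>R v + y1 *\<^sub>R w) w \<bullet> b)"
      by (simp add: \<Delta>_def inner_diff_left inner_add_left add_ac)
    have "((\<lambda>x. f (z + s *\<^sub>R v + x *\<^sub>R w) \<bullet> b - f (z + x *\<^sub>R w) \<bullet> b) has_real_derivative
        f' (z + s *\<^sub>R v + x *\<^sub>R w) w \<bullet> b - f' (z + x *\<^sub>R w) w \<bullet> b) (at x)"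
      if "0 \<le> x" "x \<le> s" for x
      using inS[of s x] inS[of 0 x] that s0 by (intro DERIV_diff line f) (auto simp: add_ac)
    from mvt[OF this] obtain x2 where x2: "0 < x2" "x2 < s" and
      "(f (z + s *\<^sub>R v + s *\<^sub>R w) \<bullet> b - f (z + s *\<^sub>R w) \<bullet> b) - (f (z + s *\<^sub>R v + 0 *\<^sub>R w) \<bullet> b - f (z + 0 *\<^sub>R w) \<bullet> b)
        = (s - 0) * (f' (z + s *\<^sub>R v + x2 *\<^sub>R w) w \<bullet> b - f' (z + x2 *\<^sub>R w) w \<bullet> b)"
      by blast
    moreover
    have "((\<lambda>y. f' (z + x2 *\<^sub>R w + y *\<^sub>R v) w \<bullet> b) has_real_derivative
        h (z + x2 *\<^sub>R w + y *\<^sub>R v) v \<bullet> b) (at y)" if "0 \<le> y" "y \<le> s" for y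
      using inS[of y x2] that x2 by (intro line[of "\<lambda>x. f' x w"] w) (auto simp: add_ac)
    from mvt[OF this] obtain y2 where y2: "0 < y2" "y2 < s" and
      "f' (z + x2 *\<^sub>R w + s *\<^sub>R v) w \<bullet> b - f' (z + x2 *\<^sub>R w + 0 *\<^sub>R v) w \<bullet> b
        = (s - 0) * (h (z + x2 *\<^sub>R w + y2 *\<^sub>R v) v \<bullet> b)"
      by blast
    ultimately have e2: "\<Delta> = s * s * (h (z + x2 *\<^sub>R w + y2 *\<^sub>R v) v \<bullet> b)"
      by (simp add: \<Delta>_def inner_diff_left inner_add_left add_ac)
    have eq: "g (z + x1 *\<^sub>R v + y1 *\<^sub>R w) w \<bullet> b = h (z + x2 *\<^sub>R w + y2 *\<^sub>R v) v \<bullet> b"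
      using e1 e2 s0 by simp
    have "dist (g (z + x1 *\<^sub>R v + y1 *\<^sub>R w) w) (g z w) < \<epsilon>"
      using near[of x1 y1] x1 y1 by (intro d1) (auto simp: d_def)
    hence A: "\<bar>(g (z + x1 *\<^sub>R v + y1 *\<^sub>R w) w - g z w) \<bullet> b\<bar> < \<epsilon>"
      using Basis_le_norm[OF b] by (smt (verit) dist_norm)
    have "dist (h (z + x2 *\<^sub>R w + y2 *\<^sub>R v) v) (h z v) < \<epsilon>"
      using near[of y2 x2] x2 y2 by (intro d2) (auto simp: d_def add_ac)
    hence B: "\<bar>(h (z + x2 *\<^sub>R w + y2 *\<^sub>R v) v - h z v) \<bullet> b\<bar> < \<epsilon>"
      using Basis_le_norm[OF b] by (smt (verit) dist_norm)
    show ?thesis using A B eq by (simp add: inner_diff_left)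
  qed
  from this[of "\<bar>(g z w - h z v) \<bullet> b\<bar> / 4"] have "(g z w - h z v) \<bullet> b = 0" by fastforce
  thus "g z w \<bullet> b = h z v \<bullet> b" by (simp add: inner_diff_left)
qed

text \<open>Turns an expression \<open>F x (w x)\<close> with linear \<open>F x\<close> into a
  finite sum of products of a scalar and a vector function, so that product rules and bounds apply
  without a topology on linear maps.\<close>

lemma linear_euclidean_expansion:
  fixes F :: "'a::euclidean_space \<Rightarrow> 'b::real_vector"
  assumes "linear F"
  shows "F v = (\<Sum>b\<in>Basis. (v \<bullet> b) *\<^sub>R F b)"
proof -
  have "F v = F (\<Sum>b\<in>Basis. (v \<bullet> b) *\<^sub>R b)" by (simp add: euclidean_representation)
  thus ?thesis by (simp only: linear_sum[OF assms] linear_scale[OF assms])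
qed

text \<open>In finite dimension pointwise continuity of linear maps is uniform on the unit ball: it
  suffices to control the basis vectors, each with the share \<epsilon> / DIM.\<close>

lemma linear_family_continuous:
  fixes F :: "'x::t2_space \<Rightarrow> 'a::euclidean_space \<Rightarrow> 'b::real_normed_vector"
  assumes lin: "\<forall>\<^sub>F x in nhds a. linear (F x)"
    and cont: "\<And>v. continuous (at a) (\<lambda>x. F x v)" and "\<epsilon> > 0"
  shows "\<forall>\<^sub>F x in nhds a. \<forall>v. norm (F x v - F a v) \<le> \<epsilon> * norm v"
proof -
  define e where "e = \<epsilon> / DIM('a)"
  have e: "e > 0" using assms by (simp add: e_def)
  have la: "linear (F a)" using lin by (rule eventually_nhds_x_imp_x)
  have "\<forall>\<^sub>F x in nhds a. norm (F x b - F a b) < e" for b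
    using cont[of b] e unfolding continuous_within tendsto_iff dist_norm
    by (auto simp: eventually_nhds_conv_at)
  hence "\<forall>\<^sub>F x in nhds a. \<forall>b\<in>Basis. norm (F x b - F a b) < e"
    by (simp add: eventually_ball_finite_distrib)
  with lin show ?thesis
  proof eventually_elim
    case (elim x)
    have "norm (F x v - F a v) \<le> \<epsilon> * norm v" for v
    proof -
      have "F x v - F a v = (\<Sum>b\<in>Basis. (v \<bullet> b) *\<^sub>R (F x b - F a b))"
        unfolding linear_euclidean_expansion[OF elim(1), of v] linear_euclidean_expansion[OF la, of v]
        by (simp add: scaleR_diff_right sum_subtractf)
      also have "norm \<dots> \<le> (\<Sum>b\<in>(Basis::'a set). norm v * e)"
        using elim(2) Basis_le_norm[of _ v]
        by (intro sum_norm_le) (auto intro!: mult_mono simp: less_imp_le)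
      also have "\<dots> = \<epsilon> * norm v" by (simp add: e_def)
      finally show ?thesis .
    qed
    thus ?case by blast
  qed
qed

text \<open>Picard iteration among bounded continuous functions on the whole line. The nearest-point
  projection onto the ball makes the field globally Lipschitz and bounded, and clamping time makes
  the iterates bounded. The fixed point stays in the ball, where the projection is the
  identity.\<close>

lemma ode_local_existence:
  fixes f :: "'a::euclidean_space \<Rightarrow> 'a"
  assumes lip: "L-lipschitz_on (cball x0 r) f" and r: "r > 0"
  shows "\<exists>\<tau>>0. \<exists>p. p 0 = x0 \<and> (\<forall>t\<in>{-\<tau>..\<tau>}. p t \<in> cball x0 r \<and>
    (p has_vector_derivative f (p t)) (at t within {-\<tau>..\<tau>}))"
proof -
  define g where "g = f \<circ> closest_point (cball x0 r)"
  have cp: "closest_point (cball x0 r) x \<in> cball x0 r" for x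
    using r by (intro closest_point_in_set) auto
  have L0: "L \<ge> 0" using lip by (rule lipschitz_on_nonneg)
  have glip: "dist (g x) (g y) \<le> L * dist x y" for x y
  proof -
    have "dist (g x) (g y) \<le> L * dist (closest_point (cball x0 r) x) (closest_point (cball x0 r) y)"
      unfolding g_def o_def by (rule lipschitz_onD[OF lip cp cp])
    also have "\<dots> \<le> L * dist x y" using r L0
      by (intro mult_left_mono closest_point_lipschitz) auto
    finally show ?thesis .
  qed
  have gcont: "continuous_on S g" for S
    by (rule lipschitz_on_continuous_on[of L]) (auto simp: lipschitz_on_def glip L0)
  define M where "M = norm (f x0) + L * r"
  have gM: "norm (g x) \<le> M" for x
  proof -
    have "dist (g x) (f x0) \<le> L * dist (closest_point (cball x0 r) x) x0"
      unfolding g_def o_def using r by (intro lipschitz_onD[OF lip cp]) auto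
    also have "\<dots> \<le> L * r" using cp[of x] L0 by (intro mult_left_mono) (auto simp: dist_commute)
    finally have "norm (g x - f x0) \<le> L * r" by (simp add: dist_norm)
    thus ?thesis using norm_triangle_sub[of "g x" "f x0"] by (simp add: M_def)
  qed
  have M0: "M \<ge> 0" using L0 r by (simp add: M_def)
  \<comment> \<open>The first bound keeps the solution in the ball, the second makes the iteration
    contract by 1/2. The factor 4 absorbs two integrals over intervals of length at most
    \<open>2 * \<tau>\<close>.\<close>
  define \<tau> where "\<tau> = min (r / (4 * (M + 1))) (1 / (8 * (L + 1)))"
  have \<tau>: "\<tau> > 0" using r M0 L0 by (auto simp: \<tau>_def)
  have "4 * M * \<tau> \<le> 4 * (M + 1) * \<tau>" using \<tau> by simp
  also have "\<dots> \<le> 4 * (M + 1) * (r / (4 * (M + 1)))" using M0 by (intro mult_left_mono) (auto simp: \<tau>_def)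
  also have "\<dots> = r" using M0 by (simp add: field_simps)
  finally have \<tau>M: "4 * M * \<tau> \<le> r" .
  have "4 * L * \<tau> \<le> 4 * (L + 1) * \<tau>" using \<tau> by simp
  also have "\<dots> \<le> 4 * (L + 1) * (1 / (8 * (L + 1)))" using L0 by (intro mult_left_mono) (auto simp: \<tau>_def)
  also have "\<dots> = 1/2" using L0 by (simp add: field_simps)
  finally have \<tau>L: "4 * L * \<tau> \<le> 1/2" .
  define cl where "cl t = max (-\<tau>) (min \<tau> t)" for t :: real
  have cl: "cl t \<in> {-\<tau>..\<tau>}" for t using \<tau> by (auto simp: cl_def)
  have clid: "cl t = t" if "t \<in> {-\<tau>..\<tau>}" for t using that by (auto simp: cl_def)
  \<comment> \<open>This is \<open>x0\<close> plus the oriented integral of \<open>h\<close> from 0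
    to \<open>t\<close>, written with integrals from \<open>-\<tau>\<close> so that negative times
    need no separate case.\<close>
  define I where "I h t = x0 + (integral {-\<tau>..t} h - integral {-\<tau>..0} h)" for h :: "real \<Rightarrow> 'a" and t
  have int: "(\<lambda>s. g (apply_bcontfun p s)) integrable_on {a..b}" for p :: "real \<Rightarrow>\<^sub>C 'a" and a b
    by (intro integrable_continuous_interval continuous_on_compose2[OF gcont[of UNIV]] continuous_intros) auto
  have der: "(I (\<lambda>s. g (apply_bcontfun p s)) has_vector_derivative g (apply_bcontfun p t)) (at t within {-\<tau>..\<tau>})"
    if "t \<in> {-\<tau>..\<tau>}" for p :: "real \<Rightarrow>\<^sub>C 'a" and t
  proof -
    have "continuous_on {-\<tau>..\<tau>} (\<lambda>s. g (apply_bcontfun p s))"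
      by (intro continuous_on_compose2[OF gcont[of UNIV]] continuous_intros) auto
    from has_vector_derivative_add[OF has_vector_derivative_const
        has_vector_derivative_diff[OF integral_has_vector_derivative[OF this that] has_vector_derivative_const]]
    show ?thesis unfolding I_def by simp
  qed
  have Icont: "continuous_on {-\<tau>..\<tau>} (I (\<lambda>s. g (apply_bcontfun p s)))" for p :: "real \<Rightarrow>\<^sub>C 'a"
    unfolding continuous_on_eq_continuous_within by (blast intro: has_vector_derivative_continuous der)
  have Ibd: "norm (integral {-\<tau>..t} h) \<le> B * (2 * \<tau>)" 
    if "t \<in> {-\<tau>..\<tau>}" "h integrable_on {-\<tau>..t}" "\<And>s. norm (h s) \<le> B" "B \<ge> 0" for h :: "real \<Rightarrow> 'a" and t B
  proof -
    have "norm (integral {-\<tau>..t} h) \<le> integral {-\<tau>..t} (\<lambda>_. B)"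
      using that by (intro integral_norm_bound_integral) auto
    also have "\<dots> = B * (t - (-\<tau>))" using that by simp
    also have "\<dots> \<le> B * (2 * \<tau>)" using that by (intro mult_left_mono) auto
    finally show ?thesis .
  qed
  have bc: "(\<lambda>t. I (\<lambda>s. g (apply_bcontfun p s)) (cl t)) \<in> bcontfun" for p :: "real \<Rightarrow>\<^sub>C 'a"
  proof -
    have "continuous_on UNIV (\<lambda>t. I (\<lambda>s. g (apply_bcontfun p s)) (cl t))"
      by (rule continuous_on_compose2[OF Icont]) (auto simp: cl_def intro!: continuous_intros, use \<tau> in auto)
    moreover have "bounded (range (\<lambda>t. I (\<lambda>s. g (apply_bcontfun p s)) (cl t)))"
      using compact_imp_bounded[OF compact_continuous_image[OF Icont compact_Icc], of p]
      by (rule bounded_subset) (use cl in auto)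
    ultimately show ?thesis by (simp add: bcontfun_def)
  qed
  define T where "T p = Bcontfun (\<lambda>t. I (\<lambda>s. g (apply_bcontfun p s)) (cl t))" for p
  have Tap: "apply_bcontfun (T p) t = I (\<lambda>s. g (apply_bcontfun p s)) (cl t)" for p t
    unfolding T_def using bc by (simp add: Bcontfun_inverse)
  have "dist (T p) (T q) \<le> (1/2) * dist p q" for p q
  proof (rule dist_bound)
    fix t
    let ?h = "\<lambda>s. g (apply_bcontfun p s) - g (apply_bcontfun q s)"
    have hb: "norm (?h s) \<le> L * dist p q" for s
      using glip[of "apply_bcontfun p s" "apply_bcontfun q s"] dist_bounded[of p s q] L0
      by (smt (verit) dist_norm mult_left_mono)
    have "I (\<lambda>s. g (apply_bcontfun p s)) (cl t) - I (\<lambda>s. g (apply_bcontfun q s)) (cl t)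
        = integral {-\<tau>..cl t} ?h - integral {-\<tau>..0} ?h"
      by (simp add: I_def int Henstock_Kurzweil_Integration.integral_diff)
    also have "norm \<dots> \<le> norm (integral {-\<tau>..cl t} ?h) + norm (integral {-\<tau>..0} ?h)"
      by (rule norm_triangle_ineq4)
    also have "\<dots> \<le> (L * dist p q) * (2 * \<tau>) + (L * dist p q) * (2 * \<tau>)"
      using \<tau> cl hb L0 by (intro add_mono Ibd integrable_diff int) auto
    also have "\<dots> = (4 * L * \<tau>) * dist p q" by simp
    also have "\<dots> \<le> (1/2) * dist p q" using \<tau>L by (intro mult_right_mono) auto
    finally show "dist (apply_bcontfun (T p) t) (apply_bcontfun (T q) t) \<le> 1/2 * dist p q"
      by (simp add: Tap dist_norm)
  qed
  hence "\<exists>!p. T p = p" by (intro banach_fix_type[of "1/2"]) auto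
  then obtain p where p: "T p = p" by blast
  have pI: "apply_bcontfun p t = I (\<lambda>s. g (apply_bcontfun p s)) (cl t)" for t
    using Tap[of p t] p by simp
  have pin: "apply_bcontfun p t \<in> cball x0 r" for t
  proof -
    have "norm (apply_bcontfun p t - x0) \<le> norm (integral {-\<tau>..cl t} (\<lambda>s. g (apply_bcontfun p s)))
        + norm (integral {-\<tau>..0} (\<lambda>s. g (apply_bcontfun p s)))"
      unfolding pI[of t] I_def using norm_triangle_ineq4 by simp
    also have "\<dots> \<le> M * (2 * \<tau>) + M * (2 * \<tau>)"
      using \<tau> cl gM M0 by (intro add_mono Ibd int) auto
    also have "\<dots> \<le> r" using \<tau>M by simp
    finally show ?thesis by (simp add: dist_norm norm_minus_commute)
  qed
  show ?thesis
  proof (intro exI[of _ \<tau>] exI[of _ "apply_bcontfun p"] conjI ballI \<tau> pin)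
    show "apply_bcontfun p 0 = x0" using \<tau> by (simp add: pI[of 0] I_def clid)
    fix t assume t: "t \<in> {-\<tau>..\<tau>}"
    have g: "g (apply_bcontfun p t) = f (apply_bcontfun p t)"
      using pin[of t] by (simp add: g_def closest_point_self)
    have "apply_bcontfun p s = I (\<lambda>s. g (apply_bcontfun p s)) s" if "s \<in> {-\<tau>..\<tau>}" for s
      by (subst pI) (simp only: clid[OF that])
    from has_vector_derivative_transform[OF t this der[OF t, of p]] g
    show "(apply_bcontfun p has_vector_derivative f (apply_bcontfun p t)) (at t within {-\<tau>..\<tau>})"
      by simp
  qed
qed

text \<open>At the first time outside \<open>W\<close>, all earlier points lie in \<open>K\<close>
  by \<open>step\<close>, and so does their limit because \<open>K\<close> is closed; but
  \<open>K\<close> is inside \<open>W\<close>. The lemma turns an estimate that is valid only as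
  long as the curve stays in a chart into the fact that it stays there.\<close>

lemma no_escape:
  fixes \<gamma> :: "real \<Rightarrow> 'x::topological_space"
  assumes cont: "continuous_on {0..1} \<gamma>" and W: "open W" and K: "closed K" "K \<subseteq> W" "\<gamma> 0 \<in> K"
    and step: "\<And>t. t \<in> {0..1} \<Longrightarrow> (\<forall>s\<in>{0..t}. \<gamma> s \<in> W) \<Longrightarrow> \<gamma> t \<in> K"
  shows "\<forall>t\<in>{0..1}. \<gamma> t \<in> K"
proof (rule ccontr)
  assume "\<not> ?thesis"
  then obtain t1 where t1: "t1 \<in> {0..1}" "\<gamma> t1 \<notin> K" by blast
  define B where "B = {0..1} \<inter> \<gamma> -` (- W)"
  have clB: "closed B" unfolding B_def
    using cont W by (intro continuous_closed_preimage) auto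
  have "B \<noteq> {}"
    using step[OF t1(1)] t1 by (force simp: B_def)
  moreover have bdd: "bdd_below B" by (rule bdd_belowI[of _ 0]) (auto simp: B_def)
  ultimately have t0: "Inf B \<in> B" using clB closed_contains_Inf by blast
  define t0 where "t0 = Inf B"
  have t0B: "t0 \<in> {0..1}" "\<gamma> t0 \<notin> W" using t0 by (auto simp: B_def t0_def)
  have t0pos: "t0 > 0" using t0B K by (cases "t0 = 0") auto
  have before: "\<gamma> s \<in> W" if "0 \<le> s" "s < t0" for s
    using that cInf_lower[OF _ bdd, of s] t0B by (force simp: B_def t0_def)
  have inK: "\<gamma> s \<in> K" if "0 \<le> s" "s < t0" for s
    using that t0B by (intro step ballI before) auto
  have "(\<gamma> \<longlongrightarrow> \<gamma> t0) (at t0 within {0..1})"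
    using cont t0B(1) by (simp add: continuous_on_def)
  hence "(\<gamma> \<longlongrightarrow> \<gamma> t0) (at t0 within {0..<t0})"
    by (rule tendsto_within_subset) (use t0B in auto)
  moreover have "at t0 within {0..<t0} \<noteq> bot"
    using t0pos by (simp add: at_within_eq_bot_iff)
  moreover have "\<forall>\<^sub>F s in at t0 within {0..<t0}. \<gamma> s \<in> K"
    using inK by (auto simp: eventually_at_filter intro!: always_eventually)
  ultimately have "\<gamma> t0 \<in> K" using K(1) Lim_in_closed_set by blast
  thus False using t0B K by blast
qed

lemma norm_increment_le_integral:
  fixes y :: "real \<Rightarrow> 'a::banach"
  assumes ab: "a \<le> b" and T: "finite T" and cont: "continuous_on {a..b} y"
    and der: "\<And>t. t \<in> {a<..<b} - T \<Longrightarrow> (y has_vector_derivative y' t) (at t)"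
    and w: "w integrable_on {a..b}" and le: "\<And>t. t \<in> {a<..<b} - T \<Longrightarrow> norm (y' t) \<le> w t"
  shows "norm (y b - y a) \<le> integral {a..b} w"
proof -
  \<comment> \<open>At the endpoints and the exceptional times both integrands are replaced by 0, so
    that the norm bound holds everywhere.\<close>
  define z where "z t = (if t \<in> {a<..<b} - T then y' t else 0)" for t
  have z: "(z has_integral (y b - y a)) {a..b}"
    using T ab cont by (intro fundamental_theorem_of_calculus_interior_strong[OF T ab]) (auto simp: z_def der)
  define v where "v t = (if t \<in> {a<..<b} - T then w t else 0)" for t
  have sp: "negligible (insert a (insert b T))" using T by (simp add: negligible_finite)
  have v: "v integrable_on {a..b}" "integral {a..b} v = integral {a..b} w"
    using integrable_spike[OF w sp, of v] integral_spike[OF sp, of "{a..b}" v w] by (auto simp: v_def)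
  have "norm (integral {a..b} z) \<le> integral {a..b} v"
    using z v(1) by (intro integral_norm_bound_integral) (auto simp: z_def v_def le)
  thus ?thesis using z v(2) by (simp add: integral_unique)
qed

section \<open>Almost everywhere differentiability of Lipschitz functions\<close>

lemma emeasure_image_le_of_small_slopes:
  fixes g :: "real \<Rightarrow> real"
  assumes mono: "strict_mono g" and p: "p > 0"
    and E: "E \<in> sets lebesgue" and gE: "g ` E \<in> sets lebesgue"
    and slope: "\<And>x. x \<in> E \<Longrightarrow> \<exists>\<^sub>F h in at 0. (g (x + h) - g x) / h < p"
  shows "emeasure lebesgue (g ` E) \<le> ennreal p * emeasure lebesgue E"
proof (rule ennreal_le_epsilon)
  fix e :: real assume e: "0 < e"
  obtain U where U: "open U" "E \<subseteq> U" "(U - E) \<in> lmeasurable" "emeasure lebesgue (U - E) < ennreal (e / p)"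
    using sets_lebesgue_outer_open[OF E, of "e / p"] e p by auto
  define K where "K = {(l, u). l < u \<and> {l..u} \<subseteq> U \<and> g u - g l < p * (u - l)}"
  define ctr where "ctr = (\<lambda>(l, u). (g l + g u) / 2)"
  define rad where "rad = (\<lambda>(l, u). (g u - g l) / 2)"
  have cb: "cball (ctr i) (rad i) = {g (fst i)..g (snd i)}" if "i \<in> K" for i
    by (auto simp: ctr_def rad_def cball_eq_atLeastAtMost field_simps split: prod.splits)
  have vit: "\<exists>i. i \<in> K \<and> y \<in> cball (ctr i) (rad i) \<and> rad i < d" if y: "y \<in> g ` E" and d: "d > 0" for y d
  proof -
    obtain x where x: "x \<in> E" "y = g x" using y by blast
    obtain r where r: "r > 0" "cball x r \<subseteq> U" using U x open_contains_cball by blast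
    \<comment> \<open>The bound \<open>r\<close> keeps the interval in \<open>U\<close>; the bound
      \<open>d / p\<close> makes the image interval, of length below
      \<open>p * \<bar>h\<bar>\<close>, have radius less than \<open>d\<close>.\<close>
    define r' where "r' = min r (d / p)"
    have "r' > 0" using r d p by (auto simp: r'_def)
    hence "\<forall>\<^sub>F h in at (0::real). \<bar>h\<bar> < r' \<and> h \<noteq> 0"
      unfolding eventually_at by (intro exI[of _ r']) auto
    from frequently_rev_mp[OF slope[OF x(1)] eventually_mono[OF this]]
    have "\<exists>\<^sub>F h in at 0. (\<bar>h\<bar> < r' \<and> h \<noteq> 0) \<and> (g (x + h) - g x) / h < p" by auto
    then obtain h where h: "\<bar>h\<bar> < r'" "h \<noteq> 0" "(g (x + h) - g x) / h < p"
      using frequently_ex by blast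
    define i where "i = (min x (x + h), max x (x + h))"
    have sub: "{min x (x + h)..max x (x + h)} \<subseteq> cball x r"
      using h by (auto simp: dist_real_def r'_def)
    have sl: "g (max x (x + h)) - g (min x (x + h)) < p * (max x (x + h) - min x (x + h))"
      using h(2,3) by (cases "h > 0") (auto simp: field_simps min_def max_def)
    have iK: "i \<in> K" unfolding K_def i_def using sub r(2) sl h(2) by auto
    moreover have "y \<in> cball (ctr i) (rad i)"
      unfolding cb[OF iK] x(2) using strict_mono_mono[OF mono] by (auto simp: i_def mono_def)
    moreover have "rad i < d"
    proof -
      have "2 * rad i < p * \<bar>h\<bar>" using sl by (simp add: rad_def i_def max_def min_def split: if_splits)
      also have "\<dots> \<le> p * (d / p)" using h(1) p by (intro mult_left_mono) (auto simp: r'_def)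
      finally show ?thesis using p d by simp
    qed
    ultimately show ?thesis by blast
  qed
  have posr: "0 < rad i" if "i \<in> K" for i
    using that strict_monoD[OF mono] by (auto simp: K_def rad_def)
  obtain C where C: "countable C" "C \<subseteq> K"
     "pairwise (\<lambda>i j. disjnt (cball (ctr i) (rad i)) (cball (ctr j) (rad j))) C"
     "negligible (g ` E - (\<Union>i\<in>C. cball (ctr i) (rad i)))"
    by (rule Vitali_covering_theorem_cballs[of K rad "g ` E" ctr, OF posr vit])
  define I where "I i = {fst i..snd i}" for i :: "real \<times> real"
  have dis: "disjoint_family_on (\<lambda>i. cball (ctr i) (rad i)) C"
    using C(3) by (auto simp: disjoint_family_on_def pairwise_def disjnt_def)
  have "disjoint_family_on I C"
    unfolding disjoint_family_on_def
  proof (intro ballI impI)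
    fix i j assume ij: "i \<in> C" "j \<in> C" "i \<noteq> j"
    have "g x \<in> cball (ctr k) (rad k)" if "x \<in> I k" "k \<in> K" for x k
      using that strict_mono_mono[OF mono] by (auto simp: cb I_def mono_def)
    thus "I i \<inter> I j = {}" using dis ij C(2) unfolding disjoint_family_on_def by blast
  qed
  note disI = this
  have "emeasure lebesgue (g ` E) \<le> emeasure lebesgue (\<Union>i\<in>C. cball (ctr i) (rad i))"
  proof -
    have "(\<Union>i\<in>C. cball (ctr i) (rad i)) \<in> sets lebesgue"
      using C(1) by (intro sets.countable_UN') auto
    note un = sets.Un[OF this gE]
    have "emeasure lebesgue (g ` E) \<le> emeasure lebesgue ((\<Union>i\<in>C. cball (ctr i) (rad i)) \<union> (g ` E - (\<Union>i\<in>C. cball (ctr i) (rad i))))"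
      using un by (intro emeasure_mono) auto
    also have "\<dots> = emeasure lebesgue (\<Union>i\<in>C. cball (ctr i) (rad i))"
      using C(1,4) gE by (intro emeasure_Un_null_set) (auto simp: negligible_iff_null_sets)
    finally show ?thesis .
  qed
  also have "\<dots> = (\<integral>\<^sup>+i. emeasure lebesgue (cball (ctr i) (rad i)) \<partial>count_space C)"
    using C(1) dis by (intro emeasure_UN_countable) auto
  also have "\<dots> \<le> (\<integral>\<^sup>+i. ennreal p * emeasure lebesgue (I i) \<partial>count_space C)"
  proof (intro nn_integral_mono)
    fix i assume "i \<in> space (count_space C)"
    hence i: "i \<in> K" using C by auto
    hence "fst i < snd i" "g (snd i) - g (fst i) < p * (snd i - fst i)" by (auto simp: K_def)
    thus "emeasure lebesgue (cball (ctr i) (rad i)) \<le> ennreal p * emeasure lebesgue (I i)"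
      unfolding cb[OF i] I_def using p strict_monoD[OF mono, of "fst i" "snd i"]
      by (simp add: ennreal_mult[symmetric])
  qed
  also have "\<dots> = ennreal p * (\<integral>\<^sup>+i. emeasure lebesgue (I i) \<partial>count_space C)"
    by (rule nn_integral_cmult) simp
  also have "(\<integral>\<^sup>+i. emeasure lebesgue (I i) \<partial>count_space C) = emeasure lebesgue (\<Union>i\<in>C. I i)"
    using C(1) disI by (intro emeasure_UN_countable[symmetric]) (simp_all add: I_def[abs_def])
  also have "ennreal p * emeasure lebesgue (\<Union>i\<in>C. I i) \<le> ennreal p * emeasure lebesgue U"
  proof -
    have "I i \<subseteq> U" if "i \<in> C" for i
      using that C(2) by (cases i) (auto simp: K_def I_def)
    thus ?thesis using U(1) by (intro mult_left_mono emeasure_mono UN_least) auto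
  qed
  also have "emeasure lebesgue U \<le> emeasure lebesgue (E \<union> (U - E))"
    using E U by (intro emeasure_mono) auto
  also have "\<dots> \<le> emeasure lebesgue E + emeasure lebesgue (U - E)"
    using E U by (intro emeasure_subadditive) auto
  also have "\<dots> \<le> emeasure lebesgue E + ennreal (e / p)"
    using U(4) by (intro add_left_mono) auto
  also have "ennreal p * (emeasure lebesgue E + ennreal (e / p)) = ennreal p * emeasure lebesgue E + ennreal e"
    using p e by (simp add: distrib_left ennreal_mult[symmetric])
  finally show "emeasure lebesgue (g ` E) \<le> ennreal p * emeasure lebesgue E + ennreal e"
    by (simp add: mult_left_mono)
qed

lemma frequently_at_0_iff:
  "(\<exists>\<^sub>F h in at (0::real). P h) \<longleftrightarrow> (\<forall>n::nat. \<exists>h. h \<noteq> 0 \<and> \<bar>h\<bar> < inverse (real (Suc n)) \<and> P h)"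
proof -
  have "(\<forall>d>0. \<exists>h. h \<noteq> 0 \<and> \<bar>h\<bar> < d \<and> P h) \<longleftrightarrow> (\<forall>n::nat. \<exists>h. h \<noteq> 0 \<and> \<bar>h\<bar> < inverse (real (Suc n)) \<and> P h)"
  proof safe
    fix d :: real assume A: "\<forall>n. \<exists>h. h \<noteq> 0 \<and> \<bar>h\<bar> < inverse (real (Suc n)) \<and> P h" and "d > 0"
    then obtain n where "inverse (real (Suc n)) < d" using reals_Archimedean by blast
    thus "\<exists>h. h \<noteq> 0 \<and> \<bar>h\<bar> < d \<and> P h" using A by (meson less_trans)
  qed auto
  thus ?thesis by (auto simp: frequently_def eventually_at)
qed

text \<open>The set is a countable intersection of open sets: for fixed nonzero \<open>h\<close> the
  slope is continuous in \<open>x\<close>, and uncountable unions over \<open>h\<close> stay open.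
  Only the bound on the size of \<open>h\<close> has to run over a sequence.\<close>

lemma frequent_slopes_borel:
  fixes g :: "real \<Rightarrow> real"
  assumes cont: "continuous_on UNIV g" and "open A"
  shows "{x. \<exists>\<^sub>F h in at 0. (g (x + h) - g x) / h \<in> A} \<in> sets borel"
proof -
  have "{x. \<exists>\<^sub>F h in at 0. (g (x + h) - g x) / h \<in> A} =
    (\<Inter>n::nat. \<Union>h\<in>{h. h \<noteq> 0 \<and> \<bar>h\<bar> < inverse (real (Suc n))}. (\<lambda>x. (g (x + h) - g x) / h) -` A)"
    unfolding frequently_at_0_iff by auto
  moreover have "open ((\<lambda>x. (g (x + h) - g x) / h) -` A)" if "h \<noteq> 0" for h
    using that by (intro open_vimage[OF \<open>open A\<close>] continuous_intros continuous_on_compose2[OF cont]) auto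
  hence "open (\<Union>h\<in>{h. h \<noteq> 0 \<and> \<bar>h\<bar> < inverse (real (Suc n))}. (\<lambda>x. (g (x + h) - g x) / h) -` A)" for n :: nat
    by auto
  ultimately show ?thesis by (auto intro!: borel_open)
qed

text \<open>\<open>c\<close> is the lower derivate. If slopes exceed some \<open>a > c\<close>
  arbitrarily close to 0, two rationals between \<open>c\<close> and \<open>a\<close> separate the
  frequent slopes; otherwise \<open>c\<close> is the derivative. The lower bound 1 on slopes makes
  the rationals positive.\<close>

lemma not_differentiable_slopes:
  fixes g :: "real \<Rightarrow> real"
  assumes nd: "\<not> g differentiable at x"
    and bd: "\<And>h. h \<noteq> 0 \<Longrightarrow> 1 \<le> (g (x + h) - g x) / h \<and> (g (x + h) - g x) / h \<le> M"
  shows "\<exists>p\<in>\<rat>. \<exists>q\<in>\<rat>. 0 < p \<and> p < q \<and>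
    (\<exists>\<^sub>F h in at 0. (g (x + h) - g x) / h < p) \<and> (\<exists>\<^sub>F h in at 0. q < (g (x + h) - g x) / h)"
proof (rule ccontr)
  assume *: "\<not> ?thesis"
  let ?s = "\<lambda>h. (g (x + h) - g x) / h"
  define P where "P = {p. \<forall>\<^sub>F h in at 0. p \<le> ?s h}"
  have nz: "\<forall>\<^sub>F h in at (0::real). h \<noteq> 0" by (simp add: eventually_at_filter)
  have P1: "1 \<in> P" unfolding P_def using nz by (auto elim!: eventually_mono simp: bd)
  have Pb: "p \<le> M" if "p \<in> P" for p
  proof -
    have "\<forall>\<^sub>F h in at (0::real). p \<le> ?s h \<and> h \<noteq> 0"
      using that nz by (simp add: P_def eventually_conj)
    from eventually_happens'[OF _ this] obtain h where "p \<le> ?s h" "h \<noteq> 0" by auto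
    thus ?thesis using bd[of h] by linarith
  qed
  have bdd: "bdd_above P" using Pb by (rule bdd_aboveI)
  define c where "c = Sup P"
  have c1: "c \<ge> 1" unfolding c_def using P1 bdd by (rule cSup_upper)
  have "(?s \<longlongrightarrow> c) (at 0)"
  proof (rule order_tendstoI)
    fix a assume "a < c"
    then obtain p where "p \<in> P" "a < p" unfolding c_def using less_cSup_iff[OF _ bdd] P1 by blast
    thus "\<forall>\<^sub>F h in at 0. a < ?s h" unfolding P_def by (auto elim!: eventually_mono)
  next
    fix a assume a: "c < a"
    show "\<forall>\<^sub>F h in at 0. ?s h < a"
    proof (rule ccontr)
      assume "\<not> ?thesis"
      hence F: "\<exists>\<^sub>F h in at 0. a \<le> ?s h" by (simp add: frequently_def not_le)
      obtain p where p: "p \<in> \<rat>" "c < p" "p < a" using Rats_dense_in_real[OF a] by blast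
      obtain q where q: "q \<in> \<rat>" "p < q" "q < a" using Rats_dense_in_real[OF p(3)] by blast
      have "\<exists>\<^sub>F h in at 0. q < ?s h" using F q by (auto elim!: frequently_elim1)
      moreover have "p \<notin> P" using p(2) cSup_upper[OF _ bdd, of p] by (auto simp: c_def)
      hence "\<exists>\<^sub>F h in at 0. ?s h < p" by (simp add: P_def frequently_def not_less)
      ultimately show False using * p q c1 by force
    qed
  qed
  hence "DERIV g x :> c" by (simp add: DERIV_def)
  thus False using nd real_differentiable_def by blast
qed

text \<open>Let \<open>E\<close> be the set where slopes below \<open>p\<close> and slopes above
  \<open>q > p\<close> both recur. The covering estimate bounds the measure of \<open>g\<close>
  E\<open>by\<close>p\<open>times that of\<close>E\<open>; applied to the inverse function, whose
  slopes are reciprocal, it bounds the measure of\<close>E\<open>by\<close>1 /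
  q\<open>times that of\<close>g \<open>E\<close>. As \<open>p / q < 1\<close>, a bounded such
  \<open>E\<close> is null.\<close>

lemma lipschitz_real_negligible_not_differentiable:
  fixes f :: "real \<Rightarrow> real"
  assumes lip: "L-lipschitz_on UNIV f"
  shows "negligible {x. \<not> f differentiable at x}"
proof -
  have L0: "L \<ge> 0" using lip by (rule lipschitz_on_nonneg)
  \<comment> \<open>Adding a linear function does not affect differentiability and puts all slopes
    into the interval from 1 to \<open>2 * L + 1\<close>, which gives an increasing Lipschitz
    bijection with 1-Lipschitz inverse.\<close>
  define g where "g x = f x + (L + 1) * x" for x
  define M where "M = 2 * L + 1"
  have sl: "1 \<le> (g (x + h) - g x) / h \<and> (g (x + h) - g x) / h \<le> M" if "h \<noteq> 0" for x h
  proof -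
    have "\<bar>f (x + h) - f x\<bar> \<le> L * \<bar>h\<bar>"
      using lipschitz_onD[OF lip, of "x + h" x] by (simp add: dist_real_def)
    hence "\<bar>(f (x + h) - f x) / h\<bar> \<le> L" using that by (simp add: abs_divide field_simps)
    moreover have "(g (x + h) - g x) / h = (f (x + h) - f x) / h + (L + 1)"
      using that by (simp add: g_def field_simps)
    ultimately show ?thesis unfolding abs_le_iff M_def by linarith
  qed
  have sm: "strict_mono g"
  proof (rule strict_monoI)
    fix x y :: real assume "x < y"
    thus "g x < g y" using sl[of "y - x" x] by (simp add: field_simps)
  qed
  have cg: "continuous_on UNIV g" unfolding g_def
    using lipschitz_on_continuous_on[OF lip] by (intro continuous_intros) auto
  have surj: "surj g"
  proof -
    have "\<exists>x. g x = y" for y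
    proof -
      define B where "B = \<bar>y - g 0\<bar> + 1"
      have B: "B > 0" by (simp add: B_def)
      have "1 \<le> (g B - g 0) / B" using sl[of B 0] B by simp
      hence "B \<le> g B - g 0" using B by (simp add: le_divide_eq)
      hence "y \<le> g B" by (simp add: B_def)
      moreover have "1 \<le> (g 0 - g (-B)) / B" using sl[of "-B" 0] B by (simp add: minus_divide_left)
      hence "B \<le> g 0 - g (-B)" using B by (simp add: le_divide_eq)
      hence "g (-B) \<le> y" by (simp add: B_def)
      ultimately show ?thesis using IVT'[of g "-B" y B] B continuous_on_subset[OF cg] by force
    qed
    thus ?thesis by (metis surjI)
  qed
  define k where "k = inv g"
  have gk: "g (k y) = y" for y unfolding k_def using surj by (simp add: surj_f_inv_f)
  have kg: "k (g x) = x" for x unfolding k_def using sm by (simp add: strict_mono_imp_inj_on)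
  have gim: "g ` X = k -` X" for X
    by (auto simp: kg) (metis gk imageI)
  have smk: "strict_mono k"
    using sm gk by (metis strict_monoI strict_mono_less)
  have ck: "continuous_on UNIV k"
  proof (rule lipschitz_on_continuous_on, rule lipschitz_onI)
    fix x y :: real
    show "dist (k x) (k y) \<le> 1 * dist x y"
    proof (cases "k x = k y")
      case False
      have "\<bar>k x - k y\<bar> \<le> \<bar>g (k x) - g (k y)\<bar>"
        using sl[of "k x - k y" "k y"] False
        by (auto simp: field_simps abs_if split: if_splits)
      thus ?thesis by (simp add: gk dist_real_def)
    qed auto
  qed auto
  have neg: "negligible ({x. (\<exists>\<^sub>F h in at 0. (g (x + h) - g x) / h < p) \<and>
       (\<exists>\<^sub>F h in at 0. q < (g (x + h) - g x) / h)} \<inter> {-real n..real n})" (is "negligible ?E")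
    if pq: "0 < p" "p < q" for p q and n :: nat
  proof -
    have "{x. (\<exists>\<^sub>F h in at 0. (g (x + h) - g x) / h < p)} \<in> sets borel"
      using frequent_slopes_borel[OF cg, of "{..<p}"] by simp
    moreover have "{x. (\<exists>\<^sub>F h in at 0. q < (g (x + h) - g x) / h)} \<in> sets borel"
      using frequent_slopes_borel[OF cg, of "{q<..}"] by simp
    ultimately have "{x. (\<exists>\<^sub>F h in at 0. (g (x + h) - g x) / h < p)} \<inter> 
      {x. (\<exists>\<^sub>F h in at 0. q < (g (x + h) - g x) / h)} \<inter> {-real n..real n} \<in> sets borel" by (intro sets.Int) auto
    hence EB: "?E \<in> sets borel" by (simp add: Collect_conj_eq)
    have gE: "g ` ?E = k -` ?E" by (rule gim)
    have gEB: "g ` ?E \<in> sets borel"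
      unfolding gE using measurable_sets[OF borel_measurable_continuous_onI[OF ck] EB] by simp
    have "emeasure lebesgue (g ` ?E) \<le> ennreal p * emeasure lebesgue ?E"
      using EB gEB pq by (intro emeasure_image_le_of_small_slopes[OF sm]) auto
    moreover have "emeasure lebesgue (k ` (g ` ?E)) \<le> ennreal (1/q) * emeasure lebesgue (g ` ?E)"
    proof (rule emeasure_image_le_of_small_slopes[OF smk])
      show "k ` g ` ?E \<in> sets lebesgue" using EB by (simp add: image_image kg)
      fix y assume "y \<in> g ` ?E"
      then obtain x where x: "y = g x" "\<exists>\<^sub>F h in at 0. q < (g (x + h) - g x) / h" by blast
      show "\<exists>\<^sub>F h in at 0. (k (y + h) - k y) / h < 1 / q"
        unfolding frequently_def eventually_at
      proof safe
        fix d :: real assume d: "d > 0" 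
          and A: "\<forall>h\<in>UNIV. h \<noteq> 0 \<and> dist h 0 < d \<longrightarrow> \<not> (k (y + h) - k y) / h < 1 / q"
        have "M > 0" using L0 by (simp add: M_def)
        hence "\<exists>h. h \<noteq> 0 \<and> \<bar>h\<bar> < d / M \<and> q < (g (x + h) - g x) / h"
          using x(2) divide_pos_pos[OF d \<open>M > 0\<close>] unfolding frequently_def eventually_at
          by (auto simp: not_less dest!: spec[of _ "d / M"])
        then obtain h where h: "h \<noteq> 0" "\<bar>h\<bar> < d / M" "q < (g (x + h) - g x) / h" by blast
        \<comment> \<open>Increments of \<open>k\<close> at \<open>y\<close> correspond to
          increments of \<open>g\<close> at \<open>x\<close>; the bound \<open>d / M\<close> on
          \<open>h\<close> guarantees that \<open>h'\<close> is smaller than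
          \<open>d\<close>.\<close>
        define h' where "h' = g (x + h) - g x"
        have h'0: "h' \<noteq> 0" using sl[of h x] h(1) by (auto simp: h'_def)
        have s1: "1 \<le> h' / h" "h' / h \<le> M" using sl[of h x] h(1) by (auto simp: h'_def)
        have "\<bar>h'\<bar> = (h' / h) * \<bar>h\<bar>" using abs_of_nonneg[of "h' / h"] s1 h(1)
          by (metis abs_mult nonzero_eq_divide_eq order_trans zero_le_one)
        also have "\<dots> \<le> M * \<bar>h\<bar>" using s1 by (intro mult_right_mono) auto
        also have "\<dots> < d" using h(2) \<open>M > 0\<close> by (simp add: field_simps)
        finally have "\<not> (k (y + h') - k y) / h' < 1 / q" using A h'0 by auto
        moreover have "k (y + h') - k y = h" by (simp add: h'_def x(1) kg)
        moreover have "h / h' < 1 / q"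
        proof -
          have "h / h' = 1 / (h' / h)" by simp
          also have "\<dots> < 1 / q"
            using h(3) pq s1 unfolding h'_def by (intro divide_strict_left_mono mult_pos_pos) linarith+
          finally show ?thesis .
        qed
        ultimately show False by simp
      qed
    qed (use gEB pq in auto)
    ultimately have "emeasure lebesgue ?E \<le> ennreal (1/q) * (ennreal p * emeasure lebesgue ?E)"
      by (simp add: image_image kg) (meson order_trans mult_left_mono zero_le)
    also have "\<dots> = ennreal (p / q) * emeasure lebesgue ?E"
      using pq by (simp add: mult.assoc[symmetric] ennreal_mult[symmetric])
    finally have le: "emeasure lebesgue ?E \<le> ennreal (p / q) * emeasure lebesgue ?E" .
    have "emeasure lebesgue ?E \<le> emeasure lebesgue {-real n..real n}"
      using EB by (intro emeasure_mono) auto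
    hence fin: "emeasure lebesgue ?E < \<infinity>" by (simp add: order_le_less_trans)
    have "\<exists>r\<ge>0. emeasure lebesgue ?E = ennreal r"
      using fin by (cases "emeasure lebesgue ?E" rule: ennreal_cases) auto
    then obtain r where r: "r \<ge> 0" "emeasure lebesgue ?E = ennreal r" by (elim exE conjE)
    have "r \<le> (p / q) * r" using le r pq by (simp add: ennreal_mult[symmetric])
    moreover have "(p / q) * r < 1 * r" if "r > 0"
      using pq that by (intro mult_strict_right_mono) auto
    ultimately have "r = 0" using r(1) by force
    thus ?thesis using r EB by (subst negligible_iff_emeasure0) auto
  qed
  have "{x. \<not> f differentiable at x} \<subseteq> (\<Union>p\<in>\<rat>\<inter>{0<..}. \<Union>q\<in>\<rat>\<inter>{p<..}. \<Union>n::nat.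
     {x. (\<exists>\<^sub>F h in at 0. (g (x + h) - g x) / h < p) \<and>
       (\<exists>\<^sub>F h in at 0. q < (g (x + h) - g x) / h)} \<inter> {-real n..real n})"
  proof
    fix x assume "x \<in> {x. \<not> f differentiable at x}"
    hence nd: "\<not> f differentiable at x" by simp
    have "\<not> g differentiable at x"
    proof
      assume "g differentiable at x"
      hence "(\<lambda>x. g x - (L + 1) * x) differentiable at x" by simp
      thus False using nd by (simp add: g_def)
    qed
    from not_differentiable_slopes[OF this, of M] sl obtain p q where
      "p \<in> \<rat>" "q \<in> \<rat>" "0 < p" "p < q" "\<exists>\<^sub>F h in at 0. (g (x + h) - g x) / h < p"
      "\<exists>\<^sub>F h in at 0. q < (g (x + h) - g x) / h" by blast
    moreover obtain n :: nat where "\<bar>x\<bar> \<le> real n" using real_arch_simple by blast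
    hence "x \<in> {-real n..real n}" by auto
    ultimately show "x \<in> (\<Union>p\<in>\<rat>\<inter>{0<..}. \<Union>q\<in>\<rat>\<inter>{p<..}. \<Union>n::nat.
     {x. (\<exists>\<^sub>F h in at 0. (g (x + h) - g x) / h < p) \<and>
       (\<exists>\<^sub>F h in at 0. q < (g (x + h) - g x) / h)} \<inter> {-real n..real n})" by fast
  qed
  moreover have "negligible \<dots>"
  proof -
    have cn: "negligible (\<Union>(X ` I))" if "countable I" "\<And>i. i \<in> I \<Longrightarrow> negligible (X i)"
      for I :: "real set" and X :: "real \<Rightarrow> real set"
      using that by (intro negligible_countable_Union) auto
    have cn2: "negligible (\<Union>n::nat. X n)" if "\<And>n. negligible (X n)" for X :: "nat \<Rightarrow> real set"
      using that by (intro negligible_countable_Union) auto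
    have Q: "countable (\<rat> \<inter> X)" for X :: "real set"
      by (rule countable_subset[OF _ countable_rat]) auto
    show ?thesis
      by (rule cn[OF Q], rule cn[OF Q], rule cn2, rule neg)
        (simp_all only: Int_iff greaterThan_iff)
  qed
  ultimately show ?thesis by (rule negligible_subset[rotated])
qed

lemma lipschitz_AE_differentiable:
  fixes f :: "real \<Rightarrow> 'a::euclidean_space"
  assumes lip: "L-lipschitz_on UNIV f"
  shows "AE x in lebesgue. f differentiable at x"
proof -
  have "negligible {x. \<not> (\<lambda>x. f x \<bullet> b) differentiable at x}" if b: "b \<in> Basis" for b
  proof (rule lipschitz_real_negligible_not_differentiable, rule lipschitz_onI)
    fix x y :: real
    have "\<bar>f x \<bullet> b - f y \<bullet> b\<bar> \<le> norm (f x - f y)"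
      using Basis_le_norm[OF b, of "f x - f y"] by (simp add: inner_diff_left)
    also have "\<dots> \<le> L * dist x y" using lipschitz_onD[OF lip, of x y] by (simp add: dist_norm)
    finally show "dist (f x \<bullet> b) (f y \<bullet> b) \<le> L * dist x y" by (simp add: dist_real_def)
  qed (rule lipschitz_on_nonneg[OF lip])
  hence "negligible (\<Union>b\<in>Basis. {x. \<not> (\<lambda>x. f x \<bullet> b) differentiable at x})"
    by (intro negligible_Union) auto
  moreover have "{x. \<not> f differentiable at x} = (\<Union>b\<in>Basis. {x. \<not> (\<lambda>x. f x \<bullet> b) differentiable at x})"
    using differentiable_componentwise_within[of f _ UNIV] by auto
  ultimately have "{x. \<not> f differentiable at x} \<in> null_sets lebesgue"
    by (simp add: negligible_iff_null_sets)
  thus ?thesis by (rule AE_I') auto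
qed

section \<open>Lie groups in a chart\<close>

lemma has_derivative_eventually_cong:
  assumes "(f has_derivative f') (at x within S)" "\<forall>\<^sub>F y in at x within S. g y = f y" "g x = f x"
  shows "(g has_derivative f') (at x within S)"
proof -
  have "bounded_linear f'" "((\<lambda>y. (1 / norm (y - x)) *\<^sub>R (f y - (f x + f' (y - x)))) \<longlongrightarrow> 0) (at x within S)"
    using assms(1) by (auto simp: has_derivative_within)
  moreover have "\<forall>\<^sub>F y in at x within S. (1 / norm (y - x)) *\<^sub>R (f y - (f x + f' (y - x)))
      = (1 / norm (y - x)) *\<^sub>R (g y - (g x + f' (y - x)))"
    using assms(2) by eventually_elim (simp add: assms(3))
  ultimately show ?thesis by (auto simp: has_derivative_within intro: Lim_transform_eventually)
qed

locale lie_chart =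
  fixes mul :: "'g::{t2_space, second_countable_topology} \<Rightarrow> 'g \<Rightarrow> 'g"
    and e :: 'g and iv :: "'g \<Rightarrow> 'g"
    and A :: "('g, 'e::euclidean_space) chart set" and c :: "('g, 'e) chart"
  assumes lie: "lie_group mul e iv A" and chart: "c \<in> A" "e \<in> fst c"
begin

notation mul (infixl "\<odot>" 70)

sublocale G: group mul e iv
  using lie by (simp add: lie_group_def)

section \<open>The chart at the identity and the group operations in it\<close>

definition "U = fst c"
definition "\<phi> = snd c"
definition "\<xi> = inv_into U \<phi>"
definition "x0 = \<phi> e"

lemma mul_iv_cancel [simp]: "iv a \<odot> (a \<odot> b) = b" "a \<odot> (iv a \<odot> b) = b"
  by (metis G.assoc G.left_inverse G.right_inverse G.left_neutral)+

lemma chart_facts: "open U" "open (\<phi> ` U)" "homeomorphism U (\<phi> ` U) \<phi> \<xi>" "e \<in> U"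
  using lie chart unfolding lie_group_def smooth_atlas_def
  by (auto simp: \<xi>_def U_def \<phi>_def split_beta)

lemma \<xi>\<phi> [simp]: "x \<in> U \<Longrightarrow> \<xi> (\<phi> x) = x"
  using chart_facts(3) by (simp add: homeomorphism_apply1)

lemma \<phi>\<xi> [simp]: "y \<in> \<phi> ` U \<Longrightarrow> \<phi> (\<xi> y) = y"
  by auto

lemma x0U: "x0 \<in> \<phi> ` U" and \<xi>x0 [simp]: "\<xi> x0 = e" and \<phi>e [simp]: "\<phi> e = x0"
  using chart_facts(4) by (auto simp: x0_def)

lemma isCont_\<phi>: "x \<in> U \<Longrightarrow> isCont \<phi> x"
  using chart_facts by (meson continuous_on_eq_continuous_at homeomorphism_def)

lemma isCont_\<xi>: "y \<in> \<phi> ` U \<Longrightarrow> isCont \<xi> y"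
  using chart_facts by (meson continuous_on_eq_continuous_at homeomorphism_def)

lemma cont_mul: "continuous_on UNIV (\<lambda>(x, y). x \<odot> y)" and cont_iv: "continuous_on UNIV iv"
  using lie by (auto simp: lie_group_def smooth_map_def)

lemma tendsto_mul [tendsto_intros]:
  assumes "(f \<longlongrightarrow> a) F" "(g \<longlongrightarrow> b) F"
  shows "((\<lambda>x. f x \<odot> g x) \<longlongrightarrow> a \<odot> b) F"
proof -
  have "isCont (\<lambda>(x, y). x \<odot> y) (a, b)" using cont_mul by (simp add: continuous_on_eq_continuous_at)
  from isCont_tendsto_compose[OF this tendsto_Pair[OF assms]] show ?thesis by simp
qed

lemma tendsto_iv [tendsto_intros]:
  assumes "(f \<longlongrightarrow> a) F"
  shows "((\<lambda>x. iv (f x)) \<longlongrightarrow> iv a) F"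
  using isCont_tendsto_compose[OF _ assms, of iv] cont_iv by (simp add: continuous_on_eq_continuous_at)

lemma continuous_mul [continuous_intros]:
  "continuous F f \<Longrightarrow> continuous F g \<Longrightarrow> continuous F (\<lambda>x. f x \<odot> g x)"
  and continuous_iv [continuous_intros]: "continuous F f \<Longrightarrow> continuous F (\<lambda>x. iv (f x))"
  and continuous_on_mul [continuous_intros]:
  "continuous_on S f \<Longrightarrow> continuous_on S g \<Longrightarrow> continuous_on S (\<lambda>x. f x \<odot> g x)"
  and continuous_on_iv [continuous_intros]: "continuous_on S f \<Longrightarrow> continuous_on S (\<lambda>x. iv (f x))"
  unfolding continuous_def continuous_on_def by (auto intro: tendsto_intros)

text \<open>The group law read in the chart, defined as in the smoothness assumption.\<close>

definition "m = \<phi> \<circ> (\<lambda>(x, y). x \<odot> y) \<circ> inv_into (U \<times> U) (map_prod \<phi> \<phi>)"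
definition "S = map_prod \<phi> \<phi> ` ((U \<times> U) \<inter> (\<lambda>(x, y). x \<odot> y) -` U)"
definition "\<iota> = \<phi> \<circ> iv \<circ> \<xi>"
definition "U0 = U \<inter> iv -` U"
definition "Dm z = frechet_derivative m (at z)"
definition "D2m v z = frechet_derivative (\<lambda>z. Dm z v) (at z)"

lemma inj_\<phi>: "inj_on \<phi> U"
  by (metis \<xi>\<phi> inj_onI)

lemma m_eq: "x \<in> U \<Longrightarrow> y \<in> U \<Longrightarrow> m (\<phi> x, \<phi> y) = \<phi> (x \<odot> y)"
  using inv_into_f_f[OF map_prod_inj_on[OF inj_\<phi> inj_\<phi>], of "(x, y)"] by (simp add: m_def)

lemma S_iff: "x \<in> U \<Longrightarrow> y \<in> U \<Longrightarrow> (\<phi> x, \<phi> y) \<in> S \<longleftrightarrow> x \<odot> y \<in> U"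
  using inj_\<phi> by (auto simp: S_def map_prod_def inj_on_def) 

lemma smooth_m: "smooth_on m S"
proof -
  have "smooth_map (prod_atlas A A) A (\<lambda>(x, y). x \<odot> y)" using lie by (simp add: lie_group_def)
  moreover have "(U \<times> U, map_prod \<phi> \<phi>) \<in> prod_atlas A A"
    using chart unfolding prod_atlas_def by (auto simp: U_def \<phi>_def split_beta intro!: image_eqI[where x = "(c, c)"])
  ultimately show ?thesis
    using chart unfolding smooth_map_def m_def S_def by (fastforce simp: U_def \<phi>_def split_beta)
qed

lemma open_S: "open S"
proof -
  have S: "S = (\<phi> ` U \<times> \<phi> ` U) \<inter> (\<lambda>z. \<xi> (fst z) \<odot> \<xi> (snd z)) -` U"
    by (force simp: S_def)
  have "continuous_on (\<phi> ` U \<times> \<phi> ` U) (\<lambda>z. \<xi> (fst z) \<odot> \<xi> (snd z))"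
    by (intro continuous_intros continuous_on_compose2[OF homeomorphism_cont2[OF chart_facts(3)]]) auto
  thus ?thesis unfolding S
    using chart_facts by (intro continuous_open_preimage) (auto intro: open_Times)
qed

lemma m_C1: "z \<in> S \<Longrightarrow> (m has_derivative Dm z) (at z)"
proof -
  have "Ck_on (Suc 0) m S" using smooth_m by (simp add: smooth_on_def del: Ck_on.simps)
  thus "z \<in> S \<Longrightarrow> (m has_derivative Dm z) (at z)" by (simp add: Dm_def frechet_derivative_works[symmetric])
qed

lemma m_C2: "z \<in> S \<Longrightarrow> ((\<lambda>z. Dm z v) has_derivative D2m v z) (at z)"
  and m_C2_cont: "z \<in> S \<Longrightarrow> isCont (\<lambda>z. D2m v z w) z"
proof -
  have "Ck_on (Suc (Suc 0)) m S" using smooth_m unfolding smooth_on_def by blast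
  hence *: "Ck_on (Suc 0) (\<lambda>z. Dm z v) S" unfolding Dm_def by (subst (asm) Ck_on.simps(2)) blast
  hence "Ck_on 0 (\<lambda>z. D2m v z w) S" unfolding D2m_def by (subst (asm) Ck_on.simps(2)) blast
  thus "z \<in> S \<Longrightarrow> isCont (\<lambda>z. D2m v z w) z"
    using open_S by (simp add: continuous_on_eq_continuous_at)
  from * show "z \<in> S \<Longrightarrow> ((\<lambda>z. Dm z v) has_derivative D2m v z) (at z)"
    unfolding D2m_def by (subst (asm) Ck_on.simps(2)) (simp add: frechet_derivative_works[symmetric])
qed

lemma m_comp:
  assumes "(a has_derivative a') (at x within T)" "(b has_derivative b') (at x within T)" "(a x, b x) \<in> S"
  shows "((\<lambda>x. m (a x, b x)) has_derivative (\<lambda>v. Dm (a x, b x) (a' v, b' v))) (at x within T)"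
  using has_derivative_compose[of "\<lambda>x. (a x, b x)" "\<lambda>v. (a' v, b' v)" x T m,
      OF has_derivative_Pair[OF assms(1,2)] m_C1[OF assms(3)]] .

lemma Dm_comp:
  assumes "(a has_derivative a') (at x within T)" "(b has_derivative b') (at x within T)" "(a x, b x) \<in> S"
  shows "((\<lambda>x. Dm (a x, b x) w) has_derivative (\<lambda>v. D2m w (a x, b x) (a' v, b' v))) (at x within T)"
  using has_derivative_compose[of "\<lambda>x. (a x, b x)" "\<lambda>v. (a' v, b' v)" x T "\<lambda>z. Dm z w",
      OF has_derivative_Pair[OF assms(1,2)] m_C2[OF assms(3)]] .

lemma linear_Dm: "z \<in> S \<Longrightarrow> linear (Dm z)"
  using m_C1 has_derivative_linear by blast

lemma D2m_sym: "z \<in> S \<Longrightarrow> D2m v z w = D2m w z v"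
  by (rule second_derivative_symmetric[OF open_S _ m_C1 m_C2 m_C2 m_C2_cont m_C2_cont])

section \<open>Derivatives of the product at the identity\<close>

lemma z0S: "(x0, x0) \<in> S"
  using S_iff[of e e] chart_facts by simp

text \<open>Both partial maps \<open>m (x, x0)\<close> and \<open>m (x0, x)\<close> are the identity
  near \<open>x0\<close>, so the derivative is addition.\<close>

lemma Dm_z0: "Dm (x0, x0) (X, Y) = X + Y"
proof -
  have ev: "\<forall>\<^sub>F x in nhds x0. x \<in> \<phi> ` U" using chart_facts x0U by (intro eventually_nhds_in_open) auto
  have d1: "((\<lambda>x. m (x, x0)) has_derivative (\<lambda>X. Dm (x0, x0) (X, 0))) (at x0)"
    by (rule m_comp[of "\<lambda>x. x" "\<lambda>X. X" x0 UNIV "\<lambda>x. x0" "\<lambda>X. 0", OF has_derivative_ident has_derivative_const z0S])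
  have d2: "((\<lambda>x. m (x, x0)) has_derivative (\<lambda>X. X)) (at x0)"
  proof (rule has_derivative_eventually_cong[OF has_derivative_ident])
    have "m (x, x0) = x" if "x \<in> \<phi> ` U" for x
      using m_eq[of "\<xi> x" e] that chart_facts by auto
    thus "\<forall>\<^sub>F x in at x0. m (x, x0) = x" "m (x0, x0) = x0"
      using eventually_mono[OF ev] x0U by (auto simp: eventually_at_filter)
  qed
  have 1: "Dm (x0, x0) (X, 0) = X" by (rule fun_cong[OF has_derivative_unique[OF d1 d2]])
  have d3: "((\<lambda>x. m (x0, x)) has_derivative (\<lambda>X. Dm (x0, x0) (0, X))) (at x0)"
    by (rule m_comp[of "\<lambda>x. x0" "\<lambda>X. 0" x0 UNIV "\<lambda>x. x" "\<lambda>X. X", OF has_derivative_const has_derivative_ident z0S])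
  have d4: "((\<lambda>x. m (x0, x)) has_derivative (\<lambda>X. X)) (at x0)"
  proof (rule has_derivative_eventually_cong[OF has_derivative_ident])
    have "m (x0, x) = x" if "x \<in> \<phi> ` U" for x
      using m_eq[of e "\<xi> x"] that chart_facts by auto
    thus "\<forall>\<^sub>F x in at x0. m (x0, x) = x" "m (x0, x0) = x0"
      using eventually_mono[OF ev] x0U by (auto simp: eventually_at_filter)
  qed
  have 2: "Dm (x0, x0) (0, Y) = Y" by (rule fun_cong[OF has_derivative_unique[OF d3 d4]])
  have "Dm (x0, x0) (X, Y) = Dm (x0, x0) ((X, 0) + (0, Y))" by simp
  also have "\<dots> = X + Y" unfolding linear_add[OF linear_Dm[OF z0S]] 1 2 ..
  finally show ?thesis .
qed

text \<open>In the chart, \<open>L x\<close> and \<open>R x\<close> are the differentials at the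
  identity of left and right translation by \<open>\<xi> x\<close>, and \<open>Linv h\<close> is the
  differential at \<open>h\<close> of left translation by \<open>iv h\<close>. \<open>B\<close> is
  the mixed second derivative of the product at the identity, whose antisymmetrization turns out to
  be the bracket.\<close>

definition "L x X = Dm (x, x0) (0, X)"
definition "R x X = Dm (x0, x) (X, 0)"
definition "Linv h Y = Dm (\<phi> (iv h), \<phi> h) (0, Y)"
definition "B X Y = D2m (0, Y) (x0, x0) (X, 0)"

abbreviation "br \<equiv> lie_bracket mul e c"

lemma Sx: "x \<in> \<phi> ` U \<Longrightarrow> (x, x0) \<in> S" "x \<in> \<phi> ` U \<Longrightarrow> (x0, x) \<in> S"
  using S_iff[of "\<xi> x" e] S_iff[of e "\<xi> x"] chart_facts by auto

lemma L_deriv: "x \<in> \<phi> ` U \<Longrightarrow> ((\<lambda>x. L x Y) has_derivative (\<lambda>X. D2m (0, Y) (x, x0) (X, 0))) (at x)"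
  unfolding L_def by (rule Dm_comp[of "\<lambda>x. x" "\<lambda>X. X" x UNIV "\<lambda>x. x0" "\<lambda>X. 0", OF has_derivative_ident has_derivative_const Sx(1)])

lemma R_deriv: "x \<in> \<phi> ` U \<Longrightarrow> ((\<lambda>x. R x Y) has_derivative (\<lambda>X. D2m (Y, 0) (x0, x) (0, X))) (at x)"
  unfolding R_def by (rule Dm_comp[of "\<lambda>x. x0" "\<lambda>X. 0" x UNIV "\<lambda>x. x" "\<lambda>X. X", OF has_derivative_const has_derivative_ident Sx(2)])

lemma L_deriv0: "((\<lambda>x. L x Y) has_derivative (\<lambda>X. B X Y)) (at x0)"
  using L_deriv[OF x0U] by (simp add: B_def)

text \<open>Symmetry of the second derivative of \<open>m\<close> exchanges the arguments of
  \<open>B\<close> compared with \<open>L_deriv0\<close>.\<close>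

lemma R_deriv0: "((\<lambda>x. R x Y) has_derivative (\<lambda>X. B Y X)) (at x0)"
  using R_deriv[OF x0U, of Y] by (simp add: B_def D2m_sym[OF z0S, of "(0, _)"])

lemma linear_slices:
  assumes "linear F" shows "linear (\<lambda>X. F (X, 0))" "linear (\<lambda>X. F (0, X))"
  using linear_add[OF assms, of "(_, 0)" "(_, 0)"] linear_scale[OF assms, of _ "(_, 0)"]
    linear_add[OF assms, of "(0, _)" "(0, _)"] linear_scale[OF assms, of _ "(0, _)"]
  by (auto intro!: linearI)

lemma linear_L: "x \<in> \<phi> ` U \<Longrightarrow> linear (L x)"
  using linear_slices(2)[OF linear_Dm[OF Sx(1)]] by (simp add: L_def[abs_def])

lemma linear_R: "x \<in> \<phi> ` U \<Longrightarrow> linear (R x)"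
  using linear_slices(1)[OF linear_Dm[OF Sx(2)]] by (simp add: R_def[abs_def])

lemma L0 [simp]: "L x0 X = X" and R0 [simp]: "R x0 X = X"
  by (simp_all add: L_def R_def Dm_z0)

lemma left_field_eq:
  assumes "x \<in> \<phi> ` U" shows "left_field mul e c X x = L x X"
proof -
  have "((\<lambda>y. m (x, y)) has_derivative (\<lambda>Y. L x Y)) (at x0)"
    unfolding L_def by (rule m_comp[of "\<lambda>y. x" "\<lambda>X. 0" x0 UNIV "\<lambda>x. x" "\<lambda>X. X", OF has_derivative_const has_derivative_ident Sx(1)[OF assms]])
  hence "((\<lambda>y. \<phi> (\<xi> x \<odot> \<xi> y)) has_derivative (\<lambda>Y. L x Y)) (at x0)"
    by (rule has_derivative_transform_within_open[OF _ chart_facts(2) x0U])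
       (use assms m_eq in auto)
  from frechet_derivative_at[OF this] show ?thesis
    by (simp add: left_field_def U_def \<phi>_def \<xi>_def x0_def split_beta)
qed

lemma br_eq: "br X Y = B X Y - B Y X"
proof -
  have "(left_field mul e c Y has_derivative (\<lambda>X. B X Y)) (at x0)" for Y
    by (rule has_derivative_transform_within_open[OF L_deriv0 chart_facts(2) x0U])
       (simp add: left_field_eq)
  note fd = frechet_derivative_at[OF this, symmetric]
  have x0: "snd c e = x0" by (simp add: x0_def \<phi>_def)
  show ?thesis unfolding lie_bracket_def x0 fd ..
qed

lemma bilinear_B: "bilinear B"
proof -
  have "linear (\<lambda>X. B X Y)" for Y using L_deriv0 by (rule has_derivative_linear)
  moreover have "linear (\<lambda>X. B Y X)" for Y using R_deriv0 by (rule has_derivative_linear)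
  ultimately show ?thesis by (simp add: bilinear_def)
qed

lemma bilinear_br: "bilinear br"
  using bilinear_B unfolding bilinear_def br_eq
  by (auto intro!: linear_compose_sub)

sublocale br: bounded_bilinear br
  using bilinear_br by (simp add: bilinear_conv_bounded_bilinear)

text \<open>Derivatives of group-valued maps, with the tangent bundle trivialized by left translation.\<close>

definition gder :: "('a::real_normed_vector \<Rightarrow> 'g) \<Rightarrow> ('a \<Rightarrow> 'e) \<Rightarrow> 'a \<Rightarrow> 'a set \<Rightarrow> bool" where
  "gder f D x T \<longleftrightarrow> continuous (at x within T) f \<and>
     ((\<lambda>y. \<phi> (iv (f x) \<odot> f y)) has_derivative D) (at x within T)"

lemma gder_left: "gder f D x T \<Longrightarrow> gder (\<lambda>y. g \<odot> f y) D x T"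
  by (simp add: gder_def continuous_intros G.inverse_distrib_swap G.assoc)

lemma gder_chain:
  assumes "gder f D (g x) UNIV" "(g has_derivative g') (at x within T)"
  shows "gder (\<lambda>y. f (g y)) (\<lambda>v. D (g' v)) x T"
  using assms has_derivative_continuous[OF assms(2)] has_derivative_compose[OF assms(2)]
    continuous_within_compose3[of g x f T]
  unfolding gder_def by (auto simp: o_def)

lemma eventually_in_open:
  assumes "continuous (at x within T) f" "open W" "f x \<in> W"
  shows "\<forall>\<^sub>F y in at x within T. f y \<in> W"
  using assms topological_tendstoD unfolding continuous_within by blast

text \<open>Near \<open>x\<close> the map is \<open>f x\<close> times an increment close to
  \<open>e\<close>, so its derivative in the chart is the left-trivialized derivative pushed forward
  by left translation. \<open>chart_gder\<close> is the converse passage.\<close>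

lemma gder_chart:
  assumes f: "f x \<in> U" and g: "gder f D x T"
  shows "((\<lambda>y. \<phi> (f y)) has_derivative (\<lambda>v. L (\<phi> (f x)) (D v))) (at x within T)"
proof -
  have cf: "continuous (at x within T) f" and D: "((\<lambda>y. \<phi> (iv (f x) \<odot> f y)) has_derivative D) (at x within T)"
    using g by (auto simp: gder_def)
  have fx: "\<phi> (f x) \<in> \<phi> ` U" using f by auto
  have ev1: "\<forall>\<^sub>F y in at x within T. f y \<in> U"
    by (rule eventually_in_open[OF cf chart_facts(1) f])
  have ev2: "\<forall>\<^sub>F y in at x within T. iv (f x) \<odot> f y \<in> U"
    by (rule eventually_in_open) (use cf chart_facts in \<open>auto intro!: continuous_intros\<close>)
  have "((\<lambda>y. m (\<phi> (f x), \<phi> (iv (f x) \<odot> f y))) has_derivative (\<lambda>v. L (\<phi> (f x)) (D v))) (at x within T)"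
    using m_comp[OF has_derivative_const D, of "\<phi> (f x)"] Sx(1)[OF fx] by (simp add: L_def)
  thus ?thesis
  proof (rule has_derivative_eventually_cong)
    have *: "\<phi> (f y) = m (\<phi> (f x), \<phi> (iv (f x) \<odot> f y))" if "iv (f x) \<odot> f y \<in> U" for y
      using m_eq[OF f that] by simp
    show "\<forall>\<^sub>F y in at x within T. \<phi> (f y) = m (\<phi> (f x), \<phi> (iv (f x) \<odot> f y))"
      using ev2 by eventually_elim (rule *)
    show "\<phi> (f x) = m (\<phi> (f x), \<phi> (iv (f x) \<odot> f x))"
      by (rule *) (simp add: chart_facts)
  qed
qed

lemma U0: "open U0" "e \<in> U0" "h \<in> U0 \<Longrightarrow> h \<in> U" "h \<in> U0 \<Longrightarrow> iv h \<in> U" "h \<in> U0 \<Longrightarrow> iv h \<in> U0"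
proof -
  have "open (iv -` U)" using cont_iv chart_facts by (simp add: open_vimage)
  thus "open U0" unfolding U0_def using chart_facts by auto
qed (use chart_facts in \<open>auto simp: U0_def\<close>)

lemma chart_gder:
  assumes f: "f x \<in> U0" and cf: "continuous (at x within T) f"
    and D: "((\<lambda>y. \<phi> (f y)) has_derivative D) (at x within T)"
  shows "gder f (\<lambda>v. Linv (f x) (D v)) x T"
proof -
  have fU: "f x \<in> U" "iv (f x) \<in> U" using f U0 by auto
  have inS: "(\<phi> (iv (f x)), \<phi> (f x)) \<in> S" using S_iff[OF fU(2,1)] chart_facts by simp
  have "((\<lambda>y. m (\<phi> (iv (f x)), \<phi> (f y))) has_derivative (\<lambda>v. Linv (f x) (D v))) (at x within T)"
    unfolding Linv_def by (rule m_comp[OF has_derivative_const D inS])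
  hence "((\<lambda>y. \<phi> (iv (f x) \<odot> f y)) has_derivative (\<lambda>v. Linv (f x) (D v))) (at x within T)"
  proof (rule has_derivative_eventually_cong)
    show "\<forall>\<^sub>F y in at x within T. \<phi> (iv (f x) \<odot> f y) = m (\<phi> (iv (f x)), \<phi> (f y))"
      using eventually_in_open[OF cf chart_facts(1) fU(1)]
      by eventually_elim (simp add: m_eq fU)
  qed (simp add: m_eq fU)
  thus ?thesis using cf by (simp add: gder_def)
qed

lemma gder_unique:
  assumes "gder f D x UNIV" "gder f D' x UNIV" shows "D = D'"
  using assms has_derivative_unique unfolding gder_def by blast

lemma gder_\<xi>0: "gder \<xi> (\<lambda>v. v) x0 UNIV"
proof -
  have "((\<lambda>y. \<phi> (\<xi> y)) has_derivative (\<lambda>v. v)) (at x0)"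
    by (rule has_derivative_transform_within_open[OF has_derivative_ident chart_facts(2) x0U]) simp
  thus ?thesis using isCont_\<xi>[OF x0U] by (simp add: gder_def G.inverse_neutral)
qed

lemma L_Linv:
  assumes h: "h \<in> U0" shows "L (\<phi> h) (Linv h Y) = Y" "Linv h (L (\<phi> h) Y) = Y"
proof -
  have hU: "h \<in> U" "\<phi> h \<in> \<phi> ` U" using h U0 by auto
  have 1: "((\<lambda>y. \<phi> (\<xi> y)) has_derivative (\<lambda>v. v)) (at (\<phi> h))"
    by (rule has_derivative_transform_within_open[OF has_derivative_ident chart_facts(2) hU(2)]) simp
  have "gder \<xi> (\<lambda>v. Linv (\<xi> (\<phi> h)) v) (\<phi> h) UNIV"
    by (rule chart_gder[OF _ _ 1]) (use h hU isCont_\<xi> in auto)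
  from gder_chart[OF _ this] hU
  have "((\<lambda>y. \<phi> (\<xi> y)) has_derivative (\<lambda>v. L (\<phi> h) (Linv h v))) (at (\<phi> h))" by auto
  from has_derivative_unique[OF this 1] show "L (\<phi> h) (Linv h Y) = Y" by meson
  have 2: "gder (\<lambda>y. h \<odot> \<xi> y) (\<lambda>v. v) x0 UNIV" using gder_\<xi>0 by (rule gder_left)
  from gder_chart[OF _ this] hU
  have 3: "((\<lambda>y. \<phi> (h \<odot> \<xi> y)) has_derivative (\<lambda>v. L (\<phi> h) v)) (at x0)" by auto
  have "gder (\<lambda>y. h \<odot> \<xi> y) (\<lambda>v. Linv (h \<odot> \<xi> x0) (L (\<phi> h) v)) x0 UNIV"
    by (rule chart_gder[OF _ _ 3]) (use h 2 in \<open>auto simp: gder_def\<close>)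
  from gder_unique[OF this 2] show "Linv h (L (\<phi> h) Y) = Y" by (simp add: fun_eq_iff)
qed

section \<open>The adjoint action\<close>

definition "Ad h = frechet_derivative (\<lambda>y. \<phi> (h \<odot> \<xi> y \<odot> iv h)) (at x0)"

text \<open>Conjugation is left translation by \<open>h\<close> followed by right multiplication by
  \<open>iv h\<close>. For \<open>h\<close> in \<open>U0\<close> all intermediate points are in the
  chart, so the chain rule for \<open>m\<close> applies; this is the source of the restriction to
  \<open>U0\<close> in the facts about \<open>Ad\<close>.\<close>

lemma Ad:
  assumes h: "h \<in> U0"
  shows Ad_deriv: "((\<lambda>y. \<phi> (h \<odot> \<xi> y \<odot> iv h)) has_derivative Ad h) (at x0)"
    and Ad_eq: "Ad h Y = Dm (\<phi> h, \<phi> (iv h)) (L (\<phi> h) Y, 0)"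
proof -
  have hU: "h \<in> U" "iv h \<in> U" "\<phi> h \<in> \<phi> ` U" using h U0 by auto
  have inS: "(\<phi> h, \<phi> (iv h)) \<in> S" using S_iff[OF hU(1,2)] chart_facts by simp
  have c1: "continuous (at x0) (\<lambda>y. h \<odot> \<xi> y)" using isCont_\<xi>[OF x0U] by (intro continuous_intros)
  have 3: "((\<lambda>y. \<phi> (h \<odot> \<xi> y)) has_derivative (\<lambda>v. L (\<phi> h) v)) (at x0)"
    using gder_chart[OF _ gder_left[OF gder_\<xi>0], of h] hU by simp
  have "((\<lambda>y. m (\<phi> (h \<odot> \<xi> y), \<phi> (iv h))) has_derivative (\<lambda>Y. Dm (\<phi> h, \<phi> (iv h)) (L (\<phi> h) Y, 0))) (at x0)"
    using m_comp[OF 3 has_derivative_const, of "\<phi> (iv h)"] inS by simp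
  hence *: "((\<lambda>y. \<phi> (h \<odot> \<xi> y \<odot> iv h)) has_derivative (\<lambda>Y. Dm (\<phi> h, \<phi> (iv h)) (L (\<phi> h) Y, 0))) (at x0)"
  proof (rule has_derivative_eventually_cong)
    show "\<forall>\<^sub>F y in at x0. \<phi> (h \<odot> \<xi> y \<odot> iv h) = m (\<phi> (h \<odot> \<xi> y), \<phi> (iv h))"
      using eventually_in_open[OF c1 chart_facts(1)] hU(1,2)
      by (auto elim!: eventually_mono simp: m_eq)
  qed (use hU in \<open>simp add: m_eq\<close>)
  have "Ad h = (\<lambda>Y. Dm (\<phi> h, \<phi> (iv h)) (L (\<phi> h) Y, 0))"
    unfolding Ad_def using frechet_derivative_at[OF *] by simp
  with * show "((\<lambda>y. \<phi> (h \<odot> \<xi> y \<odot> iv h)) has_derivative Ad h) (at x0)"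
    "Ad h Y = Dm (\<phi> h, \<phi> (iv h)) (L (\<phi> h) Y, 0)" by auto
qed

lemma linear_Ad: "h \<in> U0 \<Longrightarrow> linear (Ad h)"
  using Ad_deriv has_derivative_linear by blast

lemma bounded_linear_Ad: "h \<in> U0 \<Longrightarrow> bounded_linear (Ad h)"
  using Ad_deriv has_derivative_bounded_linear by blast

lemma Ad_e [simp]: "Ad e Y = Y"
  using Ad_eq[OF U0(2), of Y] by (simp add: G.inverse_neutral Dm_z0)

lemma gder_conj:
  assumes g: "gder f D x T" and h: "h \<in> U0"
  shows "gder (\<lambda>y. h \<odot> f y \<odot> iv h) (\<lambda>v. Ad h (D v)) x T"
proof -
  let ?a = "\<lambda>y. iv (f x) \<odot> f y"
  have cf: "continuous (at x within T) f" and D: "((\<lambda>y. \<phi> (?a y)) has_derivative D) (at x within T)"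
    using g by (auto simp: gder_def)
  have "((\<lambda>y. \<phi> (h \<odot> \<xi> (\<phi> (?a y)) \<odot> iv h)) has_derivative (\<lambda>v. Ad h (D v))) (at x within T)"
    by (rule has_derivative_compose[OF D]) (simp add: Ad_deriv[OF h])
  hence "((\<lambda>y. \<phi> (h \<odot> ?a y \<odot> iv h)) has_derivative (\<lambda>v. Ad h (D v))) (at x within T)"
  proof (rule has_derivative_eventually_cong)
    have "\<forall>\<^sub>F y in at x within T. ?a y \<in> U"
      by (rule eventually_in_open) (use cf chart_facts in \<open>auto intro!: continuous_intros\<close>)
    thus "\<forall>\<^sub>F y in at x within T. \<phi> (h \<odot> ?a y \<odot> iv h) = \<phi> (h \<odot> \<xi> (\<phi> (?a y)) \<odot> iv h)"
      by eventually_elim simp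
  qed simp
  thus ?thesis using cf by (simp add: gder_def continuous_intros G.inverse_distrib_swap G.assoc)
qed

text \<open>After translation back to \<open>e\<close>, the product becomes the increment of
  \<open>f\<close> conjugated by \<open>iv (g x)\<close>, times the increment of \<open>g\<close>.
  Both factors are \<open>e\<close> at \<open>y = x\<close>, where the derivative of the product is
  addition.\<close>

lemma gder_mult:
  assumes f: "gder f D x T" and g: "gder g E x T" and h: "g x \<in> U0"
  shows "gder (\<lambda>y. f y \<odot> g y) (\<lambda>v. Ad (iv (g x)) (D v) + E v) x T"
proof -
  let ?a = "\<lambda>y. iv (g x) \<odot> (iv (f x) \<odot> f y) \<odot> g x" and ?b = "\<lambda>y. iv (g x) \<odot> g y"
  have c: "continuous (at x within T) f" "continuous (at x within T) g"
    and E: "((\<lambda>y. \<phi> (?b y)) has_derivative E) (at x within T)"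
    using f g by (auto simp: gder_def)
  have A: "((\<lambda>y. \<phi> (?a y)) has_derivative (\<lambda>v. Ad (iv (g x)) (D v))) (at x within T)"
    using gder_conj[OF gder_left[OF f, of "iv (f x)"] U0(5)[OF h]]
    by (simp add: gder_def G.inverse_distrib_swap G.inverse_neutral)
  have "((\<lambda>y. m (\<phi> (?a y), \<phi> (?b y))) has_derivative (\<lambda>v. Dm (x0, x0) (Ad (iv (g x)) (D v), E v))) (at x within T)"
    using m_comp[OF A E] z0S by (simp add: G.left_inverse)
  hence "((\<lambda>y. \<phi> (?a y \<odot> ?b y)) has_derivative (\<lambda>v. Dm (x0, x0) (Ad (iv (g x)) (D v), E v))) (at x within T)"
  proof (rule has_derivative_eventually_cong)
    have "\<forall>\<^sub>F y in at x within T. ?a y \<in> U" "\<forall>\<^sub>F y in at x within T. ?b y \<in> U"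
      by (rule eventually_in_open; use c chart_facts in \<open>auto intro!: continuous_intros\<close>)+
    thus "\<forall>\<^sub>F y in at x within T. \<phi> (?a y \<odot> ?b y) = m (\<phi> (?a y), \<phi> (?b y))"
      by eventually_elim (simp add: m_eq)
  qed (use chart_facts m_eq[of e e] in simp)
  thus ?thesis using c by (simp add: gder_def continuous_intros G.inverse_distrib_swap G.assoc Dm_z0)
qed

text \<open>Smoothness provides some derivative \<open>D\<close>; differentiating
  \<open>m (x, \<iota> x) = x0\<close> with \<open>Dm_z0\<close> gives
  \<open>v + D v = 0\<close>.\<close>

lemma \<iota>_deriv: "(\<iota> has_derivative (\<lambda>v. - v)) (at x0)"
proof -
  have "smooth_map A A iv" using lie by (simp add: lie_group_def)
  hence "smooth_on \<iota> (\<phi> ` U0)" using chart unfolding smooth_map_def \<iota>_def \<xi>_def U0_def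
    by (fastforce simp: U_def \<phi>_def split_beta)
  hence "Ck_on (Suc 0) \<iota> (\<phi> ` U0)" unfolding smooth_on_def by blast
  moreover have "x0 \<in> \<phi> ` U0" using U0(2) by force
  ultimately obtain D where D: "(\<iota> has_derivative D) (at x0)" by (auto simp: differentiable_def)
  have \<iota>0: "\<iota> x0 = x0" by (simp add: \<iota>_def G.inverse_neutral)
  have d1: "((\<lambda>x. m (x, \<iota> x)) has_derivative (\<lambda>v. Dm (x0, x0) (v, D v))) (at x0)"
    using m_comp[OF has_derivative_ident D] z0S by (simp add: \<iota>0)
  have d2: "((\<lambda>x. m (x, \<iota> x)) has_derivative (\<lambda>v. 0)) (at x0)"
  proof (rule has_derivative_eventually_cong[OF has_derivative_const])
    have *: "m (x, \<iota> x) = x0" if "\<xi> x \<in> U0" "x \<in> \<phi> ` U" for x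
      using m_eq[of "\<xi> x" "iv (\<xi> x)"] that U0 by (simp add: \<iota>_def)
    have "\<forall>\<^sub>F x in at x0. \<xi> x \<in> U0" using isCont_\<xi>[OF x0U] U0 by (intro eventually_in_open) auto
    moreover have "\<forall>\<^sub>F x in at x0. x \<in> \<phi> ` U" using chart_facts x0U by (intro eventually_in_open) auto
    ultimately show "\<forall>\<^sub>F x in at x0. m (x, \<iota> x) = x0" by eventually_elim (rule *)
    show "m (x0, \<iota> x0) = x0" by (rule *) (simp_all add: U0 x0U)
  qed
  have "v + D v = 0" for v
    using fun_cong[OF has_derivative_unique[OF d1 d2], of v] by (simp add: Dm_z0)
  hence "D = (\<lambda>v. - v)" by (auto simp: fun_eq_iff add_eq_0_iff)
  with D show ?thesis by simp
qed

text \<open>With the increment \<open>a = iv (f x) \<odot> f y\<close>, the inverse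
  \<open>iv (f y)\<close> is \<open>iv (f x)\<close> times the conjugate of \<open>iv a\<close> by
  \<open>f x\<close>.\<close>

lemma gder_inverse:
  assumes f: "gder f D x T" and h: "f x \<in> U0"
  shows "gder (\<lambda>y. iv (f y)) (\<lambda>v. - Ad (f x) (D v)) x T"
proof -
  let ?a = "\<lambda>y. iv (f x) \<odot> f y"
  have cf: "continuous (at x within T) f" and D: "((\<lambda>y. \<phi> (?a y)) has_derivative D) (at x within T)"
    using f by (auto simp: gder_def)
  have "((\<lambda>y. \<iota> (\<phi> (?a y))) has_derivative (\<lambda>v. - D v)) (at x within T)"
    by (rule has_derivative_compose[OF D]) (simp add: \<iota>_deriv)
  hence "((\<lambda>y. \<phi> (iv (?a y))) has_derivative (\<lambda>v. - D v)) (at x within T)"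
  proof (rule has_derivative_eventually_cong)
    have "\<forall>\<^sub>F y in at x within T. ?a y \<in> U"
      by (rule eventually_in_open) (use cf chart_facts in \<open>auto intro!: continuous_intros\<close>)
    thus "\<forall>\<^sub>F y in at x within T. \<phi> (iv (?a y)) = \<iota> (\<phi> (?a y))"
      by eventually_elim (simp add: \<iota>_def)
  qed (simp add: \<iota>_def)
  hence "gder (\<lambda>y. iv (?a y)) (\<lambda>v. - D v) x T"
    using cf by (simp add: gder_def continuous_intros G.inverse_neutral)
  from gder_conj[OF this h] have "gder (\<lambda>y. f x \<odot> iv (?a y) \<odot> iv (f x)) (\<lambda>v. - Ad (f x) (D v)) x T"
    by (simp add: linear_neg[OF linear_Ad[OF h]])
  from gder_left[OF this, of "iv (f x)"] show ?thesis
    by (simp add: G.inverse_distrib_swap G.assoc)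
qed

text \<open>Left translation by \<open>h\<close> is conjugation by \<open>h\<close> followed by
  right translation by \<open>h\<close>.\<close>

lemma R_Ad:
  assumes h: "h \<in> U0" shows "R (\<phi> h) (Ad h Y) = L (\<phi> h) Y"
proof -
  have hU: "h \<in> U" "iv h \<in> U" "\<phi> h \<in> \<phi> ` U" using h U0 by auto
  have c1: "continuous (at x0) (\<lambda>y. h \<odot> \<xi> y \<odot> iv h)" using isCont_\<xi>[OF x0U] by (intro continuous_intros)
  have "((\<lambda>y. m (\<phi> (h \<odot> \<xi> y \<odot> iv h), \<phi> h)) has_derivative (\<lambda>Y. R (\<phi> h) (Ad h Y))) (at x0)"
    using m_comp[OF Ad_deriv[OF h] has_derivative_const, of "\<phi> h"] Sx(2)[OF hU(3)] by (simp add: R_def)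
  hence d1: "((\<lambda>y. \<phi> (h \<odot> \<xi> y)) has_derivative (\<lambda>Y. R (\<phi> h) (Ad h Y))) (at x0)"
  proof (rule has_derivative_eventually_cong)
    show "\<forall>\<^sub>F y in at x0. \<phi> (h \<odot> \<xi> y) = m (\<phi> (h \<odot> \<xi> y \<odot> iv h), \<phi> h)"
      using eventually_in_open[OF c1 chart_facts(1)] hU(1,2) chart_facts
      by (auto elim!: eventually_mono simp: m_eq G.assoc)
  qed (use hU m_eq[of e h] chart_facts in simp)
  have d2: "((\<lambda>y. \<phi> (h \<odot> \<xi> y)) has_derivative (\<lambda>v. L (\<phi> h) v)) (at x0)"
    using gder_chart[OF _ gder_left[OF gder_\<xi>0], of h] hU by simp
  show ?thesis by (rule fun_cong[OF has_derivative_unique[OF d1 d2]])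
qed

text \<open>The derivative of the adjoint action at the identity is the bracket. Differentiating
  \<open>R (Ad h Y) = L Y\<close> at \<open>h = e\<close> gives \<open>B Y v + D v = B v Y\<close>
  for the unknown derivative \<open>D\<close>, and the difference of the two values of
  \<open>B\<close> is \<open>br v Y\<close>.\<close>

lemma Ad_deriv_e: "((\<lambda>x. Ad (\<xi> x) Y) has_derivative (\<lambda>X. br X Y)) (at x0)"
proof -
  have x0U0: "\<xi> x0 \<in> U0" using U0 by simp
  have ev0: "\<forall>\<^sub>F x in at x0. \<xi> x \<in> U0" using isCont_\<xi>[OF x0U] U0 by (intro eventually_in_open) auto
  have ev1: "\<forall>\<^sub>F x in at x0. x \<in> \<phi> ` U" using chart_facts x0U by (intro eventually_in_open) auto
  have \<iota>0: "\<iota> x0 = x0" by (simp add: \<iota>_def G.inverse_neutral)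
  \<comment> \<open>A version of \<open>Ad (\<xi> x) Y\<close> built from products of differentiable
    functions. It serves to show that a derivative exists; its value is found from the identity
    above.\<close>
  define G where "G x = (\<Sum>b\<in>Basis. (L x Y \<bullet> b) *\<^sub>R Dm (x, \<iota> x) (b, 0))" for x
  have Geq: "Ad (\<xi> x) Y = G x" if "\<xi> x \<in> U0" "x \<in> \<phi> ` U" for x
  proof -
    have "(x, \<iota> x) \<in> S"
      using S_iff[of "\<xi> x" "iv (\<xi> x)"] that U0 chart_facts by (simp add: \<iota>_def)
    hence "linear (\<lambda>v. Dm (x, \<iota> x) (v, 0))"
      by (intro linear_slices linear_Dm)
    from linear_euclidean_expansion[OF this, of "L x Y"] show ?thesis
      using Ad_eq[OF that(1), of Y] that(2) by (simp add: G_def \<iota>_def)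
  qed
  have "((\<lambda>x. Dm (x, \<iota> x) (b, 0)) has_derivative (\<lambda>v. D2m (b, 0) (x0, x0) (v, - v))) (at x0)" for b
    using Dm_comp[OF has_derivative_ident \<iota>_deriv] z0S by (simp add: \<iota>0)
  hence "\<exists>D. (G has_derivative D) (at x0)"
    unfolding G_def by (intro exI) (auto intro!: derivative_eq_intros L_deriv0)
  then obtain D where D: "(G has_derivative D) (at x0)" by blast
  have d1: "((\<lambda>x. \<Sum>b\<in>Basis. (G x \<bullet> b) *\<^sub>R R x b) has_derivative
      (\<lambda>v. \<Sum>b\<in>Basis. (G x0 \<bullet> b) *\<^sub>R B b v + (D v \<bullet> b) *\<^sub>R R x0 b)) (at x0)"
    by (rule has_derivative_sum has_derivative_scaleR has_derivative_inner_left D R_deriv0)+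
  have eq: "(\<lambda>v. \<Sum>b\<in>Basis. (G x0 \<bullet> b) *\<^sub>R B b v + (D v \<bullet> b) *\<^sub>R R x0 b) = (\<lambda>v. B Y v + D v)"
  proof
    fix v
    have "G x0 = Y" using Geq[OF x0U0 x0U] by simp
    moreover have "linear (\<lambda>Y. B Y v)" using bilinear_B by (simp add: bilinear_def)
    ultimately show "(\<Sum>b\<in>Basis. (G x0 \<bullet> b) *\<^sub>R B b v + (D v \<bullet> b) *\<^sub>R R x0 b) = B Y v + D v"
      using linear_euclidean_expansion[of "\<lambda>Y. B Y v" Y] by (simp add: sum.distrib euclidean_representation)
  qed
  have d2: "((\<lambda>x. \<Sum>b\<in>Basis. (G x \<bullet> b) *\<^sub>R R x b) has_derivative (\<lambda>X. B X Y)) (at x0)"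
  proof (rule has_derivative_eventually_cong[OF L_deriv0])
    have *: "(\<Sum>b\<in>Basis. (G x \<bullet> b) *\<^sub>R R x b) = L x Y" if "\<xi> x \<in> U0" "x \<in> \<phi> ` U" for x
      using R_Ad[OF that(1), of Y] that(2) linear_euclidean_expansion[OF linear_R[OF that(2)], of "G x"]
      by (simp add: Geq[OF that])
    show "\<forall>\<^sub>F x in at x0. (\<Sum>b\<in>Basis. (G x \<bullet> b) *\<^sub>R R x b) = L x Y"
      using ev0 ev1 by eventually_elim (rule *)
    show "(\<Sum>b\<in>Basis. (G x0 \<bullet> b) *\<^sub>R R x0 b) = L x0 Y" by (rule *[OF x0U0 x0U])
  qed
  have "B Y v + D v = B v Y" for v
    using fun_cong[OF has_derivative_unique[OF d1[unfolded eq] d2], of v] .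
  hence "D v = br v Y" for v by (simp add: br_eq algebra_simps)
  hence Db: "D = (\<lambda>X. br X Y)" by blast
  show ?thesis
  proof (rule has_derivative_eventually_cong[OF D[unfolded Db]])
    show "\<forall>\<^sub>F x in at x0. Ad (\<xi> x) Y = G x" using ev0 ev1 by eventually_elim (rule Geq)
  qed (rule Geq[OF x0U0 x0U])
qed

lemma Ad_mult:
  assumes "g \<in> U0" "h \<in> U0" "g \<odot> h \<in> U0"
  shows "Ad (g \<odot> h) Y = Ad g (Ad h Y)"
proof -
  have c: "gder (\<lambda>y. k \<odot> \<xi> y \<odot> iv k) (Ad k) x0 UNIV" if "k \<in> U0" for k
    using gder_conj[OF gder_\<xi>0 that] by simp
  have "gder (\<lambda>y. g \<odot> (h \<odot> \<xi> y \<odot> iv h) \<odot> iv g) (\<lambda>v. Ad g (Ad h v)) x0 UNIV"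
    by (rule gder_conj[OF c]) fact+
  moreover have "(\<lambda>y. g \<odot> (h \<odot> \<xi> y \<odot> iv h) \<odot> iv g) = (\<lambda>y. (g \<odot> h) \<odot> \<xi> y \<odot> iv (g \<odot> h))"
    by (simp add: G.inverse_distrib_swap G.assoc)
  ultimately show ?thesis using gder_unique[OF _ c[OF assms(3)]] by (metis (no_types, lifting))
qed

text \<open>Multiplicativity writes \<open>Ad (f y)\<close> as \<open>Ad (f x)\<close> after
  \<open>Ad\<close> of an increment near \<open>e\<close>, to which \<open>Ad_deriv_e\<close>
  applies.\<close>

lemma Ad_gder:
  assumes f: "gder f D x T" and h: "f x \<in> U0"
  shows "((\<lambda>y. Ad (f y) Y) has_derivative (\<lambda>v. Ad (f x) (br (D v) Y))) (at x within T)"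
proof -
  let ?a = "\<lambda>y. iv (f x) \<odot> f y"
  have cf: "continuous (at x within T) f" and D: "((\<lambda>y. \<phi> (?a y)) has_derivative D) (at x within T)"
    using f by (auto simp: gder_def)
  have "((\<lambda>y. Ad (\<xi> (\<phi> (?a y))) Y) has_derivative (\<lambda>v. br (D v) Y)) (at x within T)"
    by (rule has_derivative_compose[OF D]) (simp add: Ad_deriv_e)
  hence "((\<lambda>y. Ad (f x) (Ad (\<xi> (\<phi> (?a y))) Y)) has_derivative (\<lambda>v. Ad (f x) (br (D v) Y))) (at x within T)"
    by (rule bounded_linear.has_derivative[OF bounded_linear_Ad[OF h]])
  thus ?thesis
  proof (rule has_derivative_eventually_cong)
    have *: "Ad (f y) Y = Ad (f x) (Ad (\<xi> (\<phi> (?a y))) Y)" if "?a y \<in> U0" "f y \<in> U0" for y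
      using Ad_mult[OF h that(1)] that U0(3) by simp
    have "\<forall>\<^sub>F y in at x within T. ?a y \<in> U0" "\<forall>\<^sub>F y in at x within T. f y \<in> U0"
      by (rule eventually_in_open; use cf U0(1,2) h in \<open>auto intro!: continuous_intros\<close>)+
    thus "\<forall>\<^sub>F y in at x within T. Ad (f y) Y = Ad (f x) (Ad (\<xi> (\<phi> (?a y))) Y)"
      by eventually_elim (rule *)
    show "Ad (f x) Y = Ad (f x) (Ad (\<xi> (\<phi> (?a x))) Y)" by simp
  qed
qed

text \<open>Both sides are derivatives at the identity of \<open>Ad h (Ad (\<xi> y) Z)\<close>,
  since this equals \<open>Ad\<close> of the conjugate of \<open>\<xi> y\<close> by
  \<open>h\<close>, applied to \<open>Ad h Z\<close>.\<close>

lemma Ad_br: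
  assumes h: "h \<in> U0" shows "Ad h (br Y Z) = br (Ad h Y) (Ad h Z)"
proof -
  let ?k = "\<lambda>y. h \<odot> \<xi> y \<odot> iv h"
  have k: "gder ?k (Ad h) x0 UNIV" using gder_conj[OF gder_\<xi>0 h] by simp
  have 1: "((\<lambda>y. Ad h (Ad (\<xi> y) Z)) has_derivative (\<lambda>Y. Ad h (br Y Z))) (at x0)"
    by (rule bounded_linear.has_derivative[OF bounded_linear_Ad[OF h] Ad_deriv_e])
  have "((\<lambda>y. Ad (?k y) (Ad h Z)) has_derivative (\<lambda>Y. br (Ad h Y) (Ad h Z))) (at x0)"
    using Ad_gder[OF k, of "Ad h Z"] U0 by simp
  hence 2: "((\<lambda>y. Ad h (Ad (\<xi> y) Z)) has_derivative (\<lambda>Y. br (Ad h Y) (Ad h Z))) (at x0)"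
  proof (rule has_derivative_eventually_cong)
    have *: "Ad h (Ad (\<xi> y) Z) = Ad (?k y) (Ad h Z)" if "\<xi> y \<in> U0" "h \<odot> \<xi> y \<in> U0" "?k y \<in> U0" for y
      using Ad_mult[OF h that(1,2)] Ad_mult[OF that(3) h, of Z] that by (simp add: G.assoc)
    have "isCont \<xi> x0" using isCont_\<xi>[OF x0U] .
    hence "\<forall>\<^sub>F y in at x0. \<xi> y \<in> U0" "\<forall>\<^sub>F y in at x0. h \<odot> \<xi> y \<in> U0" "\<forall>\<^sub>F y in at x0. ?k y \<in> U0"
      by (rule_tac [!] eventually_in_open) (use U0(1,2) h in \<open>auto intro!: continuous_intros\<close>)
    thus "\<forall>\<^sub>F y in at x0. Ad h (Ad (\<xi> y) Z) = Ad (?k y) (Ad h Z)"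
      by eventually_elim (rule *)
    show "Ad h (Ad (\<xi> x0) Z) = Ad (?k x0) (Ad h Z)" by simp
  qed
  from has_derivative_unique[OF 1 2] show ?thesis by meson
qed

text \<open>\<open>Ad (\<xi> x)\<close> respects the bracket for all \<open>x\<close> near
  \<open>x0\<close>; the derivative of this identity at \<open>x0\<close>, by the product rule for
  \<open>br\<close>, is the Jacobi identity.\<close>

lemma jacobi: "br X (br Y Z) = br (br X Y) Z + br Y (br X Z)"
proof -
  have "((\<lambda>x. br (Ad (\<xi> x) Y) (Ad (\<xi> x) Z)) has_derivative
      (\<lambda>X. br (Ad (\<xi> x0) Y) (br X Z) + br (br X Y) (Ad (\<xi> x0) Z))) (at x0)"
    by (rule br.FDERIV[OF Ad_deriv_e Ad_deriv_e])
  hence 1: "((\<lambda>x. br (Ad (\<xi> x) Y) (Ad (\<xi> x) Z)) has_derivative (\<lambda>X. br Y (br X Z) + br (br X Y) Z)) (at x0)"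
    by simp
  have "((\<lambda>x. br (Ad (\<xi> x) Y) (Ad (\<xi> x) Z)) has_derivative (\<lambda>X. br X (br Y Z))) (at x0)"
  proof (rule has_derivative_eventually_cong[OF Ad_deriv_e])
    have "\<forall>\<^sub>F x in at x0. \<xi> x \<in> U0" using isCont_\<xi>[OF x0U] U0 by (intro eventually_in_open) auto
    thus "\<forall>\<^sub>F x in at x0. br (Ad (\<xi> x) Y) (Ad (\<xi> x) Z) = Ad (\<xi> x) (br Y Z)"
      by eventually_elim (simp add: Ad_br)
  qed simp
  from has_derivative_unique[OF this 1] show ?thesis by (metis add.commute)
qed

end

section \<open>One-parameter subgroups and dilations of the Lie algebra\<close>

text \<open>Plays the role of uniqueness for differential equations: identities along one-parameter
  subgroups are shown by moving everything to one side and checking that the derivative in time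
  vanishes.\<close>

lemma constant_on_symmetric_interval:
  fixes f :: "real \<Rightarrow> 'z::real_normed_vector"
  assumes d: "\<And>t. \<bar>t\<bar> < \<tau> \<Longrightarrow> (f has_derivative (\<lambda>v. 0)) (at t)" and t: "\<bar>t\<bar> < \<tau>"
  shows "f t = f 0"
proof (rule has_derivative_zero_unique[of "{-\<tau><..<\<tau>}" f t 0])
  fix x assume "x \<in> {-\<tau><..<\<tau>}"
  hence "\<bar>x\<bar> < \<tau>" by auto
  from d[OF this] show "(f has_derivative (\<lambda>h. 0)) (at x within {-\<tau><..<\<tau>})"
    by (rule has_derivative_at_withinI)
qed (use t in auto)

context lie_chart
begin

text \<open>A local one-parameter subgroup. The homomorphism law is asked only where all three times
  stay in the interval, so no extension to all times is needed.\<close>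

definition is_exp :: "'e \<Rightarrow> real \<Rightarrow> (real \<Rightarrow> 'g) \<Rightarrow> bool" where
  "is_exp X \<tau> \<eta> \<longleftrightarrow> \<tau> > 0 \<and> \<eta> 0 = e \<and>
     (\<forall>t. \<bar>t\<bar> < \<tau> \<longrightarrow> \<eta> t \<in> U0 \<and> gder \<eta> (\<lambda>v. v *\<^sub>R X) t UNIV) \<and>
     (\<forall>s t. \<bar>s\<bar> < \<tau> \<longrightarrow> \<bar>t\<bar> < \<tau> \<longrightarrow> \<bar>s + t\<bar> < \<tau> \<longrightarrow> \<eta> (s + t) = \<eta> s \<odot> \<eta> t)"

lemma left_field_lipschitz:
  "\<exists>r>0. \<exists>K. K-lipschitz_on (cball x0 r) (\<lambda>x. L x X) \<and> (\<forall>x\<in>cball x0 r. x \<in> \<phi> ` U \<and> \<xi> x \<in> U0)"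
proof -
  let ?F = "\<lambda>x v. D2m (0, X) (x, x0) (v, 0)"
  have evU: "\<forall>\<^sub>F x in nhds x0. x \<in> \<phi> ` U" using chart_facts x0U by (intro eventually_nhds_in_open) auto
  have "isCont \<xi> x0" using isCont_\<xi>[OF x0U] .
  hence "(\<xi> \<longlongrightarrow> e) (nhds x0)" by (simp add: continuous_at tendsto_nhds_iff isCont_def)
  hence evU0: "\<forall>\<^sub>F x in nhds x0. \<xi> x \<in> U0" using U0 by (auto intro: topological_tendstoD)
  have lin: "\<forall>\<^sub>F x in nhds x0. linear (?F x)"
    using evU by eventually_elim (rule has_derivative_linear[OF L_deriv])
  have cont: "isCont (\<lambda>x. ?F x v) x0" for v
  proof -
    have "isCont (\<lambda>x. (x, x0)) x0" by (intro continuous_intros)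
    from isCont_o2[OF this m_C2_cont[OF z0S]] show ?thesis .
  qed
  have ev: "\<forall>\<^sub>F x in nhds x0. \<forall>v. norm (?F x v - ?F x0 v) \<le> 1 * norm v"
    by (rule linear_family_continuous[OF lin cont]) simp
  obtain K where K: "\<And>v. norm (?F x0 v) \<le> norm v * K"
    using bounded_linear.bounded[OF has_derivative_bounded_linear[OF L_deriv[OF x0U]]] by blast
  obtain d where d: "d > 0" "\<And>x. dist x x0 < d \<Longrightarrow> x \<in> \<phi> ` U \<and> \<xi> x \<in> U0 \<and> (\<forall>v. norm (?F x v - ?F x0 v) \<le> 1 * norm v)"
    using eventually_conj[OF evU eventually_conj[OF evU0 ev]] unfolding eventually_nhds_metric by blast
  define K' where "K' = \<bar>K\<bar> + 1"
  have bd: "norm (?F x v) \<le> K' * norm v" if "dist x x0 < d" for x v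
  proof -
    have "norm (?F x v) \<le> norm (?F x0 v) + norm (?F x v - ?F x0 v)" by (metis norm_triangle_sub add.commute)
    also have "\<dots> \<le> norm v * K + norm v" using K[of v] d(2)[OF that] by (smt (verit) mult_1)
    also have "\<dots> \<le> K' * norm v" 
      using mult_right_mono[OF abs_ge_self[of K], of "norm v"] by (simp add: K'_def algebra_simps)
    finally show ?thesis .
  qed
  have "K'-lipschitz_on (cball x0 (d/2)) (\<lambda>x. L x X)"
  proof (rule lipschitz_onI)
    fix x y assume xy: "x \<in> cball x0 (d/2)" "y \<in> cball x0 (d/2)"
    have "norm (L x X - L y X) \<le> K' * norm (x - y)"
    proof (rule differentiable_bound[OF convex_cball _ _ xy])
      fix z assume z: "z \<in> cball x0 (d/2)"
      hence zd: "dist z x0 < d" using d(1) by (auto simp: dist_commute)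
      show "((\<lambda>x. L x X) has_derivative ?F z) (at z within cball x0 (d/2))"
        using d(2)[OF zd] L_deriv has_derivative_at_withinI by blast
      show "onorm (?F z) \<le> K'" using bd[OF zd] by (rule onorm_le)
    qed
    thus "dist (L x X) (L y X) \<le> K' * dist x y" by (simp add: dist_norm)
  qed (simp add: K'_def)
  thus ?thesis using d by (intro exI[of _ "d/2"]) (auto simp: dist_commute)
qed

text \<open>The curve is an integral curve of the left-invariant field of \<open>X\<close>. For the
  homomorphism law, the quotient of \<eta> s \<odot> \<eta> y by \<eta> (s + y) is differentiated in
  \<open>y\<close>: the velocities of the two factors cancel, so it keeps its initial value
  \<open>e\<close>.\<close>

lemma exp_exists: "\<exists>\<tau> \<eta>. is_exp X \<tau> \<eta>"
proof -
  obtain r K where r: "r > 0" "K-lipschitz_on (cball x0 r) (\<lambda>x. L x X)"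
    "\<And>x. x \<in> cball x0 r \<Longrightarrow> x \<in> \<phi> ` U \<and> \<xi> x \<in> U0"
    using left_field_lipschitz by blast
  obtain \<tau> p where \<tau>: "\<tau> > 0" and p0: "p 0 = x0" and p: "\<And>t. t \<in> {-\<tau>..\<tau>} \<Longrightarrow> p t \<in> cball x0 r"
    "\<And>t. t \<in> {-\<tau>..\<tau>} \<Longrightarrow> (p has_vector_derivative L (p t) X) (at t within {-\<tau>..\<tau>})"
    using ode_local_existence[OF r(2,1)] by blast
  define \<eta> where "\<eta> t = \<xi> (p t)" for t
  have in1: "p t \<in> \<phi> ` U" "\<eta> t \<in> U0" "\<phi> (\<eta> t) = p t" if "\<bar>t\<bar> < \<tau>" for t
  proof -
    have "t \<in> {-\<tau>..\<tau>}" using that by auto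
    from r(3)[OF p(1)[OF this]] show "p t \<in> \<phi> ` U" "\<eta> t \<in> U0" "\<phi> (\<eta> t) = p t" by (auto simp: \<eta>_def)
  qed
  have gd: "gder \<eta> (\<lambda>v. v *\<^sub>R X) t UNIV" if t: "\<bar>t\<bar> < \<tau>" for t
  proof -
    have pd: "(p has_derivative (\<lambda>v. v *\<^sub>R L (p t) X)) (at t)"
      using p(2)[of t] t at_within_Icc_at[of "-\<tau>" t \<tau>] by (auto simp: has_vector_derivative_def abs_less_iff)
    have cp: "isCont p t" using has_derivative_continuous[OF pd] .
    have ct: "isCont \<eta> t" unfolding \<eta>_def using isCont_o2[OF cp isCont_\<xi>[OF in1(1)[OF t]]] .
    have "((\<lambda>y. \<phi> (\<eta> y)) has_derivative (\<lambda>v. v *\<^sub>R L (p t) X)) (at t)"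
    proof (rule has_derivative_eventually_cong[OF pd])
      have "\<forall>\<^sub>F y in at t. \<bar>y\<bar> < \<tau>"
        using t by (intro eventually_in_open[of t UNIV "\<lambda>y. y" "{y. \<bar>y\<bar> < \<tau>}", simplified]) (auto intro!: open_Collect_less continuous_intros)
      thus "\<forall>\<^sub>F y in at t. \<phi> (\<eta> y) = p y" by eventually_elim (rule in1)
      show "\<phi> (\<eta> t) = p t" using in1 t by blast
    qed
    from chart_gder[OF in1(2)[OF t] ct this]
    have "gder \<eta> (\<lambda>v. Linv (\<eta> t) (v *\<^sub>R L (p t) X)) t UNIV" .
    moreover have "Linv (\<eta> t) (v *\<^sub>R L (p t) X) = v *\<^sub>R X" for v
    proof -
      have "v *\<^sub>R L (p t) X = L (\<phi> (\<eta> t)) (v *\<^sub>R X)"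
        using in1[OF t] linear_scale[OF linear_L[OF in1(1)[OF t]]] by simp
      thus ?thesis using L_Linv(2)[OF in1(2)[OF t]] by simp
    qed
    ultimately show ?thesis by simp
  qed
  have \<eta>0: "\<eta> 0 = e" by (simp add: \<eta>_def p0)
  have c0: "isCont \<eta> 0" using gd[of 0] \<tau> by (simp add: gder_def)
  let ?F = "\<lambda>z. \<eta> (fst z) \<odot> \<eta> (snd z) \<odot> iv (\<eta> (fst z + snd z))"
  have t\<eta>: "(\<eta> \<longlongrightarrow> \<eta> 0) (nhds 0)" using c0 by (simp add: isCont_def tendsto_nhds_iff)
  have comp: "((\<lambda>z. \<eta> (f z)) \<longlongrightarrow> \<eta> 0) (nhds (0, 0))"
    if "isCont f (0, 0)" "f (0, 0) = 0" for f :: "real \<times> real \<Rightarrow> real"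
    by (rule filterlim_compose[OF t\<eta>]) (use that in \<open>simp add: isCont_def tendsto_nhds_iff\<close>)
  have "(?F \<longlongrightarrow> \<eta> 0 \<odot> \<eta> 0 \<odot> iv (\<eta> 0)) (nhds (0, 0))"
    by (intro tendsto_mul tendsto_iv comp continuous_intros) simp_all
  hence "(?F \<longlongrightarrow> ?F (0, 0)) (nhds (0, 0))" by simp
  moreover have "?F (0, 0) \<in> U" using \<eta>0 chart_facts by (simp add: G.inverse_neutral)
  ultimately have "\<forall>\<^sub>F z in nhds (0, 0). ?F z \<in> U" by (rule topological_tendstoD[OF _ chart_facts(1)])
  then obtain d where d: "d > 0" "\<And>z. dist z (0, 0) < d \<Longrightarrow> ?F z \<in> U"
    unfolding eventually_nhds_metric by blast
  \<comment> \<open>\<open>d / 2\<close> keeps the quotient in the chart, where constancy can be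
    tested; \<open>\<tau> / 2\<close> keeps the sum of two times in the domain of \<eta>.\<close>
  define \<tau>' where "\<tau>' = min (\<tau> / 2) (d / 2)"
  have \<tau>': "\<tau>' > 0" "\<tau>' < \<tau>" using \<tau> d by (auto simp: \<tau>'_def)
  have hom: "\<eta> (s + t) = \<eta> s \<odot> \<eta> t" if st: "\<bar>s\<bar> < \<tau>'" "\<bar>t\<bar> < \<tau>'" for s t
  proof -
    have inU: "?F (s, y) \<in> U" if "\<bar>y\<bar> < \<tau>'" for y
    proof (rule d(2))
      have "dist (s, y) (0, 0) \<le> \<bar>s\<bar> + \<bar>y\<bar>"
        using norm_Pair_le[of s y] by (simp add: dist_norm)
      also have "\<dots> < d" using that st by (simp add: \<tau>'_def)
      finally show "dist (s, y) (0, 0) < d" .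
    qed
    let ?f = "\<lambda>y. \<eta> s \<odot> \<eta> y \<odot> iv (\<eta> (s + y))"
    have der: "((\<lambda>y. \<phi> (?f y)) has_derivative (\<lambda>v. 0)) (at y)" if y: "\<bar>y\<bar> < \<tau>'" for y
    proof -
      have y1: "\<bar>y\<bar> < \<tau>" "\<bar>s + y\<bar> < \<tau>" using y st by (auto simp: \<tau>'_def)
      have g1: "gder (\<lambda>y. \<eta> s \<odot> \<eta> y) (\<lambda>v. v *\<^sub>R X) y UNIV" by (rule gder_left[OF gd[OF y1(1)]])
      have "gder (\<lambda>y. \<eta> (s + y)) (\<lambda>v. v *\<^sub>R X) y UNIV"
        by (rule gder_chain[of \<eta> "\<lambda>v. v *\<^sub>R X" "\<lambda>y. s + y" y, OF gd[OF y1(2)]])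
          (auto intro!: derivative_eq_intros)
      from gder_mult[OF g1 gder_inverse[OF this in1(2)[OF y1(2)]] U0(5)[OF in1(2)[OF y1(2)]]]
      have "gder ?f (\<lambda>v. 0) y UNIV" by simp
      from gder_chart[OF _ this] inU[OF y] have "((\<lambda>y. \<phi> (?f y)) has_derivative (\<lambda>v. L (\<phi> (?f y)) 0)) (at y)" by simp
      moreover have "L (\<phi> (?f y)) 0 = 0" using inU[OF y] by (intro linear_0 linear_L) auto
      ultimately show ?thesis by simp
    qed
    have "\<phi> (?f t) = \<phi> (?f 0)"
      by (rule constant_on_symmetric_interval[OF der st(2)])
    hence "\<phi> (?f t) = \<phi> e" using \<eta>0 by simp
    hence "?f t = e" using inU[OF st(2)] chart_facts(4) inj_\<phi> by (simp add: inj_on_def)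
    hence "\<eta> s \<odot> \<eta> t = iv (iv (\<eta> (s + t)))" by (metis G.inverse_unique G.inverse_inverse G.right_inverse G.right_cancel)
    thus ?thesis by simp
  qed
  have "is_exp X \<tau>' \<eta>" unfolding is_exp_def using \<tau>' \<eta>0 in1 gd hom by auto
  thus ?thesis by blast
qed

text \<open>\<open>Xp X t\<close> is \<open>exp (t X)\<close> for \<open>\<bar>t\<bar> < tau X\<close> and unspecified otherwise.\<close>

definition "Xp X = (SOME \<eta>. \<exists>\<tau>. is_exp X \<tau> \<eta>)"
definition "tau X = (SOME \<tau>. is_exp X \<tau> (Xp X))"

lemma Xp: "is_exp X (tau X) (Xp X)"
proof -
  have "\<exists>\<tau>. is_exp X \<tau> (Xp X)" unfolding Xp_def 
    using someI_ex[of "\<lambda>\<eta>. \<exists>\<tau>. is_exp X \<tau> \<eta>"] exp_exists[of X] by blast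
  thus ?thesis unfolding tau_def by (rule someI_ex)
qed

lemma tau_pos: "tau X > 0" and Xp_0 [simp]: "Xp X 0 = e"
  and Xp_U0: "\<bar>t\<bar> < tau X \<Longrightarrow> Xp X t \<in> U0"
  and Xp_gder: "\<bar>t\<bar> < tau X \<Longrightarrow> gder (Xp X) (\<lambda>v. v *\<^sub>R X) t UNIV"
  and Xp_add: "\<bar>a\<bar> < tau X \<Longrightarrow> \<bar>t\<bar> < tau X \<Longrightarrow> \<bar>a + t\<bar> < tau X \<Longrightarrow> Xp X (a + t) = Xp X a \<odot> Xp X t"
  using Xp[of X] by (auto simp: is_exp_def)

lemma Xp_uminus: "\<bar>t\<bar> < tau X \<Longrightarrow> Xp X (- t) = iv (Xp X t)"
  using Xp_add[of "-t" X t] tau_pos[of X] by (simp add: G.inverse_unique[symmetric]) (metis G.inverse_unique G.inverse_inverse)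

lemma Ad_iv: "h \<in> U0 \<Longrightarrow> Ad (iv h) (Ad h Y) = Y" "h \<in> U0 \<Longrightarrow> Ad h (Ad (iv h) Y) = Y"
  using Ad_mult[of "iv h" h Y] Ad_mult[of h "iv h" Y] U0 by auto

lemma Ad_gder2:
  assumes f: "gder f D x T" "f x \<in> U0" and w: "(w has_derivative w') (at x within T)"
  shows "((\<lambda>y. Ad (f y) (w y)) has_derivative (\<lambda>v. Ad (f x) (br (D v) (w x) + w' v))) (at x within T)"
proof -
  have lin: "linear (Ad (f x))" using linear_Ad f by blast
  have "((\<lambda>y. \<Sum>b\<in>Basis. (w y \<bullet> b) *\<^sub>R Ad (f y) b) has_derivative
     (\<lambda>v. \<Sum>b\<in>Basis. (w x \<bullet> b) *\<^sub>R Ad (f x) (br (D v) b) + (w' v \<bullet> b) *\<^sub>R Ad (f x) b)) (at x within T)"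
    by (intro has_derivative_sum has_derivative_scaleR has_derivative_inner_left w Ad_gder f)
  moreover have eq: "(\<lambda>v. \<Sum>b\<in>Basis. (w x \<bullet> b) *\<^sub>R Ad (f x) (br (D v) b) + (w' v \<bullet> b) *\<^sub>R Ad (f x) b)
      = (\<lambda>v. Ad (f x) (br (D v) (w x) + w' v))"
  proof
    fix v
    have "linear (\<lambda>Y. Ad (f x) (br (D v) Y))"
      using linear_compose[OF bounded_linear.linear[OF br.bounded_linear_right] lin] by (simp add: o_def)
    from linear_euclidean_expansion[OF this, of "w x"] linear_euclidean_expansion[OF lin, of "w' v"]
    show "(\<Sum>b\<in>Basis. (w x \<bullet> b) *\<^sub>R Ad (f x) (br (D v) b) + (w' v \<bullet> b) *\<^sub>R Ad (f x) b)
      = Ad (f x) (br (D v) (w x) + w' v)" by (simp only: sum.distrib linear_add[OF lin])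
  qed
  ultimately have *: "((\<lambda>y. \<Sum>b\<in>Basis. (w y \<bullet> b) *\<^sub>R Ad (f y) b) has_derivative
     (\<lambda>v. Ad (f x) (br (D v) (w x) + w' v))) (at x within T)" by (simp only: eq)
  show ?thesis
  proof (rule has_derivative_eventually_cong[OF *])
    have eq: "Ad (f y) (w y) = (\<Sum>b\<in>Basis. (w y \<bullet> b) *\<^sub>R Ad (f y) b)" if "f y \<in> U0" for y
      by (rule linear_euclidean_expansion[OF linear_Ad[OF that]])
    have "\<forall>\<^sub>F y in at x within T. f y \<in> U0"
      using f U0(1) by (intro eventually_in_open) (auto simp: gder_def)
    thus "\<forall>\<^sub>F y in at x within T. Ad (f y) (w y) = (\<Sum>b\<in>Basis. (w y \<bullet> b) *\<^sub>R Ad (f y) b)"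
      by eventually_elim (rule eq)
    show "Ad (f x) (w x) = (\<Sum>b\<in>Basis. (w x \<bullet> b) *\<^sub>R Ad (f x) b)" by (rule eq[OF f(2)])
  qed
qed

lemma br_self [simp]: "br X X = 0"
  by (simp add: br_eq)

lemma Ad_Xp_self: "\<bar>t\<bar> < tau X \<Longrightarrow> Ad (Xp X t) X = X"
proof -
  assume t: "\<bar>t\<bar> < tau X"
  have "((\<lambda>t. Ad (Xp X t) X) has_derivative (\<lambda>v. 0)) (at t)" if "\<bar>t\<bar> < tau X" for t
    using Ad_gder[OF Xp_gder[OF that] Xp_U0[OF that], of X] linear_0[OF linear_Ad[OF Xp_U0[OF that]]]
    by (simp add: br.scaleR_left)
  from constant_on_symmetric_interval[OF this t] show ?thesis by simp
qed

end

locale carnot = lie_chart mul e iv A c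
  for mul :: "'g::{t2_space, second_countable_topology} \<Rightarrow> 'g \<Rightarrow> 'g"
    and e iv and A :: "('g, 'e::euclidean_space) chart set" and c +
  fixes s :: nat and V :: "nat \<Rightarrow> 'e set" and ip :: "'e \<Rightarrow> 'e \<Rightarrow> real"
  assumes strat: "stratification (lie_bracket mul e c) s V"
    and ip: "inner_product_on (V 1) ip" and conn: "connected (UNIV :: 'g set)"
begin

declare One_nat_def [simp del]

lemma s1: "s \<ge> 1" and subspace_V: "i \<in> {1..s} \<Longrightarrow> subspace (V i)"
  and ex1_decomp: "\<exists>!v. v \<in> PiE {1..s} V \<and> x = (\<Sum>i=1..s. v i)"
  and V_Suc: "1 \<le> i \<Longrightarrow> i < s \<Longrightarrow> V (Suc i) = span {br X Y | X Y. X \<in> V 1 \<and> Y \<in> V i}"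
  and br_1s: "X \<in> V 1 \<Longrightarrow> Y \<in> V s \<Longrightarrow> br X Y = 0"
  using strat by (auto simp: stratification_def)

section \<open>Projections onto the layers and dilations of the Lie algebra\<close>

definition "P i x = (THE v. v \<in> PiE {1..s} V \<and> x = (\<Sum>i=1..s. v i)) i"

lemma P_in: "i \<in> {1..s} \<Longrightarrow> P i x \<in> V i" and P_sum: "(\<Sum>i=1..s. P i x) = x"
proof -
  have "(THE v. v \<in> PiE {1..s} V \<and> x = (\<Sum>i=1..s. v i)) \<in> PiE {1..s} V \<and>
     x = (\<Sum>i=1..s. (THE v. v \<in> PiE {1..s} V \<and> x = (\<Sum>i=1..s. v i)) i)"
    by (rule theI'[OF ex1_decomp])
  thus "i \<in> {1..s} \<Longrightarrow> P i x \<in> V i" "(\<Sum>i=1..s. P i x) = x" unfolding P_def by auto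
qed

lemma P_unique:
  assumes "\<And>i. i \<in> {1..s} \<Longrightarrow> w i \<in> V i" "x = (\<Sum>i=1..s. w i)" "i \<in> {1..s}"
  shows "P i x = w i"
proof -
  have "restrict w {1..s} \<in> PiE {1..s} V \<and> x = (\<Sum>i=1..s. restrict w {1..s} i)"
    using assms by auto
  note w = this
  have "(THE v. v \<in> PiE {1..s} V \<and> x = (\<Sum>i=1..s. v i)) = restrict w {1..s}"
  proof (rule the_equality)
    show "restrict w {1..s} \<in> PiE {1..s} V \<and> x = (\<Sum>i=1..s. restrict w {1..s} i)" by (rule w)
    fix v assume "v \<in> PiE {1..s} V \<and> x = (\<Sum>i=1..s. v i)"
    thus "v = restrict w {1..s}" using ex1_decomp[of x] w by (metis (no_types, lifting))
  qed
  thus ?thesis using assms(3) by (simp add: P_def)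
qed

lemma linear_P: assumes i: "i \<in> {1..s}" shows "linear (P i)"
proof (rule linearI)
  fix x y :: 'e and r :: real
  show "P i (x + y) = P i x + P i y"
    using P_in subspace_V i by (intro P_unique) (auto simp: sum.distrib P_sum subspace_add)
  show "P i (r *\<^sub>R x) = r *\<^sub>R P i x"
    using P_in subspace_V i by (intro P_unique) (auto simp: scaleR_sum_right[symmetric] P_sum subspace_scale)
qed

lemma P_V: assumes "i \<in> {1..s}" "j \<in> {1..s}" "x \<in> V j" shows "P i x = (if i = j then x else 0)"
  using assms subspace_0[OF subspace_V]
  by (intro P_unique[where w = "\<lambda>i. if i = j then x else 0"]) auto

definition "\<delta> r x = (\<Sum>i=1..s. r ^ i *\<^sub>R P i x)"

lemma linear_\<delta>: "linear (\<delta> r)"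
proof -
  have "linear (\<lambda>x. \<Sum>i=1..s. r ^ i *\<^sub>R P i x)"
    by (intro linear_compose_sum ballI linear_compose_scale_right linear_P) auto
  thus ?thesis by (simp add: \<delta>_def[abs_def])
qed

lemma bounded_linear_\<delta>: "bounded_linear (\<delta> r)"
  using linear_\<delta> by (simp add: linear_conv_bounded_linear)

lemma bounded_linear_P: "i \<in> {1..s} \<Longrightarrow> bounded_linear (P i)"
  using linear_P by (simp add: linear_conv_bounded_linear)

lemma P_\<delta>: "i \<in> {1..s} \<Longrightarrow> P i (\<delta> r x) = r ^ i *\<^sub>R P i x"
  unfolding \<delta>_def using P_in subspace_V by (intro P_unique) (auto simp: subspace_scale)

lemma \<delta>_V: "i \<in> {1..s} \<Longrightarrow> x \<in> V i \<Longrightarrow> \<delta> r x = r ^ i *\<^sub>R x"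
  unfolding \<delta>_def by (subst sum.cong[OF refl, of _ _ "\<lambda>j. if j = i then r ^ i *\<^sub>R x else 0"]) (auto simp: P_V)

lemma \<delta>_\<delta>: "\<delta> r (\<delta> q x) = \<delta> (r * q) x"
  unfolding \<delta>_def[of r] \<delta>_def[of "r * q"] by (intro sum.cong) (auto simp: P_\<delta> power_mult_distrib)

lemma \<delta>_1 [simp]: "\<delta> 1 x = x" by (simp add: \<delta>_def P_sum)

text \<open>The stratification speaks of brackets with the first layer only. For the step from
  \<open>i\<close> to \<open>Suc i\<close>, the layer \<open>V (Suc i)\<close> is spanned by
  brackets \<open>br Z W\<close> with \<open>Z\<close> in \<open>V 1\<close> and \<open>W\<close> in
  \<open>V i\<close>, and the Jacobi identity reduces \<open>br (br Z W) Y\<close> to brackets with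
  \<open>Z\<close> and with \<open>W\<close>, which raise the degree as expected.\<close>

lemma br_V:
  assumes "1 \<le> i" "i \<le> s" "1 \<le> j" "j \<le> s" "X \<in> V i" "Y \<in> V j"
  shows "(i + j \<le> s \<longrightarrow> br X Y \<in> V (i + j)) \<and> (s < i + j \<longrightarrow> br X Y = 0)"
  using assms
proof (induction i arbitrary: j X Y rule: nat_induct_at_least[of 1])
  case base
  hence "br X Y \<in> V (Suc j)" if "j < s"
    unfolding V_Suc[OF \<open>1 \<le> j\<close> that] using base by (intro span_base) auto
  moreover have "br X Y = 0" if "j = s" using base br_1s that by auto
  ultimately show ?case using base by (cases "j = s") (auto simp: plus_1_eq_Suc)
next
  case (Suc i)
  have one: "(1 + k \<le> s \<longrightarrow> br X Y \<in> V (1 + k)) \<and> (s < 1 + k \<longrightarrow> br X Y = 0)"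
    if "1 \<le> k" "k \<le> s" "X \<in> V 1" "Y \<in> V k" for k X Y
  proof -
    have "br X Y \<in> V (Suc k)" if "k < s"
      unfolding V_Suc[OF \<open>1 \<le> k\<close> that] using \<open>X \<in> V 1\<close> \<open>Y \<in> V k\<close> by (intro span_base) auto
    moreover have "br X Y = 0" if "k = s" using \<open>X \<in> V 1\<close> \<open>Y \<in> V k\<close> br_1s that by auto
    ultimately show ?thesis using \<open>k \<le> s\<close> by (cases "k = s") (auto simp: plus_1_eq_Suc)
  qed
  have pr: "1 \<le> i" "Suc i \<le> s" "i \<le> s" "1 \<le> j" "j \<le> s" "X \<in> V (Suc i)" "Y \<in> V j"
    using Suc.hyps Suc.prems by auto
  let ?T = "if Suc i + j \<le> s then V (Suc i + j) else {0}"
  have sT: "subspace ?T" using subspace_V pr by auto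
  have lin: "linear (\<lambda>X. br X Y)" by (rule bounded_linear.linear[OF br.bounded_linear_left])
  have "br (br Z W) Y \<in> ?T" if "Z \<in> V 1" "W \<in> V i" for Z W
  proof -
    have jac: "br (br Z W) Y = br Z (br W Y) - br W (br Z Y)" using jacobi[of Z W Y] by simp
    have "br Z (br W Y) \<in> ?T"
    proof (cases "i + j \<le> s")
      case True
      hence "br W Y \<in> V (i + j)" using Suc.IH[of j W Y] pr that by auto
      thus ?thesis using one[of "i + j" Z "br W Y"] True that pr by (auto simp: not_le plus_1_eq_Suc)
    next
      case False
      hence "br W Y = 0" using Suc.IH[of j W Y] pr that by auto
      thus ?thesis using False by (simp add: br.zero_right)
    qed
    moreover have "br W (br Z Y) \<in> ?T"
    proof (cases "1 + j \<le> s")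
      case True
      hence "br Z Y \<in> V (1 + j)" using one[of j Z Y] pr that by auto
      thus ?thesis using Suc.IH[of "1 + j" W "br Z Y"] True that pr by (auto simp: not_le plus_1_eq_Suc)
    next
      case False
      hence "br Z Y = 0" using one[of j Z Y] pr that by auto
      thus ?thesis using False by (simp add: br.zero_right)
    qed
    ultimately show ?thesis unfolding jac using sT by (rule subspace_diff[rotated])
  qed
  hence "(\<lambda>X. br X Y) ` {br X Y | X Y. X \<in> V 1 \<and> Y \<in> V i} \<subseteq> ?T" by blast
  hence "span ((\<lambda>X. br X Y) ` {br X Y | X Y. X \<in> V 1 \<and> Y \<in> V i}) \<subseteq> ?T" by (rule span_minimal[OF _ sT])
  hence "(\<lambda>X. br X Y) ` V (Suc i) \<subseteq> ?T"
    using V_Suc[of i] pr linear_span_image[OF lin] by auto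
  hence "br X Y \<in> ?T" using pr by auto
  thus ?case by (auto split: if_splits)
qed

lemma br_expand: "br X Y = (\<Sum>i=1..s. \<Sum>j=1..s. br (P i X) (P j Y))"
proof -
  have "br X Y = br (\<Sum>i=1..s. P i X) (\<Sum>j=1..s. P j Y)" by (simp add: P_sum)
  thus ?thesis by (simp only: br.sum_left br.sum_right) (rule sum.swap)
qed

lemma \<delta>_br: "\<delta> r (br X Y) = br (\<delta> r X) (\<delta> r Y)"
proof -
  have "\<delta> r (br (P i X) (P j Y)) = br (P i (\<delta> r X)) (P j (\<delta> r Y))" if ij: "i \<in> {1..s}" "j \<in> {1..s}" for i j
  proof -
    have "\<delta> r (br (P i X) (P j Y)) = r ^ (i + j) *\<^sub>R br (P i X) (P j Y)"
      using br_V[of i j "P i X" "P j Y"] ij P_in[OF ij(1), of X] P_in[OF ij(2), of Y] \<delta>_V[of "i + j"] linear_0[OF linear_\<delta>]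
      by (cases "i + j \<le> s") auto
    thus ?thesis using ij by (simp add: P_\<delta> br.scaleR_left br.scaleR_right power_add mult.commute)
  qed
  thus ?thesis unfolding br_expand[of X Y] br_expand[of "\<delta> r X"] by (simp add: linear_sum[OF linear_\<delta>])
qed

lemma P1_br: "P 1 (br X Y) = 0"
proof -
  have i1: "(1::nat) \<in> {1..s}" using s1 by simp
  have "P 1 (br (P i X) (P j Y)) = 0" if ij: "i \<in> {1..s}" "j \<in> {1..s}" for i j
    using br_V[of i j "P i X" "P j Y"] ij P_in[OF ij(1), of X] P_in[OF ij(2), of Y] P_V[OF i1, of "i + j"] linear_0[OF linear_P[OF i1]]
    by (cases "i + j \<le> s") auto
  thus ?thesis unfolding br_expand[of X Y] by (simp add: linear_sum[OF linear_P[OF i1]])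
qed

text \<open>By \<open>Ad_br\<close> the time derivative is a bracket, and brackets have no component
  in the first layer. Hence conjugations do not change horizontal components.\<close>

lemma P1_Ad_Xp: assumes t: "\<bar>t\<bar> < tau X" shows "P 1 (Ad (Xp X t) Y) = P 1 Y"
proof -
  have i1: "(1::nat) \<in> {1..s}" using s1 by simp
  have "((\<lambda>t. P 1 (Ad (Xp X t) Y)) has_derivative (\<lambda>v. 0)) (at t)" if "\<bar>t\<bar> < tau X" for t
    using bounded_linear.has_derivative[OF bounded_linear_P[OF i1] Ad_gder[OF Xp_gder[OF that] Xp_U0[OF that], of Y]]
    by (simp add: Ad_br[OF Xp_U0[OF that]] P1_br)
  from constant_on_symmetric_interval[OF this t] show ?thesis by simp
qed

text \<open>The integrated form of \<open>\<delta>_br\<close>. As \<delta> r X is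
  \<open>r ^ d *\<^sub>R X\<close>, the map \<open>Ad (Xp X (r ^ d * t))\<close> after \<delta> r
  after \<open>Ad (Xp X (- t))\<close> has zero derivative in \<open>t\<close> and is \<delta> r at
  time 0. The bound \<open>r \<le> 1\<close> keeps \<open>r ^ d * t\<close> where
  \<open>Xp X\<close> is controlled.\<close>

lemma \<delta>_Ad_Xp:
  assumes X: "X \<in> V d" "d \<in> {1..s}" and r: "0 < r" "r \<le> 1" and t: "\<bar>t\<bar> < tau X"
  shows "\<delta> r (Ad (Xp X t) Y) = Ad (Xp X (r ^ d * t)) (\<delta> r Y)"
proof -
  have rt: "\<bar>r ^ d * t\<bar> < tau X" if "\<bar>t\<bar> < tau X" for t
  proof -
    have "\<bar>r ^ d * t\<bar> \<le> 1 * \<bar>t\<bar>" unfolding abs_mult using r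
      by (intro mult_right_mono) (auto simp: power_le_one)
    thus ?thesis using that by simp
  qed
  have key: "Ad (Xp X (r ^ d * t)) (\<delta> r (Ad (Xp X (- t)) Y)) = \<delta> r Y" if t: "\<bar>t\<bar> < tau X" for Y t
  proof -
    have "((\<lambda>t. Ad (Xp X (r ^ d * t)) (\<delta> r (Ad (Xp X (- t)) Y))) has_derivative (\<lambda>v. 0)) (at t)" if t: "\<bar>t\<bar> < tau X" for t
    proof -
      have mt: "\<bar>- t\<bar> < tau X" using t by simp
      have "gder (\<lambda>t. Xp X (- t)) (\<lambda>v. (- v) *\<^sub>R X) t UNIV"
        by (rule gder_chain[of "Xp X" "\<lambda>v. v *\<^sub>R X" "\<lambda>t. - t" t, OF Xp_gder[OF mt]])
          (auto intro!: derivative_eq_intros)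
      from Ad_gder[OF this Xp_U0[OF mt], of Y]
      have w: "((\<lambda>t. \<delta> r (Ad (Xp X (- t)) Y)) has_derivative (\<lambda>v. \<delta> r (Ad (Xp X (- t)) (br ((- v) *\<^sub>R X) Y)))) (at t)"
        by (rule bounded_linear.has_derivative[OF bounded_linear_\<delta>])
      have "gder (\<lambda>t. Xp X (r ^ d * t)) (\<lambda>v. (r ^ d * v) *\<^sub>R X) t UNIV"
        by (rule gder_chain[of "Xp X" "\<lambda>v. v *\<^sub>R X" "\<lambda>t. r ^ d * t" t, OF Xp_gder[OF rt[OF t]]])
          (auto intro!: derivative_eq_intros)
      from Ad_gder2[OF this Xp_U0[OF rt[OF t]] w]
      show ?thesis
        using linear_0[OF linear_Ad[OF Xp_U0[OF rt[OF t]]]] Ad_Xp_self[OF mt] linear_neg[OF linear_Ad[OF Xp_U0[OF mt]]]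
        by (simp add: Ad_br[OF Xp_U0[OF mt]] \<delta>_br br.scaleR_left linear_scale[OF linear_Ad[OF Xp_U0[OF mt]]]
            linear_scale[OF linear_\<delta>] \<delta>_V[OF X(2,1)] br.minus_left linear_neg[OF linear_\<delta>] mult.commute)
    qed
    from constant_on_symmetric_interval[OF this t] show ?thesis by simp
  qed
  have "Ad (Xp X (- t)) (Ad (Xp X t) Y) = Y"
    using Xp_uminus[OF t] Ad_iv(1)[OF Xp_U0[OF t]] by simp
  thus ?thesis using key[OF t, of "Ad (Xp X t) Y"] by simp
qed

end

section \<open>Coordinates of the second kind\<close>

context lie_chart
begin

text \<open>Coordinates of the second kind along a list of triples (degree, direction, coordinate function).\<close>

primrec Psi :: "(nat \<times> 'e \<times> ('e \<Rightarrow> real)) list \<Rightarrow> 'e \<Rightarrow> 'g" where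
  "Psi [] x = e"
| "Psi (b # bs) x = Xp (fst (snd b)) (snd (snd b) x) \<odot> Psi bs x"

text \<open>The points where the formulas for \<open>Psi\<close> are valid: each coordinate is a
  time at which its one-parameter subgroup is controlled, and each partial product lies in
  \<open>U0\<close>, where \<open>Ad\<close> is controlled.\<close>

primrec good :: "(nat \<times> 'e \<times> ('e \<Rightarrow> real)) list \<Rightarrow> 'e \<Rightarrow> bool" where
  "good [] x = True"
| "good (b # bs) x \<longleftrightarrow> \<bar>snd (snd b) x\<bar> < tau (fst (snd b)) \<and> Psi (b # bs) x \<in> U0 \<and> good bs x"

text \<open>A velocity that is moved to the right past the remaining product \<open>Psi bs x\<close>
  gets conjugated by the inverse of that product.\<close>

definition "TT bs x Y = Ad (iv (Psi bs x)) Y"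

text \<open>\<open>Am bs x\<close> is the derivative of \<open>Psi bs\<close> at \<open>x\<close> in the left trivialization, and \<open>DAm bs x v\<close>
  the derivative of \<open>\<lambda>x. Am bs x v\<close>.\<close>

primrec Am :: "(nat \<times> 'e \<times> ('e \<Rightarrow> real)) list \<Rightarrow> 'e \<Rightarrow> 'e \<Rightarrow> 'e" where
  "Am [] x v = 0"
| "Am (b # bs) x v = snd (snd b) v *\<^sub>R TT bs x (fst (snd b)) + Am bs x v"

primrec DAm :: "(nat \<times> 'e \<times> ('e \<Rightarrow> real)) list \<Rightarrow> 'e \<Rightarrow> 'e \<Rightarrow> 'e \<Rightarrow> 'e" where
  "DAm [] x v w = 0"
| "DAm (b # bs) x v w = snd (snd b) v *\<^sub>R (- br (Am bs x w) (TT bs x (fst (snd b)))) + DAm bs x v w"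

definition "lincoords bs \<longleftrightarrow> (\<forall>b\<in>set bs. bounded_linear (snd (snd b) :: 'e \<Rightarrow> real))"

lemma lincoords_Cons: "lincoords (b # bs) \<longleftrightarrow> bounded_linear (snd (snd b)) \<and> lincoords bs"
  by (simp add: lincoords_def)

lemma good_Psi: "good bs x \<Longrightarrow> Psi bs x \<in> U0"
  using U0 by (cases bs) auto

lemma Psi_gder: "lincoords bs \<Longrightarrow> good bs x \<Longrightarrow> gder (Psi bs) (Am bs x) x UNIV"
proof (induction bs)
  case Nil
  have "Psi [] = (\<lambda>x. e)" "Am [] x = (\<lambda>v. 0)" by auto
  thus ?case by (simp add: gder_def)
next
  case (Cons b bs)
  let ?f = "snd (snd b)" and ?X = "fst (snd b)"
  have lf: "(?f has_derivative ?f) (at x)" 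
    using Cons.prems by (intro bounded_linear_imp_has_derivative) (simp add: lincoords_Cons)
  have "gder (\<lambda>y. Xp ?X (?f y)) (\<lambda>v. ?f v *\<^sub>R ?X) x UNIV"
    by (rule gder_chain[of "Xp ?X" "\<lambda>v. v *\<^sub>R ?X" ?f x, OF Xp_gder lf]) (use Cons.prems in simp)
  from gder_mult[OF this Cons.IH good_Psi]
  have "gder (\<lambda>y. Xp ?X (?f y) \<odot> Psi bs y) (\<lambda>v. Ad (iv (Psi bs x)) (?f v *\<^sub>R ?X) + Am bs x v) x UNIV"
    using Cons.prems by (simp add: lincoords_Cons)
  moreover have "Ad (iv (Psi bs x)) (?f v *\<^sub>R ?X) = ?f v *\<^sub>R TT bs x ?X" for v
    using linear_scale[OF linear_Ad[OF U0(5)[OF good_Psi]]] Cons.prems by (simp add: TT_def)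
  moreover have "Psi (b # bs) = (\<lambda>y. Xp ?X (?f y) \<odot> Psi bs y)" by auto
  moreover have "Am (b # bs) x = (\<lambda>v. ?f v *\<^sub>R TT bs x ?X + Am bs x v)" by auto
  ultimately show ?case by simp
qed

lemma Psi_0: "lincoords bs \<Longrightarrow> Psi bs 0 = e"
  by (induction bs) (auto simp: lincoords_Cons linear_simps)

lemma good_0: "lincoords bs \<Longrightarrow> good bs 0"
  by (induction bs) (auto simp: lincoords_Cons linear_simps tau_pos U0 Psi_0)

lemma isCont_Psi: "lincoords bs \<Longrightarrow> good bs x \<Longrightarrow> isCont (Psi bs) x"
  using Psi_gder by (auto simp: gder_def)

lemma eventually_nhds_isCont:
  assumes "isCont f x" "open W" "f x \<in> W" shows "\<forall>\<^sub>F y in nhds x. f y \<in> W"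
  using topological_tendstoD[of f "f x" "at x" W] assms by (simp add: isCont_def eventually_nhds_conv_at)

lemma eventually_good: "lincoords bs \<Longrightarrow> \<forall>\<^sub>F x in nhds 0. good bs x"
proof (induction bs)
  case (Cons b bs)
  let ?f = "snd (snd b)"
  have "isCont (\<lambda>x. \<bar>?f x\<bar>) 0" using Cons.prems
    by (intro continuous_intros linear_continuous_at) (simp add: lincoords_Cons)
  from eventually_nhds_isCont[OF this open_lessThan[of "tau (fst (snd b))"]]
  have "\<forall>\<^sub>F x in nhds 0. \<bar>?f x\<bar> < tau (fst (snd b))"
    using Cons.prems tau_pos by (simp add: lincoords_Cons linear_simps)
  moreover have "\<forall>\<^sub>F x in nhds 0. Psi (b # bs) x \<in> U0"
    by (rule eventually_nhds_isCont[OF isCont_Psi[OF Cons.prems good_0] U0(1)])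
       (simp_all only: Cons.prems Psi_0[OF Cons.prems] U0)
  moreover have "\<forall>\<^sub>F x in nhds 0. good bs x" using Cons by (simp add: lincoords_Cons)
  ultimately show ?case by eventually_elim auto
next
  case Nil
  have "good [] = (\<lambda>x. True)" by auto
  thus ?case by simp
qed

lemma linear_TT: "good bs x \<Longrightarrow> linear (TT bs x)"
  using linear_Ad[OF U0(5)[OF good_Psi]] by (simp add: TT_def[abs_def])

lemma linear_Am: "lincoords bs \<Longrightarrow> linear (Am bs x)"
proof (induction bs)
  case Nil
  have "Am [] x = (\<lambda>v. 0)" by auto
  thus ?case by (simp add: linear_zero)
next
  case (Cons b bs)
  have "linear (\<lambda>v. snd (snd b) v *\<^sub>R TT bs x (fst (snd b)))"
    using Cons.prems by (intro linear_scaleR_left[THEN linear_compose[unfolded o_def, rotated]] bounded_linear.linear) (simp add: lincoords_Cons)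
  moreover have "Am (b # bs) x = (\<lambda>v. snd (snd b) v *\<^sub>R TT bs x (fst (snd b)) + Am bs x v)" by auto
  ultimately show ?case using Cons by (simp add: lincoords_Cons linear_compose_add)
qed

lemma TT_deriv:
  assumes "lincoords bs" "good bs x"
  shows "((\<lambda>x. TT bs x Y) has_derivative (\<lambda>w. - br (Am bs x w) (TT bs x Y))) (at x)"
proof -
  have h: "Psi bs x \<in> U0" using assms good_Psi by blast
  have "Ad (iv (Psi bs x)) (br (- Ad (Psi bs x) w) Y) = - br w (TT bs x Y)" for w
    using Ad_br[OF U0(5)[OF h]] Ad_iv(1)[OF h] linear_neg[OF linear_Ad[OF U0(5)[OF h]]]
    by (simp add: TT_def br.minus_left)
  with Ad_gder[OF gder_inverse[OF Psi_gder[OF assms] h] U0(5)[OF h], of Y]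
  show ?thesis by (simp add: TT_def)
qed

lemma Am_deriv:
  "lincoords bs \<Longrightarrow> good bs x \<Longrightarrow> ((\<lambda>x. Am bs x v) has_derivative DAm bs x v) (at x)"
proof (induction bs)
  case Nil
  have "DAm [] x v = (\<lambda>w. 0)" by auto
  thus ?case by simp
next
  case (Cons b bs)
  have eq: "DAm (b # bs) x v = (\<lambda>w. snd (snd b) v *\<^sub>R (- br (Am bs x w) (TT bs x (fst (snd b)))) + DAm bs x v w)" by auto
  show ?case unfolding eq Am.simps using Cons
    by (intro has_derivative_add has_derivative_scaleR_right TT_deriv) (auto simp: lincoords_Cons)
qed

lemma isCont_TT: "lincoords bs \<Longrightarrow> good bs x \<Longrightarrow> isCont (\<lambda>x. TT bs x Y) x"
  using TT_deriv has_derivative_continuous by blast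

lemma TT_bound: assumes "lincoords bs" shows "\<exists>C\<ge>0. \<forall>\<^sub>F x in nhds 0. norm (TT bs x Y) \<le> C"
proof -
  have "isCont (\<lambda>x. norm (TT bs x Y)) 0" using isCont_TT[OF assms good_0[OF assms]] by (intro continuous_intros)
  from eventually_nhds_isCont[OF this open_lessThan[of "norm (TT bs 0 Y) + 1"]]
  have "\<forall>\<^sub>F x in nhds 0. norm (TT bs x Y) < norm (TT bs 0 Y) + 1" by simp
  hence "\<forall>\<^sub>F x in nhds 0. norm (TT bs x Y) \<le> norm (TT bs 0 Y) + 1" by eventually_elim simp
  thus ?thesis by (intro exI[of _ "norm (TT bs 0 Y) + 1"]) auto
qed

lemma Am_bound: "lincoords bs \<Longrightarrow> \<exists>C\<ge>0. \<forall>\<^sub>F x in nhds 0. \<forall>v. norm (Am bs x v) \<le> C * norm v"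
proof (induction bs)
  case (Cons b bs)
  obtain C where C: "C \<ge> 0" "\<forall>\<^sub>F x in nhds 0. \<forall>v. norm (Am bs x v) \<le> C * norm v"
    using Cons by (auto simp: lincoords_Cons)
  obtain D where D: "D \<ge> 0" "\<forall>\<^sub>F x in nhds 0. norm (TT bs x (fst (snd b))) \<le> D"
    using TT_bound[of bs "fst (snd b)"] Cons.prems by (auto simp: lincoords_Cons)
  obtain K where K: "K \<ge> 0" "\<And>v. norm (snd (snd b) v) \<le> norm v * K"
    using bounded_linear.nonneg_bounded Cons.prems by (metis lincoords_Cons)
  from C(2) D(2) have "\<forall>\<^sub>F x in nhds 0. \<forall>v. norm (Am (b # bs) x v) \<le> (K * D + C) * norm v"
  proof eventually_elim
    case (elim x)
    have "norm (Am (b # bs) x v) \<le> norm (snd (snd b) v) * norm (TT bs x (fst (snd b))) + norm (Am bs x v)" for v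
      using norm_triangle_ineq[of "snd (snd b) v *\<^sub>R TT bs x (fst (snd b))"] by simp
    moreover have "norm (snd (snd b) v) * norm (TT bs x (fst (snd b))) \<le> (norm v * K) * D" for v
      using K elim by (intro mult_mono) auto
    ultimately show ?case using elim by (smt (verit) distrib_right mult.commute mult.left_commute)
  qed
  thus ?case using C D K by (intro exI[of _ "K * D + C"]) auto
qed auto

lemma DAm_bound:
  "lincoords bs \<Longrightarrow> \<exists>C\<ge>0. \<forall>\<^sub>F x in nhds 0. \<forall>v w. norm (DAm bs x v w) \<le> C * norm v * norm w"
proof (induction bs)
  case (Cons b bs)
  let ?X = "fst (snd b)"
  obtain C where C: "C \<ge> 0" "\<forall>\<^sub>F x in nhds 0. \<forall>v w. norm (DAm bs x v w) \<le> C * norm v * norm w"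
    using Cons by (auto simp: lincoords_Cons)
  obtain E where E: "E \<ge> 0" "\<forall>\<^sub>F x in nhds 0. \<forall>v. norm (Am bs x v) \<le> E * norm v"
    using Am_bound[of bs] Cons.prems by (auto simp: lincoords_Cons)
  obtain D where D: "D \<ge> 0" "\<forall>\<^sub>F x in nhds 0. norm (TT bs x ?X) \<le> D"
    using TT_bound[of bs "?X"] Cons.prems by (auto simp: lincoords_Cons)
  obtain K where K: "K \<ge> 0" "\<And>v. norm (snd (snd b) v) \<le> norm v * K"
    using bounded_linear.nonneg_bounded Cons.prems by (metis lincoords_Cons)
  obtain M where M: "M \<ge> 0" "\<And>v w. norm (br v w) \<le> norm v * norm w * M"
    using br.nonneg_bounded by blast
  from C(2) D(2) E(2) have "\<forall>\<^sub>F x in nhds 0. \<forall>v w. norm (DAm (b # bs) x v w) \<le> (K * (E * D * M) + C) * norm v * norm w"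
  proof eventually_elim
    case (elim x)
    show ?case
    proof (intro allI)
      fix v w
      have "norm (br (Am bs x w) (TT bs x ?X)) \<le> norm (Am bs x w) * norm (TT bs x ?X) * M" by (rule M)
      also have "\<dots> \<le> (E * norm w) * D * M" using elim M E by (intro mult_right_mono mult_mono) auto
      finally have 1: "norm (br (Am bs x w) (TT bs x ?X)) \<le> (E * norm w) * D * M" .
      have "norm (DAm (b # bs) x v w) \<le> norm (snd (snd b) v) * norm (br (Am bs x w) (TT bs x ?X)) + norm (DAm bs x v w)"
        using norm_triangle_ineq[of "snd (snd b) v *\<^sub>R (- br (Am bs x w) (TT bs x ?X))"] by simp
      also have "\<dots> \<le> (norm v * K) * ((E * norm w) * D * M) + C * norm v * norm w"
        using K 1 elim by (intro add_mono mult_mono) auto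
      also have "\<dots> = (K * (E * D * M) + C) * norm v * norm w" by (simp add: algebra_simps)
      finally show "norm (DAm (b # bs) x v w) \<le> (K * (E * D * M) + C) * norm v * norm w" .
    qed
  qed
  thus ?case using C D K E M by (intro exI[of _ "K * (E * D * M) + C"]) auto
qed auto

lemma Am_0: "lincoords bs \<Longrightarrow> Am bs 0 v = (\<Sum>b\<leftarrow>bs. snd (snd b) v *\<^sub>R fst (snd b))"
  by (induction bs) (auto simp: lincoords_Cons TT_def Psi_0 G.inverse_neutral)

end

context carnot
begin

declare One_nat_def [simp del]

section \<open>Homogeneity of the frame\<close>

definition "graded bs \<longleftrightarrow> (\<forall>b\<in>set bs. fst b \<in> {1..s} \<and> fst (snd b) \<in> V (fst b) \<and>
   (\<forall>r x. snd (snd b) (\<delta> r x) = r ^ fst b * snd (snd b) x))"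

lemma graded_Cons: "graded (b # bs) \<longleftrightarrow> (fst b \<in> {1..s} \<and> fst (snd b) \<in> V (fst b) \<and>
   (\<forall>r x. snd (snd b) (\<delta> r x) = r ^ fst b * snd (snd b) x)) \<and> graded bs"
  by (simp add: graded_def)

lemma TT_Cons:
  assumes "good (b # bs) x"
  shows "TT (b # bs) x Y = TT bs x (Ad (Xp (fst (snd b)) (- snd (snd b) x)) Y)"
proof -
  let ?X = "fst (snd b)" and ?f = "snd (snd b)"
  have f: "\<bar>?f x\<bar> < tau ?X" "Psi (b # bs) x \<in> U0" "Psi bs x \<in> U0" using assms good_Psi by auto
  have "iv (Psi (b # bs) x) = iv (Psi bs x) \<odot> Xp ?X (- ?f x)"
    using f by (simp add: G.inverse_distrib_swap Xp_uminus)
  moreover have "Xp ?X (- ?f x) \<in> U0" using f by (intro Xp_U0) auto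
  ultimately show ?thesis using Ad_mult[OF U0(5)[OF f(3)], of "Xp ?X (- ?f x)"] U0(5)[OF f(2)]
    by (simp add: TT_def)
qed

text \<open>The conjugations are peeled off one factor at a time. Each coordinate scales with the
  degree of its direction, which is exactly the time change in
  \<open>\<delta>_Ad_Xp\<close>.\<close>

lemma TT_\<delta>:
  assumes "0 < r" "r \<le> 1"
  shows "graded bs \<Longrightarrow> good bs x \<Longrightarrow> good bs (\<delta> r x) \<Longrightarrow> TT bs (\<delta> r x) (\<delta> r Y) = \<delta> r (TT bs x Y)"
proof (induction bs arbitrary: Y)
  case Nil thus ?case by (simp add: TT_def G.inverse_neutral)
next
  case (Cons b bs)
  let ?X = "fst (snd b)" and ?f = "snd (snd b)"
  have g: "?X \<in> V (fst b)" "fst b \<in> {1..s}" "?f (\<delta> r x) = r ^ fst b * ?f x" "\<bar>- ?f x\<bar> < tau ?X"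
    using Cons.prems by (auto simp: graded_Cons)
  have "Ad (Xp ?X (- ?f (\<delta> r x))) (\<delta> r Y) = \<delta> r (Ad (Xp ?X (- ?f x)) Y)"
    using \<delta>_Ad_Xp[OF g(1,2) assms g(4), of Y] g(3) by simp
  thus ?case
    unfolding TT_Cons[OF Cons.prems(2)] TT_Cons[OF Cons.prems(3)]
    using Cons by (simp add: graded_Cons)
qed

text \<open>In each summand the coordinate contributes the weight \<open>r ^ d\<close>, which is
  absorbed into the direction because that lies in layer \<open>d\<close>.\<close>

lemma Am_\<delta>:
  assumes "0 < r" "r \<le> 1"
  shows "graded bs \<Longrightarrow> good bs x \<Longrightarrow> good bs (\<delta> r x) \<Longrightarrow> Am bs (\<delta> r x) (\<delta> r v) = \<delta> r (Am bs x v)"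
proof (induction bs)
  case Nil thus ?case using linear_0[OF linear_\<delta>] by simp
next
  case (Cons b bs)
  let ?X = "fst (snd b)" and ?f = "snd (snd b)"
  have g: "?X \<in> V (fst b)" "fst b \<in> {1..s}" "?f (\<delta> r v) = r ^ fst b * ?f v" "graded bs" "good bs x" "good bs (\<delta> r x)"
    using Cons.prems by (auto simp: graded_Cons)
  have "r ^ fst b *\<^sub>R TT bs (\<delta> r x) ?X = TT bs (\<delta> r x) (\<delta> r ?X)"
    by (simp add: \<delta>_V[OF g(2,1)] linear_scale[OF linear_TT[OF g(6)]])
  also have "\<dots> = \<delta> r (TT bs x ?X)" by (rule TT_\<delta>[OF assms g(4-6)])
  finally have 1: "r ^ fst b *\<^sub>R TT bs (\<delta> r x) ?X = \<delta> r (TT bs x ?X)" .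
  have "Am (b # bs) (\<delta> r x) (\<delta> r v) = ?f v *\<^sub>R (r ^ fst b *\<^sub>R TT bs (\<delta> r x) ?X) + \<delta> r (Am bs x v)"
    using Cons.IH g by (simp add: mult.commute)
  thus ?case unfolding 1 by (simp add: linear_add[OF linear_\<delta>] linear_scale[OF linear_\<delta>])
qed

lemma P1_TT: "good bs x \<Longrightarrow> P 1 (TT bs x Y) = P 1 Y"
proof (induction bs arbitrary: Y)
  case Nil thus ?case by (simp add: TT_def G.inverse_neutral)
next
  case (Cons b bs)
  have "\<bar>- snd (snd b) x\<bar> < tau (fst (snd b))" using Cons.prems by auto
  from P1_Ad_Xp[OF this] show ?case unfolding TT_Cons[OF Cons.prems] using Cons by simp
qed

lemma P1_Am: "good bs x \<Longrightarrow> P 1 (Am bs x v) = P 1 (\<Sum>b\<leftarrow>bs. snd (snd b) v *\<^sub>R fst (snd b))"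
proof (induction bs)
  case (Cons b bs)
  have l: "linear (P 1)" using s1 by (intro linear_P) auto
  show ?case using Cons by (simp add: linear_add[OF l] linear_scale[OF l] P1_TT)
qed simp

text \<open>For each layer all projections of standard basis vectors are taken. The family is
  redundant, but since the coordinate functions come from the same projections its combination
  reproduces every vector, so no bases adapted to the layers have to be chosen.\<close>

definition "frame = [(i, P i b, \<lambda>x. P i x \<bullet> b). i \<leftarrow> [1..<Suc s], b \<leftarrow> (SOME l. set l = Basis \<and> distinct l)]"

lemma basis_list: "set (SOME l. set l = (Basis :: 'e set) \<and> distinct l) = Basis"
  "distinct (SOME l. set l = (Basis :: 'e set) \<and> distinct l)"
proof -
  have "\<exists>l. set l = (Basis :: 'e set) \<and> distinct l" by (rule finite_distinct_list) simp
  from someI_ex[OF this] show "set (SOME l. set l = (Basis :: 'e set) \<and> distinct l) = Basis"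
    "distinct (SOME l. set l = (Basis :: 'e set) \<and> distinct l)" by auto
qed

lemma lincoords_frame: "lincoords frame"
proof -
  have "bounded_linear (\<lambda>x. P i x \<bullet> b)" if "i \<in> {1..s}" for i b
    using bounded_linear_compose[OF bounded_linear_inner_left bounded_linear_P[OF that]] .
  thus ?thesis by (auto simp: lincoords_def frame_def)
qed

lemma graded_frame: "graded frame"
  by (auto simp: graded_def frame_def P_\<delta> P_in)

lemma frame_sum: "(\<Sum>b\<leftarrow>frame. snd (snd b) v *\<^sub>R fst (snd b)) = v"
proof -
  define l where "l = (SOME l. set l = (Basis :: 'e set) \<and> distinct l)"
  have l: "set l = Basis" "distinct l" using basis_list by (auto simp: l_def)
  have sum_list_concat: "sum_list (concat xs) = (\<Sum>x\<leftarrow>xs. sum_list x)" for xs :: "'e list list"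
    by (induction xs) auto
  have "(\<Sum>b\<leftarrow>frame. snd (snd b) v *\<^sub>R fst (snd b)) = (\<Sum>i\<leftarrow>[1..<Suc s]. \<Sum>b\<leftarrow>l. (P i v \<bullet> b) *\<^sub>R P i b)"
    unfolding frame_def l_def[symmetric] by (simp add: map_concat sum_list_concat o_def)
  also have "\<dots> = (\<Sum>i=1..s. \<Sum>b\<in>Basis. (P i v \<bullet> b) *\<^sub>R P i b)"
    using l by (simp add: sum_list_distinct_conv_sum_set atLeastLessThanSuc_atLeastAtMost del: upt_Suc)
  also have "\<dots> = (\<Sum>i=1..s. P i (P i v))"
    by (intro sum.cong refl linear_euclidean_expansion[OF linear_P, symmetric])
  also have "\<dots> = (\<Sum>i=1..s. P i v)"
    by (intro sum.cong refl) (auto simp: P_V P_in)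
  finally show ?thesis by (simp add: P_sum)
qed

end

text \<open>\<open>AA x\<close> is the derivative of \<open>\<Psi>\<close> at \<open>x\<close>, left-trivialized.  Its homogeneity \<open>AA_\<delta>\<close> makes the local
  maps \<open>\<Psi> \<circ> \<delta> r \<circ> \<kappa>\<close> scale horizontal curves, so that no dilation automorphisms of the group are needed.\<close>

locale carnot_coords = carnot mul e iv A c s V ip
  for mul :: "'g::{t2_space, second_countable_topology} \<Rightarrow> 'g \<Rightarrow> 'g"
    and e iv and A :: "('g, 'e::euclidean_space) chart set" and c s V ip +
  fixes \<Psi> :: "'e \<Rightarrow> 'g" and \<kappa> :: "'g \<Rightarrow> 'e" and R0 :: real and AA and DA and CA :: real
  assumes R0: "R0 > 0" and CA: "CA \<ge> 0"
    and \<Psi>_0: "\<Psi> 0 = e"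
    and open_W: "open (\<Psi> ` ball 0 R0)"
    and \<kappa>_\<Psi>: "x \<in> ball 0 R0 \<Longrightarrow> \<kappa> (\<Psi> x) = x"
    and cont_\<kappa>: "continuous_on (\<Psi> ` ball 0 R0) \<kappa>"
    and \<Psi>_gder: "x \<in> ball 0 R0 \<Longrightarrow> gder \<Psi> (AA x) x UNIV"
    and linear_AA: "linear (AA x)"
    and AA_near: "x \<in> ball 0 R0 \<Longrightarrow> norm (AA x v - v) \<le> norm v / 2"
    and P1_AA: "x \<in> ball 0 R0 \<Longrightarrow> P 1 (AA x v) = P 1 v"
    and AA_\<delta>: "x \<in> ball 0 R0 \<Longrightarrow> 0 < r \<Longrightarrow> r \<le> 1 \<Longrightarrow> \<delta> r x \<in> ball 0 R0 \<Longrightarrow> AA (\<delta> r x) (\<delta> r v) = \<delta> r (AA x v)"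
    and AA_deriv: "x \<in> ball 0 R0 \<Longrightarrow> ((\<lambda>x. AA x v) has_derivative DA x v) (at x)"
    and DA_bound: "x \<in> ball 0 R0 \<Longrightarrow> norm (DA x v w) \<le> CA * norm v * norm w"
    and \<kappa>_deriv: "gder \<gamma> D (t :: real) T \<Longrightarrow> \<gamma> t \<in> \<Psi> ` ball 0 R0 \<Longrightarrow>
        \<exists>y'. ((\<lambda>t. \<kappa> (\<gamma> t)) has_derivative y') (at t within T) \<and> (\<forall>v. AA (\<kappa> (\<gamma> t)) (y' v) = D v)"

context carnot
begin

text \<open>The derivative of \<open>Psi frame\<close> at 0 is the identity, so the inverse function
  theorem in the chart yields \<kappa>. The radius is then shrunk until the frame is within 1/2 of
  the identity and its derivative is bounded.\<close>

lemma coordinates_exist: "\<exists>\<Psi> \<kappa> R0 AA DA CA. carnot_coords mul e iv A c s V ip \<Psi> \<kappa> R0 AA DA CA"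
proof -
  note lf = lincoords_frame
  define F where "F x = \<phi> (Psi frame x)" for x
  define Bx where "Bx x = Blinfun (\<lambda>v. L (\<phi> (Psi frame x)) (Am frame x v))" for x
  have Am0: "Am frame 0 v = v" for v using Am_0[OF lf] by (simp add: frame_sum)
  obtain d0 where d0: "d0 > 0" "\<And>x. dist x 0 < d0 \<Longrightarrow> good frame x"
    using eventually_good[OF lf] unfolding eventually_nhds_metric by blast
  have good: "good frame x" if "x \<in> ball 0 d0" for x using d0(2) that by (simp add: dist_commute)
  have U: "Psi frame x \<in> U" "\<phi> (Psi frame x) \<in> \<phi> ` U" if "x \<in> ball 0 d0" for x
    using good_Psi[OF good[OF that]] U0 by auto
  have Bx: "blinfun_apply (Bx x) = (\<lambda>v. L (\<phi> (Psi frame x)) (Am frame x v))" if "x \<in> ball 0 d0" for x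
  proof -
    have "linear (\<lambda>v. L (\<phi> (Psi frame x)) (Am frame x v))"
      using linear_compose[OF linear_Am[OF lf] linear_L[OF U(2)[OF that]]] by (simp add: o_def)
    thus ?thesis unfolding Bx_def by (intro bounded_linear_Blinfun_apply) (simp add: linear_conv_bounded_linear)
  qed
  have derF: "(F has_derivative blinfun_apply (Bx x)) (at x)" if "x \<in> ball 0 d0" for x
    using gder_chart[of "Psi frame" x, OF U(1)[OF that] Psi_gder[OF lf good[OF that]]]
    unfolding Bx[OF that] F_def[abs_def] .
  have cBx: "continuous_on (ball 0 d0) Bx"
  proof (rule continuous_on_blinfun_componentwise)
    fix b :: 'e assume "b \<in> Basis"
    have "isCont (\<lambda>x. \<Sum>k\<in>Basis. (Am frame x b \<bullet> k) *\<^sub>R L (\<phi> (Psi frame x)) k) x" if x: "x \<in> ball 0 d0" for x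
    proof -
      have 1: "isCont (\<lambda>x. Am frame x b) x"
        using has_derivative_continuous[OF Am_deriv[OF lf good[OF x]]] .
      have 2: "isCont (\<lambda>x. L (\<phi> (Psi frame x)) k) x" for k
        using isCont_o2[OF has_derivative_continuous[OF derF[OF x], unfolded F_def[abs_def]]
            has_derivative_continuous[OF L_deriv[OF U(2)[OF x]]]] .
      show ?thesis by (intro continuous_intros 1 2)
    qed
    hence "continuous_on (ball 0 d0) (\<lambda>x. \<Sum>k\<in>Basis. (Am frame x b \<bullet> k) *\<^sub>R L (\<phi> (Psi frame x)) k)"
      by (simp add: continuous_on_eq_continuous_at)
    thus "continuous_on (ball 0 d0) (\<lambda>x. blinfun_apply (Bx x) b)"
    proof (rule continuous_on_eq)
      fix x :: 'e assume x: "x \<in> ball 0 d0"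
      show "(\<Sum>k\<in>Basis. (Am frame x b \<bullet> k) *\<^sub>R L (\<phi> (Psi frame x)) k) = blinfun_apply (Bx x) b"
        unfolding Bx[OF x] by (rule linear_euclidean_expansion[OF linear_L[OF U(2)[OF x]], symmetric])
    qed
  qed
  have idB: "id_blinfun o\<^sub>L Bx 0 = id_blinfun"
    by (rule blinfun_eqI) (use d0 Bx[of 0] in \<open>simp add: Psi_0[OF lf] Am0\<close>)
  have z: "0 \<in> ball 0 d0" using d0 by simp
  obtain U' V' g g' where g: "open U'" "U' \<subseteq> ball 0 d0" "0 \<in> U'" "open V'" "F 0 \<in> V'"
      "homeomorphism U' V' F g"
      "\<And>y. y \<in> V' \<Longrightarrow> (g has_derivative (g' y)) (at y)"
      "\<And>y. y \<in> V' \<Longrightarrow> g' y = inv (blinfun_apply (Bx (g y)))"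
      "\<And>y. y \<in> V' \<Longrightarrow> bij (blinfun_apply (Bx (g y)))"
  proof (rule inverse_function_theorem[of "ball 0 d0" F Bx 0 id_blinfun, OF open_ball derF cBx z idB])
    fix U' V' g g'
    assume *: "open U'" "U' \<subseteq> ball 0 d0" "0 \<in> U'" "open V'" "F 0 \<in> V'" "homeomorphism U' V' F g"
      "\<And>y. y \<in> V' \<Longrightarrow> (g has_derivative (g' y)) (at y)"
      "\<And>y. y \<in> V' \<Longrightarrow> g' y = inv (blinfun_apply (Bx (g y)))"
      "\<And>y. y \<in> V' \<Longrightarrow> bij (blinfun_apply (Bx (g y)))"
    show thesis by (rule that[OF *])
  qed
  obtain CA where CA: "CA \<ge> 0" "\<forall>\<^sub>F x in nhds 0. \<forall>v w. norm (DAm frame x v w) \<le> CA * norm v * norm w"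
    using DAm_bound[OF lf] by blast
  have "\<forall>\<^sub>F x in nhds 0. \<forall>v. norm (Am frame x v - Am frame 0 v) \<le> (1/2) * norm v"
    using has_derivative_continuous[OF Am_deriv[OF lf good_0[OF lf]]] linear_Am[OF lf]
    by (intro linear_family_continuous) auto
  moreover have "\<forall>\<^sub>F x in nhds 0. x \<in> U'" using g by (intro eventually_nhds_in_open) auto
  ultimately have "\<forall>\<^sub>F x in nhds 0. (\<forall>v. norm (Am frame x v - v) \<le> (1/2) * norm v) \<and> x \<in> U' \<and>
      (\<forall>v w. norm (DAm frame x v w) \<le> CA * norm v * norm w)"
    using CA(2) by eventually_elim (simp add: Am0)
  then obtain R where R: "R > 0" "\<And>x. dist x 0 < R \<Longrightarrow> (\<forall>v. norm (Am frame x v - v) \<le> (1/2) * norm v) \<and> x \<in> U' \<and>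
      (\<forall>v w. norm (DAm frame x v w) \<le> CA * norm v * norm w)"
    unfolding eventually_nhds_metric by blast
  have Rb: "norm (Am frame x v - v) \<le> norm v / 2" "x \<in> U'" "norm (DAm frame x v w) \<le> CA * norm v * norm w"
    "x \<in> ball 0 d0" "good frame x"
    if "x \<in> ball 0 R" for x v w
    using R(2)[of x] that g(2) good by (auto simp: dist_commute)
  define \<kappa> where "\<kappa> h = g (\<phi> h)" for h
  have gF: "g (F x) = x" if "x \<in> U'" for x using g(6) that by (simp add: homeomorphism_apply1)
  have Fg: "F (g y) = y" if "y \<in> V'" for y using g(6) that by (simp add: homeomorphism_apply2)
  have FV: "F x \<in> V'" if "x \<in> U'" for x using g(6) that by (auto simp: homeomorphism_def)
  have \<phi>W: "\<phi> h \<in> V'" "h \<in> U" "h \<in> U0" if "h \<in> Psi frame ` ball 0 R" for h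
    using that FV Rb U good_Psi unfolding F_def by blast+
  have contg: "continuous_on V' g" using g(6) by (simp add: homeomorphism_def)
  have contU: "continuous_on U \<phi>" using chart_facts(3) by (simp add: homeomorphism_def)
  \<comment> \<open>Describes the image of the ball by conditions on chart values only, from which
    its openness follows.\<close>
  have W: "Psi frame ` ball 0 R = U \<inter> \<phi> -` (V' \<inter> g -` ball 0 R)"
  proof (intro equalityI subsetI)
    fix h assume h: "h \<in> Psi frame ` ball 0 R"
    then obtain x where x: "x \<in> ball 0 R" "h = Psi frame x" by blast
    have "g (\<phi> h) = x" using gF[OF Rb(2)[OF x(1)]] x by (simp add: F_def)
    thus "h \<in> U \<inter> \<phi> -` (V' \<inter> g -` ball 0 R)" using \<phi>W[OF h] x by auto
  next
    fix h assume h: "h \<in> U \<inter> \<phi> -` (V' \<inter> g -` ball 0 R)"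
    hence "\<phi> (Psi frame (g (\<phi> h))) = \<phi> h" using Fg[of "\<phi> h"] by (simp add: F_def)
    moreover have "Psi frame (g (\<phi> h)) \<in> U" using h Rb(4) U by auto
    ultimately have "Psi frame (g (\<phi> h)) = h" using h inj_\<phi> by (auto simp: inj_on_def)
    thus "h \<in> Psi frame ` ball 0 R" using h by (metis IntD2 image_eqI vimageE)
  qed
  have "carnot_coords mul e iv A c s V ip (Psi frame) \<kappa> R (Am frame) (DAm frame) CA"
  proof (unfold_locales)
    show "0 < R" "0 \<le> CA" by fact+
    show "Psi frame 0 = e" by (rule Psi_0[OF lf])
    have "open (V' \<inter> g -` ball 0 R)" using contg g(4) by (intro continuous_open_preimage) auto
    thus "open (Psi frame ` ball 0 R)" unfolding W
      by (rule continuous_open_preimage[OF contU chart_facts(1)])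
    show "\<kappa> (Psi frame x) = x" if "x \<in> ball 0 R" for x
      using gF[OF Rb(2)[OF that]] by (simp add: \<kappa>_def F_def)
    show "continuous_on (Psi frame ` ball 0 R) \<kappa>" unfolding \<kappa>_def
      by (rule continuous_on_compose2[OF contg continuous_on_subset[OF contU]]) (use \<phi>W in auto)
    show "gder (Psi frame) (Am frame x) x UNIV" if "x \<in> ball 0 R" for x
      using Psi_gder[OF lf Rb(5)[OF that]] .
    show "Am frame x (v + w) = Am frame x v + Am frame x w" for x v w by (rule linear_add[OF linear_Am[OF lf]])
    show "Am frame x (r *\<^sub>R v) = r *\<^sub>R Am frame x v" for x r v by (rule linear_scale[OF linear_Am[OF lf]])
    show "norm (Am frame x v - v) \<le> norm v / 2" if "x \<in> ball 0 R" for x v using Rb(1)[OF that] .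
    show "P 1 (Am frame x v) = P 1 v" if "x \<in> ball 0 R" for x v
      using P1_Am[OF Rb(5)[OF that]] by (simp add: frame_sum)
    show "Am frame (\<delta> r x) (\<delta> r v) = \<delta> r (Am frame x v)"
      if "x \<in> ball 0 R" "0 < r" "r \<le> 1" "\<delta> r x \<in> ball 0 R" for x r v
      by (rule Am_\<delta>[OF that(2,3) graded_frame Rb(5)[OF that(1)] Rb(5)[OF that(4)]])
    show "((\<lambda>x. Am frame x v) has_derivative DAm frame x v) (at x)" if "x \<in> ball 0 R" for x v
      by (rule Am_deriv[OF lf Rb(5)[OF that]])
    show "norm (DAm frame x v w) \<le> CA * norm v * norm w" if "x \<in> ball 0 R" for x v w using Rb(3)[OF that] .
    fix \<gamma> :: "real \<Rightarrow> 'g" and D t T assume gd: "gder \<gamma> D t T" and W: "\<gamma> t \<in> Psi frame ` ball 0 R"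
    then obtain x where x: "x \<in> ball 0 R" "\<gamma> t = Psi frame x" by blast
    have \<kappa>x: "\<kappa> (\<gamma> t) = x" "g (\<phi> (\<gamma> t)) = x" using gF[OF Rb(2)[OF x(1)]] x by (auto simp: \<kappa>_def F_def)
    note h = \<phi>W[OF W]
    define y' where "y' v = g' (\<phi> (\<gamma> t)) (L (\<phi> (\<gamma> t)) (D v))" for v
    have "((\<lambda>t. g (\<phi> (\<gamma> t))) has_derivative y') (at t within T)"
      unfolding y'_def
      by (rule has_derivative_compose[OF gder_chart[OF h(2) gd] g(7)[OF h(1)]])
    moreover have "Am frame x (y' v) = D v" for v
    proof -
      have "L (\<phi> (\<gamma> t)) (Am frame x (y' v)) = blinfun_apply (Bx x) (y' v)"
        using x by (simp add: Bx[OF Rb(4)[OF x(1)]])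
      also have "\<dots> = L (\<phi> (\<gamma> t)) (D v)"
        unfolding y'_def g(8)[OF h(1)] \<kappa>x(2)
        using g(9)[OF h(1)] \<kappa>x(2) by (simp add: bij_is_surj surj_f_inv_f)
      \<comment> \<open>Equality holds after pushing forward by \<open>L\<close>;
        \<open>Linv\<close> inverts \<open>L\<close> on \<open>U0\<close> and brings it back to
        left-trivialized velocities.\<close>
      finally have "Linv (\<gamma> t) (L (\<phi> (\<gamma> t)) (Am frame x (y' v))) = Linv (\<gamma> t) (L (\<phi> (\<gamma> t)) (D v))" by simp
      thus ?thesis using L_Linv(2)[OF h(3)] by simp
    qed
    ultimately show "\<exists>y'. ((\<lambda>t. \<kappa> (\<gamma> t)) has_derivative y') (at t within T) \<and> (\<forall>v. Am frame (\<kappa> (\<gamma> t)) (y' v) = D v)"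
      unfolding \<kappa>x(1) unfolding \<kappa>_def by blast
  qed
  thus ?thesis by blast
qed

end

section \<open>The Carnot-Caratheodory distance\<close>

context lie_chart
begin

lemma gder_cong_open:
  assumes f: "gder f D x UNIV" and W: "open W" "x \<in> W" and eq: "\<And>y. y \<in> W \<Longrightarrow> g y = f y"
  shows "gder g D x UNIV"
proof -
  have ev: "\<forall>\<^sub>F y in nhds x. g y = f y"
    using eventually_nhds_in_open[OF W] by eventually_elim (rule eq)
  have "isCont g x" using f ev isCont_cong[of g f x] by (simp add: gder_def)
  moreover have "((\<lambda>y. \<phi> (iv (g x) \<odot> g y)) has_derivative D) (at x)"
  proof (rule has_derivative_eventually_cong)
    show "((\<lambda>y. \<phi> (iv (f x) \<odot> f y)) has_derivative D) (at x)" using f by (simp add: gder_def)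
    show "\<forall>\<^sub>F y in at x. \<phi> (iv (g x) \<odot> g y) = \<phi> (iv (f x) \<odot> f y)"
      using ev by (simp add: eq[OF W(2)] eventually_at_filter eventually_mono)
  qed (simp add: eq[OF W(2)])
  ultimately show ?thesis by (simp add: gder_def)
qed

end

context carnot
begin

declare One_nat_def [simp del]

section \<open>The norm on the first layer\<close>

definition "N X = sqrt (ip X X)"

lemma N_scale: "X \<in> V 1 \<Longrightarrow> N (r *\<^sub>R X) = \<bar>r\<bar> * N X"
proof -
  assume X: "X \<in> V 1"
  have i1: "(1::nat) \<in> {1..s}" using s1 by simp
  have lin: "ip (r *\<^sub>R x + y) z = r * ip x z + ip y z" if "x \<in> V 1" "y \<in> V 1" "z \<in> V 1" for x y z r
    using ip that unfolding inner_product_on_def by blast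
  have sym: "ip x y = ip y x" if "x \<in> V 1" "y \<in> V 1" for x y
    using ip that unfolding inner_product_on_def by blast
  have z: "0 \<in> V 1" by (rule subspace_0[OF subspace_V[OF i1]])
  have z0: "ip 0 y = 0" if "y \<in> V 1" for y using lin[OF z z that, of 1] by simp
  have sc: "ip (r *\<^sub>R x) y = r * ip x y" if "x \<in> V 1" "y \<in> V 1" for x y
    using lin[OF that(1) z that(2), of r] z0[OF that(2)] by simp
  have rX: "r *\<^sub>R X \<in> V 1" using X subspace_scale[OF subspace_V[OF i1]] by blast
  have "ip (r *\<^sub>R X) (r *\<^sub>R X) = r * (r * ip X X)"
    using sc[OF X rX] sym[OF X rX] sc[OF X X] by simp
  hence "N (r *\<^sub>R X) = sqrt (r\<^sup>2 * ip X X)" by (simp add: N_def power2_eq_square mult.assoc)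
  thus ?thesis by (simp add: N_def real_sqrt_mult)
qed

text \<open>Compactness of the unit sphere of \<open>V 1\<close>. If this sphere is empty, then
  \<open>V 1\<close> contains only 0 and any constant serves.\<close>

lemma N_bound: "\<exists>a>0. \<forall>X\<in>V 1. a * norm X \<le> N X"
proof -
  have i1: "(1::nat) \<in> {1..s}" using s1 by simp
  note sub = subspace_V[OF i1] and lP = linear_P[OF i1]
  have lin: "ip (r *\<^sub>R x + y) z = r * ip x z + ip y z" if "x \<in> V 1" "y \<in> V 1" "z \<in> V 1" for x y z r
    using ip that unfolding inner_product_on_def by blast
  have sym: "ip x y = ip y x" if "x \<in> V 1" "y \<in> V 1" for x y
    using ip that unfolding inner_product_on_def by blast
  have z: "0 \<in> V 1" by (rule subspace_0[OF sub])
  have z0: "ip 0 y = 0" if "y \<in> V 1" for y using lin[OF z z that, of 1] by simp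
  \<comment> \<open>The inner product is given on \<open>V 1\<close> only; composing with the
    projection makes it a bilinear form on the whole space, hence continuous.\<close>
  define q where "q x y = ip (P 1 x) (P 1 y)" for x y
  have PV: "P 1 x \<in> V 1" for x using P_in[OF i1] .
  have q1: "linear (\<lambda>x. q x y)" for y
  proof (rule linearI)
    fix u v :: 'e and r :: real
    show "q (u + v) y = q u y + q v y" 
      using lin[OF PV[of u] PV[of v] PV[of y], of 1] by (simp add: q_def linear_add[OF lP])
    show "q (r *\<^sub>R u) y = r *\<^sub>R q u y"
      using lin[OF PV[of u] z PV[of y], of r] z0[OF PV[of y]] by (simp add: q_def linear_scale[OF lP])
  qed
  have qs: "q x y = q y x" for x y by (simp add: q_def sym PV)
  have "linear (\<lambda>y. q x y)" for x using q1[of x] by (simp add: qs)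
  with q1 have "bilinear q" by (simp add: bilinear_def)
  then interpret q: bounded_bilinear q by (simp add: bilinear_conv_bounded_bilinear)
  have cont: "continuous_on X (\<lambda>x. q x x)" for X by (intro q.continuous_on continuous_intros)
  define C where "C = V 1 \<inter> sphere 0 1"
  have "compact C" unfolding C_def using closed_subspace[OF sub] by (simp add: closed_Int_compact)
  have qq: "q X X = ip X X" if "X \<in> V 1" for X using that by (simp add: q_def P_V[OF i1 i1])
  show ?thesis
  proof (cases "C = {}")
    case True
    have "X = 0" if "X \<in> V 1" for X
    proof (rule ccontr)
      assume "X \<noteq> 0"
      hence "(1 / norm X) *\<^sub>R X \<in> C" using that subspace_scale[OF sub] by (auto simp: C_def)
      thus False using True by blast
    qed
    moreover have "N 0 = 0" using z0[OF z] by (simp add: N_def)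
    ultimately have "1 * norm X \<le> N X" if "X \<in> V 1" for X
      using that by (metis mult_1 norm_zero order_refl)
    thus ?thesis by (intro exI[of _ 1]) auto
  next
    case False
    obtain X0 where X0: "X0 \<in> C" "\<And>X. X \<in> C \<Longrightarrow> q X0 X0 \<le> q X X"
      using continuous_attains_inf[OF \<open>compact C\<close> False cont] by blast
    have pos: "q X0 X0 > 0"
    proof -
      have "X0 \<in> V 1" "X0 \<noteq> 0" using X0(1) by (auto simp: C_def)
      thus ?thesis using ip qq unfolding inner_product_on_def by auto
    qed
    show ?thesis
    proof (intro exI[of _ "sqrt (q X0 X0)"] conjI ballI)
      fix X assume X: "X \<in> V 1"
      show "sqrt (q X0 X0) * norm X \<le> N X"
      proof (cases "X = 0")
        case True thus ?thesis using z0[OF z] by (simp add: N_def)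
      next
        case nz: False
        define Y where "Y = (1 / norm X) *\<^sub>R X"
        have Y: "Y \<in> C" using nz X subspace_scale[OF sub] by (auto simp: C_def Y_def)
        have YV: "Y \<in> V 1" using Y by (simp add: C_def)
        have "sqrt (q X0 X0) \<le> N Y" using X0(2)[OF Y] qq[OF YV] by (simp add: N_def)
        moreover have "N X = norm X * N Y" using N_scale[OF YV, of "norm X"] nz by (simp add: Y_def)
        ultimately show ?thesis by (simp add: mult.commute mult_left_mono)
      qed
    qed (use pos in simp)
  qed
qed

text \<open>The numerator 2 is the bound for the inverse of the coordinate frame in
  \<open>AA_lower\<close>. With it, \<open>C1\<close> times the norm of the left velocity bounds the
  speed of a horizontal curve in coordinates.\<close>

definition "C1 = 2 / (SOME a. a > 0 \<and> (\<forall>X\<in>V 1. a * norm X \<le> N X))"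

lemma C1: "C1 > 0" "X \<in> V 1 \<Longrightarrow> 2 * norm X \<le> C1 * N X"
proof -
  define a where "a = (SOME a. a > 0 \<and> (\<forall>X\<in>V 1. a * norm X \<le> N X))"
  have a: "a > 0 \<and> (\<forall>X\<in>V 1. a * norm X \<le> N X)"
    unfolding a_def using someI_ex[of "\<lambda>a. a > 0 \<and> (\<forall>X\<in>V 1. a * norm X \<le> N X)"] N_bound by blast
  show "C1 > 0" using a by (simp add: C1_def a_def[symmetric])
  show "2 * norm X \<le> C1 * N X" if "X \<in> V 1"
    using a that by (simp add: C1_def a_def[symmetric] field_simps)
qed

lemma N_nonneg: "X \<in> V 1 \<Longrightarrow> 0 \<le> N X"
  using C1(1) C1(2)[of X] norm_ge_zero[of X] by (smt (verit) mult_pos_neg)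

section \<open>Horizontal curves and their lengths\<close>

definition "hc p q \<gamma> u \<longleftrightarrow> continuous_on {p..q} \<gamma> \<and>
   (\<exists>T. finite T \<and> continuous_on ({p<..<q} - T) u \<and>
      (\<forall>t\<in>{p<..<q} - T. u t \<in> V 1 \<and> gder \<gamma> (\<lambda>v. v *\<^sub>R u t) (t::real) UNIV))"

text \<open>Records the length of an individual curve. Lengths add up and scale exactly under this
  relation; the infimum is taken afterwards.\<close>

definition "reach x y l \<longleftrightarrow> (\<exists>\<gamma> u. hc 0 1 \<gamma> u \<and> \<gamma> 0 = x \<and> \<gamma> 1 = y \<and> ((\<lambda>t. N (u t)) has_integral l) {0..1})"

lemma isCont_interior: "continuous_on {p..q} f \<Longrightarrow> t \<in> {p<..<q} \<Longrightarrow> isCont f (t::real)"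
  using continuous_on_interior by (metis interior_atLeastAtMost_real)

text \<open>The two notions differ at the endpoints only, and a finite exceptional set is allowed: 0
  and 1 are added to it. At interior times the derivative within \<open>{0..1}\<close> is the
  two-sided one.\<close>

lemma horizontal_curve_iff: "horizontal_curve mul iv c (V 1) \<gamma> u \<longleftrightarrow> hc 0 1 \<gamma> u"
proof
  assume "horizontal_curve mul iv c (V 1) \<gamma> u"
  then obtain T where T: "continuous_on {0..1} \<gamma>" "finite T" "continuous_on ({0..1} - T) u"
    "\<And>t. t \<in> {0..1} - T \<Longrightarrow> u t \<in> V 1 \<and> ((\<lambda>r. \<phi> (iv (\<gamma> t) \<odot> \<gamma> r)) has_vector_derivative u t) (at t within {0..1})"
    unfolding horizontal_curve_def \<phi>_def by blast
  have "u t \<in> V 1 \<and> gder \<gamma> (\<lambda>v. v *\<^sub>R u t) t UNIV" if "t \<in> {0<..<1} - T" for t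
  proof -
    have t: "t \<in> {0..1} - T" "t \<in> {0<..<1}" using that by auto
    thus ?thesis using T(4)[OF t(1)] isCont_interior[OF T(1) t(2)] at_within_Icc_at[of 0 t 1]
      by (simp add: gder_def has_vector_derivative_def)
  qed
  moreover have "continuous_on ({0<..<1} - T) u" by (rule continuous_on_subset[OF T(3)]) auto
  ultimately show "hc 0 1 \<gamma> u" using T(1,2) unfolding hc_def by blast
next
  assume "hc 0 1 \<gamma> u"
  then obtain T where T: "continuous_on {0..1} \<gamma>" "finite T" "continuous_on ({0<..<1} - T) u"
    "\<And>t. t \<in> {0<..<1} - T \<Longrightarrow> u t \<in> V 1 \<and> gder \<gamma> (\<lambda>v. v *\<^sub>R u t) t UNIV"
    unfolding hc_def by blast
  have eq: "{0..1} - (insert 0 (insert 1 T)) = {0<..<1} - T" by auto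
  have "u t \<in> V 1 \<and> ((\<lambda>r. \<phi> (iv (\<gamma> t) \<odot> \<gamma> r)) has_vector_derivative u t) (at t within {0..1})"
    if "t \<in> {0<..<1} - T" for t
    using T(4)[OF that] has_derivative_at_withinI by (auto simp: gder_def has_vector_derivative_def)
  thus "horizontal_curve mul iv c (V 1) \<gamma> u"
    unfolding horizontal_curve_def \<phi>_def[symmetric] using T(1-3)
    by (intro conjI exI[of _ "insert 0 (insert 1 T)"]) (simp_all add: eq)
qed

definition "d = cc_dist mul iv c (V 1) ip"

lemma d_eq: "d x y = Inf {l. reach x y l}"
  unfolding d_def cc_dist_def reach_def horizontal_curve_iff N_def ..

lemma hc_integral_nonneg:
  assumes "hc p q \<gamma> u" "((\<lambda>t. N (u t)) has_integral l) {p..q}" shows "0 \<le> l"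
proof -
  obtain T where T: "finite T" "\<And>t. t \<in> {p<..<q} - T \<Longrightarrow> u t \<in> V 1" using assms(1) unfolding hc_def by blast
  have "((\<lambda>t. if t \<in> {p<..<q} - T then N (u t) else 0) has_integral l) {p..q}"
    by (rule has_integral_spike_finite[OF _ _ assms(2), of "insert p (insert q T)"]) (use T in auto)
  thus ?thesis by (rule has_integral_nonneg) (use T N_nonneg in auto)
qed

lemma reach_nonneg: "reach x y l \<Longrightarrow> 0 \<le> l"
  unfolding reach_def using hc_integral_nonneg by blast

lemma hc_affine:
  assumes h: "hc p q \<gamma> u" and k: "k \<noteq> 0"
    and img: "\<And>t. t \<in> {p'..q'} \<Longrightarrow> k * t + b \<in> {p..q}" "\<And>t. t \<in> {p'<..<q'} \<Longrightarrow> k * t + b \<in> {p<..<q}"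
  shows "hc p' q' (\<lambda>t. \<gamma> (k * t + b)) (\<lambda>t. k *\<^sub>R u (k * t + b))"
proof -
  have i1: "(1::nat) \<in> {1..s}" using s1 by simp
  obtain T where T: "continuous_on {p..q} \<gamma>" "finite T" "continuous_on ({p<..<q} - T) u"
    "\<And>t. t \<in> {p<..<q} - T \<Longrightarrow> u t \<in> V 1 \<and> gder \<gamma> (\<lambda>v. v *\<^sub>R u t) t UNIV"
    using h unfolding hc_def by blast
  define T' where "T' = (\<lambda>t. (t - b) / k) ` T"
  have T': "k * t + b \<notin> T" if "t \<notin> T'" for t
  proof
    assume "k * t + b \<in> T"
    hence "(k * t + b - b) / k \<in> T'" unfolding T'_def by (rule imageI)
    thus False using that k by simp
  qed
  show ?thesis unfolding hc_def
  proof (intro conjI exI[of _ T'] ballI)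
    show "continuous_on {p'..q'} (\<lambda>t. \<gamma> (k * t + b))"
      by (rule continuous_on_compose2[OF T(1)]) (use img(1) in \<open>auto intro!: continuous_intros\<close>)
    show "finite T'" using T by (simp add: T'_def)
    show "continuous_on ({p'<..<q'} - T') (\<lambda>t. k *\<^sub>R u (k * t + b))"
      by (intro continuous_intros continuous_on_compose2[OF T(3)]) (use img(2) T' in auto)
    fix t assume "t \<in> {p'<..<q'} - T'"
    hence mt: "k * t + b \<in> {p<..<q} - T" using img(2) T' by auto
    show "k *\<^sub>R u (k * t + b) \<in> V 1" using T(4)[OF mt] subspace_scale[OF subspace_V[OF i1]] by blast
    have "gder (\<lambda>t. \<gamma> (k * t + b)) (\<lambda>v. (k * v) *\<^sub>R u (k * t + b)) t UNIV"
      by (rule gder_chain[of \<gamma> "\<lambda>v. v *\<^sub>R u (k * t + b)" "\<lambda>t. k * t + b" t])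
         (use T(4)[OF mt] in \<open>auto intro!: derivative_eq_intros\<close>)
    thus "gder (\<lambda>t. \<gamma> (k * t + b)) (\<lambda>v. v *\<^sub>R k *\<^sub>R u (k * t + b)) t UNIV" by (simp add: mult.commute)
  qed
qed

lemma hc_N_scale_integral:
  assumes h: "hc p q \<gamma> u" and l: "((\<lambda>t. N (u t)) has_integral l) {p..q}"
  shows "((\<lambda>t. N (k *\<^sub>R u t)) has_integral (\<bar>k\<bar> * l)) {p..q}"
proof -
  obtain T where T: "finite T" "\<And>t. t \<in> {p<..<q} - T \<Longrightarrow> u t \<in> V 1" using h unfolding hc_def by blast
  show ?thesis
    by (rule has_integral_spike_finite[OF _ _ has_integral_mult_right[OF l], of "insert p (insert q T)"])
       (use T N_scale in auto)
qed

lemma hc_affine_integral: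
  assumes h: "hc p q \<gamma> u" and l: "((\<lambda>t. N (u t)) has_integral l) {p..q}" and k: "k > 0" and pq: "k * p' + b = p" "k * q' + b = q"
  shows "hc p' q' (\<lambda>t. \<gamma> (k * t + b)) (\<lambda>t. k *\<^sub>R u (k * t + b))"
    "((\<lambda>t. N (k *\<^sub>R u (k * t + b))) has_integral l) {p'..q'}"
proof -
  have lt: "k * t + b \<le> k * t' + b \<longleftrightarrow> t \<le> t'" "k * t + b < k * t' + b \<longleftrightarrow> t < t'" for t t'
    using k by auto
  show h': "hc p' q' (\<lambda>t. \<gamma> (k * t + b)) (\<lambda>t. k *\<^sub>R u (k * t + b))"
    using k lt by (intro hc_affine[OF h]) (auto simp: pq[symmetric])
  have e: "(p - b) /\<^sub>R k = p'" "(q - b) /\<^sub>R k = q'" "(k * l) /\<^sub>R k ^ DIM(real) = l"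
    using k by (simp_all add: pq[symmetric])
  have "((\<lambda>t. N (k *\<^sub>R u t)) has_integral (k * l)) (cbox p q)"
    using hc_N_scale_integral[OF h l, of k] k by (simp add: cbox_interval)
  from has_integral_affinity'[OF this k, of b]
  show "((\<lambda>t. N (k *\<^sub>R u (k * t + b))) has_integral l) {p'..q'}"
    unfolding e by (simp add: cbox_interval)
qed

lemma reach_interval:
  assumes h: "hc p q \<gamma> u" and l: "((\<lambda>t. N (u t)) has_integral l) {p..q}" and pq: "p < q"
  shows "reach (\<gamma> p) (\<gamma> q) l"
  unfolding reach_def
  using hc_affine_integral[OF h l, of "q - p" 0 p 1] pq
  by (intro exI[of _ "\<lambda>t. \<gamma> ((q - p) * t + p)"] exI[of _ "\<lambda>t. (q - p) *\<^sub>R u ((q - p) * t + p)"]) auto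

lemma reach_refl: "reach x x 0"
proof -
  have i1: "(1::nat) \<in> {1..s}" using s1 by simp
  have z: "0 \<in> V 1" by (rule subspace_0[OF subspace_V[OF i1]])
  have "hc 0 1 (\<lambda>t. x) (\<lambda>t. 0)" unfolding hc_def
    by (intro conjI exI[of _ "{}"]) (auto simp: z gder_def)
  moreover have "N 0 = 0" using N_scale[OF z, of 0] by simp
  ultimately show ?thesis unfolding reach_def by (intro exI[of _ "\<lambda>t. x"] exI[of _ "\<lambda>t. 0"]) simp
qed

lemma hc_left: "hc p q \<gamma> u \<Longrightarrow> hc p q (\<lambda>t. g \<odot> \<gamma> t) u"
  unfolding hc_def
proof (elim conjE exE, intro conjI)
  fix T assume T: "continuous_on {p..q} \<gamma>" "finite T" "continuous_on ({p<..<q} - T) u"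
    "\<forall>t\<in>{p<..<q} - T. u t \<in> V 1 \<and> gder \<gamma> (\<lambda>v. v *\<^sub>R u t) t UNIV"
  show "continuous_on {p..q} (\<lambda>t. g \<odot> \<gamma> t)" using T(1) by (intro continuous_intros)
  have "\<forall>t\<in>{p<..<q} - T. u t \<in> V 1 \<and> gder (\<lambda>t. g \<odot> \<gamma> t) (\<lambda>v. v *\<^sub>R u t) t UNIV"
    using T(4) gder_left by blast
  with T show "\<exists>T. finite T \<and> continuous_on ({p<..<q} - T) u \<and>
      (\<forall>t\<in>{p<..<q} - T. u t \<in> V 1 \<and> gder (\<lambda>t. g \<odot> \<gamma> t) (\<lambda>v. v *\<^sub>R u t) t UNIV)" by blast
qed

lemma reach_left: "reach x y l \<Longrightarrow> reach (g \<odot> x) (g \<odot> y) l"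
  unfolding reach_def using hc_left by blast

lemma reach_sym: assumes "reach x y l" shows "reach y x l"
proof -
  obtain \<gamma> u where h: "hc 0 1 \<gamma> u" "\<gamma> 0 = x" "\<gamma> 1 = y" and l: "((\<lambda>t. N (u t)) has_integral l) {0..1}"
    using assms unfolding reach_def by blast
  have 1: "hc 0 1 (\<lambda>t. \<gamma> (-1 * t + 1)) (\<lambda>t. -1 *\<^sub>R u (-1 * t + 1))"
    by (rule hc_affine[OF h(1)]) auto
  have "((\<lambda>t. N (-1 *\<^sub>R u t)) has_integral l) {0..1}"
    using hc_N_scale_integral[OF h(1) l, of "-1"] by simp
  from has_integral_affinity[of "\<lambda>t. N (-1 *\<^sub>R u t)" l "0::real" 1 "-1" 1, unfolded cbox_interval, OF this]
  have "((\<lambda>t. N (-1 *\<^sub>R u (-1 * t + 1))) has_integral l) {0..1}"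
    using image_affinity_atLeastAtMost[of "-1" 1 0 "1::real"] by simp
  with 1 h show ?thesis unfolding reach_def
    by (intro exI[of _ "\<lambda>t. \<gamma> (-1 * t + 1)"] exI[of _ "\<lambda>t. -1 *\<^sub>R u (-1 * t + 1)"]) auto
qed

lemma hc_concat:
  assumes h1: "hc p q \<gamma> u" and h2: "hc q r \<gamma>' u'" and eq: "\<gamma> q = \<gamma>' q" and pqr: "p \<le> q" "q \<le> r"
    and l1: "((\<lambda>t. N (u t)) has_integral l) {p..q}" and l2: "((\<lambda>t. N (u' t)) has_integral l') {q..r}"
  shows "hc p r (\<lambda>t. if t \<le> q then \<gamma> t else \<gamma>' t) (\<lambda>t. if t \<le> q then u t else u' t)"
    "((\<lambda>t. N (if t \<le> q then u t else u' t)) has_integral (l + l')) {p..r}"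
proof -
  obtain T where T: "continuous_on {p..q} \<gamma>" "finite T" "continuous_on ({p<..<q} - T) u"
    "\<And>t. t \<in> {p<..<q} - T \<Longrightarrow> u t \<in> V 1 \<and> gder \<gamma> (\<lambda>v. v *\<^sub>R u t) t UNIV"
    using h1 unfolding hc_def by blast
  obtain T' where T': "continuous_on {q..r} \<gamma>'" "finite T'" "continuous_on ({q<..<r} - T') u'"
    "\<And>t. t \<in> {q<..<r} - T' \<Longrightarrow> u' t \<in> V 1 \<and> gder \<gamma>' (\<lambda>v. v *\<^sub>R u' t) t UNIV"
    using h2 unfolding hc_def by blast
  let ?g = "\<lambda>t. if t \<le> q then \<gamma> t else \<gamma>' t" and ?u = "\<lambda>t. if t \<le> q then u t else u' t"
  show "hc p r ?g ?u" unfolding hc_def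
  proof (intro conjI exI[of _ "insert q (T \<union> T')"] ballI)
    have "continuous_on ({p..q} \<union> {q..r}) ?g"
      using T(1) T'(1) eq by (intro continuous_on_If) auto
    thus "continuous_on {p..r} ?g" using pqr by (simp add: ivl_disj_un_two_touch)
    show "finite (insert q (T \<union> T'))" using T T' by simp
    have 1: "open ({p<..<q} - T)" "open ({q<..<r} - T')"
      using T(2) T'(2) by (auto intro!: open_Diff finite_imp_closed)
    have "continuous_on (({p<..<q} - T) \<union> ({q<..<r} - T')) ?u"
    proof (rule continuous_on_open_Un)
      show "continuous_on ({p<..<q} - T) ?u" by (rule continuous_on_eq[OF T(3)]) auto
      show "continuous_on ({q<..<r} - T') ?u" by (rule continuous_on_eq[OF T'(3)]) auto
    qed (use 1 in auto)
    thus "continuous_on ({p<..<r} - insert q (T \<union> T')) ?u" by (rule continuous_on_subset) auto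
    fix t assume t: "t \<in> {p<..<r} - insert q (T \<union> T')"
    show "?u t \<in> V 1" using T(4)[of t] T'(4)[of t] t by auto
    show "gder ?g (\<lambda>v. v *\<^sub>R ?u t) t UNIV"
    proof (cases "t < q")
      case True
      have "gder \<gamma> (\<lambda>v. v *\<^sub>R ?u t) t UNIV" using T(4)[of t] t True by auto
      thus ?thesis by (rule gder_cong_open[of _ _ _ "{..<q}"]) (use True in auto)
    next
      case False
      hence "q < t" using t by auto
      hence "gder \<gamma>' (\<lambda>v. v *\<^sub>R ?u t) t UNIV" using T'(4)[of t] t by auto
      thus ?thesis by (rule gder_cong_open[of _ _ _ "{q<..}"]) (use \<open>q < t\<close> in auto)
    qed
  qed
  show "((\<lambda>t. N (?u t)) has_integral (l + l')) {p..r}"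
  proof (rule has_integral_combine[OF pqr])
    show "((\<lambda>t. N (?u t)) has_integral l) {p..q}"
      by (rule has_integral_spike_finite[OF _ _ l1, of "{}"]) auto
    show "((\<lambda>t. N (?u t)) has_integral l') {q..r}"
      by (rule has_integral_spike_finite[OF _ _ l2, of "{q}"]) auto
  qed
qed

lemma reach_trans: assumes "reach x y l" "reach y z l'" shows "reach x z (l + l')"
proof -
  obtain \<gamma> u where h: "hc 0 1 \<gamma> u" "\<gamma> 0 = x" "\<gamma> 1 = y" and l: "((\<lambda>t. N (u t)) has_integral l) {0..1}"
    using assms unfolding reach_def by blast
  obtain \<gamma>' u' where h': "hc 0 1 \<gamma>' u'" "\<gamma>' 0 = y" "\<gamma>' 1 = z" and l': "((\<lambda>t. N (u' t)) has_integral l') {0..1}"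
    using assms unfolding reach_def by blast
  note c = hc_affine_integral[OF h'(1) l', of 1 1 "-1" 2]
  from reach_interval[OF hc_concat[OF h(1) c(1) _ _ _ l c(2)]] h h' show ?thesis by auto
qed

lemma subreach:
  assumes h: "hc p q \<gamma> u" and l: "((\<lambda>t. N (u t)) has_integral l) {p..q}" and t: "t \<in> {p..q}"
  shows "\<exists>l'\<le>l. reach (\<gamma> p) (\<gamma> t) l'"
proof (cases "t = p")
  case True
  thus ?thesis using reach_refl hc_integral_nonneg[OF h l] by auto
next
  case False
  obtain T where T: "continuous_on {p..q} \<gamma>" "finite T" "continuous_on ({p<..<q} - T) u"
    "\<And>t. t \<in> {p<..<q} - T \<Longrightarrow> u t \<in> V 1 \<and> gder \<gamma> (\<lambda>v. v *\<^sub>R u t) t UNIV"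
    using h unfolding hc_def by blast
  have h1: "hc p t \<gamma> u" unfolding hc_def
    by (intro conjI exI[of _ T] ballI T continuous_on_subset[OF T(1)] continuous_on_subset[OF T(3)]) (use t T in auto)
  have h2: "hc t q \<gamma> u" unfolding hc_def
    by (intro conjI exI[of _ T] ballI T continuous_on_subset[OF T(1)] continuous_on_subset[OF T(3)]) (use t T in auto)
  have int: "(\<lambda>t. N (u t)) integrable_on {p..q}" using l by blast
  obtain l1 where l1: "((\<lambda>t. N (u t)) has_integral l1) {p..t}"
    using integrable_subinterval_real[OF int, of p t] t by (auto simp: integrable_on_def)
  obtain l2 where l2: "((\<lambda>t. N (u t)) has_integral l2) {t..q}"
    using integrable_subinterval_real[OF int, of t q] t by (auto simp: integrable_on_def)
  have "l = l1 + l2" using has_integral_unique[OF l has_integral_combine[OF _ _ l1 l2]] t by simp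
  thus ?thesis using reach_interval[OF h1 l1] hc_integral_nonneg[OF h2 l2] False t by (intro exI[of _ l1]) auto
qed

lemma reach_Xp:
  assumes X: "X \<in> V 1" and t: "\<bar>t\<bar> < tau X" shows "reach e (Xp X t) (\<bar>t\<bar> * N X)"
proof -
  have i1: "(1::nat) \<in> {1..s}" using s1 by simp
  have bt: "\<bar>r * t\<bar> < tau X" if "r \<in> {0..1}" for r
  proof -
    have "\<bar>r * t\<bar> \<le> 1 * \<bar>t\<bar>" unfolding abs_mult using that by (intro mult_right_mono) auto
    thus ?thesis using t by simp
  qed
  have g: "gder (\<lambda>r. Xp X (r * t)) (\<lambda>v. v *\<^sub>R (t *\<^sub>R X)) r UNIV" if "r \<in> {0..1}" for r
  proof -
    have "gder (\<lambda>r. Xp X (r * t)) (\<lambda>v. (v * t) *\<^sub>R X) r UNIV"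
      by (rule gder_chain[of "Xp X" "\<lambda>v. v *\<^sub>R X" "\<lambda>r. r * t" r, OF Xp_gder[OF bt[OF that]]])
         (auto intro!: derivative_eq_intros)
    thus ?thesis by simp
  qed
  have "hc 0 1 (\<lambda>r. Xp X (r * t)) (\<lambda>r. t *\<^sub>R X)" unfolding hc_def
  proof (intro conjI exI[of _ "{}"] ballI)
    show "continuous_on {0..1} (\<lambda>r. Xp X (r * t))"
      using g by (auto simp: gder_def intro!: continuous_at_imp_continuous_on)
    show "t *\<^sub>R X \<in> V 1" using X subspace_scale[OF subspace_V[OF i1]] by blast
  qed (use g in auto)
  moreover have "((\<lambda>r::real. N (t *\<^sub>R X)) has_integral (\<bar>t\<bar> * N X)) {0..1}"
    using has_integral_const_real[of "N (t *\<^sub>R X)" 0 1] by (simp add: N_scale[OF X])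
  ultimately show ?thesis unfolding reach_def
    by (intro exI[of _ "\<lambda>r. Xp X (r * t)"] exI[of _ "\<lambda>r. t *\<^sub>R X"]) simp
qed

lemma reach_mult: "reach e g l \<Longrightarrow> reach e h l' \<Longrightarrow> reach e (g \<odot> h) (l + l')"
  using reach_trans[of e g l "g \<odot> h" l'] reach_left[of e h l' g] by simp

lemma reach_iv: "reach e g l \<Longrightarrow> reach e (iv g) l"
  using reach_sym[OF reach_left[of e g l "iv g"]] by (simp add: G.left_inverse)

section \<open>Chow's theorem\<close>

definition "gens r = {Ad h X | h X. h \<in> U0 \<and> X \<in> V 1 \<and> (\<exists>l<r. reach e h l)}"

text \<open>For \<open>Z = Ad h X\<close> the curve \<open>Ad (Xp Y t) Z\<close> consists of
  generators of the same kind and has derivative \<open>br Y Z\<close> at 0, so brackets with the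
  first layer are limits of elements of the span. The induction hypothesis is used at
  \<open>r/2\<close>, which leaves length for the additional factor \<open>Xp Y t\<close>.\<close>

lemma gens_span: "0 < r \<Longrightarrow> k \<in> {1..s} \<Longrightarrow> V k \<subseteq> span (gens r)"
proof (induction k arbitrary: r)
  case (Suc k)
  show ?case
  proof (cases "k = 0")
    case True
    have "X \<in> gens r" if "X \<in> V 1" for X
      unfolding gens_def using that U0(2) reach_refl Suc.prems by (force intro!: exI[of _ e])
    thus ?thesis using True span_base by (auto simp: One_nat_def)
  next
    case False
    hence k: "1 \<le> k" "k < s" "k \<in> {1..s}" using Suc.prems by auto
    have step: "br Y Z \<in> span (gens r)" if Y: "Y \<in> V 1" and Z: "Z \<in> gens (r/2)" for Y Z
    proof -
      obtain h X l where h: "Z = Ad h X" "h \<in> U0" "X \<in> V 1" "l < r/2" "reach e h l"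
        using Z unfolding gens_def by blast
      have isC: "isCont (Xp Y) 0" using Xp_gder[of 0 Y] tau_pos by (simp add: gder_def)
      have "isCont (\<lambda>t. Xp Y t \<odot> h) 0" using isC by (intro continuous_intros)
      hence ev1: "\<forall>\<^sub>F t in at 0. Xp Y t \<odot> h \<in> U0" 
        by (intro eventually_in_open) (use U0 h in auto)
      have "isCont (\<lambda>t. \<bar>t\<bar> * N Y) 0" by (intro continuous_intros)
      hence ev2: "\<forall>\<^sub>F t in at 0. \<bar>t\<bar> * N Y \<in> {..<r/2}" 
        by (intro eventually_in_open) (use Suc.prems in auto)
      have "isCont (\<lambda>t::real. \<bar>t\<bar>) 0" by (intro continuous_intros)
      hence ev3: "\<forall>\<^sub>F t in at 0. \<bar>t\<bar> \<in> {..<tau Y}" 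
        by (intro eventually_in_open) (use tau_pos in auto)
      have Zr: "Z \<in> span (gens r)"
        using h Suc.prems by (intro span_base) (auto simp: gens_def intro!: exI[of _ h] exI[of _ X] exI[of _ l])
      have ev: "\<forall>\<^sub>F t in at 0. (1 / t) *\<^sub>R (Ad (Xp Y t) Z - Z) \<in> span (gens r)"
        using ev1 ev2 ev3
      proof eventually_elim
        case (elim t)
        have "Ad (Xp Y t) Z = Ad (Xp Y t \<odot> h) X"
          using Ad_mult[OF Xp_U0 h(2), of t Y X] elim h(1) by simp
        moreover have "reach e (Xp Y t \<odot> h) (\<bar>t\<bar> * N Y + l)"
          using reach_mult[OF reach_Xp[OF Y] h(5)] elim by simp
        ultimately have "Ad (Xp Y t) Z \<in> gens r"
          using elim h unfolding gens_def
          by (intro CollectI exI[of _ "Xp Y t \<odot> h"] exI[of _ X] conjI exI[of _ "\<bar>t\<bar> * N Y + l"]) auto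
        hence "Ad (Xp Y t) Z \<in> span (gens r)" by (rule span_base)
        thus ?case using Zr by (intro span_scale span_diff)
      qed
      have "((\<lambda>t. Ad (Xp Y t) Z) has_derivative (\<lambda>v. v *\<^sub>R br Y Z)) (at 0)"
        using Ad_gder[OF Xp_gder Xp_U0, of 0 Y Z] tau_pos by (simp add: br.scaleR_left)
      hence "((\<lambda>t. norm (Ad (Xp Y t) Z - Z - t *\<^sub>R br Y Z) / \<bar>t\<bar>) \<longlongrightarrow> 0) (at 0)"
        by (simp add: has_derivative_iff_norm)
      moreover have "norm (Ad (Xp Y t) Z - Z - t *\<^sub>R br Y Z) / \<bar>t\<bar> = norm ((1 / t) *\<^sub>R (Ad (Xp Y t) Z - Z) - br Y Z)"
        if "t \<noteq> 0" for t
      proof -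
        have "(1 / t) *\<^sub>R (Ad (Xp Y t) Z - Z) - br Y Z = (1 / t) *\<^sub>R (Ad (Xp Y t) Z - Z - t *\<^sub>R br Y Z)"
          using that by (simp add: scaleR_diff_right)
        thus ?thesis by simp
      qed
      hence "\<forall>\<^sub>F t in at 0. norm (Ad (Xp Y t) Z - Z - t *\<^sub>R br Y Z) / \<bar>t\<bar> = norm ((1 / t) *\<^sub>R (Ad (Xp Y t) Z - Z) - br Y Z)"
        by (simp add: eventually_at_filter)
      ultimately have "((\<lambda>t. norm ((1 / t) *\<^sub>R (Ad (Xp Y t) Z - Z) - br Y Z)) \<longlongrightarrow> 0) (at 0)"
        by (rule Lim_transform_eventually)
      hence "((\<lambda>t. (1 / t) *\<^sub>R (Ad (Xp Y t) Z - Z)) \<longlongrightarrow> br Y Z) (at 0)"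
        by (simp add: tendsto_norm_zero_iff LIM_zero_iff)
      \<comment> \<open>The difference quotients lie in a finite-dimensional subspace, which is
        closed and therefore contains their limit.\<close>
      from Lim_in_closed_set[OF closed_subspace[OF subspace_span] ev _ this]
      show ?thesis by simp
    qed
    have "br Y Z \<in> span (gens r)" if Y: "Y \<in> V 1" and Z: "Z \<in> V k" for Y Z
    proof -
      have lin: "linear (\<lambda>Z. br Y Z)" by (rule bounded_linear.linear[OF br.bounded_linear_right])
      have "(\<lambda>Z. br Y Z) ` gens (r/2) \<subseteq> span (gens r)" using step[OF Y] by blast
      hence "span ((\<lambda>Z. br Y Z) ` gens (r/2)) \<subseteq> span (gens r)" by (rule span_minimal) simp
      hence "(\<lambda>Z. br Y Z) ` span (gens (r/2)) \<subseteq> span (gens r)" by (simp add: linear_span_image[OF lin])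
      thus ?thesis using Suc.IH[of "r/2"] Suc.prems(1) k Z by auto
    qed
    hence "{br X Y | X Y. X \<in> V 1 \<and> Y \<in> V k} \<subseteq> span (gens r)" by blast
    hence "span {br X Y | X Y. X \<in> V 1 \<and> Y \<in> V k} \<subseteq> span (gens r)" by (rule span_minimal) simp
    thus ?thesis using V_Suc[OF k(1,2)] by simp
  qed
qed simp

lemma gens_span_UNIV: "0 < r \<Longrightarrow> span (gens r) = UNIV"
proof -
  assume r: "0 < r"
  have "x \<in> span (gens r)" for x
  proof -
    have "(\<Sum>i=1..s. P i x) \<in> span (gens r)"
      using gens_span[OF r] P_in by (intro span_sum) blast
    thus ?thesis by (simp add: P_sum)
  qed
  thus ?thesis by blast
qed

text \<open>A map from the Lie algebra into the group that only uses horizontal motions: conjugates of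
  horizontal one-parameter subgroups by points reached by short horizontal curves.  Since such
  directions span the Lie algebra, suitable choices map neighborhoods of \<open>0\<close> onto neighborhoods of \<open>e\<close>:
  this is Chow's theorem.\<close>

primrec Theta :: "('g \<times> 'e \<times> ('e \<Rightarrow> real)) list \<Rightarrow> 'e \<Rightarrow> 'g" where
  "Theta [] x = e"
| "Theta (b # bs) x = fst b \<odot> Xp (fst (snd b)) (snd (snd b) x) \<odot> iv (fst b) \<odot> Theta bs x"

text \<open>The derivative is claimed at 0 only, where the remaining product is \<open>e\<close> and
  causes no conjugation. Each factor costs at most \<open>2 * r + \<eta>\<close>: less than
  \<open>r\<close> each for the conjugating point and its inverse, and at most \<eta> for the
  one-parameter subgroup.\<close>

lemma Theta_props:
  assumes "\<And>b. b \<in> set bs \<Longrightarrow> fst b \<in> U0 \<and> fst (snd b) \<in> V 1 \<and> bounded_linear (snd (snd b))"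
  shows "Theta bs 0 = e"
    and "gder (Theta bs) (\<lambda>v. \<Sum>b\<leftarrow>bs. snd (snd b) v *\<^sub>R Ad (fst b) (fst (snd b))) 0 UNIV"
    and "(\<And>b. b \<in> set bs \<Longrightarrow> \<bar>snd (snd b) x\<bar> < tau (fst (snd b))) \<Longrightarrow> isCont (Theta bs) x"
    and "(\<And>b. b \<in> set bs \<Longrightarrow> \<bar>snd (snd b) x\<bar> < tau (fst (snd b)) \<and> \<bar>snd (snd b) x\<bar> * N (fst (snd b)) \<le> \<eta> \<and> (\<exists>l<r. reach e (fst b) l)) \<Longrightarrow>
      \<exists>l\<le>real (length bs) * (2 * r + \<eta>). reach e (Theta bs x) l"
  using assms
proof (induction bs)
  case Nil
  {
    case 2
    have "Theta [] = (\<lambda>x. e)" by auto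
    thus ?case by (simp add: gder_def)
  next
    case 3
    have "Theta [] = (\<lambda>x. e)" by auto
    thus ?case by simp
  next
    case 4 thus ?case using reach_refl by auto
  }
  show "Theta [] 0 = e" by simp
next
  case (Cons b bs)
  let ?h = "fst b" and ?X = "fst (snd b)" and ?f = "snd (snd b)"
  have b: "?h \<in> U0" "?X \<in> V 1" "bounded_linear ?f"
    and prems: "\<And>b. b \<in> set bs \<Longrightarrow> fst b \<in> U0 \<and> fst (snd b) \<in> V 1 \<and> bounded_linear (snd (snd b))"
    if "\<And>b'. b' \<in> set (b # bs) \<Longrightarrow> fst b' \<in> U0 \<and> fst (snd b') \<in> V 1 \<and> bounded_linear (snd (snd b'))"
    using that by auto
  {
    case 1
    show ?case using Cons.IH(1)[OF prems[OF 1]] b(3)[OF 1] by (simp add: linear_simps)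
  next
    case 2
    note bb = b[OF 2] and pp = prems[OF 2]
    have f0: "?f 0 = 0" using bb(3) by (simp add: linear_simps)
    have "gder (\<lambda>y. Xp ?X (?f y)) (\<lambda>v. ?f v *\<^sub>R ?X) 0 UNIV"
      by (rule gder_chain[of "Xp ?X" "\<lambda>v. v *\<^sub>R ?X" ?f 0, OF Xp_gder bounded_linear_imp_has_derivative[OF bb(3)]])
         (simp add: f0 tau_pos)
    from gder_mult[OF gder_conj[OF this bb(1)] Cons.IH(2)[OF pp]]
    have "gder (\<lambda>y. ?h \<odot> Xp ?X (?f y) \<odot> iv ?h \<odot> Theta bs y)
      (\<lambda>v. Ad ?h (?f v *\<^sub>R ?X) + (\<Sum>b\<leftarrow>bs. snd (snd b) v *\<^sub>R Ad (fst b) (fst (snd b)))) 0 UNIV"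
      using Cons.IH(1)[OF pp] U0(2) by (simp add: G.inverse_neutral)
    moreover have "Theta (b # bs) = (\<lambda>y. ?h \<odot> Xp ?X (?f y) \<odot> iv ?h \<odot> Theta bs y)" by auto
    moreover have "Ad ?h (?f v *\<^sub>R ?X) = ?f v *\<^sub>R Ad ?h ?X" for v
      by (rule linear_scale[OF linear_Ad[OF bb(1)]])
    ultimately show ?case by (simp only: list.map sum_list.Cons)
  next
    case 3
    note bb = b[OF 3(2)] and pp = prems[OF 3(2)]
    have "isCont ?f x" using bb(3) by (rule linear_continuous_at)
    moreover have "isCont (Xp ?X) (?f x)" using Xp_gder[of "?f x" ?X] 3(1)[of b] by (simp add: gder_def)
    ultimately have "isCont (\<lambda>y. Xp ?X (?f y)) x" by (rule isCont_o2)
    moreover have "isCont (Theta bs) x" using Cons.IH(3)[OF _ pp] 3(1) by auto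
    ultimately have "isCont (\<lambda>y. ?h \<odot> Xp ?X (?f y) \<odot> iv ?h \<odot> Theta bs y) x" by (intro continuous_intros)
    moreover have "Theta (b # bs) = (\<lambda>y. ?h \<odot> Xp ?X (?f y) \<odot> iv ?h \<odot> Theta bs y)" by auto
    ultimately show ?case by simp
  next
    case 4
    note bb = b[OF 4(2)] and pp = prems[OF 4(2)]
    obtain l where l: "l \<le> real (length bs) * (2 * r + \<eta>)" "reach e (Theta bs x) l"
      using Cons.IH(4)[OF _ pp] 4(1) by auto
    obtain k where k: "k < r" "reach e ?h k" using 4(1)[of b] by auto
    have "reach e (Xp ?X (?f x)) (\<bar>?f x\<bar> * N ?X)" using 4(1)[of b] by (intro reach_Xp bb) auto
    from reach_mult[OF reach_mult[OF reach_mult[OF k(2) this] reach_iv[OF k(2)]] l(2)]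
    have "reach e (Theta (b # bs) x) (k + \<bar>?f x\<bar> * N ?X + k + l)" by simp
    moreover have "k + \<bar>?f x\<bar> * N ?X + k + l \<le> real (length (b # bs)) * (2 * r + \<eta>)"
      using k(1) l(1) 4(1)[of b] by (simp add: algebra_simps)
    ultimately show ?case by blast
  }
qed

text \<open>A basis of the Lie algebra is chosen among the directions \<open>gens r\<close>, with
  its dual coordinates as parameters. Then the derivative of \<open>Theta\<close> at 0 is the
  identity, so every point near \<open>e\<close> is a value of \<open>Theta\<close> at a small
  parameter and is reached at small cost.\<close>

lemma chow_local: assumes \<epsilon>: "\<epsilon> > 0" shows "\<forall>\<^sub>F h in nhds e. \<exists>l<\<epsilon>. reach e h l"
proof -
  define n where "n = DIM('e)"
  \<comment> \<open>Together with the value of \<eta> below, at most \<open>n\<close> factors cost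
    at most \<open>n * (2 * r + \<eta>)\<close>, which is half of \<epsilon>.\<close>
  define r where "r = \<epsilon> / (8 * n)"
  have n: "n > 0" by (simp add: n_def)
  have r: "r > 0" using \<epsilon> n by (simp add: r_def)
  obtain B where B: "B \<subseteq> gens r" "independent B" "gens r \<subseteq> span B" using maximal_independent_subset by blast
  have spB: "span B = UNIV" using gens_span_UNIV[OF r] B(3) by (metis span_mono span_span top.extremum_uniqueI)
  have finB: "finite B" using B(2) by (rule independent_imp_finite)
  have cardB: "card B \<le> n" using independent_bound[OF B(2)] by (simp add: n_def)
  have "\<forall>b\<in>B. \<exists>h X. b = Ad h X \<and> h \<in> U0 \<and> X \<in> V 1 \<and> (\<exists>l<r. reach e h l)" using B(1) unfolding gens_def by blast
  then obtain hh XX where hX: "\<And>b. b \<in> B \<Longrightarrow> b = Ad (hh b) (XX b) \<and> hh b \<in> U0 \<and> XX b \<in> V 1 \<and> (\<exists>l<r. reach e (hh b) l)" by metis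
  obtain bl where bl: "set bl = B" "distinct bl" using finite_distinct_list[OF finB] by blast
  define bs where "bs = map (\<lambda>b. (hh b, XX b, \<lambda>x. representation B x b)) bl"
  have repl: "bounded_linear (\<lambda>x. representation B x b)" for b
    unfolding linear_conv_bounded_linear[symmetric]
    by (intro linearI) (simp_all add: representation_add[OF B(2)] representation_scale[OF B(2)] spB)
  have bs: "fst b \<in> U0 \<and> fst (snd b) \<in> V 1 \<and> bounded_linear (snd (snd b))" if "b \<in> set bs" for b
    using that hX bl repl by (auto simp: bs_def)
  note TH = Theta_props[of bs, OF bs]
  have der: "(\<Sum>b\<leftarrow>bs. snd (snd b) v *\<^sub>R Ad (fst b) (fst (snd b))) = v" for v
  proof -
    have "representation B v b *\<^sub>R Ad (hh b) (XX b) = representation B v b *\<^sub>R b" if "b \<in> set bl" for b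
      using hX[of b] that bl(1) by auto
    hence "map (\<lambda>b. representation B v b *\<^sub>R Ad (hh b) (XX b)) bl = map (\<lambda>b. representation B v b *\<^sub>R b) bl"
      by (rule map_cong[OF refl])
    hence "(\<Sum>b\<leftarrow>bs. snd (snd b) v *\<^sub>R Ad (fst b) (fst (snd b))) = (\<Sum>b\<leftarrow>bl. representation B v b *\<^sub>R b)"
      by (simp add: bs_def o_def del: map_eq_conv)
    also have "\<dots> = (\<Sum>b\<in>B. representation B v b *\<^sub>R b)" using bl by (simp add: sum_list_distinct_conv_sum_set)
    also have "\<dots> = v" using sum_representation_eq[OF B(2), of v B] spB finB by simp
    finally show ?thesis .
  qed
  define \<eta> where "\<eta> = \<epsilon> / (4 * n)"
  have \<eta>: "\<eta> > 0" using \<epsilon> n by (simp add: \<eta>_def)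
  have small: "\<forall>\<^sub>F x in nhds 0. \<bar>snd (snd b) x\<bar> < tau (fst (snd b)) \<and> \<bar>snd (snd b) x\<bar> * N (fst (snd b)) \<le> \<eta>" if "b \<in> set bs" for b
  proof -
    have c: "isCont (snd (snd b)) 0" "snd (snd b) 0 = 0" using bs[OF that] by (auto simp: linear_simps intro: linear_continuous_at)
    have c1: "isCont (\<lambda>x. \<bar>snd (snd b) x\<bar>) 0" and c2: "isCont (\<lambda>x. \<bar>snd (snd b) x\<bar> * N (fst (snd b))) 0"
      using c(1) by (intro continuous_intros; assumption)+
    show ?thesis
      using eventually_nhds_isCont[OF c1 open_lessThan[of "tau (fst (snd b))"]] eventually_nhds_isCont[OF c2 open_lessThan[of \<eta>]]
        c(2) tau_pos \<eta> by (simp add: eventually_conj_iff eventually_mono less_imp_le)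
  qed
  have "\<forall>\<^sub>F x in nhds 0. \<forall>b\<in>set bs. \<bar>snd (snd b) x\<bar> < tau (fst (snd b)) \<and> \<bar>snd (snd b) x\<bar> * N (fst (snd b)) \<le> \<eta>"
    using small by (simp add: eventually_ball_finite_distrib)
  moreover have "isCont (Theta bs) 0" using TH(2) by (simp add: gder_def)
  hence "\<forall>\<^sub>F x in nhds 0. Theta bs x \<in> U"
    by (rule eventually_nhds_isCont) (use chart_facts TH(1) in auto)
  ultimately have "\<forall>\<^sub>F x in nhds 0. (\<forall>b\<in>set bs. \<bar>snd (snd b) x\<bar> < tau (fst (snd b)) \<and> \<bar>snd (snd b) x\<bar> * N (fst (snd b)) \<le> \<eta>) \<and> Theta bs x \<in> U"
    by eventually_elim auto
  then obtain dd where dd: "dd > 0" "\<And>x. dist x 0 < dd \<Longrightarrow> (\<forall>b\<in>set bs. \<bar>snd (snd b) x\<bar> < tau (fst (snd b)) \<and> \<bar>snd (snd b) x\<bar> * N (fst (snd b)) \<le> \<eta>) \<and> Theta bs x \<in> U"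
    unfolding eventually_nhds_metric by blast
  have dball: "(\<forall>b\<in>set bs. \<bar>snd (snd b) x\<bar> < tau (fst (snd b)) \<and> \<bar>snd (snd b) x\<bar> * N (fst (snd b)) \<le> \<eta>) \<and> Theta bs x \<in> U"
    if "x \<in> ball 0 dd" for x using dd(2)[of x] that by (simp add: dist_commute)
  define F where "F x = \<phi> (Theta bs x)" for x
  have contF: "continuous_on (ball 0 dd) F"
  proof -
    have "isCont F x" if "x \<in> ball 0 dd" for x
      unfolding F_def using dball[OF that] by (intro isCont_o2[OF TH(3) isCont_\<phi>]) auto
    thus ?thesis by (simp add: continuous_at_imp_continuous_on)
  qed
  have "(F has_derivative (\<lambda>v. v)) (at 0)"
    using gder_chart[OF _ TH(2)] TH(1) chart_facts by (simp add: F_def[abs_def] der)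
  \<comment> \<open>Differentiability is known at the single point 0, so openness comes from
    continuity near 0 and an invertible derivative at 0, not from the inverse function
    theorem.\<close>
  hence "F 0 \<in> interior (F ` ball 0 dd)"
    by (intro sussmann_open_mapping[OF open_ball contF, where f' = "\<lambda>v. v" and g' = "\<lambda>v. v"]) (use dd in \<open>auto simp: o_def id_def\<close>)
  hence int: "\<phi> e \<in> interior (F ` ball 0 dd)" by (simp add: F_def TH(1))
  have "\<forall>\<^sub>F h in nhds e. \<phi> h \<in> interior (F ` ball 0 dd)"
    by (rule eventually_nhds_isCont[OF isCont_\<phi>]) (use int chart_facts in auto)
  moreover have "\<forall>\<^sub>F h in nhds e. h \<in> U" using chart_facts by (intro eventually_nhds_in_open) auto
  ultimately show ?thesis
  proof eventually_elim
    case (elim h)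
    then obtain x where x: "x \<in> ball 0 dd" "\<phi> h = F x" using interior_subset by blast
    hence h: "h = Theta bs x" using dball[OF x(1)] elim(2) inj_\<phi> by (auto simp: F_def inj_on_def)
    have "\<exists>l\<le>real (length bs) * (2 * r + \<eta>). reach e (Theta bs x) l"
      using dball[OF x(1)] hX bl by (intro TH(4)) (auto simp: bs_def)
    then obtain l where l: "l \<le> real (length bs) * (2 * r + \<eta>)" "reach e h l" using h by blast
    have "length bs = card B" using bl distinct_card[of bl] by (simp add: bs_def)
    hence "real (length bs) * (2 * r + \<eta>) \<le> real n * (2 * r + \<eta>)"
      using cardB r \<eta> by (intro mult_right_mono) auto
    also have "\<dots> = \<epsilon> / 2" using n by (simp add: r_def \<eta>_def field_simps)
    finally show ?case using l \<epsilon> by (intro exI[of _ l]) auto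
  qed
qed

text \<open>The set reachable from \<open>e\<close> and its complement are both open, because each
  contains with a point the translate of the neighborhood from \<open>chow_local\<close>.
  Connectedness makes the reachable set everything.\<close>

lemma chow_global: "\<exists>l. reach x y l"
proof -
  define H where "H = {h. \<exists>l. reach e h l}"
  obtain W where W': "open W" "e \<in> W" "\<forall>h\<in>W. \<exists>l<1. reach e h l"
    using chow_local[of 1] by (auto simp: eventually_nhds)
  have "h \<in> H" if "h \<in> W" for h using W'(3) that by (auto simp: H_def)
  note W = W'(1,2) this
  have tr: "open ((\<lambda>y. iv h \<odot> y) -` W)" for h
  proof -
    have "continuous_on UNIV (\<lambda>y. iv h \<odot> y)" by (intro continuous_intros)
    thus ?thesis using W(1) by (simp add: open_vimage)
  qed
  have "open H"
    unfolding open_subopen[of H]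
  proof
    fix h assume h: "h \<in> H"
    have "y \<in> H" if "iv h \<odot> y \<in> W" for y
    proof -
      have "iv h \<odot> y \<in> H" using W(3) that by blast
      then obtain l l' where "reach e h l" "reach e (iv h \<odot> y) l'" using h by (auto simp: H_def)
      from reach_mult[OF this] show ?thesis by (auto simp: H_def)
    qed
    thus "\<exists>T. open T \<and> h \<in> T \<and> T \<subseteq> H" using tr W(2) by (intro exI[of _ "(\<lambda>y. iv h \<odot> y) -` W"]) auto
  qed
  moreover have "open (- H)"
    unfolding open_subopen[of "- H"]
  proof
    fix h assume h: "h \<in> - H"
    have "y \<in> - H" if "iv h \<odot> y \<in> W" for y
    proof
      assume "y \<in> H"
      moreover have "iv h \<odot> y \<in> H" using W(3) that by blast
      ultimately obtain l l' where "reach e y l" "reach e (iv h \<odot> y) l'" by (auto simp: H_def)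
      from reach_mult[OF this(1) reach_iv[OF this(2)]] have "reach e h (l + l')"
        by (simp add: G.inverse_distrib_swap)
      thus False using h by (auto simp: H_def)
    qed
    thus "\<exists>T. open T \<and> h \<in> T \<and> T \<subseteq> - H" using tr W(2) by (intro exI[of _ "(\<lambda>y. iv h \<odot> y) -` W"]) auto
  qed
  moreover have "e \<in> H" using reach_refl by (auto simp: H_def)
  ultimately have "H = UNIV"
    using conn connected_clopen[of "UNIV :: 'g set"] by (auto simp: closed_def)
  then obtain l where "reach e (iv x \<odot> y) l" by (auto simp: H_def)
  from reach_left[OF this, of x] show ?thesis by auto
qed

section \<open>Basic properties of the distance\<close>

lemma d_le: "reach x y l \<Longrightarrow> d x y \<le> l"
  unfolding d_eq by (rule cInf_lower) (auto intro!: bdd_belowI[of _ 0] reach_nonneg)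

lemma d_less: "d x y < l \<Longrightarrow> \<exists>l'<l. reach x y l'"
  unfolding d_eq using chow_global[of x y] by (subst (asm) cInf_less_iff) (auto intro!: bdd_belowI[of _ 0] reach_nonneg)

lemma d_nonneg: "0 \<le> d x y"
  unfolding d_eq using chow_global[of x y] by (intro cInf_greatest) (auto intro: reach_nonneg)

lemma d_triangle: "d x z \<le> d x y + d y z"
proof (rule field_le_epsilon)
  fix \<epsilon> :: real assume "\<epsilon> > 0"
  then obtain l l' where "l < d x y + \<epsilon>/2" "reach x y l" "l' < d y z + \<epsilon>/2" "reach y z l'"
    using d_less[of x y "d x y + \<epsilon>/2"] d_less[of y z "d y z + \<epsilon>/2"] by auto
  thus "d x z \<le> d x y + d y z + \<epsilon>" using d_le[OF reach_trans, of x y l z l'] by linarith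
qed

lemma d_sym: "d x y = d y x"
proof -
  have "{l. reach x y l} = {l. reach y x l}" using reach_sym by blast
  thus ?thesis by (simp only: d_eq)
qed

lemma d_left: "d (g \<odot> x) (g \<odot> y) = d x y"
proof -
  have "reach (g \<odot> x) (g \<odot> y) l \<longleftrightarrow> reach x y l" for l
    using reach_left[of x y l g] reach_left[of "g \<odot> x" "g \<odot> y" l "iv g"] by auto
  hence "{l. reach (g \<odot> x) (g \<odot> y) l} = {l. reach x y l}" by blast
  thus ?thesis by (simp only: d_eq)
qed

end

section \<open>Local dilations and comparison of horizontal curves\<close>

context carnot
begin

declare One_nat_def [simp del]

lemma one_in: "1 \<in> {1..s}" using s1 by simp

lemma N_integral_part:
  fixes p q :: real
  assumes T: "finite T" "\<And>t. t \<in> {p<..<q} - T \<Longrightarrow> u t \<in> V 1"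
    and l: "((\<lambda>t. N (u t)) has_integral l) {p..q}" and t: "t \<in> {p..q}"
  shows "(\<lambda>t. N (u t)) integrable_on {p..t}" "integral {p..t} (\<lambda>t. N (u t)) \<le> l"
proof -
  have int: "(\<lambda>t. N (u t)) integrable_on {p..q}" using l by blast
  show i1: "(\<lambda>t. N (u t)) integrable_on {p..t}"
    using integrable_subinterval_real[OF int, of p t] t by auto
  have i2: "(\<lambda>t. N (u t)) integrable_on {t..q}"
    using integrable_subinterval_real[OF int, of t q] t by auto
  have "((\<lambda>r. if r \<in> {p<..<q} - T then N (u r) else 0) has_integral integral {t..q} (\<lambda>t. N (u t))) {t..q}"
    by (rule has_integral_spike_finite[OF _ _ integrable_integral[OF i2], of "insert p (insert q T)"]) (use T t in auto)
  hence "0 \<le> integral {t..q} (\<lambda>t. N (u t))"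
    by (rule has_integral_nonneg) (use T N_nonneg in auto)
  moreover have "l = integral {p..t} (\<lambda>t. N (u t)) + integral {t..q} (\<lambda>t. N (u t))"
    using has_integral_unique[OF l has_integral_combine[OF _ _ integrable_integral[OF i1] integrable_integral[OF i2]]] t by simp
  ultimately show "integral {p..t} (\<lambda>t. N (u t)) \<le> l" by simp
qed

section \<open>Uniform bounds for dilations and the horizontal projection\<close>

lemma \<delta>_bound: "\<exists>C\<ge>1. \<forall>r x. 0 \<le> r \<longrightarrow> r \<le> 1 \<longrightarrow> norm (\<delta> r x) \<le> C * norm x"
proof -
  have "\<forall>i\<in>{1..s}. \<exists>K. \<forall>x. norm (P i x) \<le> norm x * K"
    using bounded_linear.bounded[OF bounded_linear_P] by blast
  then obtain K where K: "\<And>i x. i \<in> {1..s} \<Longrightarrow> norm (P i x) \<le> norm x * K i" by metis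
  define C where "C = (\<Sum>i=1..s. \<bar>K i\<bar>) + 1"
  have "norm (\<delta> r x) \<le> C * norm x" if r: "0 \<le> r" "r \<le> 1" for r x
  proof -
    have "norm (\<delta> r x) \<le> (\<Sum>i=1..s. \<bar>K i\<bar> * norm x)"
      unfolding \<delta>_def
    proof (rule sum_norm_le)
      fix i assume i: "i \<in> {1..s}"
      have "norm (r ^ i *\<^sub>R P i x) \<le> 1 * norm (P i x)"
        unfolding norm_scaleR using r by (intro mult_right_mono) (auto simp: power_le_one)
      also have "\<dots> \<le> \<bar>K i\<bar> * norm x"
        using K[OF i, of x] mult_left_mono[OF abs_ge_self[of "K i"], of "norm x"] by (simp add: mult.commute)
      finally show "norm (r ^ i *\<^sub>R P i x) \<le> \<bar>K i\<bar> * norm x" .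
    qed
    also have "\<dots> \<le> C * norm x" by (simp add: C_def sum_distrib_right distrib_right)
    finally show ?thesis .
  qed
  moreover have "C \<ge> 1" by (simp add: C_def sum_nonneg)
  ultimately show ?thesis by blast
qed

definition "CD = (SOME C. C \<ge> 1 \<and> (\<forall>r x. 0 \<le> r \<longrightarrow> r \<le> 1 \<longrightarrow> norm (\<delta> r x) \<le> C * norm x))"

lemma CD: "CD \<ge> 1" "0 \<le> r \<Longrightarrow> r \<le> 1 \<Longrightarrow> norm (\<delta> r x) \<le> CD * norm x"
  using someI_ex[OF \<delta>_bound] unfolding CD_def[symmetric] by auto

definition "CP = (SOME C. C \<ge> 0 \<and> (\<forall>x. norm (P 1 x) \<le> C * norm x))"

lemma CP: "CP \<ge> 0" "norm (P 1 x) \<le> CP * norm x"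
proof -
  have "\<exists>C\<ge>0. \<forall>x. norm (P 1 x) \<le> C * norm x"
    using bounded_linear.nonneg_bounded[OF bounded_linear_P[OF one_in]] by (simp add: mult.commute)
  from someI_ex[OF this] show "CP \<ge> 0" "norm (P 1 x) \<le> CP * norm x" unfolding CP_def[symmetric] by auto
qed

section \<open>Approximation of Lipschitz curves by horizontal curves\<close>

lemma hc_chain:
  assumes "\<And>i. i < n \<Longrightarrow> \<exists>l\<le>Lm. reach (p i) (p (Suc i)) l"
  shows "\<exists>\<gamma> u l. hc 0 (real n) \<gamma> u \<and> ((\<lambda>t. N (u t)) has_integral l) {0..real n} \<and> l \<le> real n * Lm \<and>
     (\<forall>i\<le>n. \<gamma> (real i) = p i) \<and> (\<forall>i<n. \<forall>t\<in>{real i..real (Suc i)}. \<exists>l\<le>Lm. reach (p i) (\<gamma> t) l)"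
  using assms
proof (induction n)
  case 0
  have "hc 0 (real 0) (\<lambda>t. p 0) (\<lambda>t. 0)" unfolding hc_def by auto
  thus ?case by (intro exI[of _ "\<lambda>t. p 0"] exI[of _ "\<lambda>t. 0"] exI[of _ 0]) auto
next
  case (Suc n)
  obtain \<gamma> u l where g: "hc 0 (real n) \<gamma> u" "((\<lambda>t. N (u t)) has_integral l) {0..real n}" "l \<le> real n * Lm"
     "\<And>i. i \<le> n \<Longrightarrow> \<gamma> (real i) = p i" "\<And>i t. i < n \<Longrightarrow> t \<in> {real i..real (Suc i)} \<Longrightarrow> \<exists>l\<le>Lm. reach (p i) (\<gamma> t) l"
    using Suc.IH Suc.prems by (metis less_Suc_eq)
  obtain l' where l': "l' \<le> Lm" "reach (p n) (p (Suc n)) l'" using Suc.prems[of n] by auto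
  then obtain \<gamma>' u' where g': "hc 0 1 \<gamma>' u'" "\<gamma>' 0 = p n" "\<gamma>' 1 = p (Suc n)" "((\<lambda>t. N (u' t)) has_integral l') {0..1}"
    unfolding reach_def by blast
  have e: "1 * real n + - real n = 0" "1 * real (Suc n) + - real n = 1" by auto
  note h = hc_affine_integral[OF g'(1,4) zero_less_one e]
  have eq: "\<gamma> (real n) = \<gamma>' (1 * real n + - real n)" using g(4)[of n] g'(2) by simp
  note cc = hc_concat[OF g(1) h(1) eq _ _ g(2) h(2)]
  let ?\<gamma> = "\<lambda>t. if t \<le> real n then \<gamma> t else \<gamma>' (1 * t + - real n)"
  let ?u = "\<lambda>t. if t \<le> real n then u t else 1 *\<^sub>R u' (1 * t + - real n)"
  have val: "?\<gamma> (real i) = p i" if "i \<le> Suc n" for i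
    using g(4)[of i] g'(3) that by (cases "i = Suc n") auto
  have near: "\<exists>l\<le>Lm. reach (p i) (?\<gamma> t) l" if i: "i < Suc n" and t: "t \<in> {real i..real (Suc i)}" for i t
  proof (cases "i = n")
    case False
    hence "i < n" using i by simp
    moreover have "t \<le> real n" using t \<open>i < n\<close> by auto
    ultimately show ?thesis using g(5)[of i t] t by simp
  next
    case True
    show ?thesis
    proof (cases "t \<le> real n")
      case tn: True
      hence "t = real n" using t True by simp
      thus ?thesis using g(4)[of n] True reach_refl[of "p n"] reach_nonneg[OF l'(2)] l'(1) by (intro exI[of _ 0]) auto
    next
      case False
      have "1 * t + - real n \<in> {0..1}" using t True False by auto
      from subreach[OF g'(1,4) this] show ?thesis using False True l'(1) g'(2) by (auto intro: order_trans)
    qed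
  qed
  show ?case
    by (rule exI[of _ ?\<gamma>], rule exI[of _ ?u], rule exI[of _ "l + l'"])
       (use cc val near g(3) l'(1) in \<open>auto simp: algebra_simps\<close>)
qed

text \<open>A curve that is Lipschitz for \<open>d\<close> need not satisfy \<open>hc\<close>, so
  nearby points on it are joined by short horizontal curves. The total length is at most twice the
  Lipschitz bound and the uniform distance is as small as desired.\<close>

lemma approx_curve:
  assumes \<sigma>: "\<And>a b. a \<in> {0..ll} \<Longrightarrow> b \<in> {0..ll} \<Longrightarrow> d (\<sigma> a) (\<sigma> b) \<le> K * \<bar>a - b\<bar>"
    and K: "K > 0" and ll: "ll > 0" and \<eta>: "\<eta> > 0"
  shows "\<exists>\<gamma> u l. hc 0 1 \<gamma> u \<and> ((\<lambda>t. N (u t)) has_integral l) {0..1} \<and> l \<le> 2 * K * ll \<and> \<gamma> 0 = \<sigma> 0 \<and> \<gamma> 1 = \<sigma> ll \<and>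
     (\<forall>t\<in>{0..1}. \<exists>l\<le>\<eta>. reach (\<sigma> (ll * t)) (\<gamma> t) l)"
proof -
  \<comment> \<open>With step length \<open>Lm = 2 * K * ll / n\<close>, a point of the chain is
    within two steps of the corresponding point of \<sigma>, which accounts for the 4.\<close>
  obtain n :: nat where n: "n > 0" "4 * K * ll / real n \<le> \<eta>"
  proof -
    obtain n :: nat where n: "real n > 4 * K * ll / \<eta>" using reals_Archimedean2 by blast
    have "0 < 4 * K * ll / \<eta>" using K ll \<eta> by simp
    hence "n > 0" using n by (intro gr0I) auto
    moreover have "4 * K * ll / real n \<le> \<eta>" using n \<eta> \<open>n > 0\<close> by (simp add: field_simps)
    ultimately show ?thesis using that by blast
  qed
  define p where "p i = \<sigma> (ll * (real i / real n))" for i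
  \<comment> \<open>The factor 2 leaves room above the distance bound, since the distance is an
    infimum that need not be attained.\<close>
  define Lm where "Lm = 2 * K * ll / real n"
  have lt: "\<exists>l\<le>Lm. reach (\<sigma> a) (\<sigma> b) l" if "a \<in> {0..ll}" "b \<in> {0..ll}" "\<bar>a - b\<bar> \<le> ll / real n" for a b
  proof -
    have "d (\<sigma> a) (\<sigma> b) \<le> K * \<bar>a - b\<bar>" by (rule \<sigma>[OF that(1,2)])
    also have "\<dots> \<le> K * (ll / real n)" using that K by (intro mult_left_mono) auto
    also have "\<dots> < Lm" unfolding Lm_def using K ll n(1) by (simp add: field_simps)
    finally show ?thesis using d_less by (meson less_imp_le)
  qed
  have in1: "ll * x \<in> {0..ll}" if "0 \<le> x" "x \<le> 1" for x using that ll mult_left_mono[of x 1 ll] by auto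
  have ch: "\<exists>l\<le>Lm. reach (p i) (p (Suc i)) l" if "i < n" for i
    unfolding p_def
  proof (rule lt)
    show "ll * (real i / real n) \<in> {0..ll}" "ll * (real (Suc i) / real n) \<in> {0..ll}" by (rule in1; use that n in simp)+
    have "ll * (real i / real n) - ll * (real (Suc i) / real n) = - (ll / real n)" using n by (simp add: field_simps)
    thus "\<bar>ll * (real i / real n) - ll * (real (Suc i) / real n)\<bar> \<le> ll / real n" using ll by simp
  qed
  have "\<exists>\<gamma> u l. hc 0 (real n) \<gamma> u \<and>
     ((\<lambda>t. N (u t)) has_integral l) {0..real n} \<and> l \<le> real n * Lm \<and> (\<forall>i\<le>n. \<gamma> (real i) = p i) \<and>
     (\<forall>i<n. \<forall>t\<in>{real i..real (Suc i)}. \<exists>l\<le>Lm. reach (p i) (\<gamma> t) l)"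
    by (rule hc_chain) (rule ch)
  then obtain \<gamma> u l where "hc 0 (real n) \<gamma> u \<and>
     ((\<lambda>t. N (u t)) has_integral l) {0..real n} \<and> l \<le> real n * Lm \<and> (\<forall>i\<le>n. \<gamma> (real i) = p i) \<and>
     (\<forall>i<n. \<forall>t\<in>{real i..real (Suc i)}. \<exists>l\<le>Lm. reach (p i) (\<gamma> t) l)"
    by (elim exE)
  hence g: "hc 0 (real n) \<gamma> u" "((\<lambda>t. N (u t)) has_integral l) {0..real n}" "l \<le> real n * Lm"
     "\<And>i. i \<le> n \<Longrightarrow> \<gamma> (real i) = p i" "\<And>i t. i < n \<Longrightarrow> t \<in> {real i..real (Suc i)} \<Longrightarrow> \<exists>l\<le>Lm. reach (p i) (\<gamma> t) l"
    by (simp_all only: simp_thms)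
  have e: "real n > 0" "real n * 0 + 0 = 0" "real n * 1 + 0 = real n" using n by auto
  note h = hc_affine_integral[OF g(1,2) e]
  have near: "\<exists>l\<le>\<eta>. reach (\<sigma> (ll * t)) (\<gamma> (real n * t + 0)) l" if t: "t \<in> {0..1}" for t
  proof -
    have "\<exists>i<n. real n * t \<in> {real i..real (Suc i)}"
    proof (cases "t = 1")
      case True
      thus ?thesis using n by (intro exI[of _ "n - 1"]) auto
    next
      case False
      define i where "i = nat \<lfloor>real n * t\<rfloor>"
      have i: "real i \<le> real n * t" "real n * t < real i + 1" using t by (auto simp: i_def)
      have "real n * t < real n * 1" using False t n by (intro mult_strict_left_mono) auto
      hence "i < n" using i by linarith
      thus ?thesis using i by (intro exI[of _ i]) auto
    qed
    then obtain i where i: "i < n" "real n * t \<in> {real i..real (Suc i)}" by blast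
    obtain l1 where l1: "l1 \<le> Lm" "reach (p i) (\<gamma> (real n * t)) l1" using g(5)[OF i] by blast
    have "\<exists>l\<le>Lm. reach (\<sigma> (ll * t)) (p i) l" unfolding p_def
    proof (rule lt)
      show "ll * t \<in> {0..ll}" "ll * (real i / real n) \<in> {0..ll}" by (rule in1; use i n t in simp)+
      have "\<bar>real n * t - real i\<bar> \<le> 1" using i by auto
      hence "\<bar>t - real i / real n\<bar> \<le> 1 / real n" using n by (simp add: field_simps abs_le_iff)
      hence "ll * \<bar>t - real i / real n\<bar> \<le> ll * (1 / real n)" using ll by (intro mult_left_mono) auto
      moreover have "\<bar>ll * t - ll * (real i / real n)\<bar> = ll * \<bar>t - real i / real n\<bar>"
        using ll by (simp add: right_diff_distrib[symmetric] abs_mult del: times_divide_eq_right)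
      ultimately show "\<bar>ll * t - ll * (real i / real n)\<bar> \<le> ll / real n" by simp
    qed
    then obtain l2 where l2: "l2 \<le> Lm" "reach (\<sigma> (ll * t)) (p i) l2" by blast
    have "l2 + l1 \<le> 2 * Lm" using l1 l2 by simp
    also have "\<dots> \<le> \<eta>" using n(2) by (simp add: Lm_def)
    finally show ?thesis using reach_trans[OF l2(2) l1(2)] by auto
  qed
  have "l \<le> 2 * K * ll" using g(3) n(1) by (simp add: Lm_def)
  moreover have "\<gamma> (real n * 0 + 0) = \<sigma> 0" "\<gamma> (real n * 1 + 0) = \<sigma> ll"
    using g(4)[of 0] g(4)[of n] n(1) by (auto simp: p_def)
  ultimately show ?thesis using h near
    by (intro exI[of _ "\<lambda>t. \<gamma> (real n * t + 0)"] exI[of _ "\<lambda>t. real n *\<^sub>R u (real n * t + 0)"] exI[of _ l]) blast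
qed

end

context carnot_coords
begin

declare One_nat_def [simp del]

abbreviation "W \<equiv> \<Psi> ` ball 0 R0"

section \<open>Horizontal curves in coordinates\<close>

lemma AA_lower: "x \<in> ball 0 R0 \<Longrightarrow> norm v \<le> 2 * norm (AA x v)"
  using AA_near[of x v] norm_triangle_sub[of v "AA x v"] by (simp add: norm_minus_commute)

lemma velocity_bound: "x \<in> ball 0 R0 \<Longrightarrow> AA x y' = X \<Longrightarrow> X \<in> V 1 \<Longrightarrow> norm y' \<le> C1 * N X"
  using AA_lower[of x y'] C1(2)[of X] by simp

lemma \<Psi>\<kappa>: "h \<in> W \<Longrightarrow> \<Psi> (\<kappa> h) = h" and \<kappa>_in: "h \<in> W \<Longrightarrow> \<kappa> h \<in> ball 0 R0"
  using \<kappa>_\<Psi> by auto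

lemma isCont_\<Psi>: "x \<in> ball 0 R0 \<Longrightarrow> isCont \<Psi> x"
  using \<Psi>_gder by (simp add: gder_def)

lemma \<kappa>_velocity:
  assumes "gder \<gamma> (\<lambda>v. v *\<^sub>R X) (t::real) UNIV" "\<gamma> t \<in> W"
  shows "\<exists>y'. ((\<lambda>t. \<kappa> (\<gamma> t)) has_vector_derivative y') (at t) \<and> AA (\<kappa> (\<gamma> t)) y' = X"
proof -
  obtain y' where y': "((\<lambda>t. \<kappa> (\<gamma> t)) has_derivative y') (at t)" "\<forall>v. AA (\<kappa> (\<gamma> t)) (y' v) = v *\<^sub>R X"
    using \<kappa>_deriv[OF assms] by blast
  have "y' v = v *\<^sub>R y' 1" for v
    using linear_scale[OF has_derivative_linear[OF y'(1)], of v 1] by simp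
  hence "y' = (\<lambda>v. v *\<^sub>R y' 1)" by blast
  hence "((\<lambda>t. \<kappa> (\<gamma> t)) has_vector_derivative y' 1) (at t)"
    using y'(1) unfolding has_vector_derivative_def by simp
  moreover have "AA (\<kappa> (\<gamma> t)) (y' 1) = X" using y'(2) by simp
  ultimately show ?thesis by blast
qed

text \<open>Horizontal curves with velocity \<open>u\<close>, written in coordinates.\<close>

definition "csol y u \<longleftrightarrow> continuous_on {0..1} y \<and> (\<forall>t\<in>{0..1}. y t \<in> ball 0 R0) \<and>
  (\<exists>T. finite T \<and> continuous_on ({0<..<1} - T) u \<and> (\<forall>t\<in>{0<..<1} - T. u t \<in> V 1 \<and>
     (\<exists>y'. (y has_vector_derivative y') (at (t::real)) \<and> AA (y t) y' = u t)))"

lemma coordinate_increment: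
  assumes cont: "continuous_on {0..t} y" and T: "finite T" and t: "t \<in> {0..1}"
    and inb: "\<And>r. r \<in> {0..t} \<Longrightarrow> y r \<in> ball 0 R0"
    and der: "\<And>r. r \<in> {0<..<t} - T \<Longrightarrow> \<exists>y'. (y has_vector_derivative y') (at r) \<and> AA (y r) y' = u r"
    and u: "\<And>r. r \<in> {0<..<1} - T \<Longrightarrow> u r \<in> V 1"
    and l: "((\<lambda>t. N (u t)) has_integral l) {0..1}"
  shows "norm (y t - y 0) \<le> C1 * l"
proof -
  note ip = N_integral_part[OF T u l t]
  have "norm (y t - y 0) \<le> integral {0..t} (\<lambda>r. C1 * N (u r))"
  proof (rule norm_increment_le_integral[where y' = "\<lambda>r. vector_derivative y (at r)"])
    show "0 \<le> t" using t by simp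
    show "finite T" "continuous_on {0..t} y" by fact+
    show "(\<lambda>r. C1 * N (u r)) integrable_on {0..t}" using ip(1) by (rule integrable_on_mult_right)
    fix r assume r: "r \<in> {0<..<t} - T"
    then obtain y' where y': "(y has_vector_derivative y') (at r)" "AA (y r) y' = u r" using der by blast
    show "(y has_vector_derivative vector_derivative y (at r)) (at r)"
      using y'(1) vector_derivative_at by force
    have "norm y' \<le> C1 * N (u r)" by (rule velocity_bound[OF inb y'(2) u]) (use r t in auto)
    thus "norm (vector_derivative y (at r)) \<le> C1 * N (u r)" using vector_derivative_at[OF y'(1)] by simp
  qed
  also have "\<dots> = C1 * integral {0..t} (\<lambda>r. N (u r))" by simp
  also have "\<dots> \<le> C1 * l" using ip(2) C1(1) by (intro mult_left_mono) auto
  finally show ?thesis .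
qed

text \<open>The coordinate speed is at most \<open>C1\<close> times the norm of the velocity, so a
  curve of length \<open>l\<close> moves by at most \<open>C1 * l\<close> as long as it is in the
  chart; \<open>no_escape\<close> removes this proviso.\<close>

lemma hc_csol:
  assumes h: "hc 0 1 \<gamma> u" and l: "((\<lambda>t. N (u t)) has_integral l) {0..1}"
    and x: "\<gamma> 0 = \<Psi> x" "norm x + C1 * l < R0"
  shows "csol (\<lambda>t. \<kappa> (\<gamma> t)) u"
    and "t \<in> {0..1} \<Longrightarrow> \<gamma> t \<in> \<Psi> ` cball 0 (norm x + C1 * l)"
proof -
  define r where "r = norm x + C1 * l"
  have l0: "0 \<le> l" by (rule hc_integral_nonneg[OF h l])
  have r: "norm x \<le> r" "r < R0" using l0 C1(1) x(2) by (auto simp: r_def)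
  obtain T where T: "continuous_on {0..1} \<gamma>" "finite T" "continuous_on ({0<..<1} - T) u"
    "\<And>t. t \<in> {0<..<1} - T \<Longrightarrow> u t \<in> V 1 \<and> gder \<gamma> (\<lambda>v. v *\<^sub>R u t) t UNIV"
    using h unfolding hc_def by blast
  have xb: "x \<in> ball 0 R0" using r by simp
  have sub: "cball 0 r \<subseteq> ball 0 R0" using r by auto
  have "continuous_on (cball 0 r) \<Psi>" using sub isCont_\<Psi> by (intro continuous_at_imp_continuous_on) auto
  \<comment> \<open>The image of the closed ball is compact, hence closed in the Hausdorff group, as
    \<open>no_escape\<close> requires.\<close>
  hence cl: "closed (\<Psi> ` cball 0 r)" by (intro compact_imp_closed compact_continuous_image) auto
  have all: "\<forall>t\<in>{0..1}. \<gamma> t \<in> \<Psi> ` cball 0 r"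
  proof (rule no_escape[OF T(1) open_W cl])
    show "\<Psi> ` cball 0 r \<subseteq> W" using sub by blast
    show "\<gamma> 0 \<in> \<Psi> ` cball 0 r" using x(1) r by auto
    fix t assume t: "t \<in> {0..1}" and inW: "\<forall>s\<in>{0..t}. \<gamma> s \<in> W"
    have "norm (\<kappa> (\<gamma> t) - \<kappa> (\<gamma> 0)) \<le> C1 * l"
    proof (rule coordinate_increment[OF _ T(2) t _ _ _ l])
      show "continuous_on {0..t} (\<lambda>t. \<kappa> (\<gamma> t))"
        by (rule continuous_on_compose2[OF cont_\<kappa> continuous_on_subset[OF T(1)]]) (use t inW in auto)
      show "\<kappa> (\<gamma> r) \<in> ball 0 R0" if "r \<in> {0..t}" for r using inW that \<kappa>_in by blast
      show "\<exists>y'. ((\<lambda>t. \<kappa> (\<gamma> t)) has_vector_derivative y') (at r) \<and> AA (\<kappa> (\<gamma> r)) y' = u r" if "r \<in> {0<..<t} - T" for r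
      proof (rule \<kappa>_velocity)
        show "gder \<gamma> (\<lambda>v. v *\<^sub>R u r) r UNIV" using T(4)[of r] that t by auto
        show "\<gamma> r \<in> W" using inW that by auto
      qed
      show "u r \<in> V 1" if "r \<in> {0<..<1} - T" for r using T(4)[OF that] by blast
    qed
    moreover have "\<kappa> (\<gamma> 0) = x" using x(1) \<kappa>_\<Psi>[OF xb] by simp
    ultimately have "\<kappa> (\<gamma> t) \<in> cball 0 r" using norm_triangle_sub[of "\<kappa> (\<gamma> t)" x] by (simp add: r_def)
    moreover have "\<gamma> t \<in> W" using inW t by auto
    ultimately show "\<gamma> t \<in> \<Psi> ` cball 0 r" using \<Psi>\<kappa> by (metis image_eqI)
  qed
  thus "t \<in> {0..1} \<Longrightarrow> \<gamma> t \<in> \<Psi> ` cball 0 (norm x + C1 * l)" by (simp add: r_def)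
  have allW: "\<gamma> t \<in> W" if "t \<in> {0..1}" for t using all sub that by blast
  show "csol (\<lambda>t. \<kappa> (\<gamma> t)) u" unfolding csol_def
  proof (intro conjI exI[of _ T] ballI)
    show "continuous_on {0..1} (\<lambda>t. \<kappa> (\<gamma> t))"
      by (rule continuous_on_compose2[OF cont_\<kappa> T(1)]) (use allW in auto)
    show "\<kappa> (\<gamma> t) \<in> ball 0 R0" if "t \<in> {0..1}" for t using allW that \<kappa>_in by blast
    show "finite T" "continuous_on ({0<..<1} - T) u" by fact+
    fix t assume t: "t \<in> {0<..<1} - T"
    show "u t \<in> V 1" using T(4)[OF t] by blast
    show "\<exists>y'. ((\<lambda>t. \<kappa> (\<gamma> t)) has_vector_derivative y') (at t) \<and> AA (\<kappa> (\<gamma> t)) y' = u t"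
      by (rule \<kappa>_velocity) (use T(4)[OF t] allW t in auto)
  qed
qed

lemma csol_hc: assumes "csol y u" shows "hc 0 1 (\<lambda>t. \<Psi> (y t)) u"
proof -
  obtain T where T: "continuous_on {0..1} y" "\<And>t. t \<in> {0..1} \<Longrightarrow> y t \<in> ball 0 R0" "finite T" "continuous_on ({0<..<1} - T) u"
    "\<And>t. t \<in> {0<..<1} - T \<Longrightarrow> u t \<in> V 1 \<and> (\<exists>y'. (y has_vector_derivative y') (at t) \<and> AA (y t) y' = u t)"
    using assms unfolding csol_def by blast
  show ?thesis unfolding hc_def
  proof (intro conjI exI[of _ T] ballI)
    have "continuous_on (ball 0 R0) \<Psi>" using isCont_\<Psi> by (intro continuous_at_imp_continuous_on) auto
    thus "continuous_on {0..1} (\<lambda>t. \<Psi> (y t))" by (rule continuous_on_compose2[OF _ T(1)]) (use T(2) in auto)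
    show "finite T" "continuous_on ({0<..<1} - T) u" by fact+
    fix t assume t: "t \<in> {0<..<1} - T"
    show "u t \<in> V 1" using T(5)[OF t] by blast
    obtain y' where y': "(y has_vector_derivative y') (at t)" "AA (y t) y' = u t" using T(5)[OF t] by blast
    have "gder (\<lambda>t. \<Psi> (y t)) (\<lambda>v. AA (y t) (v *\<^sub>R y')) t UNIV"
      by (rule gder_chain[of \<Psi> "AA (y t)" y t, OF \<Psi>_gder[OF T(2)]])
         (use t y'(1) in \<open>auto simp: has_vector_derivative_def\<close>)
    thus "gder (\<lambda>t. \<Psi> (y t)) (\<lambda>v. v *\<^sub>R u t) t UNIV" by (simp add: linear_scale[OF linear_AA] y'(2))
  qed
qed

lemma csol_\<delta>:
  assumes c: "csol y u" and r: "0 < r" "r \<le> 1" and inb: "\<And>t. t \<in> {0..1} \<Longrightarrow> \<delta> r (y t) \<in> ball 0 R0"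
  shows "csol (\<lambda>t. \<delta> r (y t)) (\<lambda>t. r *\<^sub>R u t)"
proof -
  obtain T where T: "continuous_on {0..1} y" "\<And>t. t \<in> {0..1} \<Longrightarrow> y t \<in> ball 0 R0" "finite T" "continuous_on ({0<..<1} - T) u"
    "\<And>t. t \<in> {0<..<1} - T \<Longrightarrow> u t \<in> V 1 \<and> (\<exists>y'. (y has_vector_derivative y') (at t) \<and> AA (y t) y' = u t)"
    using c unfolding csol_def by blast
  show ?thesis unfolding csol_def
  proof (intro conjI exI[of _ T] ballI)
    show "continuous_on {0..1} (\<lambda>t. \<delta> r (y t))"
      by (rule continuous_on_compose2[OF linear_continuous_on[OF bounded_linear_\<delta>] T(1)]) auto
    show "\<delta> r (y t) \<in> ball 0 R0" if "t \<in> {0..1}" for t by (rule inb[OF that])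
    show "finite T" by fact
    show "continuous_on ({0<..<1} - T) (\<lambda>t. r *\<^sub>R u t)" using T(4) by (intro continuous_intros)
    fix t assume t: "t \<in> {0<..<1} - T"
    have t1: "t \<in> {0..1}" using t by auto
    show "r *\<^sub>R u t \<in> V 1" using T(5)[OF t] subspace_scale[OF subspace_V[OF one_in]] by blast
    obtain y' where y': "(y has_vector_derivative y') (at t)" "AA (y t) y' = u t" using T(5)[OF t] by blast
    have "((\<lambda>t. \<delta> r (y t)) has_vector_derivative \<delta> r y') (at t)"
      by (rule bounded_linear.has_vector_derivative[OF bounded_linear_\<delta> y'(1)])
    moreover have "AA (\<delta> r (y t)) (\<delta> r y') = r *\<^sub>R u t"
      using AA_\<delta>[OF T(2)[OF t1] r inb[OF t1], of y'] y'(2) T(5)[OF t] \<delta>_V[OF one_in, of "u t" r] by simp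
    ultimately show "\<exists>y'. ((\<lambda>t. \<delta> r (y t)) has_vector_derivative y') (at t) \<and> AA (\<delta> r (y t)) y' = r *\<^sub>R u t" by blast
  qed
qed

text \<open>Enlarging by \<open>1 / r\<close> could leave the chart. As long as the enlarged curve
  stays inside, homogeneity shows that it is horizontal with length \<open>l / r\<close>, hence
  confined to a ball of radius \<open>C1 * (l / r)\<close>; \<open>no_escape\<close> then
  applies.\<close>

lemma csol_expand:
  assumes c: "csol y u" and l: "((\<lambda>t. N (u t)) has_integral l) {0..1}" and y0: "y 0 = 0"
    and r: "0 < r" "r \<le> 1" and small: "C1 * (l / r) < R0"
  shows "csol (\<lambda>t. \<delta> (1 / r) (y t)) (\<lambda>t. (1 / r) *\<^sub>R u t)"
    and "((\<lambda>t. N ((1 / r) *\<^sub>R u t)) has_integral l / r) {0..1}"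
    and "t \<in> {0..1} \<Longrightarrow> norm (\<delta> (1 / r) (y t)) \<le> C1 * (l / r)"
proof -
  obtain T where T: "continuous_on {0..1} y" "\<And>t. t \<in> {0..1} \<Longrightarrow> y t \<in> ball 0 R0" "finite T" "continuous_on ({0<..<1} - T) u"
    "\<And>t. t \<in> {0<..<1} - T \<Longrightarrow> u t \<in> V 1 \<and> (\<exists>y'. (y has_vector_derivative y') (at t) \<and> AA (y t) y' = u t)"
    using c unfolding csol_def by blast
  let ?Y = "\<lambda>t. \<delta> (1 / r) (y t)" and ?u = "\<lambda>t. (1 / r) *\<^sub>R u t"
  have bk: "\<delta> r (\<delta> (1 / r) x) = x" "\<delta> (1 / r) (\<delta> r x) = x" for x using r by (simp_all add: \<delta>_\<delta>)
  show l': "((\<lambda>t. N (?u t)) has_integral l / r) {0..1}"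
    using hc_N_scale_integral[OF csol_hc[OF c] l, of "1 / r"] r by simp
  have contY: "continuous_on {0..1} ?Y"
    by (rule continuous_on_compose2[OF linear_continuous_on[OF bounded_linear_\<delta>] T(1)]) auto
  have uV: "?u t \<in> V 1" if "t \<in> {0<..<1} - T" for t
    using T(5)[OF that] subspace_scale[OF subspace_V[OF one_in]] by blast
  have der: "\<exists>y'. (?Y has_vector_derivative y') (at t) \<and> AA (?Y t) y' = ?u t"
    if t: "t \<in> {0<..<1} - T" and Y: "?Y t \<in> ball 0 R0" for t
  proof -
    have t1: "t \<in> {0..1}" using t by auto
    obtain y' where y': "(y has_vector_derivative y') (at t)" "AA (y t) y' = u t" using T(5)[OF t] by blast
    have "(?Y has_vector_derivative \<delta> (1 / r) y') (at t)"
      by (rule bounded_linear.has_vector_derivative[OF bounded_linear_\<delta> y'(1)])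
    moreover have "AA (?Y t) (\<delta> (1 / r) y') = ?u t"
    proof -
      have "\<delta> r (?Y t) \<in> ball 0 R0" using T(2)[OF t1] by (simp add: bk)
      \<comment> \<open>Homogeneity is stated for contractions, so it is applied at the enlarged
        point, whose contraction by \<open>r\<close> is the original one, and then inverted.\<close>
      from AA_\<delta>[OF Y r this, of "\<delta> (1 / r) y'"]
      have "u t = \<delta> r (AA (?Y t) (\<delta> (1 / r) y'))" by (simp add: bk y'(2))
      hence "\<delta> (1 / r) (u t) = AA (?Y t) (\<delta> (1 / r) y')" by (simp add: bk)
      thus ?thesis using \<delta>_V[OF one_in, of "u t" "1 / r"] T(5)[OF t] by simp
    qed
    ultimately show ?thesis by blast
  qed
  have l0: "0 \<le> l / r" using hc_integral_nonneg[OF csol_hc[OF c] l] r by simp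
  have all: "\<forall>t\<in>{0..1}. ?Y t \<in> cball 0 (C1 * (l / r))"
  proof (rule no_escape[OF contY open_ball closed_cball])
    show "cball 0 (C1 * (l / r)) \<subseteq> ball 0 R0" using small by auto
    show "?Y 0 \<in> cball 0 (C1 * (l / r))" using y0 linear_0[OF linear_\<delta>] mult_nonneg_nonneg[OF less_imp_le[OF C1(1)] l0] by simp
    fix t :: real
    assume t: "t \<in> {0..1}" and inb: "\<forall>s\<in>{0..t}. ?Y s \<in> ball 0 R0"
    have "norm (?Y t - ?Y 0) \<le> C1 * (l / r)"
    proof (rule coordinate_increment[OF _ T(3) t _ _ uV l'])
      show "continuous_on {0..t} ?Y" by (rule continuous_on_subset[OF contY]) (use t in auto)
      show "?Y r \<in> ball 0 R0" if "r \<in> {0..t}" for r using inb that by blast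
      show "\<exists>y'. (?Y has_vector_derivative y') (at s) \<and> AA (?Y s) y' = ?u s" if "s \<in> {0<..<t} - T" for s
        by (rule der) (use that t inb in auto)
    qed
    thus "?Y t \<in> cball 0 (C1 * (l / r))" using y0 linear_0[OF linear_\<delta>] by simp
  qed
  have bd: "norm (?Y t) \<le> C1 * (l / r)" if "t \<in> {0..1}" for t using all that by simp
  thus "t \<in> {0..1} \<Longrightarrow> norm (?Y t) \<le> C1 * (l / r)" .
  have inb: "?Y t \<in> ball 0 R0" if "t \<in> {0..1}" for t using bd[OF that] small by simp
  show "csol ?Y ?u" unfolding csol_def
  proof (intro conjI exI[of _ T] ballI contY T(3))
    show "?Y t \<in> ball 0 R0" if "t \<in> {0..1}" for t by (rule inb[OF that])
    show "continuous_on ({0<..<1} - T) ?u" using T(4) by (intro continuous_intros)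
    fix t assume t: "t \<in> {0<..<1} - T"
    show "?u t \<in> V 1" by (rule uV[OF t])
    show "\<exists>y'. (?Y has_vector_derivative y') (at t) \<and> AA (?Y t) y' = ?u t"
      by (rule der[OF t inb]) (use t in auto)
  qed
qed

lemma AA_lipschitz:
  assumes "x \<in> ball 0 R0" "y \<in> ball 0 R0"
  shows "norm (AA x v - AA y v) \<le> CA * norm v * norm (x - y)"
proof (rule differentiable_bound[OF convex_ball _ _ assms])
  fix z :: 'e assume z: "z \<in> ball 0 R0"
  show "((\<lambda>x. AA x v) has_derivative DA z v) (at z within ball 0 R0)"
    using AA_deriv[OF z] by (rule has_derivative_at_withinI)
  show "onorm (DA z v) \<le> CA * norm v" by (rule onorm_le) (rule DA_bound[OF z])
qed

text \<open>Since \<open>u = P 1 y'\<close>, the difference of the two equations is the derivative of \<open>AA (y2 t) (D t) - P 1 (D t)\<close>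
  up to terms bounded by \<open>D\<close> times the speeds; only the sup norm of \<open>P 1 \<circ> D\<close> enters, not its derivative.\<close>

lemma compare:
  assumes c1: "csol y1 u1" and c2: "csol y2 u2" and y0: "y1 0 = y2 0"
    and l1: "((\<lambda>t. N (u1 t)) has_integral l1) {0..1}" and l2: "((\<lambda>t. N (u2 t)) has_integral l2) {0..1}"
    and \<epsilon>: "\<And>t. t \<in> {0..1} \<Longrightarrow> norm (P 1 (y1 t) - P 1 (y2 t)) \<le> \<epsilon>"
    and small: "DIM('e) * CA * C1 * (l1 + l2) \<le> 1 / 4" and t: "t \<in> {0..1}"
  shows "norm (y1 t - y2 t) \<le> 4 * \<epsilon>"
proof -
  obtain T1 where T1: "continuous_on {0..1} y1" "\<And>t. t \<in> {0..1} \<Longrightarrow> y1 t \<in> ball 0 R0" "finite T1"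
    "\<And>t. t \<in> {0<..<1} - T1 \<Longrightarrow> u1 t \<in> V 1 \<and> (\<exists>y'. (y1 has_vector_derivative y') (at t) \<and> AA (y1 t) y' = u1 t)"
    using c1 unfolding csol_def by blast
  obtain T2 where T2: "continuous_on {0..1} y2" "\<And>t. t \<in> {0..1} \<Longrightarrow> y2 t \<in> ball 0 R0" "finite T2"
    "\<And>t. t \<in> {0<..<1} - T2 \<Longrightarrow> u2 t \<in> V 1 \<and> (\<exists>y'. (y2 has_vector_derivative y') (at t) \<and> AA (y2 t) y' = u2 t)"
    using c2 unfolding csol_def by blast
  define D where "D t = y1 t - y2 t" for t
  have contD: "continuous_on {0..1} D" unfolding D_def by (intro continuous_intros T1 T2)
  have "\<exists>tm\<in>{0..1}. \<forall>t\<in>{0..1}. norm (D t) \<le> norm (D tm)"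
    by (rule continuous_attains_sup) (auto intro!: continuous_intros contD)
  then obtain tm where tm: "tm \<in> {0..1}" "\<And>t. t \<in> {0..1} \<Longrightarrow> norm (D t) \<le> norm (D tm)" by blast
  \<comment> \<open>The estimate of \<open>E\<close> is made relative to the maximum of the
    difference and is absorbed into that maximum at the end.\<close>
  define M where "M = norm (D tm)"
  define E where "E t = (\<Sum>b\<in>Basis. (D t \<bullet> b) *\<^sub>R AA (y2 t) b) - P 1 (D t)" for t
  have E: "E t = AA (y2 t) (D t) - P 1 (D t)" for t
    using linear_euclidean_expansion[OF linear_AA, of "y2 t" "D t"] by (simp add: E_def)
  have contAA: "continuous_on {0..1} (\<lambda>t. AA (y2 t) b)" for b
  proof (rule continuous_on_compose2[OF _ T2(1)])
    show "continuous_on (ball 0 R0) (\<lambda>x. AA x b)"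
      using has_derivative_continuous[OF AA_deriv] by (intro continuous_at_imp_continuous_on) auto
  qed (use T2(2) in auto)
  have contE: "continuous_on {0..1} E" unfolding E_def
    by (intro continuous_intros contD contAA continuous_on_compose2[OF linear_continuous_on[OF bounded_linear_P[OF one_in]] contD]) auto
  define k where "k = DIM('e) * CA * M * C1"
  have Eb: "norm (E t) \<le> M / 4" if t: "t \<in> {0..1}" for t
  proof -
    let ?w = "\<lambda>r. k * N (u1 r) + k * N (u2 r)"
    note i1 = N_integral_part[OF T1(3) conjunct1[OF T1(4)] l1 t] and i2 = N_integral_part[OF T2(3) conjunct1[OF T2(4)] l2 t]
    have ex: "\<exists>E'. (E has_vector_derivative E') (at r) \<and> norm E' \<le> ?w r" if r: "r \<in> {0<..<t} - (T1 \<union> T2)" for r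
    proof -
      have r1: "r \<in> {0..1}" "r \<in> {0<..<1} - T1" "r \<in> {0<..<1} - T2" using r t by auto
      obtain a1 where a1: "(y1 has_vector_derivative a1) (at r)" "AA (y1 r) a1 = u1 r" using T1(4)[OF r1(2)] by blast
      obtain a2 where a2: "(y2 has_vector_derivative a2) (at r)" "AA (y2 r) a2 = u2 r" using T2(4)[OF r1(3)] by blast
      have uV: "u1 r \<in> V 1" "u2 r \<in> V 1" using T1(4)[OF r1(2)] T2(4)[OF r1(3)] by auto
      note yb = T1(2)[OF r1(1)] T2(2)[OF r1(1)]
      have dD: "(D has_vector_derivative (a1 - a2)) (at r)"
        unfolding D_def using a1(1) a2(1) by (rule has_vector_derivative_diff)
      have dA: "((\<lambda>t. AA (y2 t) b) has_vector_derivative DA (y2 r) b a2) (at r)" for b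
      proof -
        have "((\<lambda>t. AA (y2 t) b) has_derivative (\<lambda>h. DA (y2 r) b (h *\<^sub>R a2))) (at r)"
          by (rule has_derivative_compose[OF a2(1)[unfolded has_vector_derivative_def] AA_deriv[OF yb(2)]])
        thus ?thesis using linear_scale[OF has_derivative_linear[OF AA_deriv[OF yb(2)]]]
          by (simp add: has_vector_derivative_def)
      qed
      have dDb: "((\<lambda>t. D t \<bullet> b) has_real_derivative (a1 - a2) \<bullet> b) (at r)" for b
        using bounded_linear.has_vector_derivative[OF bounded_linear_inner_left dD]
        by (simp add: has_real_derivative_iff_has_vector_derivative)
      define E' where "E' = (\<Sum>b\<in>Basis. (D r \<bullet> b) *\<^sub>R DA (y2 r) b a2 + ((a1 - a2) \<bullet> b) *\<^sub>R AA (y2 r) b) - P 1 (a1 - a2)"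
      have "(E has_vector_derivative E') (at r)" unfolding E_def[abs_def] E'_def
        by (intro has_vector_derivative_diff has_vector_derivative_sum has_vector_derivative_scaleR dDb dA
            bounded_linear.has_vector_derivative[OF bounded_linear_P[OF one_in]] dD)
      moreover have "norm E' \<le> ?w r"
      proof -
        have s1: "(\<Sum>b\<in>Basis. ((a1 - a2) \<bullet> b) *\<^sub>R AA (y2 r) b) = AA (y2 r) a1 - u2 r"
          using linear_euclidean_expansion[OF linear_AA, of "y2 r" "a1 - a2"] a2(2) by (simp add: linear_diff[OF linear_AA])
        have "P 1 a1 = u1 r" using P1_AA[OF yb(1), of a1] a1(2) P_V[OF one_in one_in uV(1)] by simp
        moreover have "P 1 a2 = u2 r" using P1_AA[OF yb(2), of a2] a2(2) P_V[OF one_in one_in uV(2)] by simp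
        \<comment> \<open>Since \<open>P 1 a1 = u1 r\<close> and \<open>P 1 a2 = u2 r\<close>, both
          velocities cancel. There remain the motion of the frame along \<open>y2\<close> and the
          difference of the frames at the two curves, both controlled by \<open>M\<close>.\<close>
        ultimately have E'2: "E' = (\<Sum>b\<in>Basis. (D r \<bullet> b) *\<^sub>R DA (y2 r) b a2) + (AA (y2 r) a1 - AA (y1 r) a1)"
          unfolding E'_def sum.distrib s1 by (simp add: linear_diff[OF linear_P[OF one_in]] a1(2))
        have DM: "norm (D r) \<le> M" using tm(2)[OF r1(1)] by (simp add: M_def)
        have M0: "M \<ge> 0" by (simp add: M_def)
        have v: "norm a1 \<le> C1 * N (u1 r)" "norm a2 \<le> C1 * N (u2 r)"
          using velocity_bound[OF yb(1) a1(2) uV(1)] velocity_bound[OF yb(2) a2(2) uV(2)] by auto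
        have nn: "0 \<le> C1 * N (u1 r)" "0 \<le> C1 * N (u2 r)" using v norm_ge_zero order_trans by blast+
        have "norm (\<Sum>b\<in>Basis. (D r \<bullet> b) *\<^sub>R DA (y2 r) b a2) \<le> (\<Sum>b\<in>(Basis::'e set). M * (CA * 1 * (C1 * N (u2 r))))"
        proof (rule sum_norm_le)
          fix b :: 'e assume b: "b \<in> Basis"
          have "\<bar>D r \<bullet> b\<bar> \<le> M" using Basis_le_norm[OF b, of "D r"] DM by simp
          moreover have "norm (DA (y2 r) b a2) \<le> CA * 1 * (C1 * N (u2 r))"
            using DA_bound[OF yb(2), of b a2] b CA v(2) mult_left_mono[OF v(2), of CA] by simp
          ultimately show "norm ((D r \<bullet> b) *\<^sub>R DA (y2 r) b a2) \<le> M * (CA * 1 * (C1 * N (u2 r)))"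
            using M0 by (simp add: mult_mono)
        qed
        hence p1: "norm (\<Sum>b\<in>Basis. (D r \<bullet> b) *\<^sub>R DA (y2 r) b a2) \<le> k * N (u2 r)"
          by (simp add: k_def algebra_simps)
        have "norm (AA (y2 r) a1 - AA (y1 r) a1) \<le> CA * norm a1 * norm (y2 r - y1 r)"
          by (rule AA_lipschitz[OF yb(2,1)])
        also have "norm (y2 r - y1 r) = norm (D r)" by (simp add: D_def norm_minus_commute)
        also have "CA * norm a1 * norm (D r) \<le> CA * (C1 * N (u1 r)) * M"
          using CA v(1) DM nn by (intro mult_mono) auto
        also have "\<dots> = 1 * (CA * (C1 * N (u1 r)) * M)" by simp
        also have "\<dots> \<le> DIM('e) * (CA * (C1 * N (u1 r)) * M)"
        proof (rule mult_right_mono)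
          show "1 \<le> real DIM('e)" using DIM_positive[where 'a = 'e] by linarith
          show "0 \<le> CA * (C1 * N (u1 r)) * M" by (rule mult_nonneg_nonneg[OF mult_nonneg_nonneg[OF CA nn(1)] M0])
        qed
        also have "\<dots> = k * N (u1 r)" by (simp add: k_def algebra_simps)
        finally have p2: "norm (AA (y2 r) a1 - AA (y1 r) a1) \<le> k * N (u1 r)" .
        show ?thesis unfolding E'2 using p1 p2 norm_triangle_le by (smt (verit))
      qed
      ultimately show ?thesis by blast
    qed
    have "norm (E t - E 0) \<le> integral {0..t} ?w"
    proof (rule norm_increment_le_integral[where y' = "\<lambda>r. vector_derivative E (at r)" and T = "T1 \<union> T2"])
      show "0 \<le> t" "finite (T1 \<union> T2)" using t T1 T2 by auto
      show "continuous_on {0..t} E" by (rule continuous_on_subset[OF contE]) (use t in auto)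
      show "?w integrable_on {0..t}" by (intro integrable_add integrable_on_mult_right i1 i2)
      fix r assume r: "r \<in> {0<..<t} - (T1 \<union> T2)"
      from ex[OF r] obtain E' where E': "(E has_vector_derivative E') (at r)" "norm E' \<le> ?w r" by blast
      show "(E has_vector_derivative vector_derivative E (at r)) (at r)" "norm (vector_derivative E (at r)) \<le> ?w r"
        using E' vector_derivative_at[OF E'(1)] by auto
    qed
    also have "\<dots> = k * integral {0..t} (\<lambda>r. N (u1 r)) + k * integral {0..t} (\<lambda>r. N (u2 r))"
      using i1(1) i2(1) by (simp add: Henstock_Kurzweil_Integration.integral_add integrable_on_mult_right)
    also have "\<dots> \<le> k * l1 + k * l2"
      using i1(2) i2(2) CA C1(1) by (intro add_mono mult_left_mono) (auto simp: k_def M_def)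
    also have "\<dots> = M * (DIM('e) * CA * C1 * (l1 + l2))" by (simp add: k_def algebra_simps)
    also have "\<dots> \<le> M * (1 / 4)" using small by (intro mult_left_mono) (auto simp: M_def)
    finally show ?thesis using y0 linear_0[OF linear_P[OF one_in]] linear_0[OF linear_AA] by (simp add: E D_def)
  qed
  have "M \<le> 2 * norm (AA (y2 tm) (D tm))" unfolding M_def by (rule AA_lower[OF T2(2)[OF tm(1)]])
  also have "AA (y2 tm) (D tm) = E tm + P 1 (D tm)" by (simp add: E)
  also have "2 * norm (E tm + P 1 (D tm)) \<le> 2 * (M / 4 + \<epsilon>)"
    using Eb[OF tm(1)] \<epsilon>[OF tm(1)] norm_triangle_ineq[of "E tm" "P 1 (D tm)"]
    by (simp add: D_def linear_diff[OF linear_P[OF one_in]])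
  \<comment> \<open>The bound reads \<open>M \<le> 2 * (M / 4 + \<epsilon>)\<close>, and half of
    \<open>M\<close> moves to the left.\<close>
  finally have "M \<le> 4 * \<epsilon>" by simp
  thus ?thesis using tm(2)[OF t] by (simp add: M_def D_def)
qed

end

section \<open>Pansu differentiability of curves\<close>

context carnot_coords
begin

declare One_nat_def [simp del]

text \<open>Contractions \<delta> r may enlarge norms by the factor \<open>CD\<close>; starting from
  this smaller radius they stay in the coordinate ball.\<close>

definition "R1 = R0 / CD"

lemma R1: "0 < R1" "R1 \<le> R0" "norm x < R1 \<Longrightarrow> 0 \<le> r \<Longrightarrow> r \<le> 1 \<Longrightarrow> \<delta> r x \<in> ball 0 R0"
proof -
  have CD0: "CD > 0" using CD(1) by simp
  show "0 < R1" using R0 CD0 by (simp add: R1_def)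
  have "R0 / CD \<le> R0 / 1" using R0 CD(1) by (intro divide_left_mono) auto
  thus "R1 \<le> R0" by (simp add: R1_def)
  assume x: "norm x < R1" and r: "0 \<le> r" "r \<le> 1"
  have "norm (\<delta> r x) \<le> CD * norm x" by (rule CD(2)[OF r])
  also have "\<dots> < CD * R1" using x CD0 by simp
  also have "\<dots> = R0" using CD0 by (simp add: R1_def)
  finally show "\<delta> r x \<in> ball 0 R0" by simp
qed

section \<open>The horizontal projection\<close>

definition "\<pi> h = P 1 (\<kappa> h)"

lemma reach_e_coord:
  assumes "reach e z l" "C1 * l < R0"
  shows "z \<in> W" "norm (\<kappa> z) \<le> C1 * l" "norm (\<pi> z) \<le> CP * (C1 * l)"
proof -
  obtain \<gamma> u where g: "hc 0 1 \<gamma> u" "\<gamma> 0 = e" "\<gamma> 1 = z" "((\<lambda>t. N (u t)) has_integral l) {0..1}"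
    using assms(1) unfolding reach_def by blast
  have "\<gamma> 1 \<in> \<Psi> ` cball 0 (norm (0::'e) + C1 * l)"
    by (rule hc_csol(2)[OF g(1,4)]) (use g(2) \<Psi>_0 assms(2) in auto)
  then obtain x where x: "z = \<Psi> x" "norm x \<le> C1 * l" using g(3) by auto
  have xb: "x \<in> ball 0 R0" using x assms(2) by simp
  show "z \<in> W" using x xb by blast
  show n: "norm (\<kappa> z) \<le> C1 * l" using x \<kappa>_\<Psi>[OF xb] by simp
  have "norm (\<pi> z) \<le> CP * norm (\<kappa> z)" unfolding \<pi>_def by (rule CP(2))
  also have "\<dots> \<le> CP * (C1 * l)" using n CP(1) by (rule mult_left_mono)
  finally show "norm (\<pi> z) \<le> CP * (C1 * l)" .
qed

text \<open>A horizontal curve from \<open>e\<close> to \<open>z\<close> and its left translate have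
  the same velocity, and by \<open>P1_AA\<close> the velocity determines the derivative of the
  projection. So both projections change by the same amount; near \<open>e\<close> the map \<pi>
  behaves like a homomorphism.\<close>

lemma \<pi>_mult:
  assumes x: "norm x + C1 * l < R0" and z: "reach e z l"
  shows "\<pi> (\<Psi> x \<odot> z) = \<pi> (\<Psi> x) + \<pi> z" "\<Psi> x \<odot> z \<in> W"
proof -
  obtain \<gamma> u where g: "hc 0 1 \<gamma> u" "\<gamma> 0 = e" "\<gamma> 1 = z" and l: "((\<lambda>t. N (u t)) has_integral l) {0..1}"
    using z unfolding reach_def by blast
  have l0: "0 \<le> l" by (rule reach_nonneg[OF z])
  have C1l: "0 \<le> C1 * l" using l0 C1(1) by simp
  let ?g = "\<lambda>t. \<Psi> x \<odot> \<gamma> t"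
  have g0: "\<gamma> 0 = \<Psi> 0" "?g 0 = \<Psi> x" using g(2) \<Psi>_0 by auto
  have n0: "norm (0::'e) + C1 * l < R0" using x norm_ge_zero[of x] by (simp add: order_le_less_trans[rotated])
  have c1: "csol (\<lambda>t. \<kappa> (?g t)) u" by (rule hc_csol(1)[OF hc_left[OF g(1)] l g0(2) x])
  have c2: "csol (\<lambda>t. \<kappa> (\<gamma> t)) u" by (rule hc_csol(1)[OF g(1) l g0(1) n0])
  have "?g 1 \<in> \<Psi> ` cball 0 (norm x + C1 * l)" by (rule hc_csol(2)[OF hc_left[OF g(1)] l g0(2) x]) simp
  thus "\<Psi> x \<odot> z \<in> W" using x g(3) by auto
  obtain T1 where T1: "continuous_on {0..1} (\<lambda>t. \<kappa> (?g t))" "\<And>t. t \<in> {0..1} \<Longrightarrow> \<kappa> (?g t) \<in> ball 0 R0" "finite T1"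
    "\<And>t. t \<in> {0<..<1} - T1 \<Longrightarrow> u t \<in> V 1 \<and> (\<exists>y'. ((\<lambda>t. \<kappa> (?g t)) has_vector_derivative y') (at t) \<and> AA (\<kappa> (?g t)) y' = u t)"
    using c1 unfolding csol_def by blast
  obtain T2 where T2: "continuous_on {0..1} (\<lambda>t. \<kappa> (\<gamma> t))" "\<And>t. t \<in> {0..1} \<Longrightarrow> \<kappa> (\<gamma> t) \<in> ball 0 R0" "finite T2"
    "\<And>t. t \<in> {0<..<1} - T2 \<Longrightarrow> u t \<in> V 1 \<and> (\<exists>y'. ((\<lambda>t. \<kappa> (\<gamma> t)) has_vector_derivative y') (at t) \<and> AA (\<kappa> (\<gamma> t)) y' = u t)"
    using c2 unfolding csol_def by blast
  let ?F = "\<lambda>t. \<pi> (?g t) - \<pi> (\<gamma> t)"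
  note blP = bounded_linear_P[OF one_in]
  have "?F 1 = ?F 0"
  proof (rule has_derivative_zero_unique_strong_interval[of "insert 0 (insert 1 (T1 \<union> T2))" 0 1 ?F "?F 0" 1])
    show "finite (insert 0 (insert 1 (T1 \<union> T2)))" using T1 T2 by simp
    show "continuous_on {0..1} ?F" unfolding \<pi>_def
      by (intro continuous_intros continuous_on_compose2[OF linear_continuous_on[OF blP] T1(1)]
          continuous_on_compose2[OF linear_continuous_on[OF blP] T2(1)]) auto
    fix t :: real assume t: "t \<in> {0..1} - insert 0 (insert 1 (T1 \<union> T2))"
    have t1: "t \<in> {0..1}" "t \<in> {0<..<1} - T1" "t \<in> {0<..<1} - T2" using t by auto
    obtain a1 where a1: "((\<lambda>t. \<kappa> (?g t)) has_vector_derivative a1) (at t)" "AA (\<kappa> (?g t)) a1 = u t" using T1(4)[OF t1(2)] by blast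
    obtain a2 where a2: "((\<lambda>t. \<kappa> (\<gamma> t)) has_vector_derivative a2) (at t)" "AA (\<kappa> (\<gamma> t)) a2 = u t" using T2(4)[OF t1(3)] by blast
    have "P 1 a1 = P 1 a2" using P1_AA[OF T1(2)[OF t1(1)], of a1] P1_AA[OF T2(2)[OF t1(1)], of a2] a1(2) a2(2) by simp
    moreover have "(?F has_vector_derivative (P 1 a1 - P 1 a2)) (at t)" unfolding \<pi>_def
      by (intro has_vector_derivative_diff bounded_linear.has_vector_derivative[OF blP] a1 a2)
    ultimately have "(?F has_derivative (\<lambda>h. 0)) (at t)" by (simp add: has_vector_derivative_def)
    thus "(?F has_derivative (\<lambda>h. 0)) (at t within {0..1})" by (rule has_derivative_at_withinI)
  qed auto
  moreover have "\<pi> e = 0" using \<kappa>_\<Psi>[of 0] R0 \<Psi>_0 linear_0[OF linear_P[OF one_in]] by (simp add: \<pi>_def)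
  ultimately show "\<pi> (\<Psi> x \<odot> z) = \<pi> (\<Psi> x) + \<pi> z" using g(2,3) by (simp add: algebra_simps)
qed

text \<open>Closeness in coordinates implies closeness in the distance, uniformly on a compact ball:
  along a subsequence of counterexamples both points converge to one point, so their quotient tends
  to \<open>e\<close>, contradicting \<open>chow_local\<close>.\<close>

lemma uniform_chow:
  assumes R2: "R2 < R0" and \<epsilon>: "\<epsilon> > 0"
  shows "\<exists>\<eta>>0. \<forall>x1 x2. norm x1 \<le> R2 \<longrightarrow> norm x2 \<le> R2 \<longrightarrow> norm (x1 - x2) \<le> \<eta> \<longrightarrow> (\<exists>l<\<epsilon>. reach (\<Psi> x1) (\<Psi> x2) l)"
proof (rule ccontr)
  assume contr: "\<not> ?thesis"
  have "\<exists>x1 x2. norm x1 \<le> R2 \<and> norm x2 \<le> R2 \<and> norm (x1 - x2) \<le> inverse (real (Suc n)) \<and> \<not> (\<exists>l<\<epsilon>. reach (\<Psi> x1) (\<Psi> x2) l)" for n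
  proof -
    have "inverse (real (Suc n)) > 0" by simp
    thus ?thesis using contr by meson
  qed
  then obtain f g where fg: "\<And>n. norm (f n) \<le> R2" "\<And>n. norm (g n) \<le> R2" "\<And>n. norm (f n - g n) \<le> inverse (real (Suc n))"
    "\<And>n. \<not> (\<exists>l<\<epsilon>. reach (\<Psi> (f n)) (\<Psi> (g n)) l)" by metis
  have "seq_compact (cball (0::'e) R2)" using compact_cball compact_imp_seq_compact by blast
  moreover have "\<forall>n. f n \<in> cball 0 R2" using fg(1) by simp
  ultimately obtain x q where x: "x \<in> cball 0 R2" "strict_mono q" "(f \<circ> q) \<longlonglongrightarrow> x"
    unfolding seq_compact_def by meson
  have xb: "x \<in> ball 0 R0" using x(1) R2 by simp
  have "(\<lambda>n. f n - g n) \<longlonglongrightarrow> 0"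
    by (rule Lim_null_comparison[OF always_eventually LIMSEQ_inverse_real_of_nat]) (use fg(3) in blast)
  hence "((\<lambda>n. f n - g n) \<circ> q) \<longlonglongrightarrow> 0" using x(2) by (rule LIMSEQ_subseq_LIMSEQ)
  from tendsto_diff[OF x(3) this] have gq: "(\<lambda>n. g (q n)) \<longlonglongrightarrow> x" by (simp add: o_def)
  have fq: "(\<lambda>n. f (q n)) \<longlonglongrightarrow> x" using x(3) by (simp add: o_def)
  have "(\<lambda>n. iv (\<Psi> (f (q n))) \<odot> \<Psi> (g (q n))) \<longlonglongrightarrow> iv (\<Psi> x) \<odot> \<Psi> x"
    by (intro tendsto_mul tendsto_iv isCont_tendsto_compose[OF isCont_\<Psi>[OF xb]] fq gq)
  moreover obtain O1 where O1: "open O1" "e \<in> O1" "\<forall>h\<in>O1. \<exists>l<\<epsilon>. reach e h l"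
    using chow_local[OF \<epsilon>] by (auto simp: eventually_nhds)
  ultimately have "\<forall>\<^sub>F n in sequentially. iv (\<Psi> (f (q n))) \<odot> \<Psi> (g (q n)) \<in> O1"
    by (intro topological_tendstoD) (auto simp: G.left_inverse)
  then obtain n where "iv (\<Psi> (f (q n))) \<odot> \<Psi> (g (q n)) \<in> O1" by (auto simp: eventually_sequentially)
  then obtain l where l: "l < \<epsilon>" "reach e (iv (\<Psi> (f (q n))) \<odot> \<Psi> (g (q n))) l" using O1(3) by blast
  from reach_left[OF l(2), of "\<Psi> (f (q n))"] have "reach (\<Psi> (f (q n))) (\<Psi> (g (q n))) l" by simp
  thus False using fg(4) l(1) by blast
qed

text \<open>The joining curve stays within norm \<open>R1\<close>, so all its contractions stay in
  the coordinate ball and are horizontal, with length multiplied by \<open>r\<close>.\<close>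

lemma scaling:
  assumes x: "norm x1 + C1 * l < R1" "x2 \<in> ball 0 R0" and h: "reach (\<Psi> x1) (\<Psi> x2) l" and r: "0 < r" "r \<le> 1"
  shows "reach (\<Psi> (\<delta> r x1)) (\<Psi> (\<delta> r x2)) (r * l)"
proof -
  obtain \<gamma> u where g: "hc 0 1 \<gamma> u" "\<gamma> 0 = \<Psi> x1" "\<gamma> 1 = \<Psi> x2" and l: "((\<lambda>t. N (u t)) has_integral l) {0..1}"
    using h unfolding reach_def by blast
  have C1l: "0 \<le> C1 * l" using reach_nonneg[OF h] C1(1) by simp
  have x0: "norm x1 + C1 * l < R0" using x(1) R1(2) by simp
  have x1b: "x1 \<in> ball 0 R0" using x0 C1l by simp
  note c = hc_csol[OF g(1) l g(2) x0]
  have small: "norm (\<kappa> (\<gamma> t)) < R1" if "t \<in> {0..1}" for t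
  proof -
    have "\<gamma> t \<in> \<Psi> ` cball 0 (norm x1 + C1 * l)" by (rule c(2)[OF that])
    then obtain y where y: "\<gamma> t = \<Psi> y" "norm y \<le> norm x1 + C1 * l" by auto
    have "y \<in> ball 0 R0" using y x0 by simp
    thus ?thesis using \<kappa>_\<Psi> y x(1) by simp
  qed
  have "csol (\<lambda>t. \<delta> r (\<kappa> (\<gamma> t))) (\<lambda>t. r *\<^sub>R u t)"
    using r by (intro csol_\<delta>[OF c(1)] R1(3) small) auto
  from csol_hc[OF this] have "hc 0 1 (\<lambda>t. \<Psi> (\<delta> r (\<kappa> (\<gamma> t)))) (\<lambda>t. r *\<^sub>R u t)" .
  moreover have "((\<lambda>t. N (r *\<^sub>R u t)) has_integral (r * l)) {0..1}"
    using hc_N_scale_integral[OF g(1) l, of r] r by simp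
  moreover have "\<kappa> (\<gamma> 0) = x1" "\<kappa> (\<gamma> 1) = x2" using g(2,3) \<kappa>_\<Psi> x1b x(2) by auto
  ultimately show ?thesis unfolding reach_def
    by (intro exI[of _ "\<lambda>t. \<Psi> (\<delta> r (\<kappa> (\<gamma> t)))"] exI[of _ "\<lambda>t. r *\<^sub>R u t"]) auto
qed

section \<open>Approximation of short curve pieces by dilations of their endpoints\<close>

definition "Dil r h = \<Psi> (\<delta> r (\<kappa> h))"

text \<open>Horizontal approximations of \<sigma> on \<open>{0..a}\<close> and on
  \<open>{0..ll}\<close> are enlarged to the scale \<open>l0\<close>, and the second is also
  contracted by \<open>a / ll\<close>. Both projections then follow the same straight line closely,
  so by \<open>compare\<close> the endpoints are close in coordinates, by
  \<open>uniform_chow\<close> close in distance, and scaling back makes the error proportional to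
  \<open>ll\<close>.\<close>

lemma pansu_step:
  assumes K: "K > 0" and \<epsilon>: "\<epsilon> > 0"
  shows "\<exists>\<epsilon>1>0. \<exists>ll1>0. \<forall>\<sigma> ll a v. 0 < a \<longrightarrow> a \<le> ll \<longrightarrow> ll < ll1 \<longrightarrow> \<sigma> 0 = e \<longrightarrow>
     (\<forall>p\<in>{0..ll}. \<forall>q\<in>{0..ll}. d (\<sigma> p) (\<sigma> q) \<le> K * \<bar>p - q\<bar>) \<longrightarrow>
     (\<forall>t\<in>{0..ll}. norm (\<pi> (\<sigma> t) - t *\<^sub>R v) \<le> \<epsilon>1 * ll) \<longrightarrow>
     d (\<sigma> a) (Dil (a / ll) (\<sigma> ll)) \<le> \<epsilon> * ll"
proof -
  define D where "D = real DIM('e)"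
  \<comment> \<open>The first bound keeps the enlarged curves within a quarter of \<open>R1\<close>;
    the second is the smallness condition of \<open>compare\<close>. The summand in
    \<open>CA + 1\<close> avoids division by zero. Nothing here depends on \<epsilon>.\<close>
  define l0 where "l0 = min (R1 / (8 * C1 * K)) (1 / (16 * D * (CA + 1) * C1 * K))"
  have D: "D > 0" by (simp add: D_def)
  have l0: "l0 > 0" using R1(1) C1(1) K D CA by (auto simp: l0_def)
  define Q where "Q = C1 * (2 * K * l0)"
  have Q0: "Q > 0" using C1(1) K l0 by (simp add: Q_def)
  have "C1 * (8 * K) * l0 \<le> C1 * (8 * K) * (R1 / (8 * C1 * K))"
    using C1(1) K by (intro mult_left_mono) (auto simp: l0_def)
  also have "\<dots> = R1" using C1(1) K by simp
  finally have QR: "4 * Q \<le> R1" by (simp add: Q_def)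
  have "16 * D * (CA + 1) * C1 * K * l0 \<le> 16 * D * (CA + 1) * C1 * K * (1 / (16 * D * (CA + 1) * C1 * K))"
    using C1(1) K D CA by (intro mult_left_mono) (auto simp: l0_def)
  also have "\<dots> = 1" using C1(1) K D CA by simp
  finally have l0D: "16 * D * (CA + 1) * C1 * K * l0 \<le> 1" .
  have sm: "D * CA * C1 * (2 * K * l0 + 2 * K * l0) \<le> 1 / 4"
  proof -
    have "D * CA * C1 * (2 * K * l0 + 2 * K * l0) = CA * (4 * D * C1 * K * l0)" by (simp add: algebra_simps)
    also have "\<dots> \<le> (CA + 1) * (4 * D * C1 * K * l0)"
      using D C1(1) K l0 by (intro mult_right_mono) auto
    also have "\<dots> \<le> 1 / 4" using l0D by (simp add: algebra_simps)
    finally show ?thesis .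
  qed
  \<comment> \<open>The contracted second curve is a dilation of points of norm at most
    \<open>Q\<close> and can exceed \<open>Q\<close> by the factor \<open>CD\<close>.\<close>
  define R2 where "R2 = CD * Q"
  have QR2: "Q \<le> R2" using CD(1) Q0 by (simp add: R2_def)
  have "R2 < CD * R1" unfolding R2_def using QR Q0 CD(1) by (intro mult_strict_left_mono) linarith+
  hence R2: "R2 < R0" using CD(1) by (simp add: R1_def)
  \<comment> \<open>The first entry becomes \<epsilon> times \<open>ll\<close> after scaling back;
    the second keeps the connecting curve within the range of \<open>scaling\<close>.\<close>
  define \<epsilon>2 where "\<epsilon>2 = min (\<epsilon> * l0) (R1 / (4 * C1))"
  have \<epsilon>2: "\<epsilon>2 > 0" using \<epsilon> l0 R1(1) C1(1) by (simp add: \<epsilon>2_def)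
  have "C1 * \<epsilon>2 \<le> C1 * (R1 / (4 * C1))" using C1(1) by (intro mult_left_mono) (auto simp: \<epsilon>2_def)
  hence C\<epsilon>2: "C1 * \<epsilon>2 \<le> R1 / 4" using C1(1) by simp
  obtain \<eta> where \<eta>: "\<eta> > 0" "\<And>x1 x2. norm x1 \<le> R2 \<Longrightarrow> norm x2 \<le> R2 \<Longrightarrow> norm (x1 - x2) \<le> \<eta> \<Longrightarrow> \<exists>l<\<epsilon>2. reach (\<Psi> x1) (\<Psi> x2) l"
    using uniform_chow[OF R2 \<epsilon>2] by blast
  \<comment> \<open>The projections will differ by at most \<open>4 * (\<epsilon>1 * l0)\<close>,
    and \<open>compare\<close> multiplies this by 4.\<close>
  define \<epsilon>1 where "\<epsilon>1 = \<eta> / (16 * l0)"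
  have \<epsilon>1: "\<epsilon>1 > 0" using \<eta>(1) l0 by (simp add: \<epsilon>1_def)
  have main: "d (\<sigma> a) (Dil (a / ll) (\<sigma> ll)) \<le> \<epsilon> * ll"
    if a: "0 < a" "a \<le> ll" and ll: "ll < l0" and \<sigma>0: "\<sigma> 0 = e"
      and lip: "\<forall>p\<in>{0..ll}. \<forall>q\<in>{0..ll}. d (\<sigma> p) (\<sigma> q) \<le> K * \<bar>p - q\<bar>"
      and lin: "\<forall>t\<in>{0..ll}. norm (\<pi> (\<sigma> t) - t *\<^sub>R v) \<le> \<epsilon>1 * ll" for \<sigma> ll a v
  proof -
    have ll0: "ll > 0" using a by simp
    \<comment> \<open>The first entry lets the approximation change projections by at most
      \<open>\<epsilon>1 * ll\<close>, doubling the error allowed for \<sigma>; the second keeps the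
      correction small enough for \<open>\<pi>_mult\<close>.\<close>
    define \<eta>' where "\<eta>' = min (\<epsilon>1 * ll / (CP * C1 + 1)) (R0 / (4 * C1))"
    have CPC: "CP * C1 + 1 > 0" using CP(1) C1(1) by (simp add: add_nonneg_pos)
    have \<eta>': "\<eta>' > 0" using \<epsilon>1 ll0 CPC R0 C1(1) by (simp add: \<eta>'_def)
    have "(CP * C1 + 1) * \<eta>' \<le> (CP * C1 + 1) * (\<epsilon>1 * ll / (CP * C1 + 1))"
      using CPC by (intro mult_left_mono) (auto simp: \<eta>'_def)
    hence "(CP * C1 + 1) * \<eta>' \<le> \<epsilon>1 * ll" using CPC by simp
    hence \<eta>'1: "CP * (C1 * \<eta>') \<le> \<epsilon>1 * ll" using \<eta>' by (simp add: algebra_simps)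
    have "C1 * \<eta>' \<le> C1 * (R0 / (4 * C1))" using C1(1) by (intro mult_left_mono) (auto simp: \<eta>'_def)
    hence \<eta>'2: "C1 * \<eta>' \<le> R0 / 4" using C1(1) by simp
    have Cll: "C1 * (2 * K * ll) \<le> Q" unfolding Q_def using ll C1(1) K by simp
    have QR0: "4 * Q \<le> R0" using QR R1(2) by simp
    have near\<sigma>: "\<exists>x. \<sigma> t = \<Psi> x \<and> norm x \<le> Q" if t: "t \<in> {0..ll}" for t
    proof -
      have "d e (\<sigma> t) \<le> K * \<bar>0 - t\<bar>" using lip \<sigma>0 t ll0 by (metis atLeastAtMost_iff less_imp_le order_refl)
      also have "\<dots> \<le> K * ll" using t K by simp
      also have "\<dots> < 2 * K * ll" using K ll0 by simp
      finally obtain l' where l': "l' < 2 * K * ll" "reach e (\<sigma> t) l'" using d_less by blast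
      have "C1 * l' \<le> C1 * (2 * K * ll)" using l' C1(1) by simp
      hence lt: "C1 * l' \<le> Q" using Cll by simp
      have lt': "C1 * l' < R0" using lt QR0 Q0 by linarith
      from reach_e_coord[OF l'(2) lt'] show ?thesis using lt \<Psi>\<kappa> by (metis order_trans)
    qed
    have approx: "\<exists>\<gamma> u l. hc 0 1 \<gamma> u \<and> ((\<lambda>t. N (u t)) has_integral l) {0..1} \<and> l \<le> 2 * K * b \<and> \<gamma> 0 = e \<and> \<gamma> 1 = \<sigma> b \<and>
       (\<forall>t\<in>{0..1}. norm (\<pi> (\<gamma> t) - (b * t) *\<^sub>R v) \<le> 2 * (\<epsilon>1 * ll))" if b: "0 < b" "b \<le> ll" for b
    proof -
      have "\<exists>\<gamma> u l. hc 0 1 \<gamma> u \<and> ((\<lambda>t. N (u t)) has_integral l) {0..1} \<and> l \<le> 2 * K * b \<and> \<gamma> 0 = \<sigma> 0 \<and> \<gamma> 1 = \<sigma> b \<and>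
       (\<forall>t\<in>{0..1}. \<exists>l\<le>\<eta>'. reach (\<sigma> (b * t)) (\<gamma> t) l)"
        by (rule approx_curve[OF _ K b(1) \<eta>']) (use lip b in auto)
      then obtain \<gamma> u l where g: "hc 0 1 \<gamma> u" "((\<lambda>t. N (u t)) has_integral l) {0..1}" "l \<le> 2 * K * b" "\<gamma> 0 = \<sigma> 0" "\<gamma> 1 = \<sigma> b"
        "\<And>t. t \<in> {0..1} \<Longrightarrow> \<exists>l\<le>\<eta>'. reach (\<sigma> (b * t)) (\<gamma> t) l" by blast
      have "norm (\<pi> (\<gamma> t) - (b * t) *\<^sub>R v) \<le> 2 * (\<epsilon>1 * ll)" if t: "t \<in> {0..1}" for t
      proof -
        have bt: "b * t \<in> {0..ll}"
        proof -
          have "b * t \<le> b" using t b by (intro mult_left_le) auto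
          moreover have "0 \<le> b * t" using t b by simp
          ultimately show ?thesis using b(2) unfolding atLeastAtMost_iff by linarith
        qed
        obtain x where x: "\<sigma> (b * t) = \<Psi> x" "norm x \<le> Q" using near\<sigma>[OF bt] by blast
        obtain l' where l': "l' \<le> \<eta>'" "reach (\<sigma> (b * t)) (\<gamma> t) l'" using g(6)[OF t] by blast
        define z where "z = iv (\<Psi> x) \<odot> \<gamma> t"
        have z: "reach e z l'" using reach_left[OF l'(2), of "iv (\<Psi> x)"] x(1) by (simp add: z_def G.left_inverse)
        have C1l': "C1 * l' \<le> C1 * \<eta>'" using l' C1(1) by simp
        have a1: "norm x + C1 * l' < R0" using x(2) C1l' \<eta>'2 QR0 Q0 R0 by linarith
        have a2: "C1 * l' < R0" using a1 norm_ge_zero[of x] by linarith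
        have "\<pi> (\<gamma> t) = \<pi> (\<sigma> (b * t)) + \<pi> z" using \<pi>_mult(1)[OF a1 z] x(1) by (simp add: z_def)
        moreover have "norm (\<pi> z) \<le> \<epsilon>1 * ll"
          using reach_e_coord(3)[OF z a2] mult_left_mono[OF C1l' CP(1)] \<eta>'1 by linarith
        moreover have "norm (\<pi> (\<sigma> (b * t)) - (b * t) *\<^sub>R v) \<le> \<epsilon>1 * ll" using lin bt by blast
        ultimately show ?thesis
          using norm_triangle_ineq[of "\<pi> (\<sigma> (b * t)) - (b * t) *\<^sub>R v" "\<pi> z"] by (simp add: algebra_simps)
      qed
      thus ?thesis using g \<sigma>0 by (intro exI[of _ \<gamma>] exI[of _ u] exI[of _ l]) auto
    qed
    \<comment> \<open>Enlarging by \<open>1 / r\<close> turns lengths of at most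
      \<open>2 * K * ll\<close> into lengths of at most \<open>2 * K * l0\<close>.\<close>
    define r where "r = ll / l0"
    have r: "0 < r" "r \<le> 1" using ll ll0 l0 by (auto simp: r_def)
    define \<theta> where "\<theta> = a / ll"
    have \<theta>: "0 < \<theta>" "\<theta> \<le> 1" using a by (auto simp: \<theta>_def)
    obtain \<gamma>1 u1 l1 where g1: "hc 0 1 \<gamma>1 u1" "((\<lambda>t. N (u1 t)) has_integral l1) {0..1}" "l1 \<le> 2 * K * a" "\<gamma>1 0 = e" "\<gamma>1 1 = \<sigma> a"
      "\<And>t. t \<in> {0..1} \<Longrightarrow> norm (\<pi> (\<gamma>1 t) - (a * t) *\<^sub>R v) \<le> 2 * (\<epsilon>1 * ll)" using approx[OF a] by blast
    obtain \<gamma>2 u2 l2 where g2: "hc 0 1 \<gamma>2 u2" "((\<lambda>t. N (u2 t)) has_integral l2) {0..1}" "l2 \<le> 2 * K * ll" "\<gamma>2 0 = e" "\<gamma>2 1 = \<sigma> ll"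
      "\<And>t. t \<in> {0..1} \<Longrightarrow> norm (\<pi> (\<gamma>2 t) - (ll * t) *\<^sub>R v) \<le> 2 * (\<epsilon>1 * ll)" using approx[OF ll0 order_refl] by blast
    have Ka: "2 * K * a \<le> 2 * K * ll" using a K by simp
    have L1: "l1 \<le> 2 * K * ll" using g1(3) Ka by simp
    have scl: "C1 * (l / r) \<le> Q" "l / r \<le> 2 * K * l0" if "l \<le> 2 * K * ll" for l
    proof -
      have "l / r \<le> 2 * K * ll / r" using that r by (intro divide_right_mono) auto
      also have "\<dots> = 2 * K * l0" using ll0 l0 by (simp add: r_def)
      finally show "l / r \<le> 2 * K * l0" .
      thus "C1 * (l / r) \<le> Q" unfolding Q_def using C1(1) by (intro mult_left_mono) auto
    qed
    have C1l: "C1 * l < R0" if "l \<le> 2 * K * ll" for l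
    proof -
      have "C1 * l \<le> C1 * (2 * K * ll)" using that C1(1) by simp
      thus ?thesis using Cll QR0 Q0 by linarith
    qed
    have \<kappa>e: "\<kappa> e = 0" using \<kappa>_\<Psi>[of 0] R0 \<Psi>_0 by simp
    have s1: "csol (\<lambda>t. \<kappa> (\<gamma>1 t)) u1" by (rule hc_csol(1)[OF g1(1,2), of 0]) (use g1(4) \<Psi>_0 C1l[OF L1] in auto)
    have s2: "csol (\<lambda>t. \<kappa> (\<gamma>2 t)) u2" by (rule hc_csol(1)[OF g2(1,2), of 0]) (use g2(4) \<Psi>_0 C1l[OF g2(3)] in auto)
    have sq1: "C1 * (l1 / r) < R0" and sq2: "C1 * (l2 / r) < R0" using scl(1)[OF L1] scl(1)[OF g2(3)] QR0 Q0 by linarith+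
    have \<kappa>0: "\<kappa> (\<gamma>1 0) = 0" "\<kappa> (\<gamma>2 0) = 0" using g1(4) g2(4) \<kappa>e by auto
    note e1 = csol_expand[OF s1 g1(2) \<kappa>0(1) r sq1]
    note e2 = csol_expand[OF s2 g2(2) \<kappa>0(2) r sq2]
    let ?Y1 = "\<lambda>t. \<delta> (1 / r) (\<kappa> (\<gamma>1 t))" and ?Z2 = "\<lambda>t. \<delta> (1 / r) (\<kappa> (\<gamma>2 t))"
    let ?Y2 = "\<lambda>t. \<delta> \<theta> (?Z2 t)"
    have nZ: "norm (?Z2 t) \<le> Q" if "t \<in> {0..1}" for t using e2(3)[OF that] scl(1)[OF g2(3)] by linarith
    have nY1: "norm (?Y1 t) \<le> Q" if "t \<in> {0..1}" for t using e1(3)[OF that] scl(1)[OF L1] by linarith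
    have nY2: "norm (?Y2 t) \<le> R2" if "t \<in> {0..1}" for t
    proof -
      have "norm (?Y2 t) \<le> CD * norm (?Z2 t)" using \<theta> by (intro CD(2)) auto
      also have "\<dots> \<le> CD * Q" using nZ[OF that] CD(1) by (intro mult_left_mono) auto
      finally show ?thesis by (simp add: R2_def)
    qed
    have c2: "csol ?Y2 (\<lambda>t. \<theta> *\<^sub>R ((1 / r) *\<^sub>R u2 t))"
    proof (rule csol_\<delta>[OF e2(1) \<theta>])
      fix t :: real assume "t \<in> {0..1}"
      from nY2[OF this] show "?Y2 t \<in> ball 0 R0" using R2 by (simp only: mem_ball_0 order_le_less_trans)
    qed
    have i2: "((\<lambda>t. N (\<theta> *\<^sub>R ((1 / r) *\<^sub>R u2 t))) has_integral (\<theta> * (l2 / r))) {0..1}"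
      using hc_N_scale_integral[OF csol_hc[OF e2(1)] e2(2), of \<theta>] \<theta> by simp
    have "norm (?Y1 1 - ?Y2 1) \<le> 4 * (4 * (\<epsilon>1 * l0))"
    proof (rule compare[OF e1(1) c2 _ e1(2) i2])
      show "?Y1 0 = ?Y2 0" using \<kappa>0 linear_0[OF linear_\<delta>] by simp
      show "(1::real) \<in> {0..1}" by simp
      have "0 \<le> l2 / r" by (rule hc_integral_nonneg[OF csol_hc[OF e2(1)] e2(2)])
      hence "\<theta> * (l2 / r) \<le> 1 * (l2 / r)" using \<theta> by (intro mult_right_mono) auto
      hence "l1 / r + \<theta> * (l2 / r) \<le> 2 * K * l0 + 2 * K * l0" using scl(2)[OF L1] scl(2)[OF g2(3)] by linarith
      hence "D * CA * C1 * (l1 / r + \<theta> * (l2 / r)) \<le> D * CA * C1 * (2 * K * l0 + 2 * K * l0)"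
        using D CA C1(1) by (intro mult_left_mono mult_nonneg_nonneg) auto
      from order_trans[OF this sm]
      show "real DIM('e) * CA * C1 * (l1 / r + \<theta> * (l2 / r)) \<le> 1 / 4" by (simp only: D_def)
      fix t :: real assume t: "t \<in> {0..1}"
      have P1: "P 1 (?Y1 t) = (1 / r) *\<^sub>R \<pi> (\<gamma>1 t)" "P 1 (?Y2 t) = (1 / r) *\<^sub>R (\<theta> *\<^sub>R \<pi> (\<gamma>2 t))"
        by (simp_all add: P_\<delta>[OF one_in] \<pi>_def)
      have n1: "norm (\<theta> *\<^sub>R (\<pi> (\<gamma>2 t) - (ll * t) *\<^sub>R v)) \<le> 1 * (2 * (\<epsilon>1 * ll))"
        unfolding norm_scaleR using \<theta> g2(6)[OF t] by (intro mult_mono) auto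
      \<comment> \<open>As \<theta> is \<open>a / ll\<close>, the line followed by the contracted
        second curve has the same speed as the line followed by the first.\<close>
      have eq: "\<theta> *\<^sub>R (\<pi> (\<gamma>2 t) - (ll * t) *\<^sub>R v) = \<theta> *\<^sub>R \<pi> (\<gamma>2 t) - (a * t) *\<^sub>R v"
        using ll0 by (simp add: \<theta>_def scaleR_diff_right)
      have n2: "norm (\<pi> (\<gamma>1 t) - \<theta> *\<^sub>R \<pi> (\<gamma>2 t)) \<le> norm (\<pi> (\<gamma>1 t) - (a * t) *\<^sub>R v) + norm (\<theta> *\<^sub>R \<pi> (\<gamma>2 t) - (a * t) *\<^sub>R v)"
        using norm_triangle_ineq4[of "\<pi> (\<gamma>1 t) - (a * t) *\<^sub>R v" "\<theta> *\<^sub>R \<pi> (\<gamma>2 t) - (a * t) *\<^sub>R v"] by simp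
      have "norm (\<pi> (\<gamma>1 t) - \<theta> *\<^sub>R \<pi> (\<gamma>2 t)) \<le> 4 * (\<epsilon>1 * ll)" using n1[unfolded eq] n2 g1(6)[OF t] by linarith
      hence "(1 / r) * norm (\<pi> (\<gamma>1 t) - \<theta> *\<^sub>R \<pi> (\<gamma>2 t)) \<le> (1 / r) * (4 * (\<epsilon>1 * ll))" using r by (intro mult_left_mono) auto
      also have "(1 / r) * (4 * (\<epsilon>1 * ll)) = 4 * (\<epsilon>1 * l0)" using ll0 l0 by (simp add: r_def)
      finally show "norm (P 1 (?Y1 t) - P 1 (?Y2 t)) \<le> 4 * (\<epsilon>1 * l0)"
        unfolding P1 scaleR_diff_right[symmetric] norm_scaleR using r by simp
    qed
    also have "4 * (4 * (\<epsilon>1 * l0)) = \<eta>" using l0 by (simp add: \<epsilon>1_def)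
    finally have close: "norm (?Y1 1 - ?Y2 1) \<le> \<eta>" .
    have n1: "norm (?Y1 1) \<le> R2" using nY1[of 1] QR2 by simp
    have n2: "norm (?Y2 1) \<le> R2" by (rule nY2) simp
    obtain l where l: "l < \<epsilon>2" "reach (\<Psi> (?Y1 1)) (\<Psi> (?Y2 1)) l" using \<eta>(2)[OF n1 n2 close] by blast
    have "C1 * l \<le> C1 * \<epsilon>2" using l(1) C1(1) by simp
    hence sc1: "norm (?Y1 1) + C1 * l < R1" using nY1[of 1] C\<epsilon>2 QR R1(1) by simp
    have sc2: "?Y2 1 \<in> ball 0 R0" using n2 R2 by (simp only: mem_ball_0 order_le_less_trans)
    from scaling[OF sc1 sc2 l(2) r]
    have "reach (\<Psi> (\<delta> r (?Y1 1))) (\<Psi> (\<delta> r (?Y2 1))) (r * l)" .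
    moreover have "\<delta> r (?Y1 1) = \<kappa> (\<sigma> a)" using r g1(5) by (simp add: \<delta>_\<delta>)
    moreover have "\<delta> r (?Y2 1) = \<delta> \<theta> (\<kappa> (\<sigma> ll))" using r g2(5) by (simp add: \<delta>_\<delta>)
    moreover have "\<Psi> (\<kappa> (\<sigma> a)) = \<sigma> a"
    proof -
      have "a \<in> {0..ll}" using a by auto
      then obtain x where x: "\<sigma> a = \<Psi> x" "norm x \<le> Q" using near\<sigma> by blast
      have "x \<in> ball 0 R0" using x(2) QR0 Q0 by simp
      thus ?thesis using x(1) \<Psi>\<kappa> by blast
    qed
    ultimately have "reach (\<sigma> a) (Dil (a / ll) (\<sigma> ll)) (r * l)" by (simp add: Dil_def \<theta>_def)
    hence "d (\<sigma> a) (Dil (a / ll) (\<sigma> ll)) \<le> r * l" by (rule d_le)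
    also have "\<dots> \<le> r * (\<epsilon> * l0)" using l(1) r by (intro mult_left_mono) (auto simp: \<epsilon>2_def)
    also have "\<dots> = \<epsilon> * ll" using l0 by (simp add: r_def)
    finally show ?thesis .
  qed
  show ?thesis
    by (rule exI[of _ \<epsilon>1], rule conjI[OF \<epsilon>1], rule exI[of _ l0], rule conjI[OF l0]) (use main in blast)
qed

text \<open>The substitute for affine interpolation between \<open>x\<close> and \<open>y\<close>:
  left translation moves \<open>x\<close> to \<open>e\<close>, where the dilation lives. It is
  meaningful only if \<open>iv x \<odot> y\<close> lies in the range of the coordinates.\<close>

definition "gref x y r = x \<odot> Dil r (iv x \<odot> y)"

text \<open>A crude bound for all short intervals, needed for domination. The Lipschitz bound gives
  \<open>K\<close>; the dilated endpoint is reached by contracting a curve of length below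
  \<open>2 * K * (r - p)\<close>.\<close>

lemma gref_bounded:
  assumes K: "K > 0" and lip: "\<And>a b. d (\<sigma> a) (\<sigma> b) \<le> K * \<bar>a - b\<bar>"
  shows "\<exists>\<delta>'>0. \<forall>p q r. p < q \<and> q < r \<and> r - p < \<delta>' \<longrightarrow> d (\<sigma> q) (gref (\<sigma> p) (\<sigma> r) ((q - p) / (r - p))) \<le> 3 * K * (r - p)"
proof (intro exI[of _ "R1 / (2 * C1 * K)"] conjI allI impI)
  show "0 < R1 / (2 * C1 * K)" using R1 C1(1) K by simp
  fix p q r :: real assume h: "p < q \<and> q < r \<and> r - p < R1 / (2 * C1 * K)"
  define z where "z = iv (\<sigma> p) \<odot> \<sigma> r"
  define th where "th = (q - p) / (r - p)"
  have th: "0 < th" "th \<le> 1" using h by (auto simp: th_def)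
  have "d e z = d (\<sigma> p) (\<sigma> r)" using d_left[of "iv (\<sigma> p)" "\<sigma> p" "\<sigma> r"] by (simp add: z_def G.left_inverse)
  also have "\<dots> \<le> K * \<bar>p - r\<bar>" by (rule lip)
  also have "\<dots> < 2 * K * (r - p)" using h K by simp
  finally obtain l where l: "l < 2 * K * (r - p)" "reach e z l" using d_less by blast
  have "C1 * l \<le> C1 * (2 * K * (r - p))" using l(1) C1(1) by simp
  also have "\<dots> = 2 * C1 * K * (r - p)" by simp
  also have "\<dots> < 2 * C1 * K * (R1 / (2 * C1 * K))" using h C1(1) K by (intro mult_strict_left_mono) auto
  also have "\<dots> = R1" using C1(1) K by simp
  finally have C1l: "C1 * l < R1" .
  hence C1l0: "C1 * l < R0" using R1(2) by simp
  note zc = reach_e_coord[OF l(2) C1l0]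
  have "reach (\<Psi> 0) (\<Psi> (\<kappa> z)) l" using l(2) \<Psi>_0 \<Psi>\<kappa>[OF zc(1)] by simp
  from scaling[OF _ \<kappa>_in[OF zc(1)] this th] C1l
  have "reach e (Dil th z) (th * l)" using \<Psi>_0 linear_0[OF linear_\<delta>] by (simp add: Dil_def)
  hence "d e (Dil th z) \<le> th * l" by (rule d_le)
  moreover have "th * l \<le> 1 * l" using th reach_nonneg[OF l(2)] by (intro mult_right_mono) auto
  moreover have "d (\<sigma> p) (gref (\<sigma> p) (\<sigma> r) th) = d e (Dil th z)"
    using d_left[of "\<sigma> p" e "Dil th z"] by (simp add: gref_def z_def)
  moreover have "d (\<sigma> q) (\<sigma> p) \<le> K * (r - p)"
  proof -
    have "d (\<sigma> q) (\<sigma> p) \<le> K * \<bar>q - p\<bar>" by (rule lip)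
    also have "\<dots> \<le> K * (r - p)" using h K by (intro mult_left_mono) auto
    finally show ?thesis .
  qed
  ultimately have "d (\<sigma> q) (gref (\<sigma> p) (\<sigma> r) th) \<le> 3 * K * (r - p)"
    using d_triangle[of "\<sigma> q" "gref (\<sigma> p) (\<sigma> r) th" "\<sigma> p"] l(1) by simp
  thus "d (\<sigma> q) (gref (\<sigma> p) (\<sigma> r) ((q - p) / (r - p))) \<le> 3 * K * (r - p)" by (simp add: th_def)
qed

text \<open>The projection is available near \<open>e\<close> only, so the curve is covered by
  countably many overlapping windows, each translated to \<open>e\<close> at its center. By
  additivity of \<pi>, differentiability of the window function at \<open>t\<close> says that the
  curve translated by any nearby start \<open>p\<close> has almost straight projection, and
  \<open>pansu_step\<close> applies.\<close>

lemma pansu_ae: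
  assumes K: "K > 0" and lip: "\<And>a b. d (\<sigma> a) (\<sigma> b) \<le> K * \<bar>a - b\<bar>"
  shows "AE t in lebesgue. \<forall>\<epsilon>>0. \<exists>\<delta>'>0. \<forall>p q r. p \<le> t \<and> t \<le> r \<and> p < q \<and> q < r \<and> r - p < \<delta>' \<longrightarrow>
     d (\<sigma> q) (gref (\<sigma> p) (\<sigma> r) ((q - p) / (r - p))) \<le> \<epsilon> * (r - p)"
proof -
  \<comment> \<open>In coordinates a time span \<rho> costs at most \<open>R0 / 10\<close>. The
    factors \<open>w\<close> and \<open>z\<close> below have lengths less than two and three such
    units, so their product stays well inside the chart.\<close>
  define \<rho> where "\<rho> = R0 / (10 * C1 * K)"
  have \<rho>: "\<rho> > 0" using R0 C1(1) K by (simp add: \<rho>_def)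
  have \<rho>R: "C1 * (K * \<rho>) = R0 / 10" using C1(1) K by (simp add: \<rho>_def)
  define cl where "cl (n::int) t = max (n * \<rho> - \<rho>) (min (n * \<rho> + \<rho>) t)" for n t
  \<comment> \<open>Clamping the time to the window makes the function Lipschitz on the whole line
    without changing it inside.\<close>
  define h where "h (n::int) t = \<pi> (iv (\<sigma> (n * \<rho>)) \<odot> \<sigma> (cl n t))" for n t
  have clin: "cl n t \<in> {n * \<rho> - \<rho>..n * \<rho> + \<rho>}" for n t using \<rho> by (auto simp: cl_def)
  have clid: "cl n t = t" if "t \<in> {n * \<rho> - \<rho>..n * \<rho> + \<rho>}" for n t using that by (auto simp: cl_def)
  have add: "\<pi> (iv (\<sigma> (n * \<rho>)) \<odot> \<sigma> b) - \<pi> (iv (\<sigma> (n * \<rho>)) \<odot> \<sigma> a) = \<pi> (iv (\<sigma> a) \<odot> \<sigma> b) \<and>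
     norm (\<pi> (iv (\<sigma> a) \<odot> \<sigma> b)) \<le> CP * C1 * K * \<bar>a - b\<bar>"
    if a: "a \<in> {n * \<rho> - \<rho>..n * \<rho> + \<rho>}" and b: "b \<in> {n * \<rho> - \<rho>..n * \<rho> + \<rho>}" for n :: int and a b
  proof -
    define w where "w = iv (\<sigma> (n * \<rho>)) \<odot> \<sigma> a"
    define z where "z = iv (\<sigma> a) \<odot> \<sigma> b"
    have "d e w = d (\<sigma> (n * \<rho>)) (\<sigma> a)" using d_left[of "iv (\<sigma> (n * \<rho>))" "\<sigma> (n * \<rho>)" "\<sigma> a"] by (simp add: w_def G.left_inverse)
    also have "\<dots> \<le> K * \<bar>n * \<rho> - a\<bar>" by (rule lip)
    also have "\<dots> \<le> K * \<rho>" using a K by (intro mult_left_mono) auto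
    also have "\<dots> < 2 * (K * \<rho>)" using K \<rho> by simp
    finally obtain l1 where l1: "l1 < 2 * (K * \<rho>)" "reach e w l1" using d_less by blast
    have "C1 * l1 \<le> C1 * (2 * (K * \<rho>))" using l1 C1(1) by simp
    hence C1: "C1 * l1 \<le> R0 / 5" using \<rho>R by simp
    hence C1': "C1 * l1 < R0" using R0 by simp
    note wc = reach_e_coord[OF l1(2) C1']
    have dz: "d e z \<le> K * \<bar>a - b\<bar>" using d_left[of "iv (\<sigma> a)" "\<sigma> a" "\<sigma> b"] lip[of a b] by (simp add: z_def G.left_inverse)
    have Kab: "K * \<bar>a - b\<bar> \<le> K * (2 * \<rho>)" using a b K by (intro mult_left_mono) auto
    have good: "\<pi> (w \<odot> z) = \<pi> w + \<pi> z \<and> norm (\<pi> z) \<le> CP * (C1 * l)" if l: "reach e z l" "l < 3 * (K * \<rho>)" for l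
    proof -
      have "C1 * l \<le> C1 * (3 * (K * \<rho>))" using l carnot.C1(1)[OF carnot_axioms] by simp
      hence C2: "C1 * l \<le> 3 * R0 / 10" using \<rho>R by simp
      have "norm (\<kappa> w) + C1 * l < R0" using wc(2) C1 C2 R0 by linarith
      from \<pi>_mult(1)[OF this l(1)] have "\<pi> (w \<odot> z) = \<pi> w + \<pi> z" using \<Psi>\<kappa>[OF wc(1)] by simp
      moreover have "norm (\<pi> z) \<le> CP * (C1 * l)" by (rule reach_e_coord(3)[OF l(1)]) (use C2 R0 in linarith)
      ultimately show ?thesis by blast
    qed
    \<comment> \<open>One curve must be short enough for the chart and at the same time almost as
      short as the distance allows.\<close>
    have ex: "\<exists>l. reach e z l \<and> l < 3 * (K * \<rho>) \<and> l < K * \<bar>a - b\<bar> + \<epsilon>" if "\<epsilon> > 0" for \<epsilon>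
    proof -
      have "K * (2 * \<rho>) < 3 * (K * \<rho>)" using K \<rho> by simp
      hence "d e z < 3 * (K * \<rho>)" using dz Kab by linarith
      moreover have "d e z < K * \<bar>a - b\<bar> + \<epsilon>" using dz that by linarith
      ultimately have "d e z < min (3 * (K * \<rho>)) (K * \<bar>a - b\<bar> + \<epsilon>)" by (simp only: min_less_iff_conj)
      from d_less[OF this] show ?thesis by auto
    qed
    have "\<pi> (w \<odot> z) = \<pi> w + \<pi> z" using ex[of 1] good by auto
    moreover have "w \<odot> z = iv (\<sigma> (n * \<rho>)) \<odot> \<sigma> b" by (simp add: w_def z_def G.assoc)
    moreover have "norm (\<pi> z) \<le> CP * C1 * K * \<bar>a - b\<bar>"
    proof (rule field_le_epsilon)
      fix \<epsilon> :: real assume \<epsilon>: "\<epsilon> > 0"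
      have CC: "CP * C1 \<ge> 0" using CP(1) carnot.C1(1)[OF carnot_axioms] by simp
      have "\<epsilon> / (CP * C1 + 1) > 0" using \<epsilon> CC by (simp add: add_nonneg_pos)
      from ex[OF this] obtain l where l: "reach e z l" "l < 3 * (K * \<rho>)" "l < K * \<bar>a - b\<bar> + \<epsilon> / (CP * C1 + 1)" by blast
      have "norm (\<pi> z) \<le> (CP * C1) * l" using good[OF l(1,2)] by (simp add: mult.assoc)
      also have "\<dots> \<le> (CP * C1) * (K * \<bar>a - b\<bar> + \<epsilon> / (CP * C1 + 1))" using l(3) CC by (intro mult_left_mono) auto
      also have "\<dots> = CP * C1 * K * \<bar>a - b\<bar> + (CP * C1) * (\<epsilon> / (CP * C1 + 1))" by (simp add: algebra_simps)
      also have "(CP * C1) * (\<epsilon> / (CP * C1 + 1)) \<le> (CP * C1 + 1) * (\<epsilon> / (CP * C1 + 1))"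
        using CC \<epsilon> by (intro mult_right_mono) auto
      also have "\<dots> = \<epsilon>" using CC by simp
      finally show "norm (\<pi> z) \<le> CP * C1 * K * \<bar>a - b\<bar> + \<epsilon>" by simp
    qed
    ultimately show ?thesis by (simp add: w_def z_def)
  qed
  have "AE t in lebesgue. h n differentiable at t" for n
  proof (rule lipschitz_AE_differentiable[of "CP * C1 * K"], rule lipschitz_onI)
    fix a b :: real
    have "norm (h n a - h n b) \<le> CP * C1 * K * \<bar>cl n b - cl n a\<bar>"
      using add[OF clin[of n b] clin[of n a]] by (simp add: h_def)
    also have "\<dots> \<le> CP * C1 * K * \<bar>a - b\<bar>"
      using CP(1) C1(1) K by (intro mult_left_mono) (auto simp: cl_def)
    finally show "dist (h n a) (h n b) \<le> CP * C1 * K * dist a b" by (simp add: dist_norm)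
  qed (use CP(1) C1(1) K in simp)
  hence "AE t in lebesgue. \<forall>n. h n differentiable at t" by (simp add: AE_all_countable)
  thus ?thesis
  proof eventually_elim
    case (elim t)
    show ?case
    proof (intro allI impI)
      fix \<epsilon> :: real assume \<epsilon>: "\<epsilon> > 0"
      define n where "n = \<lfloor>t / \<rho>\<rfloor>"
      have "of_int n \<le> t / \<rho>" "t / \<rho> < of_int n + 1" by (auto simp: n_def)
      hence nt: "n * \<rho> \<le> t" "t < n * \<rho> + \<rho>" using \<rho> by (auto simp: field_simps)
      obtain h' where h': "(h n has_derivative h') (at t)" using elim unfolding differentiable_def by blast
      define v where "v = h' 1"
      have h'v: "h' x = x *\<^sub>R v" for x using linear_scale[OF has_derivative_linear[OF h'], of x 1] by (simp add: v_def)
      obtain \<epsilon>1 ll1 where e1: "\<epsilon>1 > 0" "ll1 > 0" and step: "\<And>\<sigma> ll a v. 0 < a \<Longrightarrow> a \<le> ll \<Longrightarrow> ll < ll1 \<Longrightarrow> \<sigma> 0 = e \<Longrightarrow>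
         (\<forall>p\<in>{0..ll}. \<forall>q\<in>{0..ll}. d (\<sigma> p) (\<sigma> q) \<le> K * \<bar>p - q\<bar>) \<Longrightarrow>
         (\<forall>t\<in>{0..ll}. norm (\<pi> (\<sigma> t) - t *\<^sub>R v) \<le> \<epsilon>1 * ll) \<Longrightarrow> d (\<sigma> a) (Dil (a / ll) (\<sigma> ll)) \<le> \<epsilon> * ll"
        using pansu_step[OF K \<epsilon>] by metis
      obtain dd where dd: "dd > 0" "\<And>y. norm (y - t) < dd \<Longrightarrow> norm (h n y - h n t - h' (y - t)) \<le> (\<epsilon>1 / 2) * norm (y - t)"
        using h' e1(1) unfolding has_derivative_at_alt by (meson half_gt_zero)
      \<comment> \<open>The last two entries keep the whole interval from \<open>p\<close> to
        \<open>r\<close> inside the window of \<open>t\<close>, to the left and to the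
        right.\<close>
      define \<delta>' where "\<delta>' = min dd (min ll1 (min \<rho> (n * \<rho> + \<rho> - t)))"
      show "\<exists>\<delta>'>0. \<forall>p q r. p \<le> t \<and> t \<le> r \<and> p < q \<and> q < r \<and> r - p < \<delta>' \<longrightarrow>
         d (\<sigma> q) (gref (\<sigma> p) (\<sigma> r) ((q - p) / (r - p))) \<le> \<epsilon> * (r - p)"
      proof (intro exI[of _ \<delta>'] conjI allI impI)
        show "0 < \<delta>'" using dd e1 \<rho> nt by (simp add: \<delta>'_def)
        fix p q r :: real assume H: "p \<le> t \<and> t \<le> r \<and> p < q \<and> q < r \<and> r - p < \<delta>'"
        define \<sigma>' where "\<sigma>' a = iv (\<sigma> p) \<odot> \<sigma> (p + a)" for a
        have inI: "x \<in> {n * \<rho> - \<rho>..n * \<rho> + \<rho>}" if "p \<le> x" "x \<le> r" for x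
          using H that nt by (auto simp: \<delta>'_def)
        have dev: "norm (h n x - h n t - (x - t) *\<^sub>R v) \<le> (\<epsilon>1 / 2) * (r - p)" if "p \<le> x" "x \<le> r" for x
        proof -
          have xt: "\<bar>x - t\<bar> \<le> r - p" using H that by auto
          hence "norm (x - t) < dd" using H by (simp add: \<delta>'_def)
          from dd(2)[OF this] have "norm (h n x - h n t - (x - t) *\<^sub>R v) \<le> (\<epsilon>1 / 2) * \<bar>x - t\<bar>" by (simp add: h'v)
          also have "\<dots> \<le> (\<epsilon>1 / 2) * (r - p)" using xt e1(1) by (intro mult_left_mono) auto
          finally show ?thesis .
        qed
        have "d (\<sigma>' (q - p)) (Dil ((q - p) / (r - p)) (\<sigma>' (r - p))) \<le> \<epsilon> * (r - p)"
        proof (rule step)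
          show "0 < q - p" "q - p \<le> r - p" "r - p < ll1" using H by (auto simp: \<delta>'_def)
          show "\<sigma>' 0 = e" by (simp add: \<sigma>'_def G.left_inverse)
          show "\<forall>x\<in>{0..r - p}. \<forall>y\<in>{0..r - p}. d (\<sigma>' x) (\<sigma>' y) \<le> K * \<bar>x - y\<bar>"
            using lip[of "p + _" "p + _"] by (simp add: \<sigma>'_def d_left)
          show "\<forall>x\<in>{0..r - p}. norm (\<pi> (\<sigma>' x) - x *\<^sub>R v) \<le> \<epsilon>1 * (r - p)"
          proof
            fix x assume x: "x \<in> {0..r - p}"
            have px: "p \<le> p + x" "p + x \<le> r" "p \<le> p" "p \<le> r" using x by auto
            have "\<pi> (\<sigma>' x) = h n (p + x) - h n p"
              using add[OF inI[OF px(3,4)] inI[OF px(1,2)]] clid[OF inI[OF px(3,4)]] clid[OF inI[OF px(1,2)]] by (simp add: \<sigma>'_def h_def)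
            \<comment> \<open>The base point of differentiation is \<open>t\<close>, that of the
              piece is \<open>p\<close>; two deviations of at most half the permitted error
              result.\<close>
            hence "\<pi> (\<sigma>' x) - x *\<^sub>R v = (h n (p + x) - h n t - (p + x - t) *\<^sub>R v) - (h n p - h n t - (p - t) *\<^sub>R v)"
              by (simp add: algebra_simps)
            thus "norm (\<pi> (\<sigma>' x) - x *\<^sub>R v) \<le> \<epsilon>1 * (r - p)"
              using dev[OF px(1,2)] dev[OF px(3,4)] norm_triangle_ineq4[of "h n (p + x) - h n t - (p + x - t) *\<^sub>R v" "h n p - h n t - (p - t) *\<^sub>R v"]
              by simp
          qed
        qed
        hence "d (\<sigma> p \<odot> \<sigma>' (q - p)) (\<sigma> p \<odot> Dil ((q - p) / (r - p)) (\<sigma>' (r - p))) \<le> \<epsilon> * (r - p)" by (simp add: d_left)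
        thus "d (\<sigma> q) (gref (\<sigma> p) (\<sigma> r) ((q - p) / (r - p))) \<le> \<epsilon> * (r - p)" by (simp add: gref_def \<sigma>'_def)
      qed
    qed
  qed
qed

end

section \<open>Thick families of geodesics\<close>

lemma partition_locate:
  fixes r :: "nat \<Rightarrow> real"
  assumes "r 0 \<le> t" shows "\<exists>i\<le>j. r i \<le> t \<and> (i < j \<longrightarrow> t < r (Suc i))"
proof (induction j)
  case 0 show ?case using assms by auto
next
  case (Suc j)
  then obtain i where i: "i \<le> j" "r i \<le> t" "i < j \<longrightarrow> t < r (Suc i)" by blast
  show ?case
  proof (cases "i < j")
    case True thus ?thesis using i by (intro exI[of _ i]) auto
  next
    case False
    hence "i = j" using i by simp
    show ?thesis
    proof (cases "t < r (Suc j)")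
      case True thus ?thesis using i \<open>i = j\<close> by (intro exI[of _ j]) auto
    next
      case False thus ?thesis by (intro exI[of _ "Suc j"]) auto
    qed
  qed
qed

lemma partition_less:
  fixes r :: "nat \<Rightarrow> real"
  assumes "\<forall>i<j. r i < r (Suc i)" "i < k" "k \<le> j" shows "r i < r k"
  using assms(2,3)
proof (induction k)
  case (Suc k)
  thus ?case using assms(1)[rule_format, of k] by (cases "i = k") auto
qed simp

lemma partition_le:
  fixes r :: "nat \<Rightarrow> real"
  assumes "\<forall>i<j. r i < r (Suc i)" "i \<le> k" "k \<le> j" shows "r i \<le> r k"
  using partition_less[OF assms(1), of i k] assms(2,3) by (cases "i = k") auto

lemma finite_set_enumeration:
  fixes T :: "real set"
  assumes "finite T" "a \<in> T" "b \<in> T" "T \<subseteq> {a..b}"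
  shows "\<exists>(k::nat) t. t 0 = a \<and> t k = b \<and> (\<forall>i<k. t i < t (Suc i)) \<and> t ` {..k} = T"
proof -
  define l where "l = sorted_list_of_set T"
  have l: "set l = T" "sorted l" "distinct l" using assms(1) by (auto simp: l_def)
  have len: "length l > 0" using l(1) assms(2) by (cases l) auto
  have st: "sorted_wrt (<) l" using l(2,3) strict_sorted_iff by blast
  define k where "k = length l - 1"
  have img: "(!) l ` {..k} = T"
  proof -
    have "{..k} = {..<length l}" using len by (simp add: k_def lessThan_Suc_atMost[symmetric])
    thus ?thesis using l(1) by (auto simp: set_conv_nth)
  qed
  have mono: "l ! i \<le> l ! j" if "i \<le> j" "j \<le> k" for i j
    using sorted_nth_mono[OF l(2) that(1)] that(2) len by (auto simp: k_def simp flip: length_greater_0_conv)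
  obtain i where i: "i \<le> k" "l ! i = a" using img assms(2) by (metis atMost_iff imageE)
  obtain j where j: "j \<le> k" "l ! j = b" using img assms(3) by (metis atMost_iff imageE)
  have "l ! 0 \<in> T" "l ! k \<in> T" using img by auto
  hence "l ! 0 = a" "l ! k = b" using mono[of 0 i] mono[of j k] i j assms(4) by force+
  moreover have "l ! i < l ! Suc i" if "i < k" for i
    using sorted_wrt_nth_less[OF st, of i "Suc i"] that by (simp add: k_def)
  ultimately show ?thesis using img by (intro exI[of _ k] exI[of _ "(!) l"]) auto
qed

text \<open>Adding these points to a partition forces its mesh below \<epsilon>: a longer interval
  would have a grid point, hence a partition point, in its interior. The spacing is \<epsilon> / 2
  so that the grid point is strictly inside.\<close>

lemma fine_grid:
  fixes a b \<epsilon> :: real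
  assumes "\<epsilon> > 0"
  shows "\<exists>G. finite G \<and> G \<subseteq> {a..b} \<and> (\<forall>x y. a \<le> x \<longrightarrow> y \<le> b \<longrightarrow> \<epsilon> \<le> y - x \<longrightarrow> (\<exists>g\<in>G. x < g \<and> g < y))"
proof -
  define G where "G = (\<lambda>i::nat. a + real i * (\<epsilon> / 2)) ` {..nat \<lceil>(b - a) / (\<epsilon> / 2)\<rceil>} \<inter> {a..b}"
  have "\<exists>g\<in>G. x < g \<and> g < y" if xy: "a \<le> x" "y \<le> b" "\<epsilon> \<le> y - x" for x y
  proof -
    define i where "i = nat \<lfloor>(x - a) / (\<epsilon> / 2)\<rfloor> + 1"
    have nn: "0 \<le> (x - a) / (\<epsilon> / 2)" using xy assms by simp
    have "real i = of_int \<lfloor>(x - a) / (\<epsilon> / 2)\<rfloor> + 1" using nn by (simp add: i_def)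
    hence i: "(x - a) / (\<epsilon> / 2) < real i" "real i \<le> (x - a) / (\<epsilon> / 2) + 1" by linarith+
    have g1: "x - a < real i * (\<epsilon> / 2)" using i(1) assms by (simp add: pos_divide_less_eq)
    have "real i * (\<epsilon> / 2) \<le> ((x - a) / (\<epsilon> / 2) + 1) * (\<epsilon> / 2)" using i(2) assms by (intro mult_right_mono) auto
    also have "\<dots> = x - a + \<epsilon> / 2" using assms by (simp add: field_simps)
    finally have g2: "real i * (\<epsilon> / 2) \<le> x - a + \<epsilon> / 2" .
    have "real i * (\<epsilon> / 2) \<le> b - a" using g2 xy assms by linarith
    hence "real i \<le> (b - a) / (\<epsilon> / 2)" using assms by (simp add: pos_le_divide_eq)
    hence "i \<le> nat \<lceil>(b - a) / (\<epsilon> / 2)\<rceil>" by linarith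
    hence "a + real i * (\<epsilon> / 2) \<in> G" unfolding G_def using g1 g2 xy assms by auto
    thus ?thesis using g1 g2 xy assms by (intro bexI[of _ "a + real i * (\<epsilon> / 2)"]) linarith+
  qed
  thus ?thesis by (intro exI[of _ G]) (auto simp: G_def)
qed

text \<open>The intermediate points are indexed from 1: \<open>q i\<close> lies strictly between
  \<open>r (i - 1)\<close> and \<open>r i\<close>, and \<open>q 0\<close> is irrelevant.\<close>

definition partition_with_points :: "real \<Rightarrow> real \<Rightarrow> nat \<Rightarrow> (nat \<Rightarrow> real) \<Rightarrow> (nat \<Rightarrow> real) \<Rightarrow> bool" where
  "partition_with_points a b j r q \<longleftrightarrow> r 0 = a \<and> r j = b \<and> (\<forall>i<j. r i < q (Suc i) \<and> q (Suc i) < r (Suc i))"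

definition ratio :: "(nat \<Rightarrow> real) \<Rightarrow> (nat \<Rightarrow> real) \<Rightarrow> nat \<Rightarrow> real" where
  "ratio r q i = (q i - r (i - 1)) / (r i - r (i - 1))"

text \<open>On each interval the old and the new curve have the same end values, so
  \<open>tri\<close> compares both middle values with the same reference point. The deviations of
  the two curves together are thus at least \<open>c0 * \<alpha>\<close>.\<close>

lemma thick_refine:
  fixes \<Gamma> :: "(real \<Rightarrow> 'm::metric_space) set" and dev :: "'m \<Rightarrow> 'm \<Rightarrow> real \<Rightarrow> 'm \<Rightarrow> real"
  assumes \<alpha>: "\<forall>\<gamma>\<in>\<Gamma>. \<forall>(k::nat) (t::nat \<Rightarrow> real).
        t 0 = a \<and> t k = b \<and> (\<forall>i<k. t i < t (Suc i)) \<longrightarrow>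
        (\<exists>(j::nat) (r::nat \<Rightarrow> real) (s::nat \<Rightarrow> real). \<exists>\<gamma>'\<in>\<Gamma>.
           r 0 = a \<and> r j = b \<and> (\<forall>i<j. r i < s (Suc i) \<and> s (Suc i) < r (Suc i)) \<and>
           t ` {..k} \<subseteq> r ` {..j} \<and>
           (\<forall>i\<le>j. \<gamma> (r i) = \<gamma>' (r i)) \<and>
           (\<Sum>i=1..j. dist (\<gamma> (s i)) (\<gamma>' (s i))) \<ge> \<alpha>)"
    and tri: "\<And>x y \<theta> z z'. c0 * dist z z' \<le> dev x y \<theta> z + dev x y \<theta> z'" and c0: "c0 > 0"
    and \<gamma>: "\<gamma> \<in> \<Gamma>" and T: "finite T" "a \<in> T" "b \<in> T" "T \<subseteq> {a..b}" and \<epsilon>: "\<epsilon> > 0"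
  shows "\<exists>\<gamma>'\<in>\<Gamma>. \<exists>j r q. partition_with_points a b j r q \<and> (\<forall>i<j. r (Suc i) - r i < \<epsilon>) \<and> T \<subseteq> r ` {..j} \<and>
     (\<forall>i\<le>j. \<gamma>' (r i) = \<gamma> (r i)) \<and>
     c0 * \<alpha> / 2 \<le> (\<Sum>i=1..j. dev (\<gamma>' (r (i - 1))) (\<gamma>' (r i)) (ratio r q i) (\<gamma>' (q i)))"
proof -
  obtain G where G: "finite G" "G \<subseteq> {a..b}" "\<And>x y. a \<le> x \<Longrightarrow> y \<le> b \<Longrightarrow> \<epsilon> \<le> y - x \<Longrightarrow> \<exists>g\<in>G. x < g \<and> g < y"
    using fine_grid[OF \<epsilon>, of a b] by blast
  obtain k t where t: "t (0::nat) = a" "t k = b" "\<forall>i<k. t i < t (Suc i)" "t ` {..k} = T \<union> G"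
    using finite_set_enumeration[of "T \<union> G" a b] T G by auto
  obtain j r q \<gamma>' where h: "\<gamma>' \<in> \<Gamma>" "r 0 = a" "r j = b" "\<forall>i<j. r i < q (Suc i) \<and> q (Suc i) < r (Suc i)"
     "t ` {..k} \<subseteq> r ` {..j}" "\<forall>i\<le>j. \<gamma> (r i) = \<gamma>' (r i)" "(\<Sum>i=1..j. dist (\<gamma> (q i)) (\<gamma>' (q i))) \<ge> \<alpha>"
    using \<alpha>[rule_format, OF \<gamma>, of t k] t by blast
  have inc: "\<forall>i<j. r i < r (Suc i)" using h(4) by (meson less_trans)
  have mesh: "r (Suc i) - r i < \<epsilon>" if i: "i < j" for i
  proof (rule ccontr)
    assume "\<not> ?thesis"
    moreover have "a \<le> r i" using partition_le[OF inc, of 0 i] h(2) i by simp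
    moreover have "r (Suc i) \<le> b" using partition_le[OF inc, of "Suc i" j] h(3) i by simp
    ultimately obtain g where g: "g \<in> G" "r i < g" "g < r (Suc i)" using G(3)[of "r i" "r (Suc i)"] by auto
    hence "g \<in> r ` {..j}" using t(4) h(5) by blast
    then obtain l where l: "l \<le> j" "g = r l" by auto
    show False
    proof (cases "l \<le> i")
      case True
      thus ?thesis using partition_le[OF inc, of l i] g l i by simp
    next
      case False
      hence "Suc i \<le> l" by simp
      from partition_le[OF inc this l(1)] g(3) l show ?thesis by simp
    qed
  qed
  have pw: "partition_with_points a b j r q" using h by (simp add: partition_with_points_def)
  have TT: "T \<subseteq> r ` {..j}" using t(4) h(5) by blast
  let ?d = "\<lambda>\<gamma> i. dev (\<gamma> (r (i - 1))) (\<gamma> (r i)) (ratio r q i) (\<gamma> (q i))"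
  have "c0 * \<alpha> \<le> c0 * (\<Sum>i=1..j. dist (\<gamma> (q i)) (\<gamma>' (q i)))" using h(7) c0 by simp
  also have "\<dots> \<le> (\<Sum>i=1..j. ?d \<gamma> i + ?d \<gamma>' i)"
    unfolding sum_distrib_left
  proof (rule sum_mono)
    fix i assume "i \<in> {1..j}"
    hence "\<gamma>' (r (i - 1)) = \<gamma> (r (i - 1))" "\<gamma>' (r i) = \<gamma> (r i)" using h(6) by auto
    thus "c0 * dist (\<gamma> (q i)) (\<gamma>' (q i)) \<le> ?d \<gamma> i + ?d \<gamma>' i" using tri by simp
  qed
  also have "\<dots> = (\<Sum>i=1..j. ?d \<gamma> i) + (\<Sum>i=1..j. ?d \<gamma>' i)" by (rule sum.distrib)
  \<comment> \<open>One of the two curves carries at least half of the total. Both agree with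
    \<gamma> at all partition points, hence either can be the next curve.\<close>
  finally have "c0 * \<alpha> / 2 \<le> (\<Sum>i=1..j. ?d \<gamma> i) \<or> c0 * \<alpha> / 2 \<le> (\<Sum>i=1..j. ?d \<gamma>' i)" by linarith
  thus ?thesis
  proof
    assume "c0 * \<alpha> / 2 \<le> (\<Sum>i=1..j. ?d \<gamma> i)"
    thus ?thesis using pw mesh TT \<gamma> by (intro bexI[of _ \<gamma>] exI[of _ j] exI[of _ r] exI[of _ q]) auto
  next
    assume "c0 * \<alpha> / 2 \<le> (\<Sum>i=1..j. ?d \<gamma>' i)"
    thus ?thesis using pw mesh TT h(1,6) by (intro bexI[of _ \<gamma>'] exI[of _ j] exI[of _ r] exI[of _ q]) auto
  qed
qed

text \<open>The set frozen after a stage contains its partition points and its intermediate points,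
  so the limit has exactly the deviation sum of that stage. This holds for every stage, and the
  meshes tend to 0.\<close>

lemma thick_limit:
  fixes \<Gamma> :: "(real \<Rightarrow> 'm::complete_space) set" and dev :: "'m \<Rightarrow> 'm \<Rightarrow> real \<Rightarrow> 'm \<Rightarrow> real"
  assumes thick: "thick_family a b p0 p1 \<Gamma>"
    and tri: "\<And>x y \<theta> z z'. c0 * dist z z' \<le> dev x y \<theta> z + dev x y \<theta> z'" and c0: "c0 > 0"
  shows "a \<le> b \<and> (\<exists>\<gamma>. \<exists>\<beta>>0. (\<forall>x\<in>{a..b}. \<forall>y\<in>{a..b}. dist (\<gamma> x) (\<gamma> y) \<le> \<bar>x - y\<bar>) \<and>
     (\<forall>\<epsilon>>0. \<exists>j r q. partition_with_points a b j r q \<and> (\<forall>i<j. r (Suc i) - r i < \<epsilon>) \<and>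
        \<beta> \<le> (\<Sum>i=1..j. dev (\<gamma> (r (i - 1))) (\<gamma> (r i)) (ratio r q i) (\<gamma> (q i)))))"
proof -
  from thick[unfolded thick_family_def, THEN conjunct2, THEN conjunct2, THEN conjunct2]
  obtain \<alpha> where \<alpha>': "\<alpha> > 0 \<and> (\<forall>\<gamma>\<in>\<Gamma>. \<forall>(k::nat) (t::nat \<Rightarrow> real).
        t 0 = a \<and> t k = b \<and> (\<forall>i<k. t i < t (Suc i)) \<longrightarrow>
        (\<exists>(j::nat) (r::nat \<Rightarrow> real) (s::nat \<Rightarrow> real). \<exists>\<gamma>'\<in>\<Gamma>.
           r 0 = a \<and> r j = b \<and> (\<forall>i<j. r i < s (Suc i) \<and> s (Suc i) < r (Suc i)) \<and>
           t ` {..k} \<subseteq> r ` {..j} \<and>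
           (\<forall>i\<le>j. \<gamma> (r i) = \<gamma>' (r i)) \<and>
           (\<Sum>i=1..j. dist (\<gamma> (s i)) (\<gamma>' (s i))) \<ge> \<alpha>))"
    ..
  note \<alpha> = conjunct1[OF \<alpha>'] conjunct2[OF \<alpha>']
  obtain \<gamma>0 where \<gamma>0: "\<gamma>0 \<in> \<Gamma>" using thick unfolding thick_family_def by auto
  have geo: "a \<le> b" "\<And>\<gamma> x y. \<gamma> \<in> \<Gamma> \<Longrightarrow> x \<in> {a..b} \<Longrightarrow> y \<in> {a..b} \<Longrightarrow> dist (\<gamma> x) (\<gamma> y) = \<bar>x - y\<bar>"
    using thick[unfolded thick_family_def, THEN conjunct2, THEN conjunct1] \<gamma>0 unfolding geodesics_def by blast+
  define \<beta> where "\<beta> = c0 * \<alpha> / 2"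
  have \<beta>: "\<beta> > 0" using c0 \<alpha> by (simp add: \<beta>_def)
  define inv where "inv = (\<lambda>(n::nat) (\<gamma>, T). \<gamma> \<in> \<Gamma> \<and> finite T \<and> a \<in> T \<and> b \<in> T \<and> T \<subseteq> {a..b})"
  define nxt where "nxt = (\<lambda>(n::nat) (\<gamma>, T) (\<gamma>', T'). \<exists>j r q. partition_with_points a b j r q \<and>
     (\<forall>i<j. r (Suc i) - r i < inverse (real (Suc n))) \<and> T \<subseteq> r ` {..j} \<and> (\<forall>i\<le>j. \<gamma>' (r i) = \<gamma> (r i)) \<and>
     T' = r ` {..j} \<union> q ` {1..j} \<and>
     \<beta> \<le> (\<Sum>i=1..j. dev (\<gamma>' (r (i - 1))) (\<gamma>' (r i)) (ratio r q i) (\<gamma>' (q i))))"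
  have "\<exists>F. \<forall>n. inv n (F n) \<and> nxt n (F n) (F (Suc n))"
  proof (rule dependent_nat_choice)
    show "\<exists>x. inv 0 x" using \<gamma>0 geo(1) by (intro exI[of _ "(\<gamma>0, {a, b})"]) (auto simp: inv_def)
    fix x n assume "inv n x"
    then obtain \<gamma> T where x: "x = (\<gamma>, T)" "\<gamma> \<in> \<Gamma>" "finite T" "a \<in> T" "b \<in> T" "T \<subseteq> {a..b}"
      by (cases x) (auto simp: inv_def)
    obtain \<gamma>' j r q where h: "\<gamma>' \<in> \<Gamma>" "partition_with_points a b j r q" "\<forall>i<j. r (Suc i) - r i < inverse (real (Suc n))"
      "T \<subseteq> r ` {..j}" "\<forall>i\<le>j. \<gamma>' (r i) = \<gamma> (r i)"
      "\<beta> \<le> (\<Sum>i=1..j. dev (\<gamma>' (r (i - 1))) (\<gamma>' (r i)) (ratio r q i) (\<gamma>' (q i)))"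
      using thick_refine[where dev = dev and \<epsilon> = "inverse (real (Suc n))", OF \<alpha>(2) tri c0 x(2-6)] unfolding \<beta>_def by auto
    define T' where "T' = r ` {..j} \<union> q ` {1..j}"
    have pw: "r 0 = a" "r j = b" "\<And>i. i < j \<Longrightarrow> r i < q (Suc i) \<and> q (Suc i) < r (Suc i)"
      using h(2) by (auto simp: partition_with_points_def)
    have inc: "\<forall>i<j. r i < r (Suc i)" using pw(3) less_trans by blast
    have rin: "r i \<in> {a..b}" if "i \<le> j" for i
      using partition_le[OF inc, of 0 i] partition_le[OF inc, of i j] that pw(1,2) by auto
    have qin: "q i \<in> {a..b}" if "i \<in> {1..j}" for i
      using that pw(3)[of "i - 1"] rin[of "i - 1"] rin[of i] by (cases i) auto
    have "inv (Suc n) (\<gamma>', T')" using h(1,4) x rin qin by (auto simp: inv_def T'_def)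
    moreover have "nxt n x (\<gamma>', T')" using h unfolding nxt_def x(1) T'_def by blast
    ultimately show "\<exists>y. inv (Suc n) y \<and> nxt n x y" by blast
  qed
  then obtain F where F: "\<And>n. inv n (F n)" "\<And>n. nxt n (F n) (F (Suc n))" by blast
  define g where "g n = fst (F n)" for n
  define T where "T n = snd (F n)" for n
  have g: "g n \<in> \<Gamma>" "T n \<subseteq> {a..b}" for n using F(1)[of n] by (auto simp: inv_def g_def T_def split: prod.splits)
  have step: "\<exists>j r q. partition_with_points a b j r q \<and>
     (\<forall>i<j. r (Suc i) - r i < inverse (real (Suc n))) \<and> T n \<subseteq> r ` {..j} \<and> (\<forall>i\<le>j. g (Suc n) (r i) = g n (r i)) \<and>
     T (Suc n) = r ` {..j} \<union> q ` {1..j} \<and>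
     \<beta> \<le> (\<Sum>i=1..j. dev (g (Suc n) (r (i - 1))) (g (Suc n) (r i)) (ratio r q i) (g (Suc n) (q i)))" for n
    using F(2)[of n] unfolding nxt_def g_def T_def by (simp add: split_beta)
  have Tmono1: "T n \<subseteq> T (Suc n)" and eq1: "x \<in> T n \<Longrightarrow> g (Suc n) x = g n x" for n x
    using step[of n] by auto
  have Tmono: "T n \<subseteq> T m" if "n \<le> m" for n m using that Tmono1 by (rule lift_Suc_mono_le[rotated])
  have eq: "g m x = g n x" if "n \<le> m" "x \<in> T n" for n m x
    using that(1)
  proof (induction m rule: dec_induct)
    case (step m)
    thus ?case using eq1[of x m] Tmono[of n m] that(2) by auto
  qed simp
  have dense: "\<exists>x\<in>T (Suc n). \<bar>x - t\<bar> < inverse (real (Suc n))" if t: "t \<in> {a..b}" for n t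
  proof -
    obtain j r q where h: "partition_with_points a b j r q" "\<forall>i<j. r (Suc i) - r i < inverse (real (Suc n))"
      "T (Suc n) = r ` {..j} \<union> q ` {1..j}" using step[of n] by blast
    have r0: "r 0 \<le> t" "r j = b" using h(1) t by (auto simp: partition_with_points_def)
    obtain i where i: "i \<le> j" "r i \<le> t" "i < j \<longrightarrow> t < r (Suc i)" using partition_locate[where r = r, OF r0(1), of j] by blast
    have "\<bar>r i - t\<bar> < inverse (real (Suc n))"
    proof (cases "i < j")
      case True thus ?thesis using i h(2) by fastforce
    next
      case False
      hence "r i = t" using i r0 t by auto
      thus ?thesis by simp
    qed
    moreover have "r i \<in> T (Suc n)" using i h(3) by auto
    ultimately show ?thesis by blast
  qed
  \<comment> \<open>Both curves agree at a frozen time \<open>x\<close> near \<open>t\<close> and,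
    being geodesics, move by exactly \<open>\<bar>x - t\<bar>\<close> from there.\<close>
  have close: "dist (g m t) (g n t) < 2 * inverse (real (Suc N))" if t: "t \<in> {a..b}" and mn: "Suc N \<le> m" "Suc N \<le> n" for m n N t
  proof -
    obtain x where x: "x \<in> T (Suc N)" "\<bar>x - t\<bar> < inverse (real (Suc N))" using dense[OF t] by blast
    have xI: "x \<in> {a..b}" using x(1) g(2) by blast
    have "g m x = g n x" using eq[OF mn(1) x(1)] eq[OF mn(2) x(1)] by simp
    hence "dist (g m t) (g n t) \<le> dist (g m x) (g m t) + dist (g n x) (g n t)"
      by (metis dist_triangle3)
    also have "\<dots> = 2 * \<bar>x - t\<bar>" using geo(2)[OF g(1) xI t] by simp
    finally show ?thesis using x(2) by simp
  qed
  have conv: "\<exists>y. (\<lambda>n. g n t) \<longlonglongrightarrow> y" if t: "t \<in> {a..b}" for t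
  proof -
    have "Cauchy (\<lambda>n. g n t)"
    proof (rule metric_CauchyI)
      fix e :: real assume "e > 0"
      then obtain N where N: "inverse (real (Suc N)) < e / 2" using reals_Archimedean[of "e / 2"] by auto
      thus "\<exists>M. \<forall>m\<ge>M. \<forall>n\<ge>M. dist (g m t) (g n t) < e"
        using close[OF t, of N] by (intro exI[of _ "Suc N"]) force
    qed
    thus ?thesis using Cauchy_convergent convergent_def by blast
  qed
  define \<gamma> where "\<gamma> t = lim (\<lambda>n. g n t)" for t
  have \<gamma>: "(\<lambda>n. g n t) \<longlonglongrightarrow> \<gamma> t" if "t \<in> {a..b}" for t
    unfolding \<gamma>_def using conv[OF that] convergent_LIMSEQ_iff convergent_def by blast
  have \<gamma>T: "\<gamma> x = g n x" if "x \<in> T n" for x n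
  proof -
    have "x \<in> {a..b}" using that g(2) by blast
    moreover have "(\<lambda>m. g m x) \<longlonglongrightarrow> g n x"
      by (intro tendsto_eventually eventually_sequentiallyI[of n] eq that)
    ultimately show ?thesis using \<gamma> LIMSEQ_unique by blast
  qed
  have lip: "dist (\<gamma> x) (\<gamma> y) \<le> \<bar>x - y\<bar>" if "x \<in> {a..b}" "y \<in> {a..b}" for x y
  proof -
    have "(\<lambda>n. dist (g n x) (g n y)) \<longlonglongrightarrow> dist (\<gamma> x) (\<gamma> y)" by (intro tendsto_dist \<gamma> that)
    thus ?thesis by (rule LIMSEQ_le_const2) (use geo(2)[OF g(1) that] in auto)
  qed
  have "\<exists>j r q. partition_with_points a b j r q \<and> (\<forall>i<j. r (Suc i) - r i < \<epsilon>) \<and>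
        \<beta> \<le> (\<Sum>i=1..j. dev (\<gamma> (r (i - 1))) (\<gamma> (r i)) (ratio r q i) (\<gamma> (q i)))" if \<epsilon>: "\<epsilon> > 0" for \<epsilon>
  proof -
    obtain n where n: "inverse (real (Suc n)) < \<epsilon>" using reals_Archimedean[OF \<epsilon>] by blast
    obtain j r q where h: "partition_with_points a b j r q" "\<forall>i<j. r (Suc i) - r i < inverse (real (Suc n))"
      "T (Suc n) = r ` {..j} \<union> q ` {1..j}"
      "\<beta> \<le> (\<Sum>i=1..j. dev (g (Suc n) (r (i - 1))) (g (Suc n) (r i)) (ratio r q i) (g (Suc n) (q i)))"
      using step[of n] by blast
    have "(\<Sum>i=1..j. dev (\<gamma> (r (i - 1))) (\<gamma> (r i)) (ratio r q i) (\<gamma> (q i))) =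
       (\<Sum>i=1..j. dev (g (Suc n) (r (i - 1))) (g (Suc n) (r i)) (ratio r q i) (g (Suc n) (q i)))"
    proof (rule sum.cong[OF refl])
      fix i assume i: "i \<in> {1..j}"
      hence "r (i - 1) \<in> T (Suc n)" "r i \<in> T (Suc n)" "q i \<in> T (Suc n)" using h(3) by auto
      thus "dev (\<gamma> (r (i - 1))) (\<gamma> (r i)) (ratio r q i) (\<gamma> (q i)) =
        dev (g (Suc n) (r (i - 1))) (g (Suc n) (r i)) (ratio r q i) (g (Suc n) (q i))" by (simp add: \<gamma>T)
    qed
    thus ?thesis using h n by (intro exI[of _ j] exI[of _ r] exI[of _ q]) (auto intro: less_trans)
  qed
  thus ?thesis using geo(1) \<beta> lip by blast
qed

text \<open>The sum is the integral of the step function that takes on each interval the deviation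
  divided by the length. These functions are bounded on \<open>{a..b}\<close> and tend to 0 almost
  everywhere.\<close>

lemma vanishing_deviation_sums:
  fixes E :: "real \<Rightarrow> real \<Rightarrow> real \<Rightarrow> real"
  assumes nonneg: "\<And>p q r. 0 \<le> E p q r"
    and bd: "\<delta>0 > 0" "\<And>p q r. p < q \<Longrightarrow> q < r \<Longrightarrow> r - p < \<delta>0 \<Longrightarrow> E p q r \<le> K * (r - p)"
    and ae: "AE t in lebesgue. \<forall>\<epsilon>>0. \<exists>\<delta>>0. \<forall>p q r. p \<le> t \<and> t \<le> r \<and> p < q \<and> q < r \<and> r - p < \<delta> \<longrightarrow> E p q r \<le> \<epsilon> * (r - p)"
    and sums: "\<And>\<epsilon>. \<epsilon> > 0 \<Longrightarrow> \<exists>j r q. partition_with_points a b j r q \<and> (\<forall>i<j. r (Suc i) - r i < \<epsilon>) \<and>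
       \<beta> \<le> (\<Sum>i=1..j. E (r (i - 1)) (q i) (r i))"
  shows "\<beta> \<le> 0"
proof -
  define mesh where "mesh n = min \<delta>0 (inverse (real (Suc n)))" for n
  have mesh: "mesh n > 0" for n using bd(1) by (simp add: mesh_def)
  have "\<forall>n. \<exists>w. partition_with_points a b (fst w) (fst (snd w)) (snd (snd w)) \<and>
      (\<forall>i<fst w. fst (snd w) (Suc i) - fst (snd w) i < mesh n) \<and>
      \<beta> \<le> (\<Sum>i=1..fst w. E (fst (snd w) (i - 1)) (snd (snd w) i) (fst (snd w) i))"
    using sums[OF mesh] by (auto simp: split_paired_Ex)
  from choice[OF this] obtain w where w: "\<forall>n. partition_with_points a b (fst (w n)) (fst (snd (w n))) (snd (snd (w n))) \<and>
      (\<forall>i<fst (w n). fst (snd (w n)) (Suc i) - fst (snd (w n)) i < mesh n) \<and>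
      \<beta> \<le> (\<Sum>i=1..fst (w n). E (fst (snd (w n)) (i - 1)) (snd (snd (w n)) i) (fst (snd (w n)) i))"
    ..
  define j where "j n = fst (w n)" for n
  define r where "r n = fst (snd (w n))" for n
  define q where "q n = snd (snd (w n))" for n
  have h: "\<And>n. partition_with_points a b (j n) (r n) (q n)" "\<And>n i. i < j n \<Longrightarrow> r n (Suc i) - r n i < mesh n"
     "\<And>n. \<beta> \<le> (\<Sum>i=1..j n. E (r n (i - 1)) (q n i) (r n i))"
    unfolding j_def r_def q_def using w by blast+
  have pw: "r n 0 = a" "r n (j n) = b" "i < j n \<Longrightarrow> r n i < q n (Suc i) \<and> q n (Suc i) < r n (Suc i)" for n i
    using h(1)[of n] by (auto simp: partition_with_points_def)
  have inc: "r n i < r n (Suc i)" if "i < j n" for n i using pw(3)[OF that] by linarith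
  define I where "I n i = {r n i<..<r n (Suc i)}" for n i
  define v where "v n i = E (r n i) (q n (Suc i)) (r n (Suc i)) / (r n (Suc i) - r n i)" for n i
  \<comment> \<open>The open intervals are disjoint, so at most one summand is nonzero; at partition
    points the value is 0, which does not affect the integral.\<close>
  define F where "F n t = (\<Sum>i<j n. indicator (I n i) t * v n i)" for n t
  have v0: "0 \<le> v n i" if "i < j n" for n i using nonneg inc[OF that] by (simp add: v_def)
  have vK: "v n i \<le> K" if "i < j n" for n i
  proof -
    have "E (r n i) (q n (Suc i)) (r n (Suc i)) \<le> K * (r n (Suc i) - r n i)"
      using pw(3)[OF that] h(2)[OF that] by (intro bd(2)) (auto simp: mesh_def)
    thus ?thesis using inc[OF that] by (simp add: v_def pos_divide_le_eq)
  qed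
  have single: "F n t \<le> X" if X: "0 \<le> X" "\<And>i. i < j n \<Longrightarrow> t \<in> I n i \<Longrightarrow> v n i \<le> X" for n t X
  proof (cases "\<exists>i<j n. t \<in> I n i")
    case True
    then obtain i where i: "i < j n" "t \<in> I n i" by blast
    have "t \<notin> I n k" if k: "k < j n" "k \<noteq> i" for k
    proof (cases "k < i")
      case True
      hence "r n (Suc k) \<le> r n i" using partition_le[of "j n" "r n" "Suc k" i] inc i by auto
      thus ?thesis using i by (auto simp: I_def)
    next
      case False
      hence "r n (Suc i) \<le> r n k" using partition_le[of "j n" "r n" "Suc i" k] inc k by auto
      thus ?thesis using i by (auto simp: I_def)
    qed
    hence "F n t = (\<Sum>k<j n. if k = i then v n i else 0)" unfolding F_def
      using i by (intro sum.cong) auto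
    thus ?thesis using i X(2) by simp
  next
    case False
    hence "F n t = 0" unfolding F_def by (intro sum.neutral) auto
    thus ?thesis using X(1) by simp
  qed
  have F0: "0 \<le> F n t" for n t unfolding F_def using v0 by (intro sum_nonneg) auto
  have Isub: "I n i \<subseteq> {a..b}" if "i < j n" for n i
    using partition_le[of "j n" "r n" 0 i] partition_le[of "j n" "r n" "Suc i" "j n"] inc that pw(1,2)[of n] by (auto simp: I_def)
  have int1: "integrable lebesgue (\<lambda>t. indicator (I n i) t * v n i :: real)" for n i
    unfolding I_def by (intro integrable_mult_left integrable_real_indicator) (auto intro!: emeasure_bounded_finite[unfolded infinity_ennreal_def])
  have intF: "integrable lebesgue (F n)" for n
    unfolding F_def by (intro Bochner_Integration.integrable_sum int1)
  have intval: "\<beta> \<le> integral\<^sup>L lebesgue (F n)" for n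
  proof -
    have "integral\<^sup>L lebesgue (F n) = (\<Sum>i<j n. integral\<^sup>L lebesgue (\<lambda>t. indicator (I n i) t * v n i :: real))"
      unfolding F_def by (rule Bochner_Integration.integral_sum) (rule int1)
    also have "\<dots> = (\<Sum>i<j n. E (r n i) (q n (Suc i)) (r n (Suc i)))"
    proof (rule sum.cong[OF refl])
      fix i assume "i \<in> {..<j n}"
      hence "r n i < r n (Suc i)" using inc by auto
      thus "integral\<^sup>L lebesgue (\<lambda>t. indicator (I n i) t * v n i :: real) = E (r n i) (q n (Suc i)) (r n (Suc i))"
        by (simp add: I_def v_def)
    qed
    also have "\<dots> = (\<Sum>i=1..j n. E (r n (i - 1)) (q n i) (r n i))"
      by (rule sum.reindex_bij_witness[of _ "\<lambda>i. i - 1" Suc]) auto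
    finally show ?thesis using h(3)[of n] by simp
  qed
  have "(\<lambda>n. integral\<^sup>L lebesgue (F n)) \<longlonglongrightarrow> integral\<^sup>L lebesgue (\<lambda>t :: real. 0 :: real)"
  proof (rule integral_dominated_convergence[where w = "\<lambda>t. indicator {a..b} t * \<bar>K\<bar>"])
    show "F n \<in> borel_measurable lebesgue" for n using intF by (rule borel_measurable_integrable)
    show "integrable lebesgue (\<lambda>t. indicator {a..b} t * \<bar>K\<bar> :: real)"
      by (intro integrable_mult_left integrable_real_indicator) (auto simp: emeasure_lborel_Icc_eq)
    show "AE t in lebesgue. norm (F n t) \<le> indicator {a..b} t * \<bar>K\<bar>" for n
    proof (rule AE_I2)
      fix t :: real
      have "F n t \<le> indicator {a..b} t * \<bar>K\<bar>"
      proof (rule single)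
        fix i assume i: "i < j n" "t \<in> I n i"
        thus "v n i \<le> indicator {a..b} t * \<bar>K\<bar>" using Isub[OF i(1)] vK[OF i(1)] by (auto simp: indicator_def subset_iff)
      qed simp
      thus "norm (F n t) \<le> indicator {a..b} t * \<bar>K\<bar>" using F0 by simp
    qed
    show "AE t in lebesgue. (\<lambda>n. F n t) \<longlonglongrightarrow> 0"
      using ae
    proof eventually_elim
      case (elim t)
      show ?case
      proof (rule LIMSEQ_I)
        fix e :: real assume e: "e > 0"
        hence "e / 2 > 0" by simp
        then obtain \<delta> where \<delta>: "\<delta> > 0" "\<And>p q r. p \<le> t \<and> t \<le> r \<and> p < q \<and> q < r \<and> r - p < \<delta> \<Longrightarrow> E p q r \<le> (e / 2) * (r - p)"
          using elim by blast
        obtain N where N: "inverse (real (Suc N)) < \<delta>" using reals_Archimedean[OF \<delta>(1)] by blast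
        have "norm (F n t - 0) < e" if n: "n \<ge> N" for n
        proof -
          have "inverse (real (Suc n)) \<le> inverse (real (Suc N))" using n by (simp add: le_imp_inverse_le)
          hence mn: "mesh n < \<delta>" using N unfolding mesh_def by linarith
          have "F n t \<le> e / 2"
          proof (rule single)
            fix i assume i: "i < j n" "t \<in> I n i"
            have "E (r n i) (q n (Suc i)) (r n (Suc i)) \<le> (e / 2) * (r n (Suc i) - r n i)"
              using i pw(3)[OF i(1)] h(2)[OF i(1)] mn by (intro \<delta>(2)) (auto simp: I_def)
            thus "v n i \<le> e / 2" using inc[OF i(1)] by (simp add: v_def pos_divide_le_eq)
          qed (use e in simp)
          thus ?thesis using F0[of n t] e by simp
        qed
        thus "\<exists>no. \<forall>n\<ge>no. norm (F n t - 0) < e" by blast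
      qed
    qed
  qed simp
  hence "(\<lambda>n. integral\<^sup>L lebesgue (F n)) \<longlonglongrightarrow> 0" by simp
  thus "\<beta> \<le> 0" by (rule LIMSEQ_le_const) (use intval in auto)
qed

text \<open>The deviation vanishes for affine maps, so only the remainder at \<open>p\<close>,
  \<open>q\<close> and \<open>r\<close> matters. The one at \<open>p\<close> counts at most twice,
  whence \<epsilon> / 4. The point \<open>t\<close> may be anywhere in the closed interval.\<close>

lemma linear_interpolation_deviation:
  fixes \<eta> :: "real \<Rightarrow> 'b::real_normed_vector"
  assumes diff: "\<eta> differentiable at t" and \<epsilon>: "\<epsilon> > 0"
  shows "\<exists>\<delta>>0. \<forall>p q r. p \<le> t \<and> t \<le> r \<and> p < q \<and> q < r \<and> r - p < \<delta> \<longrightarrow>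
    norm (\<eta> q - (\<eta> p + ((q - p) / (r - p)) *\<^sub>R (\<eta> r - \<eta> p))) \<le> \<epsilon> * (r - p)"
proof -
  obtain D where D: "(\<eta> has_derivative D) (at t)" using diff unfolding differentiable_def by blast
  have Dl: "D x = x *\<^sub>R D 1" for x using linear_scale[OF has_derivative_linear[OF D], of x 1] by simp
  have "\<epsilon> / 4 > 0" using \<epsilon> by simp
  then obtain \<delta> where \<delta>: "\<delta> > 0" "\<And>y. norm (y - t) < \<delta> \<Longrightarrow> norm (\<eta> y - \<eta> t - D (y - t)) \<le> (\<epsilon> / 4) * norm (y - t)"
    using D unfolding has_derivative_at_alt by blast
  show ?thesis
  proof (intro exI[of _ \<delta>] conjI \<delta>(1) allI impI)
    fix p q r assume h: "p \<le> t \<and> t \<le> r \<and> p < q \<and> q < r \<and> r - p < \<delta>"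
    define err where "err y = \<eta> y - \<eta> t - (y - t) *\<^sub>R D 1" for y
    have e: "norm (err y) \<le> (\<epsilon> / 4) * (r - p)" if "p \<le> y" "y \<le> r" for y
    proof -
      have "\<bar>y - t\<bar> \<le> r - p" using h that by auto
      moreover have "norm (err y) \<le> (\<epsilon> / 4) * \<bar>y - t\<bar>"
        using \<delta>(2)[of y] h calculation by (simp add: err_def Dl[of "y - t"])
      ultimately show ?thesis using \<epsilon> by (smt (verit) mult_left_mono divide_nonneg_nonneg)
    qed
    define \<theta> where "\<theta> = (q - p) / (r - p)"
    have \<theta>: "0 \<le> \<theta>" "\<theta> \<le> 1" "\<theta> * (r - p) = q - p" using h by (auto simp: \<theta>_def)
    have "\<eta> q - (\<eta> p + \<theta> *\<^sub>R (\<eta> r - \<eta> p)) = (err q - err p) - \<theta> *\<^sub>R (err r - err p) + ((q - p) - \<theta> * (r - p)) *\<^sub>R D 1"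
      by (simp add: err_def algebra_simps)
    hence "\<eta> q - (\<eta> p + \<theta> *\<^sub>R (\<eta> r - \<eta> p)) = (err q - err p) - \<theta> *\<^sub>R (err r - err p)" using \<theta>(3) by simp
    also have "norm \<dots> \<le> (norm (err q) + norm (err p)) + 1 * (norm (err r) + norm (err p))"
    proof -
      have "norm (\<theta> *\<^sub>R (err r - err p)) \<le> 1 * (norm (err r) + norm (err p))"
        unfolding norm_scaleR using \<theta> by (intro mult_mono norm_triangle_ineq4) auto
      thus ?thesis using norm_triangle_ineq4[of "err q - err p" "\<theta> *\<^sub>R (err r - err p)"] norm_triangle_ineq4[of "err q" "err p"] by linarith
    qed
    also have "\<dots> \<le> \<epsilon> * (r - p)" using e[of q] e[of p] e[of r] h by simp
    finally show "norm (\<eta> q - (\<eta> p + ((q - p) / (r - p)) *\<^sub>R (\<eta> r - \<eta> p))) \<le> \<epsilon> * (r - p)" by (simp add: \<theta>_def)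
  qed
qed

theorem corollary1p5:
  fixes mul :: "'g::{t2_space, second_countable_topology} \<Rightarrow> 'g \<Rightarrow> 'g"
    and e :: 'g and iv :: "'g \<Rightarrow> 'g"
    and A :: "('g, 'e::euclidean_space) chart set" and c :: "('g, 'e) chart"
    and s :: nat and V :: "nat \<Rightarrow> 'e set" and ip :: "'e \<Rightarrow> 'e \<Rightarrow> real"
  assumes "\<exists>a b p q (\<Gamma> :: (real \<Rightarrow> 'm::complete_space) set). thick_family a b p q \<Gamma>"
    and "carnot_group mul e iv A c s V ip"
    and "RNP TYPE('b::banach)"
  shows "\<not> (\<exists>f :: 'm \<Rightarrow> 'g \<times> 'b.
           bilipschitz_embedding dist (max_dist (cc_dist mul iv c (V 1) ip) dist) f)"
proof
  assume "\<exists>f :: 'm \<Rightarrow> 'g \<times> 'b.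
           bilipschitz_embedding dist (max_dist (cc_dist mul iv c (V 1) ip) dist) f"
  then obtain f :: "'m \<Rightarrow> 'g \<times> 'b" and c0 C0 where c0: "c0 > 0" and C0: "C0 > 0"
    and low: "\<And>x y. c0 * dist x y \<le> max_dist (cc_dist mul iv c (V 1) ip) dist (f x) (f y)"
    and upp: "\<And>x y. max_dist (cc_dist mul iv c (V 1) ip) dist (f x) (f y) \<le> C0 * dist x y"
    unfolding bilipschitz_embedding_def by blast
  obtain a b p0 p1 and \<Gamma> :: "(real \<Rightarrow> 'm) set" where thick: "thick_family a b p0 p1 \<Gamma>" using assms(1) by blast
  interpret carnot mul e iv A c s V ip
    using assms(2) unfolding carnot_group_def by unfold_locales auto
  obtain \<Psi> \<kappa> R0 AA DA CA where "carnot_coords mul e iv A c s V ip \<Psi> \<kappa> R0 AA DA CA"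
    using coordinates_exist by blast
  then interpret carnot_coords mul e iv A c s V ip \<Psi> \<kappa> R0 AA DA CA .
  define g where "g x = fst (f x)" for x
  define h where "h x = snd (f x)" for x
  have md: "max_dist (cc_dist mul iv c (V 1) ip) dist (f x) (f y) = max (d (g x) (g y)) (dist (h x) (h y))" for x y
    by (simp add: max_dist_def d_def g_def h_def)
  \<comment> \<open>The two deviations are added although the product carries the maximum: the sum
    dominates the maximum, so the lower biLipschitz bound gives \<open>tri\<close>.\<close>
  define dev where "dev x y \<theta> z = d (g z) (gref (g x) (g y) \<theta>) + norm (h z - (h x + \<theta> *\<^sub>R (h y - h x)))" for x y \<theta> z
  have tri: "c0 * dist z z' \<le> dev x y \<theta> z + dev x y \<theta> z'" for x y \<theta> z z'
  proof -
    have "d (g z) (g z') \<le> d (g z) (gref (g x) (g y) \<theta>) + d (g z') (gref (g x) (g y) \<theta>)"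
      using d_triangle[of "g z" "g z'" "gref (g x) (g y) \<theta>"] by (simp add: d_sym)
    moreover have "dist (h z) (h z') \<le> norm (h z - (h x + \<theta> *\<^sub>R (h y - h x))) + norm (h z' - (h x + \<theta> *\<^sub>R (h y - h x)))"
      unfolding dist_norm[symmetric] by (rule dist_triangle2)
    ultimately show ?thesis
      using low[of z z'] d_nonneg[of "g z" "gref (g x) (g y) \<theta>"] d_nonneg[of "g z'" "gref (g x) (g y) \<theta>"]
      unfolding md dev_def by (smt (verit) norm_ge_zero)
  qed
  obtain \<gamma> \<beta> where ab: "a \<le> b" and \<beta>: "\<beta> > 0" and lip: "\<And>x y. x \<in> {a..b} \<Longrightarrow> y \<in> {a..b} \<Longrightarrow> dist (\<gamma> x) (\<gamma> y) \<le> \<bar>x - y\<bar>"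
    and sums: "\<And>\<epsilon>. \<epsilon> > 0 \<Longrightarrow> \<exists>j r q. partition_with_points a b j r q \<and> (\<forall>i<j. r (Suc i) - r i < \<epsilon>) \<and>
        \<beta> \<le> (\<Sum>i=1..j. dev (\<gamma> (r (i - 1))) (\<gamma> (r i)) (ratio r q i) (\<gamma> (q i)))"
    using thick_limit[where dev = dev, OF thick tri c0] by blast
  \<comment> \<open>Clamping extends the curve by constants to the whole line, on which both
    differentiability statements are formulated.\<close>
  define cl where "cl t = max a (min b t)" for t
  have clin: "cl t \<in> {a..b}" for t using ab by (auto simp: cl_def)
  have clid: "cl t = t" if "t \<in> {a..b}" for t using that by (auto simp: cl_def)
  define \<sigma> where "\<sigma> t = g (\<gamma> (cl t))" for t
  define \<eta> where "\<eta> t = h (\<gamma> (cl t))" for t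
  have lipc: "max (d (\<sigma> x) (\<sigma> y)) (dist (\<eta> x) (\<eta> y)) \<le> C0 * \<bar>x - y\<bar>" for x y
  proof -
    have "max (d (\<sigma> x) (\<sigma> y)) (dist (\<eta> x) (\<eta> y)) \<le> C0 * dist (\<gamma> (cl x)) (\<gamma> (cl y))"
      using upp[of "\<gamma> (cl x)" "\<gamma> (cl y)"] unfolding md \<sigma>_def \<eta>_def .
    also have "\<dots> \<le> C0 * \<bar>cl x - cl y\<bar>" using lip[OF clin clin] C0 by (intro mult_left_mono) auto
    also have "\<dots> \<le> C0 * \<bar>x - y\<bar>" using C0 by (intro mult_left_mono) (auto simp: cl_def)
    finally show ?thesis .
  qed
  have lip\<sigma>: "d (\<sigma> x) (\<sigma> y) \<le> C0 * \<bar>x - y\<bar>" and lip\<eta>: "norm (\<eta> x - \<eta> y) \<le> C0 * \<bar>x - y\<bar>" for x y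
    using lipc[of x y] by (auto simp: dist_norm)
  define E where "E p q r = d (\<sigma> q) (gref (\<sigma> p) (\<sigma> r) ((q - p) / (r - p))) +
     norm (\<eta> q - (\<eta> p + ((q - p) / (r - p)) *\<^sub>R (\<eta> r - \<eta> p)))" for p q r
  obtain \<delta>0 where \<delta>0: "\<delta>0 > 0" "\<And>p q r. p < q \<Longrightarrow> q < r \<Longrightarrow> r - p < \<delta>0 \<Longrightarrow>
      d (\<sigma> q) (gref (\<sigma> p) (\<sigma> r) ((q - p) / (r - p))) \<le> 3 * C0 * (r - p)"
    using gref_bounded[OF C0 lip\<sigma>] by blast
  \<comment> \<open>The group part contributes \<open>3 * C0\<close>, the Banach part
    \<open>C0\<close> for the move to \<open>q\<close> and \<open>C0\<close> for the interpolating
    vector.\<close>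
  have bd: "E p q r \<le> (5 * C0) * (r - p)" if pqr: "p < q" "q < r" "r - p < \<delta>0" for p q r
  proof -
    have "norm (((q - p) / (r - p)) *\<^sub>R (\<eta> r - \<eta> p)) \<le> 1 * (C0 * (r - p))"
      unfolding norm_scaleR using pqr lip\<eta>[of r p] by (intro mult_mono) auto
    moreover have "norm (\<eta> q - \<eta> p) \<le> C0 * (r - p)"
      using lip\<eta>[of q p] pqr C0 by (smt (verit) mult_left_mono)
    moreover have "norm (\<eta> q - (\<eta> p + ((q - p) / (r - p)) *\<^sub>R (\<eta> r - \<eta> p))) \<le>
       norm (\<eta> q - \<eta> p) + norm (((q - p) / (r - p)) *\<^sub>R (\<eta> r - \<eta> p))"
      using norm_triangle_ineq4[of "\<eta> q - \<eta> p" "((q - p) / (r - p)) *\<^sub>R (\<eta> r - \<eta> p)"] by (simp add: algebra_simps)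
    ultimately show ?thesis using \<delta>0(2)[OF pqr] unfolding E_def by linarith
  qed
  have "C0-lipschitz_on UNIV \<eta>" using lip\<eta> C0 by (intro lipschitz_onI) (auto simp: dist_norm)
  hence "AE t in lebesgue. \<eta> differentiable at t" using assms(3) unfolding RNP_def by blast
  with pansu_ae[OF C0 lip\<sigma>]
  have ae: "AE t in lebesgue. \<forall>\<epsilon>>0. \<exists>\<delta>>0. \<forall>p q r. p \<le> t \<and> t \<le> r \<and> p < q \<and> q < r \<and> r - p < \<delta> \<longrightarrow> E p q r \<le> \<epsilon> * (r - p)"
  proof eventually_elim
    case (elim t)
    show ?case
    proof (intro allI impI)
      fix \<epsilon> :: real assume "\<epsilon> > 0"
      hence \<epsilon>: "\<epsilon> / 2 > 0" by simp
      obtain \<delta>1 where \<delta>1: "\<delta>1 > 0" "\<And>p q r. p \<le> t \<and> t \<le> r \<and> p < q \<and> q < r \<and> r - p < \<delta>1 \<Longrightarrow>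
        d (\<sigma> q) (gref (\<sigma> p) (\<sigma> r) ((q - p) / (r - p))) \<le> (\<epsilon> / 2) * (r - p)" using elim(1) \<epsilon> by blast
      obtain \<delta>2 where \<delta>2: "\<delta>2 > 0" "\<And>p q r. p \<le> t \<and> t \<le> r \<and> p < q \<and> q < r \<and> r - p < \<delta>2 \<Longrightarrow>
        norm (\<eta> q - (\<eta> p + ((q - p) / (r - p)) *\<^sub>R (\<eta> r - \<eta> p))) \<le> (\<epsilon> / 2) * (r - p)"
        using linear_interpolation_deviation[OF elim(2) \<epsilon>] by blast
      have "E p q r \<le> \<epsilon> * (r - p)" if "p \<le> t \<and> t \<le> r \<and> p < q \<and> q < r \<and> r - p < min \<delta>1 \<delta>2" for p q r
        using \<delta>1(2)[of p r q] \<delta>2(2)[of p r q] that unfolding E_def by (simp add: field_simps)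
      thus "\<exists>\<delta>>0. \<forall>p q r. p \<le> t \<and> t \<le> r \<and> p < q \<and> q < r \<and> r - p < \<delta> \<longrightarrow> E p q r \<le> \<epsilon> * (r - p)"
        using \<delta>1(1) \<delta>2(1) by (intro exI[of _ "min \<delta>1 \<delta>2"]) auto
    qed
  qed
  have sums': "\<exists>j r q. partition_with_points a b j r q \<and> (\<forall>i<j. r (Suc i) - r i < \<epsilon>) \<and>
       \<beta> \<le> (\<Sum>i=1..j. E (r (i - 1)) (q i) (r i))" if "\<epsilon> > 0" for \<epsilon>
  proof -
    note k0 = sums[OF that]
    obtain j r q where k: "partition_with_points a b j r q" "\<forall>i<j. r (Suc i) - r i < \<epsilon>"
        "\<beta> \<le> (\<Sum>i=1..j. dev (\<gamma> (r (i - 1))) (\<gamma> (r i)) (ratio r q i) (\<gamma> (q i)))"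
      using k0 by blast
    have pw: "r 0 = a" "r j = b" "\<And>i. i < j \<Longrightarrow> r i < q (Suc i) \<and> q (Suc i) < r (Suc i)"
      using k(1) by (auto simp: partition_with_points_def)
    have inc: "\<forall>i<j. r i < r (Suc i)" using pw(3) less_trans by blast
    have rin: "r i \<in> {a..b}" if "i \<le> j" for i
      using partition_le[OF inc, of 0 i] partition_le[OF inc, of i j] that pw(1,2) by auto
    have "dev (\<gamma> (r (i - 1))) (\<gamma> (r i)) (ratio r q i) (\<gamma> (q i)) = E (r (i - 1)) (q i) (r i)" if i: "i \<in> {1..j}" for i
    proof -
      have "q i \<in> {a..b}" using i pw(3)[of "i - 1"] rin[of "i - 1"] rin[of i] by (cases i) auto
      moreover have "r (i - 1) \<in> {a..b}" "r i \<in> {a..b}" using i rin[of "i - 1"] rin[of i] by auto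
      ultimately show ?thesis by (simp add: dev_def E_def \<sigma>_def \<eta>_def clid ratio_def)
    qed
    hence "(\<Sum>i=1..j. dev (\<gamma> (r (i - 1))) (\<gamma> (r i)) (ratio r q i) (\<gamma> (q i))) = (\<Sum>i=1..j. E (r (i - 1)) (q i) (r i))"
      by (rule sum.cong[OF refl])
    thus ?thesis using k by auto
  qed
  have "\<beta> \<le> 0"
    by (rule vanishing_deviation_sums[OF _ \<delta>0(1) bd ae sums']) (simp add: E_def d_nonneg)
  thus False using \<beta> by simp
qed

end
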